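(* Let $L,M$ be positive integers with $LM$ even and let ${\cal D}=[0,L]\times[0,M]$. Then ${\cal D}$ is regular if and only if $\min\{L,M\}\ge 3$.
   Context: A quadriculated disk ${\cal D}\subset\mathbb{R}^2$ is a finite union of unit squares $[a,a+1]\times[b,b+1]$, $(a,b)\in\mathbb{Z}^2$, which is contractible with contractible interior; the square has color $(-1)^{a+b}$, and ${\cal D}$ is balanced if it has as many squares of each color. A (3D) domino is the union of two unit cubes $[a,a+1]\times[b,b+1]\times[c,c+1]$ ($(a,b,c)\in\mathbb{Z}^3$) sharing a face; the cube is black if $a+b+c$ is even and white otherwise. A domino is vertical if it is of the form $[a,a+1]\times[b,b+1]\times[c,c+2]$. A tiling of a union ${\cal R}$ of unit cubes is a set of dominoes with disjoint interiors whose union is ${\cal R}$; ${\cal T}({\cal R})$ is the set of tilings. A flip removes two dominoes of a tiling whose union is a $2\times2\times1$ box and replaces them by the other pair of dominoes tiling that box; ${\mathbf t}_0\approx{\mathbf t}_1$ means the tilings are joined by a finite sequence of flips. Let ${\cal R}_N={\cal D}\times[0,N]$. For $N$ even, ${\mathbf t}_{\operatorname{vert},N}\in{\cal T}({\cal R}_N)$ is the tiling by vertical dominoes only. For ${\mathbf t}_0\in{\cal T}({\cal R}_{N_0})$, ${\mathbf t}_1\in{\cal T}({\cal R}_{N_1})$, the concatenation ${\mathbf t}_0\ast{\mathbf t}_1\in{\cal T}({\cal R}_{N_0+N_1})$ consists of the dominoes of ${\mathbf t}_0$ and of ${\mathbf t}_1$ translated by $(0,0,N_0)$. For $N_0\equiv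 N_1\pmod 2$ write ${\mathbf t}_0\sim{\mathbf t}_1$ if there are even $M_0,M_1\ge 0$ with $N_0+M_0=N_1+M_1$ and ${\mathbf t}_0\ast{\mathbf t}_{\operatorname{vert},M_0}\approx{\mathbf t}_1\ast{\mathbf t}_{\operatorname{vert},M_1}$. The domino group $G_{\cal D}$ is $\left(\bigsqcup_{N\ge1}{\cal T}({\cal R}_N)\right)/\sim$ with operation induced by $\ast$ (a group); $G^+_{\cal D}$ is its subgroup of classes of tilings of ${\cal R}_N$ with $N$ even. Twist: for a domino $d$ let $v(d)\in\{\pm e_1,\pm e_2,\pm e_3\}$ be the unit vector from the center of its white cube to the center of its black cube. For $u\in\{\pm e_1,\pm e_2\}$ and $X\subset\mathbb{R}^3$ let ${\cal S}^u(X)=\operatorname{int}((X+[0,\infty)u)\setminus X)$. For dominoes $d_0,d_1$ set $\tau^u(d_0,d_1)=\frac14\det(v(d_1),v(d_0),u)$ if $d_1\cap{\cal S}^u(d_0)\neq\emptyset$ and $0$ otherwise. The twist of ${\mathbf t}\in{\cal T}({\cal R}_N)$ is $\operatorname{Tw}({\mathbf t})=\sum_{d_0,d_1\in{\mathbf t}}\tau^u(d_0,d_1)$; it is an integer independent of $u$, invariant under flips, and induces a group homomorphism $\operatorname{Tw}:G_{\cal D}\to\mathbb{Z}$. A balanced quadriculated disk ${\cal D}$ is regular if $\operatorname{Tw}:G^+_{\cal D}\to\mathbb{Z}$ is an isomorphism. *)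

theory Defs
  imports "HOL-Analysis.Analysis" "HOL-Algebra.Elementary_Groups"
begin

section \<open>Quadriculated disks\<close>

definition unit_square :: "int \<Rightarrow> int \<Rightarrow> (real \<times> real) set" where
  "unit_square a b = {real_of_int a..real_of_int a + 1} \<times> {real_of_int b..real_of_int b + 1}"

text \<open>Contractible spaces are nonempty, whereas \<^const>\<open>contractible\<close> holds for the empty set.\<close>

definition quadriculated_disk :: "(real \<times> real) set \<Rightarrow> bool" where
  "quadriculated_disk D \<longleftrightarrow>
     (\<exists>S. finite S \<and> D = (\<Union>(a, b)\<in>S. unit_square a b)) \<and>
     D \<noteq> {} \<and> contractible D \<and> interior D \<noteq> {} \<and> contractible (interior D)"

definition balanced :: "(real \<times> real) set \<Rightarrow> bool" where
  "balanced D \<longleftrightarrow>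
     card {(a, b). unit_square a b \<subseteq> D \<and> even (a + b)} =
     card {(a, b). unit_square a b \<subseteq> D \<and> odd (a + b)}"


section \<open>Cubes, dominoes and tilings\<close>

definition corner :: "int^3 \<Rightarrow> real^3" where
  "corner p = (\<chi> i. real_of_int (p $ i))"

definition unit_cube :: "int^3 \<Rightarrow> (real^3) set" where
  "unit_cube p = cbox (corner p) (corner p + 1)"

definition cube_center :: "int^3 \<Rightarrow> real^3" where
  "cube_center p = corner p + (\<chi> i. 1/2)"

definition black :: "int^3 \<Rightarrow> bool" where
  "black p \<longleftrightarrow> even (p $ 1 + p $ 2 + p $ 3)"

definition domino :: "(real^3) set \<Rightarrow> bool" where
  "domino d \<longleftrightarrow> (\<exists>p i. d = unit_cube p \<union> unit_cube (p + axis i 1))"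

definition tilings :: "(real^3) set \<Rightarrow> (real^3) set set set" where
  "tilings R = {t. (\<forall>d\<in>t. domino d) \<and>
                   pairwise (\<lambda>d e. interior d \<inter> interior e = {}) t \<and> \<Union>t = R}"

definition flat_box :: "(real^3) set \<Rightarrow> bool" where
  "flat_box B \<longleftrightarrow> (\<exists>p i. B = cbox (corner p) (corner p + (\<chi> j. if j = i then 1 else 2)))"

text \<open>A flat box has exactly two tilings, each consisting of two dominoes.\<close>

definition flip_step :: "(real^3) set set \<Rightarrow> (real^3) set set \<Rightarrow> bool" where
  "flip_step t0 t1 \<longleftrightarrow>
     (\<exists>B f0 f1. flat_box B \<and> f0 \<in> tilings B \<and> f1 \<in> tilings B \<and> f0 \<noteq> f1 \<and>
                f0 \<subseteq> t0 \<and> t1 = (t0 - f0) \<union> f1)"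

abbreviation flip_connected :: "(real^3) set set \<Rightarrow> (real^3) set set \<Rightarrow> bool" where
  "flip_connected \<equiv> flip_step\<^sup>*\<^sup>*"


section \<open>The domino group\<close>

definition cylinder :: "(real \<times> real) set \<Rightarrow> nat \<Rightarrow> (real^3) set" where
  "cylinder D N = {x. (x $ 1, x $ 2) \<in> D \<and> 0 \<le> x $ 3 \<and> x $ 3 \<le> real N}"

text \<open>
  For even \<open>N\<close> the vertical dominoes of the all-vertical tiling start at even heights.
  For \<open>N = 0\<close> the set is empty, as needed for concatenation with it to be trivial.
\<close>

definition vert_tiling :: "(real \<times> real) set \<Rightarrow> nat \<Rightarrow> (real^3) set set" where
  "vert_tiling D N = {d. d \<subseteq> cylinder D N \<and>
     (\<exists>p. even (p $ 3) \<and> d = unit_cube p \<union> unit_cube (p + axis 3 1))}"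

text \<open>
  A pair \<open>(N, t)\<close> stands for a tiling \<open>t\<close> of the cylinder of height \<open>N\<close>; the set of all
  such pairs is the disjoint union of the sets of tilings over \<open>N \<ge> 1\<close>.
\<close>

type_synonym cyl_tiling = "nat \<times> (real^3) set set"

definition cyl_tilings :: "(real \<times> real) set \<Rightarrow> cyl_tiling set" where
  "cyl_tilings D = (SIGMA N:{1..}. tilings (cylinder D N))"

fun concat_tiling :: "cyl_tiling \<Rightarrow> cyl_tiling \<Rightarrow> cyl_tiling" where
  "concat_tiling (N0, t0) (N1, t1) = (N0 + N1, t0 \<union> (\<lambda>d. (+) (axis 3 (real N0)) ` d) ` t1)"

definition tiling_rel :: "(real \<times> real) set \<Rightarrow> cyl_tiling rel" where
  "tiling_rel D = {((N0, t0), (N1, t1)).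
     (N0, t0) \<in> cyl_tilings D \<and> (N1, t1) \<in> cyl_tilings D \<and> (even N0 \<longleftrightarrow> even N1) \<and>
     (\<exists>M0 M1. even M0 \<and> even M1 \<and> N0 + M0 = N1 + M1 \<and>
        flip_connected (snd (concat_tiling (N0, t0) (M0, vert_tiling D M0)))
                       (snd (concat_tiling (N1, t1) (M1, vert_tiling D M1))))}"

definition domino_group :: "(real \<times> real) set \<Rightarrow> cyl_tiling set monoid" where
  "domino_group D =
     \<lparr>carrier = cyl_tilings D // tiling_rel D,
      monoid.mult = (\<lambda>A B. \<Union>x\<in>A. \<Union>y\<in>B. tiling_rel D `` {concat_tiling x y}),
      one = tiling_rel D `` {(2, vert_tiling D 2)}\<rparr>"

definition even_domino_group :: "(real \<times> real) set \<Rightarrow> cyl_tiling set monoid" where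
  "even_domino_group D =
     (domino_group D)\<lparr>carrier := {(N, t) \<in> cyl_tilings D. even N} // tiling_rel D\<rparr>"


section \<open>Twist and regularity\<close>

definition domino_vec :: "(real^3) set \<Rightarrow> real^3" where
  "domino_vec d = (THE w. \<exists>p q. \<not> black p \<and> black q \<and> d = unit_cube p \<union> unit_cube q \<and>
                                w = cube_center q - cube_center p)"

definition shade :: "real^3 \<Rightarrow> (real^3) set \<Rightarrow> (real^3) set" where
  "shade u X = interior ({x + s *\<^sub>R u | x s. x \<in> X \<and> 0 \<le> s} - X)"

definition tau :: "real^3 \<Rightarrow> (real^3) set \<Rightarrow> (real^3) set \<Rightarrow> real" where
  "tau u d0 d1 = (if d1 \<inter> shade u d0 \<noteq> {}
     then det (vector [domino_vec d1, domino_vec d0, u] :: real^3^3) / 4 else 0)"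

text \<open>
  For tilings of cylinders, the sum of all \<open>tau u d0 d1\<close> is an integer that does not depend on
  the choice of \<open>u\<close> among the four horizontal unit vectors; the first basis vector is used here.
\<close>

definition twist :: "(real^3) set set \<Rightarrow> int" where
  "twist t = (THE k. real_of_int k = (\<Sum>d0\<in>t. \<Sum>d1\<in>t. tau (axis 1 1) d0 d1))"

definition twist_class :: "cyl_tiling set \<Rightarrow> int" where
  "twist_class c = the_elem ((\<lambda>(N, t). twist t) ` c)"

text \<open>\<^const>\<open>integer_group\<close> is the additive group of integers.\<close>

definition regular_disk :: "(real \<times> real) set \<Rightarrow> bool" where
  "regular_disk D \<longleftrightarrow> quadriculated_disk D \<and> balanced D \<and>
     twist_class \<in> iso (even_domino_group D) integer_group"

end

theory Submission
  imports Defs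
begin

text \<open>
  Cut a tiling into floors. Up to flips and pairs of vertical floors, every tiling is a word of
  moves, each of which adds a single horizontal domino to the plug or removes one from it, so the
  even domino group is the group of loops of moves at the empty plug. Order the rectangle in
  boustrophedon fashion. Complementing the plug on one color turns plugs into sets of \<open>LM/2\<close>
  tokens on a path, and a move into the passage of a token along an edge. Passages along the path
  itself contribute nothing. The class of any other passage depends only on the number of tokens
  before, between and after its ends, and since disjoint moves commute and the two ways to tile a
  \<open>2\<times>2\<close> square agree, all classes are generated by that of a single token turning around a
  corner, provided the path has at least four rows of length at least three. That class has twist
  \<open>\<plusminus>1\<close>, so the twist is an isomorphism.

  If a side is \<open>1\<close>, or both are \<open>2\<close>, the twist vanishes. On a board of width \<open>2\<close>, counting the
  dominoes across the board with alternating signs, but only those where the colors of the plug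
  beyond the domino add up to \<open>1\<close> (or to \<open>-1\<close>), is invariant under flips. The two counts are
  linearly independent homomorphisms, so the group is not cyclic.
\<close>

section \<open>Floors and plugs\<close>

text \<open>The group is not known to be commutative beforehand, so it is only bounded from above:
  every class lies in each subgroup containing the class of one corner passage, and a homomorphism
  with value 1 or -1 there finishes the proof. The same principle shows that the twist is an
  integer, because the classes on which four times the twist is divisible by 4 form such a subgroup.
  Noncommutativity does no harm, since the relations have the shapes \<open>x x = y x\<close> and
  \<open>a b = c d\<close> with two factors under control. The former makes the class of a passage
  independent of the number of tokens in front of it; the latter carries membership from one turning
  point to the next. The real constraint is room: a relation holds only for counts that fit into the
  gaps of a half filled path, and an edge of full width has no edge around it, so that the relation
  \<open>x x = y x\<close> is missing there. Four rows make the needed counts possible. Width three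
  makes the crossing partner of an outermost edge an inner edge; in width two this partner is itself
  outermost, and the group is really larger.\<close>

definition planar_domino :: "(int \<times> int) set \<Rightarrow> bool" where
  "planar_domino d \<longleftrightarrow> (\<exists>x y. d = {(x, y), (x + 1, y)} \<or> d = {(x, y), (x, y + 1)})"

definition hblock :: "int \<Rightarrow> int \<Rightarrow> (int \<times> int) set set" where
  "hblock x y = {{(x, y), (x + 1, y)}, {(x, y + 1), (x + 1, y + 1)}}"

definition vblock :: "int \<Rightarrow> int \<Rightarrow> (int \<times> int) set set" where
  "vblock x y = {{(x, y), (x, y + 1)}, {(x + 1, y), (x + 1, y + 1)}}"

text \<open>
  A tiling is encoded by the list of its horizontal dominoes, floor by floor. The \<^emph>\<open>plug\<close> below
  a floor is the set of squares whose cubes on that floor are joined to the cubes underneath.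
\<close>

locale board =
  fixes D :: "(int \<times> int) set"
  assumes finite_D: "finite D"
begin

definition floor_ok :: "(int \<times> int) set \<Rightarrow> (int \<times> int) set set \<Rightarrow> bool" where
  "floor_ok p f \<longleftrightarrow> (\<forall>d\<in>f. planar_domino d \<and> d \<subseteq> D - p) \<and> disjoint f"

text \<open>A square of the floor that is neither joined downwards nor covered by a horizontal
  domino has to be joined upwards. An empty floor therefore complements the plug.\<close>

definition next_plug :: "(int \<times> int) set \<Rightarrow> (int \<times> int) set set \<Rightarrow> (int \<times> int) set" where
  "next_plug p f = D - p - \<Union>f"

fun legit :: "(int \<times> int) set \<Rightarrow> (int \<times> int) set set list \<Rightarrow> bool" where
  "legit p [] \<longleftrightarrow> p \<subseteq> D"
| "legit p (f # fs) \<longleftrightarrow> p \<subseteq> D \<and> floor_ok p f \<and> legit (next_plug p f) fs"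

fun fin :: "(int \<times> int) set \<Rightarrow> (int \<times> int) set set list \<Rightarrow> (int \<times> int) set" where
  "fin p [] = p"
| "fin p (f # fs) = fin (next_plug p f) fs"

inductive eqw :: "bool \<Rightarrow> (int \<times> int) set \<Rightarrow> (int \<times> int) set set list \<Rightarrow> (int \<times> int) set set list \<Rightarrow> bool"
  for b :: bool
where
  eqw_refl: "legit p xs \<Longrightarrow> eqw b p xs xs"
| eqw_sym: "eqw b p xs ys \<Longrightarrow> eqw b p ys xs"
| eqw_trans: "eqw b p xs ys \<Longrightarrow> eqw b p ys zs \<Longrightarrow> eqw b p xs zs"
| eqw_hflip: "legit p (f # xs) \<Longrightarrow> hblock x y \<subseteq> f \<Longrightarrow> eqw b p (f # xs) ((f - hblock x y \<union> vblock x y) # xs)"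
| eqw_vflip: "legit p (f # g # xs) \<Longrightarrow> d \<in> f \<Longrightarrow> d \<in> g \<Longrightarrow>
    eqw b p (f # g # xs) ((f - {d}) # (g - {d}) # xs)"
| eqw_stab: "b \<Longrightarrow> legit p xs \<Longrightarrow> eqw b p ({} # {} # xs) xs"
| eqw_Cons: "p \<subseteq> D \<Longrightarrow> floor_ok p f \<Longrightarrow> eqw b (next_plug p f) xs ys \<Longrightarrow> eqw b p (f # xs) (f # ys)"

text \<open>The flag \<open>b\<close> tells whether inserting two floors of vertical dominoes is allowed.\<close>

lemmas [trans] = eqw_trans

section \<open>Legal lists of floors and their behavior under flips\<close>

lemma legit_subset: "legit p xs \<Longrightarrow> p \<subseteq> D"
  by (cases xs) auto

lemma next_plug_subset [simp]: "next_plug p f \<subseteq> D"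
  by (auto simp: next_plug_def)

lemma floor_ok_empty [simp]: "floor_ok p {}"
  by (simp add: floor_ok_def)

lemma next_plug_empty: "p \<subseteq> D \<Longrightarrow> next_plug (next_plug p {}) {} = p"
  by (auto simp: next_plug_def)

lemma Union_blocks: "\<Union>(hblock x y) = \<Union>(vblock x y)"
  by (auto simp: hblock_def vblock_def)

lemma planar_domino_nonempty: "planar_domino d \<Longrightarrow> d \<noteq> {}"
  by (auto simp: planar_domino_def)

lemma floor_ok_finite: assumes "floor_ok p f" shows "finite f"
proof (rule finite_subset)
  show "f \<subseteq> Pow D" using assms by (auto simp: floor_ok_def)
qed (use finite_D in simp)

lemma floor_ok_subset: "floor_ok p f \<Longrightarrow> g \<subseteq> f \<Longrightarrow> floor_ok p g"
  by (auto simp: floor_ok_def intro: pairwise_subset)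

lemma floor_ok_insert:
  assumes "floor_ok p f" "planar_domino d" "d \<subseteq> D - p" "d \<inter> \<Union>f = {}"
  shows "floor_ok p (insert d f)"
  using assms by (auto simp: floor_ok_def pairwise_insert disjnt_def)

lemma floor_ok_disj:
  assumes "floor_ok p f" "d \<in> f" shows "d \<inter> \<Union>(f - {d}) = {}"
  using assms by (force simp: floor_ok_def pairwise_def disjnt_def)

text \<open>Both blocks cover the same four squares, so disjointness from the other dominoes and the
  next plug carry over.\<close>

lemma floor_ok_hflip:
  assumes f: "floor_ok p f" and H: "hblock x y \<subseteq> f"
  shows "floor_ok p (f - hblock x y \<union> vblock x y)" and "\<Union>(f - hblock x y \<union> vblock x y) = \<Union>f"
    and "next_plug p (f - hblock x y \<union> vblock x y) = next_plug p f"
proof -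
  have d: "disjoint f" using f by (simp add: floor_ok_def)
  have disj: "disjnt a c" if "a \<in> f - hblock x y" "c \<in> vblock x y" for a c
  proof -
    have "a \<inter> \<Union>(hblock x y) = {}"
      using d that(1) H by (fastforce simp: pairwise_def disjnt_def)
    then have "a \<inter> \<Union>(vblock x y) = {}" by (simp add: Union_blocks)
    with that show ?thesis by (auto simp: disjnt_def)
  qed
  have vv: "disjoint (vblock x y)" by (auto simp: vblock_def pairwise_def disjnt_def)
  have "disjoint (f - hblock x y \<union> vblock x y)"
    using d vv disj by (auto simp: pairwise_def disjnt_sym)
  moreover have "planar_domino c \<and> c \<subseteq> D - p" if "c \<in> vblock x y" for c
  proof
    show "planar_domino c" using that by (auto simp: vblock_def planar_domino_def)
    have "\<Union>(hblock x y) \<subseteq> D - p" using f H by (force simp: floor_ok_def)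
    with that show "c \<subseteq> D - p" unfolding Union_blocks by blast
  qed
  ultimately show "floor_ok p (f - hblock x y \<union> vblock x y)" using f by (auto simp: floor_ok_def)
  have "\<Union>(f - hblock x y \<union> vblock x y) = \<Union>(f - hblock x y) \<union> \<Union>(hblock x y)"
    by (simp add: Union_blocks)
  also have "\<dots> = \<Union>f" using H by blast
  finally show "\<Union>(f - hblock x y \<union> vblock x y) = \<Union>f" .
  then show "next_plug p (f - hblock x y \<union> vblock x y) = next_plug p f" by (simp add: next_plug_def)
qed

text \<open>On the squares of \<open>d\<close> two horizontal dominoes are replaced by pillars
  joining the two floors, so the only plug that changes is the one in between, which gains
  \<open>d\<close>.\<close>

lemma legit_vflip:
  assumes l: "legit p (f # g # xs)" and d: "d \<in> f" "d \<in> g"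
  shows "legit p ((f - {d}) # (g - {d}) # xs)"
    and "next_plug (next_plug p (f - {d})) (g - {d}) = next_plug (next_plug p f) g"
    and "next_plug p (f - {d}) = next_plug p f \<union> d"
proof -
  have f: "floor_ok p f" and g: "floor_ok (next_plug p f) g" using l by auto
  have fd: "d \<inter> \<Union>(f - {d}) = {}" and gd: "d \<inter> \<Union>(g - {d}) = {}"
    using f g d by (auto dest: floor_ok_disj)
  have dD: "d \<subseteq> D - p" using f d by (auto simp: floor_ok_def)
  have Uf: "\<Union>f = d \<union> \<Union>(f - {d})" and Ug: "\<Union>g = d \<union> \<Union>(g - {d})" using d by auto
  show 1: "next_plug p (f - {d}) = next_plug p f \<union> d"
    unfolding next_plug_def Uf using fd dD by auto
  show 2: "next_plug (next_plug p (f - {d})) (g - {d}) = next_plug (next_plug p f) g"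
    unfolding 1 unfolding next_plug_def Ug by auto
  have "floor_ok (next_plug p (f - {d})) (g - {d})"
    using g gd unfolding 1 by (auto simp: floor_ok_def intro: pairwise_subset)
  then show "legit p ((f - {d}) # (g - {d}) # xs)"
    using l 2 floor_ok_subset[OF f] by simp
qed

lemma eqw_legit: "eqw b p xs ys \<Longrightarrow> legit p xs \<and> legit p ys \<and> fin p xs = fin p ys"
proof (induction rule: eqw.induct)
  case (eqw_hflip p f xs x y)
  then show ?case using floor_ok_hflip[of p f x y] by simp
next
  case (eqw_vflip p f g xs d)
  then show ?case using legit_vflip[OF eqw_vflip(1-3)] by simp
next
  case (eqw_stab p xs)
  then show ?case using next_plug_empty[OF legit_subset] legit_subset[of p xs] by auto
qed auto

lemma eqw_length: "eqw b p xs ys \<Longrightarrow> even (length xs) = even (length ys)"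
  by (induction rule: eqw.induct) auto

lemma eqw_length_eq: "eqw False p xs ys \<Longrightarrow> length xs = length ys"
  by (induction rule: eqw.induct) auto

lemma legit_append [simp]: "legit p (xs @ ys) \<longleftrightarrow> legit p xs \<and> legit (fin p xs) ys"
  by (induction xs arbitrary: p) (auto dest: legit_subset)

lemma fin_append [simp]: "fin p (xs @ ys) = fin (fin p xs) ys"
  by (induction xs arbitrary: p) auto

lemma fin_subset: "p \<subseteq> D \<Longrightarrow> fin p xs \<subseteq> D"
  by (induction xs arbitrary: p) auto

lemma eqw_append_right:
  "eqw b p xs ys \<Longrightarrow> legit (fin p xs) zs \<Longrightarrow> eqw b p (xs @ zs) (ys @ zs)"
proof (induction rule: eqw.induct)
  case (eqw_sym p xs ys)
  then show ?case using eqw_legit[OF eqw_sym(1)] by (auto intro: eqw.eqw_sym)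
next
  case (eqw_trans p xs ys zs)
  then show ?case using eqw_legit[OF eqw_trans(1)] by (auto intro: eqw.eqw_trans)
next
  case (eqw_hflip p f xs x y)
  then show ?case using eqw.eqw_hflip[of p f "xs @ zs"] by auto
next
  case (eqw_vflip p f g xs d)
  then show ?case using eqw.eqw_vflip[of p f g "xs @ zs"] by auto
next
  case (eqw_stab p xs)
  then show ?case using eqw.eqw_stab[of b p "xs @ zs"] next_plug_empty[OF legit_subset[of p xs]] by auto
qed (auto intro: eqw.intros)

lemma eqw_append_left:
  "legit p zs \<Longrightarrow> eqw b (fin p zs) xs ys \<Longrightarrow> eqw b p (zs @ xs) (zs @ ys)"
  by (induction zs arbitrary: p) (auto intro: eqw.intros)

lemma eqw_append:
  assumes "eqw b p xs ys" "eqw b (fin p xs) us vs"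
  shows "eqw b p (xs @ us) (ys @ vs)"
proof (rule eqw_trans)
  have l: "legit p ys" "fin p xs = fin p ys" "legit (fin p xs) us"
    using assms by (auto dest: eqw_legit)
  show "eqw b p (xs @ us) (ys @ us)" using assms(1) l(3) by (rule eqw_append_right)
  show "eqw b p (ys @ us) (ys @ vs)" using l assms(2) by (intro eqw_append_left) simp_all
qed

lemma eqw_mono: "eqw False p xs ys \<Longrightarrow> eqw True p xs ys"
  by (induction rule: eqw.induct) (auto intro: eqw.intros)

text \<open>Both sides arise by one vertical flip from the list with \<open>d\<close> on all three
  floors: one flip removes the upper two copies, the other the lower two.\<close>

lemma slide:
  assumes l: "legit p (insert d f # g # h # xs)" and d: "d \<notin> f" "d \<inter> \<Union>g = {}"
  shows "eqw b p (insert d f # g # h # xs) (f # g # insert d h # xs)"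
proof -
  define p1 where "p1 = next_plug p (insert d f)"
  define p2 where "p2 = next_plug p1 g"
  have f: "floor_ok p (insert d f)" and g: "floor_ok p1 g" and h: "floor_ok p2 h"
    and xs: "legit (next_plug p2 h) xs" and p: "p \<subseteq> D" using l by (auto simp: p1_def p2_def)
  have pd: "planar_domino d" "d \<subseteq> D - p" using f by (auto simp: floor_ok_def)
  have dne: "d \<noteq> {}" using pd planar_domino_nonempty by auto
  have dp1: "d \<inter> p1 = {}" by (auto simp: p1_def next_plug_def)
  have dp2: "d \<subseteq> p2" using pd dp1 d by (auto simp: p2_def next_plug_def)
  have dh: "d \<inter> \<Union>h = {}" using h dp2 by (force simp: floor_ok_def)
  have dg: "d \<notin> g" "d \<notin> h" using d dh dne by auto
  have p2': "next_plug p1 (insert d g) = p2 - d" by (auto simp: p2_def next_plug_def)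
  have g': "floor_ok p1 (insert d g)" using floor_ok_insert[OF g] pd dp1 d by auto
  have "floor_ok (p2 - d) h" using h dp2 dh by (force simp: floor_ok_def)
  then have h': "floor_ok (p2 - d) (insert d h)" using floor_ok_insert pd dh by auto
  have p3: "next_plug (p2 - d) (insert d h) = next_plug p2 h"
    using dp2 pd by (auto simp: next_plug_def)
  have l2: "legit p (insert d f # insert d g # insert d h # xs)"
    using f g' h' p xs p3 p2' by (auto simp: p1_def[symmetric]) (auto simp: p1_def p2_def next_plug_def)
  have "eqw b p1 (insert d g # insert d h # xs) (g # h # xs)"
    using eqw_vflip[of p1 "insert d g" "insert d h" xs d b] l2 dg by (simp add: p1_def)
  then have 1: "eqw b p (insert d f # insert d g # insert d h # xs) (insert d f # g # h # xs)"
    using f p by (intro eqw_Cons) (auto simp: p1_def)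
  have "eqw b p (insert d f # insert d g # insert d h # xs) (f # g # insert d h # xs)"
    using eqw_vflip[of p "insert d f" "insert d g" "insert d h # xs" d b] l2 dg d by simp
  with 1 show ?thesis by (meson eqw_sym eqw_trans)
qed

lemma slide_many:
  assumes "finite f1" "legit p ((f1 \<union> f2) # {} # h # xs)" "f1 \<inter> f2 = {}"
  shows "eqw b p ((f1 \<union> f2) # {} # h # xs) (f2 # {} # (f1 \<union> h) # xs)"
  using assms
proof (induction arbitrary: h rule: finite_induct)
  case empty
  then show ?case by (simp add: eqw_refl)
next
  case (insert d f1)
  have 1: "eqw b p (insert d (f1 \<union> f2) # {} # h # xs) ((f1 \<union> f2) # {} # insert d h # xs)"
    using insert by (intro slide) auto
  have 2: "eqw b p ((f1 \<union> f2) # {} # insert d h # xs) (f2 # {} # (f1 \<union> insert d h) # xs)"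
    using insert.IH[of "insert d h"] insert.prems eqw_legit[OF 1] by auto
  from eqw_trans[OF 1 2] show ?case by simp
qed

text \<open>All dominoes of \<open>f\<close> slide by two floors through the empty floor in the
  middle.\<close>

lemma vert_Cons:
  assumes "legit p (f # xs)"
  shows "eqw b p ({} # {} # f # xs) (f # {} # {} # xs)"
proof -
  have "legit p ((f \<union> {}) # {} # {} # xs)"
    using assms by (auto simp: next_plug_empty)
  from slide_many[OF floor_ok_finite this] assms show ?thesis by (auto intro: eqw_sym)
qed

lemma vert_append:
  assumes "legit p xs"
  shows "eqw b p ({} # {} # xs) (xs @ [{}, {}])"
  using assms
proof (induction xs arbitrary: p)
  case (Cons f xs)
  have "eqw b p ({} # {} # f # xs) (f # {} # {} # xs)" using Cons by (intro vert_Cons) auto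
  also have "eqw b p (f # {} # {} # xs) (f # xs @ [{}, {}])"
    using Cons by (intro eqw_Cons) auto
  finally show ?case by simp
qed (simp add: eqw_refl)

section \<open>Stable equivalence and appended vertical floors\<close>

abbreviation vert :: "nat \<Rightarrow> (int \<times> int) set set list" where
  "vert M \<equiv> replicate M {}"

lemma legit_vert [simp]: "p \<subseteq> D \<Longrightarrow> legit p (vert n)"
  by (induction n arbitrary: p) auto

lemma fin_vert: "p \<subseteq> D \<Longrightarrow> even n \<Longrightarrow> fin p (vert n) = p"
proof (induction n rule: less_induct)
  case (less n)
  show ?case
  proof (cases "n = 0")
    case False
    then obtain m where "n = Suc (Suc m)" using less.prems by (cases n; cases "n - 1") auto
    then show ?thesis using less by (simp add: next_plug_empty)
  qed simp
qed

text \<open>A pair of vertical floors commutes with everything, so each insertion can be postponed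
  to the end of the list. This matches the stable relation with the one in which both tilings are
  padded at the top.\<close>

lemma eqw_vert:
  assumes "eqw True p xs ys"
  shows "\<exists>a b. even a \<and> even b \<and> eqw False p (xs @ vert a) (ys @ vert b)"
  using assms
proof (induction rule: eqw.induct)
  case (eqw_refl p xs)
  then show ?case by (intro exI[of _ 0]) (simp add: eqw.eqw_refl)
next
  case (eqw_sym p xs ys)
  then obtain a b where "even a" "even b" "eqw False p (xs @ vert a) (ys @ vert b)" by blast
  then show ?case using eqw.eqw_sym by blast
next
  case (eqw_trans p xs ys zs)
  then obtain a b c d where *: "even a" "even b" "even c" "even d"
    "eqw False p (xs @ vert a) (ys @ vert b)" "eqw False p (ys @ vert c) (zs @ vert d)" by blast
  have l: "fin p xs \<subseteq> D" "fin p ys \<subseteq> D" using eqw_legit[OF *(5)] eqw_legit[OF *(6)] by (auto dest: legit_subset)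
  have 1: "eqw False p ((xs @ vert a) @ vert c) ((ys @ vert b) @ vert c)"
    using * l by (intro eqw_append_right) (auto simp: fin_vert)
  have 2: "eqw False p ((ys @ vert c) @ vert b) ((zs @ vert d) @ vert b)"
    using * l by (intro eqw_append_right) (auto simp: fin_vert)
  have 3: "(ys @ vert b) @ vert c = (ys @ vert c) @ vert b"
    by (simp add: replicate_add[symmetric] add.commute)
  from 1[unfolded 3] 2 have "eqw False p ((xs @ vert a) @ vert c) ((zs @ vert d) @ vert b)"
    by (rule eqw.eqw_trans)
  then have "eqw False p (xs @ vert (a + c)) (zs @ vert (d + b))"
    by (simp add: replicate_add)
  moreover have "even (a + c)" "even (d + b)" using * by auto
  ultimately show ?case by blast
next
  case (eqw_hflip p f xs x y)
  then show ?case using eqw.eqw_hflip[of p f xs x y False] by (intro exI[of _ 0]) simp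
next
  case (eqw_vflip p f g xs d)
  then show ?case using eqw.eqw_vflip[of p f g xs d False] by (intro exI[of _ 0]) simp
next
  case (eqw_stab p xs)
  then show ?case using vert_append[of p xs False]
    by (intro exI[of _ 0] exI[of _ 2]) (auto simp: numeral_2_eq_2)
next
  case (eqw_Cons p f xs ys)
  then obtain a b where *: "even a" "even b" "eqw False (next_plug p f) (xs @ vert a) (ys @ vert b)" by blast
  then have "eqw False p ((f # xs) @ vert a) ((f # ys) @ vert b)"
    using eqw_Cons by (simp add: eqw.eqw_Cons)
  with * show ?case by blast
qed

lemma eqw_append_vert:
  assumes "legit p xs" "even a"
  shows "eqw True p (xs @ vert a) xs"
proof -
  have "eqw True p (vert a) []" if "p \<subseteq> D" "even a" for a p
    using that
  proof (induction a rule: less_induct)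
    case (less n)
    show ?case
    proof (cases "n = 0")
      case False
      then obtain m where m: "n = Suc (Suc m)" using less.prems by (cases n; cases "n - 1") auto
      have "eqw True p ({} # {} # vert m) (vert m)" using less by (intro eqw_stab) auto
      also have "eqw True p (vert m) []" using less m by simp
      finally show ?thesis using m by simp
    qed (use less in \<open>simp add: eqw_refl\<close>)
  qed
  then have "eqw True (fin p xs) (vert a) []"
    using fin_subset[OF legit_subset[OF assms(1)]] assms(2) .
  then show ?thesis using eqw_append_left[OF assms(1), of True "vert a" "[]"] by simp
qed

lemma eqw_iff_vert:
  assumes "legit p xs" "legit p ys"
  shows "eqw True p xs ys \<longleftrightarrow> (\<exists>a b. even a \<and> even b \<and> eqw False p (xs @ vert a) (ys @ vert b))"
proof (intro iffI)
  assume "\<exists>a b. even a \<and> even b \<and> eqw False p (xs @ vert a) (ys @ vert b)"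
  then obtain a b where ab: "even a" "even b" "eqw False p (xs @ vert a) (ys @ vert b)" by blast
  have "eqw True p xs (xs @ vert a)" using eqw_append_vert[OF assms(1) ab(1)] by (rule eqw_sym)
  also have "eqw True p (xs @ vert a) (ys @ vert b)" using ab(3) by (rule eqw_mono)
  also have "eqw True p (ys @ vert b) ys" using eqw_append_vert[OF assms(2) ab(2)] .
  finally show "eqw True p xs ys" .
qed (rule eqw_vert)

text \<open>Reading a floor downwards exchanges the plugs below and above it; this prepares the
  reflection of lists as an inverse.\<close>

lemma next_plug_back:
  assumes "p \<subseteq> D" "floor_ok p f"
  shows "next_plug (next_plug p f) f = p" "floor_ok (next_plug p f) f"
proof -
  have "\<Union>f \<subseteq> D - p" using assms by (auto simp: floor_ok_def)
  then show "next_plug (next_plug p f) f = p" using assms by (auto simp: next_plug_def)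
  show "floor_ok (next_plug p f) f" using assms by (force simp: floor_ok_def next_plug_def)
qed

lemma legit_rev: "legit p xs \<Longrightarrow> legit (fin p xs) (rev xs) \<and> fin (fin p xs) (rev xs) = p"
proof (induction xs arbitrary: p)
  case (Cons f xs)
  then show ?case using next_plug_back[of p f] by auto
qed simp

text \<open>One vertical flip removes a domino together with its copy on the next floor; in the end
  a pair of vertical floors is left, which is cancelled by \<open>eqw_stab\<close>.\<close>

lemma eqw_cancel_floor:
  assumes "legit p xs" "floor_ok p f"
  shows "eqw True p (f # f # xs) xs"
proof -
  have p: "p \<subseteq> D" using assms legit_subset by auto
  have "finite f" using assms floor_ok_finite by auto
  moreover have "eqw True p (g # g # xs) xs" if "finite g" "g \<subseteq> f" for g
    using that
  proof (induction rule: finite_induct)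
    case empty then show ?case using assms by (auto intro: eqw_stab)
  next
    case (insert d g)
    have ok: "floor_ok p (insert d g)" using insert assms floor_ok_subset by metis
    have "eqw True p (insert d g # insert d g # xs) ((insert d g - {d}) # (insert d g - {d}) # xs)"
      using ok assms p next_plug_back[OF p ok] by (intro eqw_vflip) auto
    also have "eqw True p ((insert d g - {d}) # (insert d g - {d}) # xs) xs" using insert by simp
    finally show ?case .
  qed
  ultimately show ?thesis by blast
qed

text \<open>The two equal floors in the middle cancel, then the next two around them, and so on.
  Reflection in a horizontal plane thus yields inverses.\<close>

lemma eqw_rev: "legit p xs \<Longrightarrow> eqw True p (xs @ rev xs) []"
proof (induction xs arbitrary: p)
  case (Cons f xs)
  have ok: "p \<subseteq> D" "floor_ok p f" using Cons.prems by auto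
  have IH: "eqw True (next_plug p f) (xs @ rev xs) []" using Cons.prems by (intro Cons.IH) simp
  have "fin (next_plug p f) (xs @ rev xs) = next_plug p f" using eqw_legit[OF IH] by (metis fin.simps(1))
  then have "legit (fin (next_plug p f) (xs @ rev xs)) [f]"
    using next_plug_back[OF ok] ok by (simp del: fin_append)
  then have "eqw True (next_plug p f) ((xs @ rev xs) @ [f]) ([] @ [f])"
    using eqw_append_right[OF IH] by blast
  then have "eqw True p (f # (xs @ rev xs) @ [f]) (f # [f])"
    using ok by (simp add: eqw_Cons)
  also have "eqw True p (f # [f]) []" using ok eqw_cancel_floor[of p "[]" f] by simp
  finally show ?case by simp
qed (simp add: eqw_refl)

lemma eqw_rev_left: "legit p xs \<Longrightarrow> eqw True (fin p xs) (rev xs @ xs) []"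
  using eqw_rev[of "fin p xs" "rev xs"] legit_rev[of p xs] by simp

end

section \<open>Tokens on a snake\<close>

definition move_token :: "nat set \<Rightarrow> nat \<Rightarrow> nat \<Rightarrow> nat set" where
  "move_token A i j = insert j (A - {i})"

text \<open>
  Positions \<open>i\<close> and \<open>j\<close> in consecutive rows of length \<open>W\<close> are adjacent if they are mirror images of
  each other in the turning point \<open>r * W - 1/2\<close> of the path.
\<close>

definition snake_edge :: "nat \<Rightarrow> nat \<Rightarrow> nat \<Rightarrow> nat \<Rightarrow> bool" where
  "snake_edge W n i j \<longleftrightarrow> i < j \<and> j < n \<and>
     (j = Suc i \<or> (\<exists>r\<ge>1. i + j + 1 = 2 * (r * W) \<and> j < r * W + W))"

definition token_state :: "nat \<Rightarrow> nat \<Rightarrow> nat set \<Rightarrow> nat \<Rightarrow> nat \<Rightarrow> bool" where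
  "token_state n K A i j \<longleftrightarrow> A \<subseteq> {..<n} \<and> card A = K \<and> i \<in> A \<and> j \<notin> A"

text \<open>The additive form avoids truncated subtraction; it is used for intervals
  \<open>I\<close> as well as for \<open>UNIV\<close>.\<close>

lemma card_move_token:
  assumes "finite A" "i \<in> A" "j \<notin> A"
  shows "card (move_token A i j \<inter> I) + (if i \<in> I then 1 else 0) = card (A \<inter> I) + (if j \<in> I then 1 else 0)"
proof -
  have 1: "card (A \<inter> I) = card ((A - {i}) \<inter> I) + (if i \<in> I then 1 else 0)"
  proof (cases "i \<in> I")
    case True
    then have "A \<inter> I = insert i ((A - {i}) \<inter> I)" using assms by auto
    then show ?thesis using assms True by simp
  next
    case False
    then have "A \<inter> I = (A - {i}) \<inter> I" by auto
    then show ?thesis using False by simp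
  qed
  have 2: "card (move_token A i j \<inter> I) = card ((A - {i}) \<inter> I) + (if j \<in> I then 1 else 0)"
    using assms by (auto simp: move_token_def Int_insert_left)
  show ?thesis using 1 2 by simp
qed

lemma card_Un_block:
  assumes "finite S" "S \<subseteq> {..<l::nat}" shows "card (S \<union> {l..<l + m}) = card S + m"
proof -
  have "S \<inter> {l..<l + m} = {}" using assms by auto
  then show ?thesis using assms by (simp add: card_Un_disjoint)
qed

lemma down_closed_block:
  fixes S :: "nat set"
  assumes "S \<subseteq> {l..<u}" "\<And>x. Suc x \<in> S \<Longrightarrow> l \<le> x \<Longrightarrow> x \<in> S"
  shows "S = {l..<l + card S}"
proof (cases "S = {}")
  case False
  have fin: "finite S" using assms(1) finite_subset by blast
  define m where "m = Max S"
  have m: "m \<in> S" using False fin by (simp add: m_def)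
  have *: "m - d \<in> S" if "d \<le> m - l" for d
    using that
  proof (induction d)
    case (Suc d)
    then have "Suc (m - Suc d) = m - d" "l \<le> m - Suc d" by auto
    then show ?case using Suc assms(2)[of "m - Suc d"] by simp
  qed (use m in simp)
  have "x \<in> S" if "l \<le> x" "x \<le> m" for x
    using *[of "m - x"] that by simp
  then have "{l..m} \<subseteq> S" by (simp add: subset_iff)
  moreover have "S \<subseteq> {l..m}" using assms(1) Max_ge[OF fin] by (force simp: m_def)
  ultimately have S: "S = {l..m}" by (rule equalityI[rotated])
  have "l \<le> m" using m assms(1) by auto
  then show ?thesis by (simp add: S atLeastLessThanSuc_atLeastAtMost)
qed simp

text \<open>An axiomatic form of the classes of passages, which separates the counting from the
  tilings. Only passages towards the larger position are recorded, the reverse ones being inverses.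
  In \<open>Phi_face\<close> the passage over the long edge of a square is compared with the passage
  over the short edge, taken after the tokens at \<open>i\<close> and \<open>j\<close> have both
  advanced by one.\<close>

locale token_rep = group G for G (structure) +
  fixes n K W R :: nat and Phi :: "nat set \<Rightarrow> nat \<Rightarrow> nat \<Rightarrow> 'a"
  assumes W: "3 \<le> W" and R: "4 \<le> R" and n: "n = R * W" and K: "2 * K = n"
    and Phi_closed: "token_state n K A i j \<Longrightarrow> snake_edge W n i j \<Longrightarrow> Phi A i j \<in> carrier G"
    and Phi_path: "token_state n K A i (Suc i) \<Longrightarrow> Suc i < n \<Longrightarrow> Phi A i (Suc i) = \<one>"
    and Phi_comm: "token_state n K A i j \<Longrightarrow> token_state n K A k l \<Longrightarrow> snake_edge W n i j \<Longrightarrow> snake_edge W n k l \<Longrightarrow>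
       i \<noteq> k \<Longrightarrow> j \<noteq> l \<Longrightarrow>
       Phi A i j \<otimes> Phi (move_token A i j) k l = Phi A k l \<otimes> Phi (move_token A k l) i j"
    and Phi_face: "token_state n K A i (Suc j) \<Longrightarrow> token_state n K A j (Suc i) \<Longrightarrow>
       snake_edge W n i (Suc j) \<Longrightarrow> snake_edge W n (Suc i) j \<Longrightarrow>
       Phi A i (Suc j) = Phi (move_token (move_token A i (Suc i)) j (Suc j)) (Suc i) j"
begin

text \<open>A slide of another token along the path commutes with the passage from \<open>i\<close>
  to \<open>j\<close>, and the class of the slide is trivial.\<close>

lemma Phi_pack_step:
  assumes A: "token_state n K A i j" and e: "snake_edge W n i j"
    and x: "Suc x \<in> A" "x \<notin> A" "x \<noteq> i" "x \<noteq> j" "Suc x \<noteq> i" "Suc x \<noteq> j"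
  shows "token_state n K (move_token A (Suc x) x) i j" "Phi A i j = Phi (move_token A (Suc x) x) i j"
    "\<And>I. (x \<in> I \<longleftrightarrow> Suc x \<in> I) \<Longrightarrow> card (move_token A (Suc x) x \<inter> I) = card (A \<inter> I)"
proof -
  have fin: "finite A" "A \<subseteq> {..<n}" "i \<in> A" "j \<notin> A" "card A = K"
    using A by (auto simp: token_state_def intro: finite_subset)
  \<comment> \<open>The commutation is applied in \<open>B\<close>, where the slide runs forwards
    from \<open>x\<close> to \<open>Suc x\<close>, since only forward passages have a class.\<close>
  define B where "B = move_token A (Suc x) x"
  show *: "card (move_token A (Suc x) x \<inter> I) = card (A \<inter> I)" if "x \<in> I \<longleftrightarrow> Suc x \<in> I" for I
    using card_move_token[OF fin(1) x(1,2), of I] that by (auto split: if_splits)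
  have cB: "card B = K" using *[of UNIV] fin by (simp add: B_def)
  have sn: "Suc x < n" using x fin by auto
  have B: "token_state n K B i j" using fin x cB sn by (auto simp: B_def move_token_def token_state_def)
  then show "token_state n K (move_token A (Suc x) x) i j" by (simp add: B_def)
  have B2: "token_state n K B x (Suc x)"
    using fin x cB sn by (auto simp: B_def move_token_def token_state_def)
  have e2: "snake_edge W n x (Suc x)" using sn by (simp add: snake_edge_def)
  have BA: "move_token B x (Suc x) = A" using x by (auto simp: B_def move_token_def)
  have "token_state n K (move_token B i j) x (Suc x)"
  proof -
    have "card (move_token B i j \<inter> UNIV) = card B"
      using card_move_token[of B i j UNIV] B by (auto simp: token_state_def dest: finite_subset)
    moreover have "j < n" using e by (simp add: snake_edge_def)
    ultimately show ?thesis using B2 B x cB by (auto simp: token_state_def move_token_def)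
  qed
  then have "Phi (move_token B i j) x (Suc x) = \<one>" using sn by (rule Phi_path)
  moreover have "Phi B x (Suc x) = \<one>" using B2 sn by (rule Phi_path)
  moreover have "Phi B i j \<otimes> Phi (move_token B i j) x (Suc x) = Phi B x (Suc x) \<otimes> Phi (move_token B x (Suc x)) i j"
    using Phi_comm[OF B B2 e e2] x by auto
  ultimately show "Phi A i j = Phi (move_token A (Suc x) x) i j"
    using Phi_closed[OF B e] Phi_closed[OF A e] by (simp add: BA B_def[symmetric])
qed

text \<open>
  Sliding tokens along the path brings any state into one that is packed to the left in each of
  the gaps before, between and after \<open>i\<close> and \<open>j\<close>.
\<close>

definition std :: "nat \<Rightarrow> nat \<Rightarrow> nat \<Rightarrow> nat \<Rightarrow> nat set" where
  "std i j a b = {0..<a} \<union> {i} \<union> {Suc i..<Suc i + b} \<union> {Suc j..<Suc j + (K - 1 - a - b)}"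

definition gam :: "nat \<Rightarrow> nat \<Rightarrow> nat \<Rightarrow> nat \<Rightarrow> 'a" where
  "gam i j a b = Phi (std i j a b) i j"

text \<open>Every slide to the left lowers the sum of the positions. Where none is possible, the
  tokens of each gap form a block at its left end, so the state is determined by its counts; the
  third count follows from the total \<open>K\<close>.\<close>

lemma Phi_eq_gam:
  assumes "token_state n K A i j" "snake_edge W n i j"
  shows "Phi A i j = gam i j (card (A \<inter> {..<i})) (card (A \<inter> {i<..<j}))"
  using assms(1)
proof (induction "\<Sum>A" arbitrary: A rule: less_induct)
  case less
  have fin: "finite A" "A \<subseteq> {..<n}" "i \<in> A" "j \<notin> A" "card A = K" and ij: "i < j"
    using less.prems assms(2) by (auto simp: token_state_def snake_edge_def intro: finite_subset)
  show ?case
  proof (cases "\<exists>x. Suc x \<in> A \<and> x \<notin> A \<and> x \<noteq> i \<and> x \<noteq> j \<and> Suc x \<noteq> i \<and> Suc x \<noteq> j")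
    case True
    then obtain x where x: "Suc x \<in> A" "x \<notin> A" "x \<noteq> i" "x \<noteq> j" "Suc x \<noteq> i" "Suc x \<noteq> j" by blast
    define B where "B = move_token A (Suc x) x"
    note step = Phi_pack_step[OF less.prems assms(2) x, folded B_def]
    have "\<Sum>A = Suc x + \<Sum>(A - {Suc x})" by (rule sum.remove[OF fin(1) x(1)])
    moreover have "\<Sum>B = x + \<Sum>(A - {Suc x})"
      unfolding B_def move_token_def using fin x by (subst sum.insert) auto
    ultimately have "\<Sum>B < \<Sum>A" by simp
    have c: "card (B \<inter> {..<i}) = card (A \<inter> {..<i})" "card (B \<inter> {i<..<j}) = card (A \<inter> {i<..<j})"
      by (rule step(3); use x in \<open>simp; linarith\<close>)+
    from less.hyps[OF \<open>\<Sum>B < \<Sum>A\<close> step(1)] show ?thesis unfolding c step(2) .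
  next
    case False
    define a b c where "a = card (A \<inter> {..<i})" and "b = card (A \<inter> {i<..<j})" and "c = card (A \<inter> {j<..<n})"
    have 1: "A \<inter> {..<i} = {0..<a}"
    proof -
      have "A \<inter> {..<i} = {0..<0 + card (A \<inter> {..<i})}"
        by (rule down_closed_block) (use False fin ij in auto)
      then show ?thesis by (simp add: a_def)
    qed
    have 2: "A \<inter> {i<..<j} = {Suc i..<Suc i + b}"
    proof -
      have "A \<inter> {i<..<j} = {Suc i..<Suc i + card (A \<inter> {i<..<j})}"
        by (rule down_closed_block) (use False fin ij in auto)
      then show ?thesis by (simp add: b_def)
    qed
    have 3: "A \<inter> {j<..<n} = {Suc j..<Suc j + c}"
    proof -
      have "A \<inter> {j<..<n} = {Suc j..<Suc j + card (A \<inter> {j<..<n})}"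
        by (rule down_closed_block) (use False fin ij in auto)
      then show ?thesis by (simp add: c_def)
    qed
    have "A = (A \<inter> {..<i}) \<union> {i} \<union> (A \<inter> {i<..<j}) \<union> (A \<inter> {j<..<n})"
    proof (rule Set.set_eqI)
      fix x
      have "x \<in> A \<Longrightarrow> x < n" using fin by auto
      then show "x \<in> A \<longleftrightarrow> x \<in> (A \<inter> {..<i}) \<union> {i} \<union> (A \<inter> {i<..<j}) \<union> (A \<inter> {j<..<n})"
        using fin ij linorder_less_linear[of x i] linorder_less_linear[of x j] by auto
    qed
    then have A: "A = {0..<a} \<union> {i} \<union> {Suc i..<Suc i + b} \<union> {Suc j..<Suc j + c}" by (simp only: 1 2 3)
    have ai: "a \<le> i" using 1 by (metis Int_lower2 atLeast0LessThan lessThan_subset_iff)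
    have bj: "Suc i + b \<le> Suc j" 
    proof (cases b)
      case (Suc b')
      then have "i + b \<in> {i<..<j}" using 2 by auto
      then show ?thesis by simp
    qed (use ij in simp)
    have "card A = a + 1 + b + c"
    proof -
      have e1: "card ({0..<a} \<union> {i..<i+1}) = a + 1" using ai by (subst card_Un_block) auto
      have e2: "card ({0..<a} \<union> {i..<i+1} \<union> {Suc i..<Suc i + b}) = a + 1 + b"
        using ai e1 by (subst card_Un_block) auto
      have "card ({0..<a} \<union> {i..<i+1} \<union> {Suc i..<Suc i + b} \<union> {Suc j..<Suc j + c}) = a + 1 + b + c"
        using ai bj ij e2 by (subst card_Un_block) auto
      moreover have "{i..<i+1} = {i}" by auto
      ultimately show ?thesis using A by simp
    qed
    then have "c = K - 1 - a - b" using fin by simp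
    then have "A = std i j a b" using A by (simp add: std_def)
    then show ?thesis by (simp add: gam_def a_def b_def)
  qed
qed

lemma Phi_gam:
  assumes "token_state n K A i j" "snake_edge W n i j" "card (A \<inter> {..<i}) = a" "card (A \<inter> {i<..<j}) = b"
  shows "Phi A i j = gam i j a b"
  using Phi_eq_gam[OF assms(1,2)] assms(3,4) by simp

text \<open>
  A state with prescribed token counts in the five gaps that two tokens \<open>i < k\<close> and two holes
  \<open>p < q\<close> (in any order relative to \<open>k\<close>) leave on the snake. The four special positions are
  \<open>s1 < s2 < s3 < s4\<close>, and \<open>t\<close> tells which of them carry a token.
\<close>

definition gaps :: "nat \<Rightarrow> nat \<Rightarrow> nat \<Rightarrow> nat \<Rightarrow> nat \<Rightarrow> nat \<Rightarrow> nat \<Rightarrow> nat \<Rightarrow> nat \<Rightarrow> bool \<Rightarrow> bool \<Rightarrow> bool \<Rightarrow> bool \<Rightarrow> nat set" where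
  "gaps s1 s2 s3 s4 al be ga de ep t1 t2 t3 t4 =
     {0..<0 + al} \<union> {s1..<s1 + of_bool t1} \<union> {Suc s1..<Suc s1 + be} \<union> {s2..<s2 + of_bool t2} \<union>
     {Suc s2..<Suc s2 + ga} \<union> {s3..<s3 + of_bool t3} \<union> {Suc s3..<Suc s3 + de} \<union>
     {s4..<s4 + of_bool t4} \<union> {Suc s4..<Suc s4 + ep}"

text \<open>All pieces of \<open>gaps\<close>, the special positions included, are intervals
  \<open>{l..<l + m}\<close> in increasing order, so that repeated use of
  \<open>card_Un_block\<close> gives every count.\<close>

lemma gaps_props:
  fixes t1 t2 t3 t4 :: bool
  assumes "al \<le> s1" "s1 + be < s2" "s2 + ga < s3" "s3 + de < s4" "s4 + ep < n"
  defines "A \<equiv> gaps s1 s2 s3 s4 al be ga de ep t1 t2 t3 t4"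
  shows "A \<subseteq> {..<n}" "finite A" "s1 \<in> A \<longleftrightarrow> t1" "s2 \<in> A \<longleftrightarrow> t2" "s3 \<in> A \<longleftrightarrow> t3" "s4 \<in> A \<longleftrightarrow> t4"
    "card (A \<inter> {..<s1}) = al" "card (A \<inter> {..<s2}) = al + of_bool t1 + be"
    "card (A \<inter> {s1<..<s3}) = be + of_bool t2 + ga"
    "card (A \<inter> {s1<..<s4}) = be + of_bool t2 + ga + of_bool t3 + de"
    "card (A \<inter> {s2<..<s4}) = ga + of_bool t3 + de"
    "card (A \<inter> {s2<..<s3}) = ga"
    "card A = al + of_bool t1 + be + of_bool t2 + ga + of_bool t3 + de + of_bool t4 + ep"
proof -
  show "A \<subseteq> {..<n}" "s1 \<in> A \<longleftrightarrow> t1" "s2 \<in> A \<longleftrightarrow> t2" "s3 \<in> A \<longleftrightarrow> t3" "s4 \<in> A \<longleftrightarrow> t4"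
    using assms(1-5) by (auto simp: A_def gaps_def of_bool_def split: if_splits)
  show "finite A" by (simp add: A_def gaps_def)
  have eqs: "A \<inter> {..<s1} = {0..<0 + al}"
    "A \<inter> {..<s2} = {0..<0 + al} \<union> {s1..<s1 + of_bool t1} \<union> {Suc s1..<Suc s1 + be}"
    "A \<inter> {s1<..<s3} = {Suc s1..<Suc s1 + be} \<union> {s2..<s2 + of_bool t2} \<union> {Suc s2..<Suc s2 + ga}"
    "A \<inter> {s1<..<s4} = {Suc s1..<Suc s1 + be} \<union> {s2..<s2 + of_bool t2} \<union> {Suc s2..<Suc s2 + ga} \<union>
       {s3..<s3 + of_bool t3} \<union> {Suc s3..<Suc s3 + de}"
    "A \<inter> {s2<..<s4} = {Suc s2..<Suc s2 + ga} \<union> {s3..<s3 + of_bool t3} \<union> {Suc s3..<Suc s3 + de}"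
    "A \<inter> {s2<..<s3} = {Suc s2..<Suc s2 + ga}"
    using assms(1-5) by (auto simp: A_def gaps_def of_bool_def split: if_splits)
  show "card (A \<inter> {..<s1}) = al" "card (A \<inter> {s2<..<s3}) = ga" unfolding eqs by simp_all
  show "card (A \<inter> {..<s2}) = al + of_bool t1 + be" unfolding eqs using assms(1-5)
    by (subst card_Un_block, force, force split: if_splits simp: of_bool_def)+ simp
  show "card (A \<inter> {s1<..<s3}) = be + of_bool t2 + ga" unfolding eqs using assms(1-5)
    by (subst card_Un_block, force, force split: if_splits simp: of_bool_def)+ simp
  show "card (A \<inter> {s1<..<s4}) = be + of_bool t2 + ga + of_bool t3 + de" unfolding eqs using assms(1-5)
    by (subst card_Un_block, force, force split: if_splits simp: of_bool_def)+ simp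
  show "card (A \<inter> {s2<..<s4}) = ga + of_bool t3 + de" unfolding eqs using assms(1-5)
    by (subst card_Un_block, force, force split: if_splits simp: of_bool_def)+ simp
  show "card A = al + of_bool t1 + be + of_bool t2 + ga + of_bool t3 + de + of_bool t4 + ep"
    unfolding A_def gaps_def using assms(1-5)
    by (subst card_Un_block, force, force split: if_splits simp: of_bool_def)+ simp
qed

section \<open>Relations between packed passages\<close>

lemma token_state_move:
  assumes "token_state n K A i j" "token_state n K A k l" "i \<noteq> k" "j \<noteq> l" "j < n"
  shows "token_state n K (move_token A i j) k l"
proof -
  have "finite A" using assms(1) by (auto simp: token_state_def intro: finite_subset)
  then have "card (move_token A i j) = card A"
    using card_move_token[of A i j UNIV] assms(1) by (simp add: token_state_def)
  then show ?thesis using assms by (auto simp: token_state_def move_token_def)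
qed

text \<open>The edges interleave, \<open>i < k < j < l\<close>, so each passage changes what the
  other one counts. The move of \<open>k\<close> takes a token out of the gap between
  \<open>i\<close> and \<open>j\<close>; the move of \<open>i\<close> takes one from in front of
  \<open>k\<close> and puts one between \<open>k\<close> and \<open>l\<close>.\<close>

lemma gam_cross:
  assumes e: "snake_edge W n i j" "snake_edge W n k l"
    and le: "al \<le> i" "i + be < k" "k + ga < j" "j + de < l" "l + ep < n" "al + be + ga + de + ep + 2 = K"
  shows "gam i j al (be + 1 + ga) \<otimes> gam k l (al + be) (ga + de + 1) =
         gam k l (al + be + 1) (ga + de) \<otimes> gam i j al (be + ga)"
proof -
  define A where "A = gaps i k j l al be ga de ep True True False False"
  note g = gaps_props[OF le(1-5), of True True False False, folded A_def]
  have ij: "token_state n K A i j" and kl: "token_state n K A k l"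
    using g le(6) by (auto simp: token_state_def)
  have ne: "i \<noteq> k" "j \<noteq> l" using le by auto
  have ln: "j < n" "l < n" using le by auto
  have ij': "token_state n K (move_token A k l) i j" and kl': "token_state n K (move_token A i j) k l"
    using token_state_move[OF ij kl] token_state_move[OF kl ij] ne ln by auto
  have "Phi A i j = gam i j al (be + 1 + ga)" using g by (intro Phi_gam[OF ij e(1)]) auto
  moreover have "Phi A k l = gam k l (al + be + 1) (ga + de)" using g by (intro Phi_gam[OF kl e(2)]) auto
  moreover have "Phi (move_token A k l) i j = gam i j al (be + ga)"
    using g card_move_token[of A k l "{..<i}"] card_move_token[of A k l "{i<..<j}"] le
    by (intro Phi_gam[OF ij' e(1)]) auto
  moreover have "Phi (move_token A i j) k l = gam k l (al + be) (ga + de + 1)"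
    using g card_move_token[of A i j "{..<k}"] card_move_token[of A i j "{k<..<l}"] le
    by (intro Phi_gam[OF kl' e(2)]) auto
  moreover have "Phi A i j \<otimes> Phi (move_token A i j) k l = Phi A k l \<otimes> Phi (move_token A k l) i j"
    using Phi_comm[OF ij kl e] ne by simp
  ultimately show ?thesis by simp
qed

text \<open>For nested edges the outer passage sees the same counts before and after the inner one,
  whereas the inner passage loses one token in front of it when the outer passage comes
  first.\<close>

lemma gam_nest:
  assumes e: "snake_edge W n i (Suc l)" "snake_edge W n (Suc i) l"
    and le: "a \<le> i" "Suc i + b < l" "Suc l + c < n" "a + b + c + 2 = K"
  shows "gam i (Suc l) a (b + 1) \<otimes> gam (Suc i) l a b = gam (Suc i) l (a + 1) b \<otimes> gam i (Suc l) a (b + 1)"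
proof -
  define A where "A = gaps i (Suc i) l (Suc l) a 0 b 0 c True True False False"
  have le': "i + 0 < Suc i" "l + 0 < Suc l" by auto
  note g = gaps_props[OF le(1) le'(1) le(2) le'(2) le(3), of True True False False, folded A_def]
  have ij: "token_state n K A i (Suc l)" and kl: "token_state n K A (Suc i) l"
    using g le(4) by (auto simp: token_state_def)
  have ln: "Suc l < n" using le by auto
  have ij': "token_state n K (move_token A (Suc i) l) i (Suc l)"
    and kl': "token_state n K (move_token A i (Suc l)) (Suc i) l"
    using token_state_move[OF ij kl] token_state_move[OF kl ij] ln by auto
  have "Phi A i (Suc l) = gam i (Suc l) a (b + 1)" using g by (intro Phi_gam[OF ij e(1)]) auto
  moreover have "Phi A (Suc i) l = gam (Suc i) l (a + 1) b" using g by (intro Phi_gam[OF kl e(2)]) auto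
  moreover have "Phi (move_token A (Suc i) l) i (Suc l) = gam i (Suc l) a (b + 1)"
    using g card_move_token[of A "Suc i" l "{..<i}"] card_move_token[of A "Suc i" l "{i<..<Suc l}"] le
    by (intro Phi_gam[OF ij' e(1)]) auto
  moreover have "Phi (move_token A i (Suc l)) (Suc i) l = gam (Suc i) l a b"
    using g card_move_token[of A i "Suc l" "{..<Suc i}"] card_move_token[of A i "Suc l" "{Suc i<..<l}"] le
    by (intro Phi_gam[OF kl' e(2)]) auto
  moreover have "Phi A i (Suc l) \<otimes> Phi (move_token A i (Suc l)) (Suc i) l =
      Phi A (Suc i) l \<otimes> Phi (move_token A (Suc i) l) i (Suc l)"
    using Phi_comm[OF ij kl e] by simp
  ultimately show ?thesis by simp
qed

text \<open>Here the tokens are on \<open>i\<close> and \<open>l\<close>, the holes on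
  \<open>Suc i\<close> and \<open>Suc l\<close>. The token on \<open>l\<close> lies between the ends
  of the outer edge, which explains the \<open>b + 1\<close>; after both tokens have advanced it
  lies behind the inner edge.\<close>

lemma gam_face:
  assumes e: "snake_edge W n i (Suc l)" "snake_edge W n (Suc i) l"
    and le: "a \<le> i" "Suc i + b < l" "Suc l + c < n" "a + b + c + 2 = K"
  shows "gam i (Suc l) a (b + 1) = gam (Suc i) l a b"
proof -
  define A where "A = gaps i (Suc i) l (Suc l) a 0 b 0 c True False True False"
  have le': "i + 0 < Suc i" "l + 0 < Suc l" by auto
  note g = gaps_props[OF le(1) le'(1) le(2) le'(2) le(3), of True False True False, folded A_def]
  define B where "B = gaps i (Suc i) l (Suc l) a 0 b 0 c False True False True"
  note h = gaps_props[OF le(1) le'(1) le(2) le'(2) le(3), of False True False True, folded B_def]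
  have st: "token_state n K A i (Suc l)" "token_state n K A l (Suc i)"
    using g le(4) by (auto simp: token_state_def)
  have stB: "token_state n K B (Suc i) l" using h le(4) by (auto simp: token_state_def)
  have "move_token (move_token A i (Suc i)) l (Suc l) = B"
    using le by (auto simp: A_def B_def gaps_def move_token_def)
  moreover have "Phi A i (Suc l) = gam i (Suc l) a (b + 1)" using g by (intro Phi_gam[OF st(1) e(1)]) auto
  moreover have "Phi B (Suc i) l = gam (Suc i) l a b" using h by (intro Phi_gam[OF stB e(2)]) auto
  ultimately show ?thesis using Phi_face[OF st e] by simp
qed

text \<open>
  The turning points of the path are the \<open>u\<close> with \<open>row u\<close>, and \<open>Gam u k\<close> belongs to the edge that
  joins the two squares at distance \<open>k\<close> from the turning point \<open>u\<close>.
\<close>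

definition row :: "nat \<Rightarrow> bool" where
  "row u \<longleftrightarrow> (\<exists>r. u = r * W \<and> 1 \<le> r \<and> r < R)"

abbreviation Gam :: "nat \<Rightarrow> nat \<Rightarrow> nat \<Rightarrow> nat \<Rightarrow> 'a" where
  "Gam u k \<equiv> gam (u - Suc k) (u + k)"

text \<open>The counts are realizable: the gaps before, between and after the two ends have
  \<open>u - k - 1\<close>, \<open>2 * k\<close> and \<open>n - u - k - 1\<close> positions, and the
  last of them receives \<open>K - 1 - a - b\<close> tokens. All conditions are written without
  subtraction.\<close>

definition valid :: "nat \<Rightarrow> nat \<Rightarrow> nat \<Rightarrow> nat \<Rightarrow> bool" where
  "valid u k a b \<longleftrightarrow> a + k + 1 \<le> u \<and> b \<le> 2 * k \<and> a + b + 1 \<le> K \<and> K + u + k \<le> n + a + b"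

lemma row_bounds:
  assumes "row u" shows "W \<le> u" "u + W \<le> n"
proof -
  obtain r where r: "u = r * W" "1 \<le> r" "r < R" using assms by (auto simp: row_def)
  show "W \<le> u" using r by simp
  have "Suc r * W \<le> R * W" using r by (intro mult_right_mono) auto
  then show "u + W \<le> n" using r n by simp
qed

lemma row_up:
  assumes "row u" "u + W < n" shows "row (u + W)"
proof -
  obtain r where r: "u = r * W" "1 \<le> r" "r < R" using assms by (auto simp: row_def)
  have "Suc r * W < R * W" using assms r n by simp
  then have "Suc r < R" by (metis mult_less_cancel2)
  then show ?thesis unfolding row_def using r by (intro exI[of _ "Suc r"]) auto
qed

lemma row_down:
  assumes "row u" "W < u" shows "row (u - W)" "2 * W \<le> u"
proof -
  obtain r where r: "u = r * W" "1 \<le> r" "r < R" using assms by (auto simp: row_def)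
  then obtain s where s: "r = Suc s" "1 \<le> s" using assms by (cases r) auto
  then show "row (u - W)" unfolding row_def using r by (intro exI[of _ s]) auto
  have "2 * W \<le> r * W" using s by (intro mult_right_mono) auto
  then show "2 * W \<le> u" using r by simp
qed

text \<open>This is where four rows give room: at half filling there are at least two full rows of
  tokens and two full rows of holes.\<close>

lemma K_bounds: "2 * W \<le> K" "K + 2 * W \<le> n"
proof -
  have "4 * W \<le> n" unfolding n using R by (rule mult_right_mono) simp
  then show "2 * W \<le> K" "K + 2 * W \<le> n" using K by linarith+
qed

lemma row_W: "row W"
  unfolding row_def using R by (intro exI[of _ 1]) auto

lemma edge_row:
  assumes "row u" "k < W" shows "snake_edge W n (u - Suc k) (u + k)"
proof -
  obtain r where r: "u = r * W" "1 \<le> r" "r < R" using assms by (auto simp: row_def)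
  have "W \<le> u" "u + W \<le> n" using row_bounds assms by auto
  then have "u - Suc k + (u + k) + 1 = 2 * u" "u - Suc k < u + k" "u + k < n" "u + k < u + W"
    using assms(2) by auto
  then show ?thesis using r(2) unfolding snake_edge_def r(1) by blast
qed

lemma Gam_closed:
  assumes "row u" "k < W" "valid u k a b" shows "Gam u k a b \<in> carrier G"
proof -
  define A where "A = std (u - Suc k) (u + k) a b"
  have "token_state n K A (u - Suc k) (u + k)"
  proof -
    have v: "a + k + 1 \<le> u" "b \<le> 2 * k" "a + b + 1 \<le> K" "K + u + k \<le> n + a + b" "u + W \<le> n"
      using assms(3) row_bounds[OF assms(1)] by (auto simp: valid_def)
    define i c where "i = u - Suc k" and "c = K - 1 - a - b"
    have iu: "u = i + Suc k" using v by (simp add: i_def)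
    have A: "A = {0..<0+a} \<union> {i..<i+1} \<union> {Suc i..<Suc i + b} \<union> {Suc (u + k)..<Suc (u + k) + c}"
      by (auto simp: A_def std_def i_def c_def)
    have "card A = a + 1 + b + c" unfolding A using v iu
      by (subst card_Un_block, force, force)+ simp
    moreover have "A \<subseteq> {..<n}" unfolding A using v iu assms(2) by (auto simp: c_def)
    ultimately show ?thesis using v iu by (auto simp: token_state_def A i_def[symmetric] c_def)
  qed
  then show ?thesis using Phi_closed[OF _ edge_row[OF assms(1,2)]] by (simp add: gam_def A_def)
qed

text \<open>The edge at distance 0 is the step of the path around the turning point.\<close>

lemma Gam_zero:
  assumes "row u" "valid u 0 a 0" shows "Gam u 0 a 0 = \<one>"
proof -
  have v: "a + 1 \<le> u" "a + 1 \<le> K" "K + u \<le> n + a" "u + W \<le> n"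
    using assms(2) row_bounds[OF assms(1)] by (auto simp: valid_def)
  define A where "A = {0..<a} \<union> {u - 1..<u - 1 + 1} \<union> {Suc u..<Suc u + (K - 1 - a)}"
  have "card A = a + 1 + (K - 1 - a)" unfolding A_def using v
    by (subst card_Un_block, force, force)+ simp
  moreover have "A \<subseteq> {..<n}" unfolding A_def using v W by auto
  ultimately have "token_state n K A (u - 1) u" using v by (auto simp: token_state_def A_def)
  moreover have "A = std (u - 1) u a 0" by (auto simp: A_def std_def)
  ultimately have st: "token_state n K (std (u - 1) u a 0) (u - 1) u" by simp
  have "Suc (u - 1) = u" "u < n" using v W by auto
  then show ?thesis using Phi_path[of "std (u - 1) u a 0" "u - 1"] st by (simp add: gam_def)
qed

lemma Gam_face:
  assumes "row u" "k + 1 < W" "valid u (k + 1) a (b + 1)" "b \<le> 2 * k"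
  shows "Gam u (k + 1) a (b + 1) = Gam u k a b"
proof -
  define i where "i = u - Suc (Suc k)"
  have "u = i + Suc (Suc k)" using assms by (auto simp: i_def valid_def)
  then have i: "u - Suc k = Suc i" "u - Suc (k + 1) = i" by auto
  have "u + (k + 1) < n" using assms row_bounds[OF assms(1)] by auto
  then show ?thesis
    using gam_face[of i "u + k" a b "K - a - b - 2"] edge_row[OF assms(1,2)] edge_row[OF assms(1), of k] assms i
    by (auto simp: valid_def)
qed

lemma Gam_reduce:
  assumes "row u" "k + m < W" "valid u (k + m) a (b + m)" "b \<le> 2 * k"
  shows "Gam u (k + m) a (b + m) = Gam u k a b"
  using assms
proof (induction m)
  case (Suc m)
  have "Gam u (k + m + 1) a (b + m + 1) = Gam u (k + m) a (b + m)"
    using Suc.prems by (intro Gam_face) auto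
  also have "\<dots> = Gam u k a b" using Suc by (intro Suc.IH) (auto simp: valid_def)
  finally show ?case by simp
qed simp

text \<open>If the gap between the ends is half filled, the face relation strips off one layer after
  another down to the step of the path at the turn.\<close>

lemma Gam_middle: "row u \<Longrightarrow> k < W \<Longrightarrow> valid u k a k \<Longrightarrow> Gam u k a k = \<one>"
  using Gam_reduce[of u 0 k a 0] Gam_zero[of u a] by (auto simp: valid_def)

text \<open>With one token more than half the stripping stops at distance 1 with both inner
  positions occupied. This is the class that will generate everything.\<close>

lemma Gam_above: "row u \<Longrightarrow> 1 \<le> k \<Longrightarrow> k < W \<Longrightarrow> valid u k a (Suc k) \<Longrightarrow> Gam u k a (Suc k) = Gam u 1 a 2"
  using Gam_reduce[of u 1 "k - 1" a 2] by (auto simp: numeral_2_eq_2)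

text \<open>By the face relation the outer and the inner passage have the same class
  \<open>x\<close>, so the nested relation reads \<open>x x = y x\<close> and cancellation gives
  \<open>x = y\<close>. It takes an edge around the given one, hence
  \<open>k + 1 < W\<close>.\<close>

lemma Gam_indep_step:
  assumes u: "row u" and k: "k + 1 < W" and v: "valid u k a b" "valid u k (a + 1) b"
  shows "Gam u k a b = Gam u k (a + 1) b"
proof -
  define i where "i = u - Suc (Suc k)"
  have vb: "a + k + 2 \<le> u" "b \<le> 2 * k" "a + b + 2 \<le> K" "K + u + k \<le> n + a + b"
    using v by (auto simp: valid_def)
  have "u = i + Suc (Suc k)" using vb by (auto simp: i_def)
  then have i: "u - Suc k = Suc i" "u - Suc (k + 1) = i" by auto
  have un: "u + (k + 1) < n" using k row_bounds[OF u] by auto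
  have e: "snake_edge W n i (Suc (u + k))" "snake_edge W n (Suc i) (u + k)"
    using edge_row[OF u, of k] edge_row[OF u, of "k + 1"] i k by auto
  have v': "valid u (k + 1) a (b + 1)" using vb by (auto simp: valid_def)
  have face: "gam i (Suc (u + k)) a (b + 1) = gam (Suc i) (u + k) a b"
    using Gam_face[OF u k v' vb(2)] i by simp
  have "gam i (Suc (u + k)) a (b + 1) \<otimes> gam (Suc i) (u + k) a b =
        gam (Suc i) (u + k) (a + 1) b \<otimes> gam i (Suc (u + k)) a (b + 1)"
    using gam_nest[OF e, of a b "K - a - b - 2"] vb i un by auto
  moreover have "gam (Suc i) (u + k) a b \<in> carrier G" "gam (Suc i) (u + k) (a + 1) b \<in> carrier G"
    using Gam_closed[OF u _ v(1)] Gam_closed[OF u _ v(2)] k i by auto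
  ultimately show ?thesis using face i by simp
qed

lemma Gam_indep:
  assumes "row u" "k + 1 < W" "valid u k a b" "valid u k a' b"
  shows "Gam u k a b = Gam u k a' b"
proof -
  have *: "Gam u k a b = Gam u k (a + m) b" if "valid u k a b" "valid u k (a + m) b" for a m
    using that
  proof (induction m)
    case (Suc m)
    then have "valid u k (a + m) b" by (auto simp: valid_def)
    then show ?case using Suc Gam_indep_step[OF assms(1,2), of "a + m" b] by auto
  qed simp
  show ?thesis
  proof (cases "a \<le> a'")
    case True
    then obtain m where "a' = a + m" using le_Suc_ex by blast
    then show ?thesis using *[of a m] assms(3,4) by blast
  next
    case False
    then obtain m where "a = a' + m" using le_Suc_ex nat_le_linear by blast
    then show ?thesis using *[of a' m, symmetric] assms(3,4) by blast
  qed
qed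

text \<open>For distances \<open>k\<close> and \<open>W - k\<close> around consecutive turning
  points the second edge starts at \<open>u + k - 1\<close>, immediately before the end
  \<open>u + k\<close> of the first, so the middle count \<open>ga\<close> of
  \<open>gam_cross\<close> is 0.\<close>

lemma Gam_cross:
  assumes u: "row u" "row (u + W)" and k: "1 \<le> k" "k' = W - k" "1 \<le> k'"
    and le: "al + k + 1 \<le> u" "be + 1 \<le> 2 * k" "de + 1 \<le> 2 * k'" "al + be + de + 2 \<le> K"
      "K + u + W + k' + 1 \<le> n + al + be + de + 2"
  shows "Gam u k al (be + 1) \<otimes> Gam (u + W) k' (al + be) (de + 1) =
         Gam (u + W) k' (al + be + 1) de \<otimes> Gam u k al be"
    and "valid u k al (be + 1)" "valid u k al be" "valid (u + W) k' (al + be) (de + 1)"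
      "valid (u + W) k' (al + be + 1) de"
proof -
  have kW: "k < W" "k' < W" "k + k' = W" using k by auto
  have b: "u + W + W \<le> n" using row_bounds[OF u(2)] by auto
  define ep where "ep = K - (al + be + de + 2)"
  have "gam (u - Suc k) (u + k) al (be + 1 + 0) \<otimes> gam (u + W - Suc k') (u + W + k') (al + be) (0 + de + 1) =
         gam (u + W - Suc k') (u + W + k') (al + be + 1) (0 + de) \<otimes> gam (u - Suc k) (u + k) al (be + 0)"
    using le kW b k
    by (intro gam_cross[OF edge_row[OF u(1) kW(1)] edge_row[OF u(2) kW(2)], of _ _ _ _ ep]) (auto simp: ep_def)
  then show "Gam u k al (be + 1) \<otimes> Gam (u + W) k' (al + be) (de + 1) =
         Gam (u + W) k' (al + be + 1) de \<otimes> Gam u k al be" by simp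
  show "valid u k al (be + 1)" "valid u k al be" "valid (u + W) k' (al + be) (de + 1)"
      "valid (u + W) k' (al + be + 1) de"
    using le kW b k by (auto simp: valid_def)
qed


text \<open>A substitute for commutativity: \<open>a\<close> equals \<open>c\<close>,
  \<open>d\<close> and the inverse of \<open>b\<close> in this order, so if \<open>b\<close> and
  \<open>c\<close> are known, membership passes between \<open>a\<close> and
  \<open>d\<close>.\<close>

lemma subgroup_fourth:
  assumes H: "subgroup H G" and eq: "a \<otimes> b = c \<otimes> d"
    and cl: "a \<in> carrier G" "b \<in> carrier G" "c \<in> carrier G" "d \<in> carrier G"
  shows "b \<in> H \<Longrightarrow> c \<in> H \<Longrightarrow> a \<in> H \<longleftrightarrow> d \<in> H" and "a \<in> H \<Longrightarrow> d \<in> H \<Longrightarrow> b \<in> H \<longleftrightarrow> c \<in> H"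
proof -
  note m = subgroup.m_closed[OF H] subgroup.m_inv_closed[OF H]
  have 1: "a = (c \<otimes> d) \<otimes> inv b" using eq cl by (metis inv_solve_right m_closed)
  have 2: "d = inv c \<otimes> (a \<otimes> b)" using eq cl by (metis inv_solve_left m_closed)
  have 3: "b = inv a \<otimes> (c \<otimes> d)" using eq cl by (metis inv_solve_left m_closed)
  have 4: "c = (a \<otimes> b) \<otimes> inv d" using eq cl by (metis inv_solve_right m_closed)
  {
    assume "b \<in> H" "c \<in> H"
    then show "a \<in> H \<longleftrightarrow> d \<in> H" using m 1[symmetric] 2[symmetric] by (metis (no_types))
  }
  {
    assume "a \<in> H" "d \<in> H"
    then show "b \<in> H \<longleftrightarrow> c \<in> H" using m 3[symmetric] 4[symmetric] by (metis (no_types))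
  }
qed

section \<open>Generation by a single corner passage\<close>

context
  fixes H and a0 :: nat
  assumes H: "subgroup H G" and seed: "valid W 1 a0 2" "Gam W 1 a0 2 \<in> H"
begin

lemma Gam_cross_H:
  assumes u: "row u" "row (u + W)" and k: "1 \<le> k" "k' = W - k" "1 \<le> k'"
    and le: "al + k + 1 \<le> u" "be + 1 \<le> 2 * k" "de + 1 \<le> 2 * k'" "al + be + de + 2 \<le> K"
      "K + u + W + k' + 1 \<le> n + al + be + de + 2"
  shows "Gam (u + W) k' (al + be) (de + 1) \<in> H \<Longrightarrow> Gam (u + W) k' (al + be + 1) de \<in> H \<Longrightarrow>
      Gam u k al (be + 1) \<in> H \<longleftrightarrow> Gam u k al be \<in> H"
    and "Gam u k al (be + 1) \<in> H \<Longrightarrow> Gam u k al be \<in> H \<Longrightarrow>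
      Gam (u + W) k' (al + be) (de + 1) \<in> H \<longleftrightarrow> Gam (u + W) k' (al + be + 1) de \<in> H"
proof -
  note c = Gam_cross[OF u k le]
  have kW: "k < W" "k' < W" using k by auto
  note cl = Gam_closed[OF u(1) kW(1) c(2)] Gam_closed[OF u(2) kW(2) c(4)]
    Gam_closed[OF u(2) kW(2) c(5)] Gam_closed[OF u(1) kW(1) c(3)]
  show "Gam (u + W) k' (al + be) (de + 1) \<in> H \<Longrightarrow> Gam (u + W) k' (al + be + 1) de \<in> H \<Longrightarrow>
      Gam u k al (be + 1) \<in> H \<longleftrightarrow> Gam u k al be \<in> H"
    by (rule subgroup_fourth(1)[OF H c(1) cl])
  show "Gam u k al (be + 1) \<in> H \<Longrightarrow> Gam u k al be \<in> H \<Longrightarrow>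
      Gam (u + W) k' (al + be) (de + 1) \<in> H \<longleftrightarrow> Gam (u + W) k' (al + be + 1) de \<in> H"
    by (rule subgroup_fourth(2)[OF H c(1) cl])
qed

lemma one_H: "\<one> \<in> H" using H by (rule subgroup.one_closed)

lemma indep_H:
  "row u \<Longrightarrow> k + 1 < W \<Longrightarrow> valid u k a b \<Longrightarrow> valid u k a' b \<Longrightarrow> Gam u k a b \<in> H \<Longrightarrow> Gam u k a' b \<in> H"
  using Gam_indep[of u k a b a'] by simp

text \<open>Induction over the turning points. In the crossing relation at distances 1 and
  \<open>W - 1\<close> two factors are trivial because their gaps are half filled, one is the seed
  at \<open>u\<close>, and the fourth reduces by faces to the seed at \<open>u + W\<close>.\<close>

lemma seed_H: assumes "row u" "valid u 1 a 2" shows "Gam u 1 a 2 \<in> H"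
proof -
  obtain r where r: "u = r * W" "1 \<le> r" "r < R" using assms by (auto simp: row_def)
  have "\<forall>a. valid (Suc s * W) 1 a 2 \<longrightarrow> Gam (Suc s * W) 1 a 2 \<in> H" if "Suc s < R" for s
    using that
  proof (induction s)
    case 0
    show ?case using indep_H[OF row_W _ seed(1) _ seed(2)] W by simp
  next
    case (Suc s)
    define u where "u = Suc s * W"
    have u: "row u" unfolding u_def row_def using Suc.prems by (intro exI[of _ "Suc s"]) auto
    have uW: "u + W = Suc (Suc s) * W" by (simp add: u_def)
    have u2: "row (u + W)" unfolding uW row_def using Suc.prems by (intro exI[of _ "Suc (Suc s)"]) auto
    have IH: "valid u 1 a 2 \<Longrightarrow> Gam u 1 a 2 \<in> H" for a using Suc by (simp add: u_def)
    have b: "W \<le> u" "u + 2 * W \<le> n" "2 * W \<le> K" "K + 2 * W \<le> n"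
      using row_bounds[OF u] row_bounds[OF u2] K_bounds by auto
    \<comment> \<open>The least number of tokens in front for which the remaining ones fit;
      truncation to 0 covers the case without such a constraint.\<close>
    define al where "al = K + u + W - 2 - n"
    have p: "al + 1 + 1 \<le> u" "1 + 1 \<le> 2 * (1::nat)" "(W - 1) + 1 \<le> 2 * (W - 1)" "al + 1 + (W - 1) + 2 \<le> K"
      "K + u + W + (W - 1) + 1 \<le> n + al + 1 + (W - 1) + 2" "1 \<le> (1::nat)" "W - 1 = W - 1" "1 \<le> W - 1"
      using b W by (auto simp: al_def)
    note v = Gam_cross(2-5)[OF u u2 p(6-8) p(1-5)]
    have W1: "W - 1 + 1 = W" "Suc (W - 1) = W" using W by auto
    have v1: "Gam u 1 al (1 + 1) \<in> H" using IH v(1) by (simp add: numeral_2_eq_2)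
    have v2: "Gam u 1 al 1 \<in> H" using Gam_middle[OF u _ v(2)] W one_H by simp
    have v3: "Gam (u + W) (W - 1) (al + 1 + 1) (W - 1) \<in> H" using Gam_middle[OF u2 _ v(4)] W one_H by simp
    have v4: "Gam (u + W) (W - 1) (al + 1) (W - 1 + 1) \<in> H"
      using Gam_cross_H(2)[OF u u2 p(6-8) p(1-5)] v1 v2 v3 by blast
    have v5: "Gam (u + W) (W - 1) (al + 1) (W - 1 + 1) = Gam (u + W) 1 (al + 1) 2"
      using Gam_above[OF u2 _ _, of "W - 1" "al + 1"] v(3) W by simp
    have v6: "valid (u + W) 1 (al + 1) 2" using v(3) W by (auto simp: valid_def)
    show ?case using indep_H[OF u2 _ v6] v4 v5 W unfolding uW by auto
  qed
  from this[of "r - 1"] show ?thesis using r assms by auto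
qed

lemma above_H: assumes "row u" "1 \<le> k" "k < W" "valid u k a (Suc k)" shows "Gam u k a (Suc k) \<in> H"
proof -
  have "valid u 1 a 2" using assms by (auto simp: valid_def)
  then show ?thesis using Gam_above[OF assms] seed_H[OF assms(1)] by simp
qed

lemma middle_H: assumes "row u" "k < W" "valid u k a k" shows "Gam u k a k \<in> H"
  using Gam_middle[OF assms] one_H by simp

text \<open>Induction on the distance. A gap that is neither empty nor full reduces by the face
  relation to the previous distance. For the extreme values of \<open>b\<close> the crossing
  relation changes \<open>b\<close> by one, while the gap of the partner passes between
  \<open>t + 1\<close> and \<open>t\<close> tokens, where the classes are known by
  \<open>above_H\<close> and \<open>middle_H\<close>. The count in front can be chosen freely by
  \<open>indep_H\<close>.\<close>

lemma inner_H:
  assumes "k + 2 \<le> W" "row u" "valid u k a b"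
  shows "Gam u k a b \<in> H"
  using assms
proof (induction k arbitrary: u a b)
  case 0
  then have "b = 0" by (simp add: valid_def)
  then show ?case using middle_H[of u 0 a] 0 by simp
next
  case (Suc k)
  note u = Suc.prems(2)
  have kW: "Suc k < W" "Suc k + 1 < W" using Suc.prems by auto
  have below: "Gam u (Suc k) a b \<in> H" if v: "valid u (Suc k) a b" "1 \<le> b" "b \<le> 2 * k + 1" and u: "row u" for u a b
  proof -
    have "Gam u (k + 1) a (b - 1 + 1) = Gam u k a (b - 1)"
      using v kW by (intro Gam_face[OF u]) auto
    moreover have "valid u k a (b - 1)" using v by (auto simp: valid_def)
    ultimately show ?thesis using Suc.IH[OF _ u] v kW by simp
  qed
  have b: "W \<le> u" "u + W \<le> n" "2 * W \<le> K" "K + 2 * W \<le> n"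
    using row_bounds[OF u] K_bounds by auto
  have bb: "b \<le> 2 * k + 2" using Suc.prems by (simp add: valid_def)
  define t where "t = W - Suc k"
  have t: "1 \<le> t" "Suc k + t = W" "2 \<le> t" using Suc.prems by (auto simp: t_def)
  show ?case
  proof (cases "u + W < n")
    case True
    then have u2: "row (u + W)" using row_up u by blast
    then have b2: "u + 2 * W \<le> n" using row_bounds[OF u2] by simp
    have step: "Gam u (Suc k) al (be + 1) \<in> H \<longleftrightarrow> Gam u (Suc k) al be \<in> H"
      if "al + Suc k + 1 \<le> u" "be + 1 \<le> 2 * Suc k" "al + be + t + 2 \<le> K" "K + u + W \<le> n + al + be + 1" for al be
    proof -
      have p: "t + 1 \<le> 2 * t" "K + u + W + t + 1 \<le> n + al + be + t + 2" "1 \<le> Suc k" using t that by auto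
      note v = Gam_cross(4,5)[OF u u2 p(3) t_def t(1) that(1,2) p(1) that(3) p(2)]
      have "Gam (u + W) t (al + be) (t + 1) \<in> H" using above_H[OF u2 t(1)] v(1) t by simp
      moreover have "Gam (u + W) t (al + be + 1) t \<in> H" using middle_H[OF u2] v(2) t by simp
      ultimately show ?thesis by (rule Gam_cross_H(1)[OF u u2 p(3) t_def t(1) that(1,2) p(1) that(3) p(2)])
    qed
    have "(1 \<le> b \<and> b \<le> 2 * k + 1) \<or> b = 0 \<or> b = 2 * Suc k" using bb by arith
    then consider "1 \<le> b" "b \<le> 2 * k + 1" | "b = 0" | "b = 2 * Suc k" by blast
    then show ?thesis
    proof cases
      case 1 then show ?thesis using below Suc.prems by blast
    next
      case 2
      \<comment> \<open>The least value allowed by the last condition of \<open>step\<close>; the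
        other conditions then hold by \<open>K_bounds\<close>. The later choices of
        \<open>al\<close> follow the same rule.\<close>
      define al where "al = K + u + W - 1 - n"
      have p: "al + Suc k + 1 \<le> u" "0 + 1 \<le> 2 * Suc k" "al + 0 + t + 2 \<le> K" "K + u + W \<le> n + al + 0 + 1"
        using b b2 t by (auto simp: al_def)
      have v: "valid u (Suc k) al 1" "valid u (Suc k) al 0" using p t b by (auto simp: valid_def)
      have "Gam u (Suc k) al (0 + 1) \<in> H" using below[OF v(1) _ _ u] by simp
      then have "Gam u (Suc k) al 0 \<in> H" using step[OF p] by blast
      then show ?thesis using indep_H[OF u kW(2) v(2)] Suc.prems 2 by blast
    next
      case 3
      define al where "al = K + u + W - (2 * k + 2) - n"
      have p: "al + Suc k + 1 \<le> u" "(2 * k + 1) + 1 \<le> 2 * Suc k" "al + (2 * k + 1) + t + 2 \<le> K"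
        "K + u + W \<le> n + al + (2 * k + 1) + 1"
        using b b2 t by (auto simp: al_def)
      have v: "valid u (Suc k) al (2 * k + 1)" "valid u (Suc k) al (2 * Suc k)" using p t b by (auto simp: valid_def)
      have "Gam u (Suc k) al (2 * k + 1) \<in> H" using below[OF v(1) _ _ u] by simp
      then have "Gam u (Suc k) al (2 * k + 1 + 1) \<in> H" using step[OF p] by blast
      then have "Gam u (Suc k) al (2 * Suc k) \<in> H" by simp
      then show ?thesis using indep_H[OF u kW(2) v(2)] Suc.prems 3 by blast
    qed
  next
    case False
    \<comment> \<open>At the last turning point there is no next one to cross with. The previous one
      takes over, so the roles of the two edges in the relation are exchanged.\<close>
    then have un: "u + W = n" using b by simp
    have "W < u" using un b W by linarith
    then have l: "row (u - W)" "2 * W \<le> u" using row_down u by auto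
    have lu: "row (u - W + W)" "u - W + W = u" using l u by auto
    have tk: "Suc k = W - t" using t by simp
    have step: "Gam u (Suc k) (al + t) (de + 1) \<in> H \<longleftrightarrow> Gam u (Suc k) (al + t + 1) de \<in> H"
      if "al + t + 1 \<le> u - W" "de + 1 \<le> 2 * Suc k" "al + t + de + 2 \<le> K" "K + u + Suc k + 1 \<le> n + al + t + de + 2" for al de
    proof -
      have p: "t + 1 \<le> 2 * t" "K + (u - W) + W + Suc k + 1 \<le> n + al + t + de + 2" "1 \<le> Suc k"
        using t that l by auto
      note v = Gam_cross(2,3)[OF l(1) lu(1) t(1) tk p(3) that(1) p(1) that(2,3) p(2)]
      have "Gam (u - W) t al (t + 1) \<in> H" using above_H[OF l(1) t(1)] v(1) t by simp
      moreover have "Gam (u - W) t al t \<in> H" using middle_H[OF l(1)] v(2) t by simp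
      ultimately show ?thesis
        using Gam_cross_H(2)[OF l(1) lu(1) t(1) tk p(3) that(1) p(1) that(2,3) p(2)] unfolding lu(2) by blast
    qed
    have "(1 \<le> b \<and> b \<le> 2 * k + 1) \<or> b = 0 \<or> b = 2 * Suc k" using bb by arith
    then consider "1 \<le> b" "b \<le> 2 * k + 1" | "b = 0" | "b = 2 * Suc k" by blast
    then show ?thesis
    proof cases
      case 1 then show ?thesis using below Suc.prems by blast
    next
      case 2
      define al where "al = K + u + Suc k - t - 1 - n"
      have p: "al + t + 1 \<le> u - W" "0 + 1 \<le> 2 * Suc k" "al + t + 0 + 2 \<le> K" "K + u + Suc k + 1 \<le> n + al + t + 0 + 2"
        using b l un t by (auto simp: al_def)
      have v: "valid u (Suc k) (al + t) 1" "valid u (Suc k) (al + t + 1) 0" using p t b by (auto simp: valid_def)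
      have "Gam u (Suc k) (al + t) (0 + 1) \<in> H" using below[OF v(1) _ _ u] by simp
      then have "Gam u (Suc k) (al + t + 1) 0 \<in> H" using step[OF p] by blast
      then show ?thesis using indep_H[OF u kW(2) v(2)] Suc.prems 2 by blast
    next
      case 3
      define al where "al = K + u - W - n"
      have p: "al + t + 1 \<le> u - W" "(2 * k + 1) + 1 \<le> 2 * Suc k" "al + t + (2 * k + 1) + 2 \<le> K"
        "K + u + Suc k + 1 \<le> n + al + t + (2 * k + 1) + 2"
        using b l un t by (auto simp: al_def)
      have v: "valid u (Suc k) (al + t) (2 * Suc k)" "valid u (Suc k) (al + t + 1) (2 * k + 1)"
        using p t b by (auto simp: valid_def)
      have "Gam u (Suc k) (al + t + 1) (2 * k + 1) \<in> H" using below[OF v(2) _ _ u] by simp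
      then have "Gam u (Suc k) (al + t) (2 * k + 1 + 1) \<in> H" using step[OF p] by blast
      then have "Gam u (Suc k) (al + t) (2 * Suc k) \<in> H" by simp
      then show ?thesis using indep_H[OF u kW(2) v(1)] Suc.prems 3 by blast
    qed
  qed
qed

lemma outer_H:
  assumes u: "row u" and v: "valid u (W - 1) a b"
  shows "Gam u (W - 1) a b \<in> H"
proof -
  define k where "k = W - 1"
  have k: "k + 1 = W" "2 \<le> k" "1 = W - k" "k < W" "k = W - 1" using W by (auto simp: k_def)
  have vk: "valid u k a b" using v by (simp add: k_def)
  have bd: "W \<le> u" "u + W \<le> n" "2 * W \<le> K" "K + 2 * W \<le> n"
    using row_bounds[OF u] K_bounds by auto
  have below: "Gam u k a b \<in> H" if "valid u k a b" "1 \<le> b" "b + 1 \<le> 2 * k" for a b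
  proof -
    note that' = that
    obtain m where m1: "k = m + 1" using k(2) by (cases k) auto
    obtain b' where m2: "b = b' + 1" using that'(2) by (cases b) auto
    note m = m1 m2
    have "Gam u (m + 1) a (b' + 1) = Gam u m a b'"
      using that' k(4) by (intro Gam_face[OF u]) (auto simp: m)
    moreover have "valid u m a b'" using that' by (auto simp: valid_def m)
    then have "Gam u m a b' \<in> H" using k(1) m by (intro inner_H[OF _ u]) auto
    ultimately show ?thesis by (simp add: m)
  qed
  have up: "Gam u k al (be + 1) \<in> H \<longleftrightarrow> Gam u k al be \<in> H"
    if "u + W < n" "al + k + 1 \<le> u" "be + 1 \<le> 2 * k" "de \<le> 1" "al + be + de + 2 \<le> K" "K + u + W \<le> n + al + be + de" for al be de
  proof -
    have u2: "row (u + W)" using row_up u that by blast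
    have p: "1 \<le> k" "1 \<le> (1::nat)" "de + 1 \<le> 2 * 1" "K + u + W + 1 + 1 \<le> n + al + be + de + 2" using k that by auto
    note c = Gam_cross(4,5)[OF u u2 p(1) k(3) p(2) that(2,3) p(3) that(5) p(4)]
    have "Gam (u + W) 1 (al + be) (de + 1) \<in> H" "Gam (u + W) 1 (al + be + 1) de \<in> H"
      by (rule inner_H[OF _ u2 c(1)] inner_H[OF _ u2 c(2)], use W in simp)+
    then show ?thesis by (rule Gam_cross_H(1)[OF u u2 p(1) k(3) p(2) that(2,3) p(3) that(5) p(4)])
  qed
  have down: "Gam u k (al + be) (de + 1) \<in> H \<longleftrightarrow> Gam u k (al + be + 1) de \<in> H"
    if "W < u" "al + 2 + W \<le> u" "be \<le> 1" "de + 1 \<le> 2 * k" "al + be + de + 2 \<le> K" "K + u + k + 1 \<le> n + al + be + de + 2" for al be de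
  proof -
    have l: "row (u - W)" "2 * W \<le> u" using row_down u that by auto
    have lu: "row (u - W + W)" "u - W + W = u" using l u by auto
    have p: "1 \<le> (1::nat)" "1 \<le> k" "al + 1 + 1 \<le> u - W" "be + 1 \<le> 2 * 1" "K + (u - W) + W + k + 1 \<le> n + al + be + de + 2"
      using that k l by auto
    note c = Gam_cross(2,3)[OF l(1) lu(1) p(1) k(5) p(2-4) that(4,5) p(5)]
    have "Gam (u - W) 1 al (be + 1) \<in> H" "Gam (u - W) 1 al be \<in> H"
      by (rule inner_H[OF _ l(1) c(1)] inner_H[OF _ l(1) c(2)], use W in simp)+
    then show ?thesis using Gam_cross_H(2)[OF l(1) lu(1) p(1) k(5) p(2-4) that(4,5) p(5)] unfolding lu(2) by blast
  qed
  have vb: "a + W \<le> u" "b \<le> 2 * k" "a + b + 1 \<le> K" "K + u + k \<le> n + a + b" using vk k by (auto simp: valid_def)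
  have down_row: "W < u \<Longrightarrow> 2 * W \<le> u" using row_down u by blast
  have up_row: "u + W < n \<Longrightarrow> u + 2 * W \<le> n" using row_up[OF u] row_bounds by fastforce
  have "(1 \<le> b \<and> b + 1 \<le> 2 * k) \<or> b = 0 \<or> b = 2 * k" using vb by arith
  then consider "1 \<le> b" "b + 1 \<le> 2 * k" | "b = 0" | "b = 2 * k" by blast
  then have "Gam u k a b \<in> H"
  proof cases
    case 1 then show ?thesis using below vk by blast
  next
    case 2
    show ?thesis
    proof (cases "a + 3 \<le> K")
      case True
      have p: "u + W < n" "a + k + 1 \<le> u" "0 + 1 \<le> 2 * k" "1 \<le> (1::nat)" "a + 0 + 1 + 2 \<le> K" "K + u + W \<le> n + a + 0 + 1"
        using True vb 2 k by auto
      have "valid u k a 1" using p k up_row by (auto simp: valid_def)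
      then have "Gam u k a (0 + 1) \<in> H" using below k by simp
      then show ?thesis using up[OF p] 2 by blast
    next
      case False
      \<comment> \<open>At most one token lies behind the edge, so nearly all of them are in front.
        This forces a row before \<open>u\<close> and gives \<open>a \<ge> 2\<close>.\<close>
      define al where "al = a - 2"
      have al: "a = al + 1 + 1" using False bd W by (simp add: al_def)
      have wu: "W < u" using vb False bd W by linarith
      have p: "al + 2 + W \<le> u" "1 \<le> (1::nat)" "0 + 1 \<le> 2 * k" "al + 1 + 0 + 2 \<le> K" "K + u + k + 1 \<le> n + al + 1 + 0 + 2"
        using vb 2 k al by auto
      have "valid u k (al + 1) 1" using p k by (auto simp: valid_def)
      then have "Gam u k (al + 1) (0 + 1) \<in> H" using below k by simp
      then show ?thesis using down[OF wu p] 2 al by simp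
    qed
  next
    case 3
    define be where "be = 2 * k - 1"
    have be: "2 * k = be + 1" using k by (simp add: be_def)
    show ?thesis
    proof (cases "K + u + 3 \<le> n + a + W")
      case True
      have p: "u + W < n" "a + k + 1 \<le> u" "be + 1 \<le> 2 * k" "0 \<le> (1::nat)" "a + be + 0 + 2 \<le> K" "K + u + W \<le> n + a + be + 0"
        using True vb 3 k be by auto
      have "valid u k a be" using p k up_row by (auto simp: valid_def)
      then have "Gam u k a be \<in> H" using below k be by simp
      then show ?thesis using up[OF p] 3 be by simp
    next
      case False
      \<comment> \<open>At most one hole lies behind the edge, and there are at least two rows of
        holes in all; hence \<open>u\<close> is not the first turning point.\<close>
      have wu: "W < u" using vb False bd W by linarith
      have p: "a + 2 + W \<le> u" "0 \<le> (1::nat)" "be + 1 \<le> 2 * k" "a + 0 + be + 2 \<le> K" "K + u + k + 1 \<le> n + a + 0 + be + 2"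
        using False vb bd 3 k be W by auto
      have "valid u k (a + 1) be" using p k by (auto simp: valid_def)
      then have "Gam u k (a + 1) be \<in> H" using below k be by simp
      then show ?thesis using down[OF wu p] 3 be by simp
    qed
  qed
  then show ?thesis by (simp add: k_def)
qed

end

text \<open>The seed crosses the edge at distance 1 around the first turning point with both inner
  positions occupied, so its class is \<open>Gam W 1 a0 2\<close>. Every other edge is a step of the
  path or belongs to a turning point at a distance below \<open>W\<close>.\<close>

theorem Phi_generated:
  assumes seed: "token_state n K A0 (W - 2) (W + 1)" "W - 1 \<in> A0" "W \<in> A0"
    and H: "subgroup H G" "Phi A0 (W - 2) (W + 1) \<in> H"
    and A: "token_state n K A i j" "snake_edge W n i j"
  shows "Phi A i j \<in> H"
proof -
  have fin: "finite A0" "A0 \<subseteq> {..<n}" using seed by (auto simp: token_state_def intro: finite_subset)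
  have count: "card (A \<inter> {..<i}) + card (A \<inter> {i<..<j}) + card (A \<inter> {j<..<n}) + 1 = K"
    "card (A \<inter> {..<i}) \<le> i" "card (A \<inter> {i<..<j}) \<le> j - Suc i" "card (A \<inter> {j<..<n}) \<le> n - Suc j"
    if "token_state n K A i j" "snake_edge W n i j" for A i j
  proof -
    have f: "finite A" "A \<subseteq> {..<n}" "i \<in> A" "j \<notin> A" "i < j" "card A = K"
      using that by (auto simp: token_state_def snake_edge_def intro: finite_subset)
    have "A = insert i ((A \<inter> {..<i}) \<union> (A \<inter> {i<..<j}) \<union> (A \<inter> {j<..<n}))"
    proof (rule Set.set_eqI)
      fix x
      have "x \<in> A \<Longrightarrow> x < n" using f by auto
      then show "x \<in> A \<longleftrightarrow> x \<in> insert i ((A \<inter> {..<i}) \<union> (A \<inter> {i<..<j}) \<union> (A \<inter> {j<..<n}))"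
        using f linorder_less_linear[of x i] linorder_less_linear[of x j] by auto
    qed
    then have "card A = card (insert i ((A \<inter> {..<i}) \<union> (A \<inter> {i<..<j}) \<union> (A \<inter> {j<..<n})))" by simp
    also have "\<dots> = Suc (card ((A \<inter> {..<i}) \<union> (A \<inter> {i<..<j}) \<union> (A \<inter> {j<..<n})))"
      using f by (subst card_insert_disjoint) auto
    also have "\<dots> = Suc (card (A \<inter> {..<i}) + card (A \<inter> {i<..<j}) + card (A \<inter> {j<..<n}))"
      using f by (subst card_Un_disjoint, force, force, force)+ simp
    finally show "card (A \<inter> {..<i}) + card (A \<inter> {i<..<j}) + card (A \<inter> {j<..<n}) + 1 = K" using f by simp
    show "card (A \<inter> {..<i}) \<le> i" using card_mono[of "{..<i}" "A \<inter> {..<i}"] by simp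
    show "card (A \<inter> {i<..<j}) \<le> j - Suc i" using card_mono[of "{i<..<j}" "A \<inter> {i<..<j}"] by simp
    show "card (A \<inter> {j<..<n}) \<le> n - Suc j" using card_mono[of "{j<..<n}" "A \<inter> {j<..<n}"] by simp
  qed
  have eW: "snake_edge W n (W - 2) (W + 1)"
    using edge_row[OF row_W, of 1] W by (simp add: numeral_2_eq_2)
  define a0 where "a0 = card (A0 \<inter> {..<W - 2})"
  have "A0 \<inter> {W - 2<..<W + 1} = {W - 1, W}" using seed W by auto
  then have b0: "card (A0 \<inter> {W - 2<..<W + 1}) = 2" using W by simp
  have v0: "valid W 1 a0 2"
    using count[OF seed(1) eW] b0 W K_bounds by (auto simp: valid_def a0_def)
  have "Phi A0 (W - 2) (W + 1) = gam (W - 2) (W + 1) a0 2"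
    by (rule Phi_gam[OF seed(1) eW]) (use b0 in \<open>simp_all add: a0_def\<close>)
  then have s: "Gam W 1 a0 2 \<in> H" using H by (simp add: numeral_2_eq_2)
  consider "j = Suc i" | r where "1 \<le> r" "i + j + 1 = 2 * (r * W)" "j < r * W + W"
    using A(2) by (auto simp: snake_edge_def)
  then show ?thesis
  proof cases
    case 1
    then have "Phi A i j = \<one>" using Phi_path A by (auto simp: snake_edge_def)
    then show ?thesis using subgroup.one_closed[OF H(1)] by simp
  next
    case 2
    have ij: "i < j" "j < n" using A by (auto simp: snake_edge_def)
    define u k where "u = r * W" and "k = j - u"
    have uk: "i = u - Suc k" "j = u + k" "k < W" "Suc k \<le> u" using 2 ij by (auto simp: u_def k_def)
    have "r * W < R * W" using 2 ij n by linarith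
    then have "r < R" by simp
    then have u: "row u" using 2 by (auto simp: row_def u_def)
    have "valid u k (card (A \<inter> {..<i})) (card (A \<inter> {i<..<j}))"
      using count[OF A] uk row_bounds[OF u] by (auto simp: valid_def)
    moreover have "k + 2 \<le> W \<or> k = W - 1" using uk by auto
    ultimately have "Gam u k (card (A \<inter> {..<i})) (card (A \<inter> {i<..<j})) \<in> H"
      using inner_H[OF H(1) v0 s _ u] outer_H[OF H(1) v0 s u] by blast
    then show ?thesis using Phi_eq_gam[OF A] uk by simp
  qed
qed

end

context board begin

section \<open>Words of single dominoes\<close>

definition togl :: "(int \<times> int) set \<Rightarrow> (int \<times> int) set \<Rightarrow> (int \<times> int) set" where
  "togl p d = (p - d) \<union> (d - p)"

definition can :: "(int \<times> int) set \<Rightarrow> (int \<times> int) set \<Rightarrow> bool" where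
  "can p d \<longleftrightarrow> p \<subseteq> D \<and> planar_domino d \<and> d \<subseteq> D \<and> (d \<subseteq> p \<or> d \<inter> p = {})"

text \<open>Each floor complements the plug, so two floors are needed to return to comparable plugs.
  A domino outside of \<open>p\<close> is free on the first floor, one inside \<open>p\<close> only
  on the second.\<close>

definition mv :: "(int \<times> int) set \<Rightarrow> (int \<times> int) set \<Rightarrow> (int \<times> int) set set list" where
  "mv p d = (if d \<subseteq> p then [{}, {d}] else [{d}, {}])"

fun wd :: "(int \<times> int) set \<Rightarrow> (int \<times> int) set list \<Rightarrow> (int \<times> int) set set list" where
  "wd p [] = []"
| "wd p (d # ds) = mv p d @ wd (togl p d) ds"

fun canw :: "(int \<times> int) set \<Rightarrow> (int \<times> int) set list \<Rightarrow> bool" where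
  "canw p [] \<longleftrightarrow> p \<subseteq> D"
| "canw p (d # ds) \<longleftrightarrow> can p d \<and> canw (togl p d) ds"

lemma floor_ok_single: "floor_ok p {d} \<longleftrightarrow> planar_domino d \<and> d \<subseteq> D - p"
  by (simp add: floor_ok_def)

lemma mv_legit:
  assumes "can p d" shows "legit p (mv p d)" "fin p (mv p d) = togl p d"
proof -
  have d: "p \<subseteq> D" "planar_domino d" "d \<subseteq> D" "d \<subseteq> p \<or> d \<inter> p = {}" "d \<noteq> {}"
    using assms planar_domino_nonempty by (auto simp: can_def)
  show "legit p (mv p d)" using d by (auto simp: mv_def floor_ok_single next_plug_def)
  show "fin p (mv p d) = togl p d" using d by (auto simp: mv_def togl_def next_plug_def)
qed

lemma mv_length [simp]: "length (mv p d) = 2"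
  by (simp add: mv_def)

lemma togl_togl [simp]: "togl (togl p d) d = p"
  by (auto simp: togl_def)

lemma can_togl: "can p d \<Longrightarrow> can (togl p d) d"
  by (auto simp: can_def togl_def)

lemma mv_togl: assumes "can p d" shows "mv (togl p d) d = rev (mv p d)"
  using assms planar_domino_nonempty[of d] by (auto simp: can_def mv_def togl_def)

lemma mv_cancel: "can p d \<Longrightarrow> eqw True p (mv p d @ mv (togl p d) d) []"
  using eqw_rev[of p "mv p d"] mv_legit by (simp add: mv_togl)

lemma mv_disjoint: "d \<inter> e = {} \<Longrightarrow> mv (togl p d) e = mv p e"
  by (auto simp: mv_def togl_def)

text \<open>The first domino slides up to the second, and the result is symmetric in
  \<open>d\<close> and \<open>e\<close>; this is how the two moves are seen to commute.\<close>

lemma mv_add2: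
  assumes "can p d" "can p e" "d \<inter> e = {}" "d \<inter> p = {}" "e \<inter> p = {}"
  shows "eqw True p (mv p d @ mv p e) [{}, {}, {d, e}, {}]"
proof -
  have d: "planar_domino d" "d \<subseteq> D" "planar_domino e" "e \<subseteq> D" "p \<subseteq> D" "d \<noteq> {}" "e \<noteq> {}"
    using assms planar_domino_nonempty by (auto simp: can_def)
  then have m: "mv p d @ mv p e = [{d}, {}, {e}, {}]" using assms by (auto simp: mv_def)
  have "legit p [{d}, {}, {e}, {}]" using d assms by (auto simp: floor_ok_single next_plug_def)
  then show ?thesis using slide[of p d "{}" "{}" "{e}" "[{}]" True] by (simp add: m)
qed

lemma mv_rem2:
  assumes "can p d" "can p e" "d \<inter> e = {}" "d \<subseteq> p" "e \<subseteq> p"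
  shows "eqw True p (mv p d @ mv p e) [{}, {}, {}, {d, e}]"
proof -
  have d: "planar_domino d" "d \<subseteq> D" "planar_domino e" "e \<subseteq> D" "p \<subseteq> D"
    using assms by (auto simp: can_def)
  have m: "mv p d @ mv p e = [{}, {d}, {}, {e}]" using assms by (auto simp: mv_def)
  have "legit (next_plug p {}) [{d}, {}, {e}]" using d assms by (auto simp: floor_ok_single next_plug_def)
  then have "eqw True (next_plug p {}) [{d}, {}, {e}] [{}, {}, {d, e}]"
    using slide[of "next_plug p {}" d "{}" "{}" "{e}" "[]" True] by simp
  then show ?thesis using d unfolding m by (intro eqw_Cons) auto
qed

text \<open>The two vertical floors between the dominoes are moved to the end. Then \<open>d\<close>
  and \<open>e\<close> are on adjacent floors, and \<open>d\<close> slides past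
  \<open>e\<close>.\<close>

lemma mv_add_rem:
  assumes "can p d" "can p e" "d \<inter> e = {}" "d \<inter> p = {}" "e \<subseteq> p"
  shows "eqw True p (mv p d @ mv p e) (mv p e @ mv p d)"
proof -
  have d: "planar_domino d" "d \<subseteq> D" "planar_domino e" "e \<subseteq> D" "p \<subseteq> D" "d \<noteq> {}"
    using assms planar_domino_nonempty by (auto simp: can_def)
  then have m: "mv p d = [{d}, {}]" "mv p e = [{}, {e}]" using assms by (auto simp: mv_def)
  have ok: "floor_ok p {d}" using d assms by (auto simp: floor_ok_single)
  have l1: "legit (next_plug p {d}) [{e}]" and l2: "legit p [{d}, {e}, {}, {}]"
    using d assms by (auto simp: floor_ok_single next_plug_def)
  have "eqw True p [{d}, {}, {}, {e}] [{d}, {e}, {}, {}]"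
    using vert_Cons[OF l1] d ok by (intro eqw_Cons) auto
  also have "eqw True p [{d}, {e}, {}, {}] [{}, {e}, {d}, {}]"
    using slide[of p d "{}" "{e}" "{}" "[{}]" True] l2 assms by simp
  finally show ?thesis by (simp add: m)
qed

lemma mv_comm:
  assumes "can p d" "can p e" "d \<inter> e = {}"
  shows "eqw True p (mv p d @ mv p e) (mv p e @ mv p d)"
proof -
  have ed: "e \<inter> d = {}" "{e, d} = {d, e}" using assms by auto
  consider "d \<inter> p = {}" "e \<inter> p = {}" | "d \<inter> p = {}" "e \<subseteq> p" | "d \<subseteq> p" "e \<inter> p = {}" | "d \<subseteq> p" "e \<subseteq> p"
    using assms by (auto simp: can_def)
  then show ?thesis
  proof cases
    case 1
    have "eqw True p (mv p e @ mv p d) [{}, {}, {d, e}, {}]"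
      using mv_add2[OF assms(2,1) ed(1) 1(2,1)] ed by simp
    from eqw_trans[OF mv_add2[OF assms 1] eqw_sym[OF this]] show ?thesis .
  next
    case 4
    have "eqw True p (mv p e @ mv p d) [{}, {}, {}, {d, e}]"
      using mv_rem2[OF assms(2,1) ed(1) 4(2,1)] ed by simp
    from eqw_trans[OF mv_rem2[OF assms 4] eqw_sym[OF this]] show ?thesis .
  next
    case 2
    then show ?thesis using mv_add_rem[OF assms] by simp
  next
    case 3
    then show ?thesis using eqw_sym[OF mv_add_rem[OF assms(2,1) ed(1)]] by simp
  qed
qed

text \<open>Two moves of the same kind can be collected on one floor, where a horizontal flip
  applies.\<close>

lemma mv_block:
  assumes B: "p \<subseteq> D" "\<Union>(hblock x y) \<subseteq> D" "\<Union>(hblock x y) \<subseteq> p \<or> \<Union>(hblock x y) \<inter> p = {}"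
    and h: "hblock x y = {h1, h2}" "vblock x y = {v1, v2}" "h1 \<noteq> h2" "v1 \<noteq> v2"
  shows "eqw True p (mv p h1 @ mv p h2) (mv p v1 @ mv p v2)"
proof -
  have un: "\<Union>(vblock x y) = \<Union>(hblock x y)" using Union_blocks by simp
  have "disjoint (hblock x y)" "disjoint (vblock x y)"
    by (auto simp: hblock_def vblock_def pairwise_def disjnt_def)
  then have dj: "h1 \<inter> h2 = {}" "v1 \<inter> v2 = {}" using h by (auto simp: pairwise_def disjnt_def)
  have pl: "planar_domino d" if "d \<in> hblock x y \<union> vblock x y" for d
    using that by (auto simp: hblock_def vblock_def planar_domino_def)
  have c: "can p d" if "d \<in> hblock x y \<union> vblock x y" for d
  proof -
    have "d \<subseteq> \<Union>(hblock x y)" using that un by auto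
    then show ?thesis unfolding can_def using B pl[OF that] by blast
  qed
  have c4: "can p h1" "can p h2" "can p v1" "can p v2" by (rule c, simp add: h)+
  have "v1 \<subseteq> \<Union>(vblock x y)" "v2 \<subseteq> \<Union>(vblock x y)" unfolding h(2) by blast+
  moreover have "h1 \<subseteq> \<Union>(hblock x y)" "h2 \<subseteq> \<Union>(hblock x y)" unfolding h(1) by blast+
  ultimately have sub: "h1 \<subseteq> \<Union>(hblock x y)" "h2 \<subseteq> \<Union>(hblock x y)" "v1 \<subseteq> \<Union>(hblock x y)" "v2 \<subseteq> \<Union>(hblock x y)"
    by (simp_all only: un)
  have ok: "hblock x y - hblock x y \<union> vblock x y = vblock x y" by auto
  show ?thesis
  proof (cases "\<Union>(hblock x y) \<subseteq> p")
    case True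
    then have s: "h1 \<subseteq> p" "h2 \<subseteq> p" "v1 \<subseteq> p" "v2 \<subseteq> p" using sub by auto
    note 1 = mv_rem2[OF c4(1,2) dj(1) s(1,2)] and 2 = mv_rem2[OF c4(3,4) dj(2) s(3,4)]
    have l: "legit p [{}, {}, {}, {h1, h2}]" using eqw_legit[OF 1] by simp
    then have "legit (fin p [{}, {}, {}]) [{h1, h2}]" by simp
    from eqw_hflip[OF this, of x y True] h ok
    have "eqw True (fin p [{}, {}, {}]) [{h1, h2}] [{v1, v2}]" by auto
    from eqw_append_left[of p "[{}, {}, {}]", OF _ this] B
    have "eqw True p [{}, {}, {}, {h1, h2}] [{}, {}, {}, {v1, v2}]" by simp
    with 1 2 show ?thesis by (meson eqw_sym eqw_trans)
  next
    case False
    then have s: "h1 \<inter> p = {}" "h2 \<inter> p = {}" "v1 \<inter> p = {}" "v2 \<inter> p = {}" using sub B(3) by blast+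
    note 1 = mv_add2[OF c4(1,2) dj(1) s(1,2)] and 2 = mv_add2[OF c4(3,4) dj(2) s(3,4)]
    have l: "legit p [{}, {}, {h1, h2}, {}]" using eqw_legit[OF 1] by simp
    then have "legit (fin p [{}, {}]) [{h1, h2}, {}]" by simp
    from eqw_hflip[OF this, of x y True] h ok
    have "eqw True (fin p [{}, {}]) [{h1, h2}, {}] [{v1, v2}, {}]" by auto
    from eqw_append_left[of p "[{}, {}]", OF _ this] B
    have "eqw True p [{}, {}, {h1, h2}, {}] [{}, {}, {v1, v2}, {}]" by simp
    with 1 2 show ?thesis by (meson eqw_sym eqw_trans)
  qed
qed

section \<open>Every list of even length as a word of moves\<close>

lemma wd_legit: "canw p ds \<Longrightarrow> legit p (wd p ds)"
  by (induction p ds rule: wd.induct) (auto simp: mv_legit)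

lemma wd_append: "canw p ds \<Longrightarrow> wd p (ds @ es) = wd p ds @ wd (fin p (wd p ds)) es"
  by (induction p ds rule: wd.induct) (auto simp: mv_legit)

lemma canw_append: "canw p ds \<Longrightarrow> canw p (ds @ es) \<longleftrightarrow> canw (fin p (wd p ds)) es"
  by (induction p ds rule: wd.induct) (auto simp: mv_legit)

text \<open>The dominoes of \<open>f\<close> are split off one by one: a vertical pair is appended
  and the domino slides two floors up, where it forms a move of its own.\<close>

lemma word_up:
  assumes "floor_ok p f" "p \<subseteq> D"
  shows "\<exists>ds. canw p ds \<and> eqw True p [f, {}] (wd p ds)"
proof -
  have "finite f" using assms floor_ok_finite by blast
  then show ?thesis using assms(1)
  proof (induction rule: finite_induct)
    case empty
    then show ?case using eqw_stab[of True p "[]"] assms by (intro exI[of _ "[]"]) simp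
  next
    case (insert d f)
    have f: "floor_ok p f" using insert floor_ok_subset by blast
    then obtain ds where ds: "canw p ds" "eqw True p [f, {}] (wd p ds)" using insert by blast
    have dd: "planar_domino d" "d \<subseteq> D - p" "d \<inter> \<Union>f = {}"
      using insert.prems floor_ok_disj[OF insert.prems, of d] insert.hyps by (auto simp: floor_ok_def)
    have "legit p [insert d f, {}]" using insert.prems assms by simp
    from eqw_append_left[OF this, of True "[{}, {}]" "[]"]
    have 1: "eqw True p [insert d f, {}, {}, {}] [insert d f, {}]"
      using eqw_stab[of True "fin p [insert d f, {}]" "[]"] by simp
    have "eqw True p [insert d f, {}, {}, {}] [f, {}, {d}, {}]"
      using slide[of p d f "{}" "{}" "[{}]" True] eqw_legit[OF 1] insert.hyps by simp
    from eqw_trans[OF eqw_sym[OF 1] this] have 2: "eqw True p [insert d f, {}] [f, {}, {d}, {}]" .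
    define q where "q = fin p [f, {}]"
    have q: "q = p \<union> \<Union>f" using f assms by (auto simp: q_def next_plug_def floor_ok_def)
    have "can q d" using dd f assms by (auto simp: can_def q floor_ok_def)
    moreover have "\<not> d \<subseteq> q" using dd planar_domino_nonempty[of d] unfolding q by blast
    then have "mv q d = [{d}, {}]" by (simp add: mv_def)
    moreover have "fin p (wd p ds) = q" using eqw_legit[OF ds(2)] by (simp add: q_def)
    ultimately have "canw p (ds @ [d])" "wd p (ds @ [d]) = wd p ds @ [{d}, {}]"
      using canw_append[OF ds(1), of "[d]"] wd_append[OF ds(1), of "[d]"]
      by (auto simp: can_def togl_def)
    moreover have "eqw True p ([f, {}] @ [{d}, {}]) (wd p ds @ [{d}, {}])"
      using eqw_legit[OF 2] by (intro eqw_append_right[OF ds(2)]) simp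
    then have "eqw True p [f, {}, {d}, {}] (wd p ds @ [{d}, {}])" by simp
    from eqw_trans[OF 2 this] have "eqw True p [insert d f, {}] (wd p ds @ [{d}, {}])" .
    ultimately show ?case by (intro exI[of _ "ds @ [d]"]) simp
  qed
qed

lemma word_down:
  assumes "floor_ok (next_plug p {}) g" "p \<subseteq> D"
  shows "\<exists>ds. canw p ds \<and> eqw True p [{}, g] (wd p ds)"
proof -
  have "finite g" using assms floor_ok_finite by blast
  then show ?thesis using assms
  proof (induction arbitrary: p rule: finite_induct)
    case empty
    then show ?case using eqw_stab[of True p "[]"] by (intro exI[of _ "[]"]) simp
  next
    case (insert d g)
    have ok: "floor_ok (next_plug p {}) (insert d g)" and p: "p \<subseteq> D" using insert by auto
    have dd: "planar_domino d" "d \<subseteq> p" "d \<inter> \<Union>g = {}"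
      using ok floor_ok_disj[OF ok, of d] insert.hyps by (auto simp: floor_ok_def next_plug_def)
    have l: "legit (next_plug p {}) [insert d g]" using ok by simp
    have 1: "eqw True p [{}, {}, {}, insert d g] [{}, insert d g]"
      using eqw_stab[of True "next_plug p {}" "[insert d g]"] l p by (intro eqw_Cons) auto
    have l3: "legit (next_plug p {}) [insert d {}, {}, g]"
    proof -
      have "floor_ok (next_plug p {}) {d}" using dd p by (auto simp: floor_ok_single next_plug_def)
      moreover have "next_plug (next_plug (next_plug p {}) {d}) {} = next_plug p {} \<union> d"
        using dd p by (auto simp: next_plug_def)
      moreover have "floor_ok (next_plug p {} \<union> d) g"
        using ok dd insert.hyps by (fastforce simp: floor_ok_def pairwise_insert)
      moreover have "d \<subseteq> D" using dd p by blast
      ultimately show ?thesis by simp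
    qed
    have "eqw True (next_plug p {}) [insert d {}, {}, g] [{}, {}, insert d g]"
      using slide[of "next_plug p {}" d "{}" "{}" g "[]" True] l3 by simp
    then have 2: "eqw True p [{}, {d}, {}, g] [{}, {}, {}, insert d g]"
      using p by (intro eqw_Cons) auto
    have 3: "eqw True p [{}, insert d g] [{}, {d}, {}, g]"
      using eqw_trans[OF 2 1] by (rule eqw_sym)
    have m: "mv p d = [{}, {d}]" using dd by (simp add: mv_def)
    have c: "can p d" using dd p by (auto simp: can_def)
    have t: "fin p [{}, {d}] = togl p d" using mv_legit[OF c] m by simp
    have tD: "togl p d \<subseteq> D" using c by (auto simp: can_def togl_def)
    then have "legit (togl p d) [{}, g]" using eqw_legit[OF 2] t by simp
    then obtain ds where ds: "canw (togl p d) ds" "eqw True (togl p d) [{}, g] (wd (togl p d) ds)"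
      using insert.IH by auto
    have "eqw True p ([{}, {d}] @ [{}, g]) ([{}, {d}] @ wd (togl p d) ds)"
      by (rule eqw_append_left) (use ds(2) mv_legit[OF c] m t tD in simp_all)
    then have "eqw True p [{}, {d}, {}, g] (wd p (d # ds))" using m by simp
    from eqw_trans[OF 3 this] show ?case using ds c by (intro exI[of _ "d # ds"]) simp
  qed
qed

text \<open>A vertical pair inserted between two consecutive floors separates them: the lower one
  then only adds dominoes to the plug, the upper one only removes dominoes from it.\<close>

lemma word_exists:
  assumes "legit p xs" "even (length xs)"
  shows "\<exists>ds. canw p ds \<and> eqw True p xs (wd p ds)"
  using assms
proof (induction xs arbitrary: p rule: induct_list012)
  case 1
  then show ?case by (intro exI[of _ "[]"]) (simp add: eqw_refl)
next
  case (3 f g xs)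
  have p: "p \<subseteq> D" and f: "floor_ok p f" and g: "floor_ok (next_plug p f) g"
    and xs: "legit (next_plug (next_plug p f) g) xs" using 3 by auto
  define q where "q = next_plug (next_plug p f) {}"
  have q: "next_plug q {} = next_plug p f" by (simp add: q_def next_plug_empty)
  have s: "eqw True p (f # g # xs) (f # {} # {} # g # xs)"
    using f p g xs by (intro eqw_Cons eqw_sym[OF eqw_stab]) auto
  obtain as where as: "canw p as" "eqw True p [f, {}] (wd p as)" using word_up[OF f p] by blast
  have qD: "q \<subseteq> D" by (simp add: q_def)
  have fa: "fin p (wd p as) = q" using eqw_legit[OF as(2)] by (simp add: q_def)
  obtain bs where bs: "canw q bs" "eqw True q [{}, g] (wd q bs)"
    using word_down[of q g] g q qD by auto
  have fb: "fin q (wd q bs) = next_plug (next_plug p f) g" using eqw_legit[OF bs(2)] q by auto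
  obtain cs where cs: "canw (fin q (wd q bs)) cs" "eqw True (fin q (wd q bs)) xs (wd (fin q (wd q bs)) cs)"
    using 3(1)[of "fin q (wd q bs)"] 3(4) xs fb by auto
  have "eqw True q ([{}, g] @ xs) (wd q bs @ wd (fin q (wd q bs)) cs)"
    using cs(2) q fb by (intro eqw_append[OF bs(2)]) simp
  then have "eqw True p ([f, {}] @ ([{}, g] @ xs)) (wd p as @ (wd q bs @ wd (fin q (wd q bs)) cs))"
    by (intro eqw_append[OF as(2)]) (simp add: q_def)
  then have "eqw True p (f # {} # {} # g # xs) (wd p as @ (wd q bs @ wd (fin q (wd q bs)) cs))" by simp
  from eqw_trans[OF s this] have "eqw True p (f # g # xs) (wd p as @ (wd q bs @ wd (fin q (wd q bs)) cs))" .
  moreover have "wd p (as @ bs @ cs) = wd p as @ (wd q bs @ wd (fin q (wd q bs)) cs)"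
    using as bs fa by (simp add: wd_append)
  moreover have "canw p (as @ bs @ cs)" using as bs cs fa by (simp add: canw_append)
  ultimately show ?case by (intro exI[of _ "as @ bs @ cs"]) simp
qed simp

end

section \<open>Loops on a snake-ordered board\<close>

definition even_below :: "nat \<Rightarrow> nat set" where
  "even_below n = {i. i < n \<and> even i}"

definition flip_even :: "nat \<Rightarrow> nat set \<Rightarrow> nat set" where
  "flip_even n A = (A - even_below n) \<union> (even_below n - A)"

lemma card_even_below: "card (even_below (2 * K)) = K"
proof -
  have "even_below (2 * K) = (\<lambda>i. 2 * i) ` {..<K}" by (auto simp: even_below_def elim!: evenE)
  then show ?thesis by (simp add: card_image inj_on_def)
qed

text \<open>In \<open>face\<close> the steps from \<open>i\<close> and from \<open>j\<close> along
  the path form one tiling of a square, and the two edges between the rows form the other; which of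
  them is horizontal depends on the direction of the rows.\<close>

locale snake_board = board +
  fixes pos :: "nat \<Rightarrow> int \<times> int" and n K W R :: nat
  assumes bij: "bij_betw pos {..<n} D"
    and W: "3 \<le> W" and R: "4 \<le> R" and n: "n = R * W" and K: "2 * K = n"
    and edge: "i < j \<Longrightarrow> j < n \<Longrightarrow> planar_domino {pos i, pos j} \<longleftrightarrow> snake_edge W n i j"
    and face: "snake_edge W n i (Suc j) \<Longrightarrow> snake_edge W n (Suc i) j \<Longrightarrow> Suc i < j \<Longrightarrow>
      \<exists>x y. {{pos i, pos (Suc i)}, {pos j, pos (Suc j)}} = hblock x y \<and> {{pos i, pos (Suc j)}, {pos j, pos (Suc i)}} = vblock x y \<or>
            {{pos i, pos (Suc i)}, {pos j, pos (Suc j)}} = vblock x y \<and> {{pos i, pos (Suc j)}, {pos j, pos (Suc i)}} = hblock x y"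
begin

text \<open>Tokens sit on the white squares of the plug and on the black squares outside of it.\<close>

definition plug :: "nat set \<Rightarrow> (int \<times> int) set" where
  "plug A = pos ` flip_even n A"

abbreviation state :: "nat set \<Rightarrow> bool" where
  "state A \<equiv> A \<subseteq> {..<n} \<and> card A = K"

lemma flip_even_subset: "A \<subseteq> {..<n} \<Longrightarrow> flip_even n A \<subseteq> {..<n}"
  by (auto simp: flip_even_def even_below_def)

lemma plug_subset: "A \<subseteq> {..<n} \<Longrightarrow> plug A \<subseteq> D"
  using bij flip_even_subset by (auto simp: plug_def bij_betw_def)

lemma inj_pos: "inj_on pos {..<n}"
  using bij by (simp add: bij_betw_def)

lemma pos_eq: "i < n \<Longrightarrow> j < n \<Longrightarrow> pos i = pos j \<longleftrightarrow> i = j"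
  using inj_pos by (simp add: inj_on_eq_iff)

lemma pos_D: "i < n \<Longrightarrow> pos i \<in> D"
  using bij by (auto simp: bij_betw_def)

lemma plug_empty: "plug (even_below n) = {}"
  by (auto simp: plug_def flip_even_def)

lemma state_even: "state (even_below n)"
  using card_even_below[of K] K by (auto simp: even_below_def)

lemma edge_parity: "snake_edge W n i j \<Longrightarrow> even i \<noteq> even j"
proof -
  assume "snake_edge W n i j"
  then consider "j = Suc i" | r where "i + j + 1 = 2 * (r * W)" by (auto simp: snake_edge_def)
  then show ?thesis
  proof cases
    case 2
    then have "even (i + j + 1)" by simp
    then show ?thesis by simp
  qed simp
qed

lemma state_move: "state A \<Longrightarrow> i \<in> A \<Longrightarrow> j \<notin> A \<Longrightarrow> j < n \<Longrightarrow> state (move_token A i j)"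
  using card_move_token[of A i j UNIV] finite_subset[of A "{..<n}"] by (auto simp: move_token_def)

text \<open>The two positions have different colors, and tokens mean presence in the plug on one
  color and absence on the other. A token that changes places therefore adds both squares to the
  plug or removes both.\<close>

lemma togl_plug:
  assumes A: "A \<subseteq> {..<n}" and ij: "i \<in> A" "j \<notin> A" "j < n" "even i \<noteq> even j"
  shows "togl (plug A) {pos i, pos j} = plug (move_token A i j)"
    "{pos i, pos j} \<subseteq> plug A \<or> {pos i, pos j} \<inter> plug A = {}"
proof -
  have i: "i < n" using A ij by auto
  have sub: "flip_even n A \<subseteq> {..<n}" "{i, j} \<subseteq> {..<n}" using flip_even_subset[OF A] i ij by auto
  have im: "{pos i, pos j} = pos ` {i, j}" by simp
  have d: "pos ` S - pos ` T = pos ` (S - T)" if "S \<subseteq> {..<n}" "T \<subseteq> {..<n}" for S T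
    using inj_on_image_set_diff[OF inj_pos] that by (metis Diff_subset subset_trans)
  have "togl (plug A) {pos i, pos j} = pos ` ((flip_even n A - {i, j}) \<union> ({i, j} - flip_even n A))"
    unfolding togl_def plug_def im d[OF sub] d[OF sub(2,1)] by (simp add: image_Un)
  also have "(flip_even n A - {i, j}) \<union> ({i, j} - flip_even n A) = flip_even n (move_token A i j)"
    using A ij i by (auto simp: flip_even_def even_below_def move_token_def)
  finally show "togl (plug A) {pos i, pos j} = plug (move_token A i j)" by (simp add: plug_def)
  have "{i, j} \<subseteq> flip_even n A \<or> {i, j} \<inter> flip_even n A = {}"
    using A ij i by (auto simp: flip_even_def even_below_def)
  moreover have "pos ` {i, j} \<inter> pos ` flip_even n A = pos ` ({i, j} \<inter> flip_even n A)"
    using inj_on_image_Int[OF inj_pos sub(2,1)] by simp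
  ultimately show "{pos i, pos j} \<subseteq> plug A \<or> {pos i, pos j} \<inter> plug A = {}"
    by (auto simp: plug_def)
qed

lemma can_plug:
  assumes "A \<subseteq> {..<n}" "i \<in> A" "j \<notin> A" "snake_edge W n i j"
  shows "can (plug A) {pos i, pos j}" "togl (plug A) {pos i, pos j} = plug (move_token A i j)"
proof -
  have "i < j" "j < n" using assms by (auto simp: snake_edge_def)
  then show "can (plug A) {pos i, pos j}" "togl (plug A) {pos i, pos j} = plug (move_token A i j)"
    using assms togl_plug[OF assms(1-3) _ edge_parity[OF assms(4)]] plug_subset edge pos_D
    by (auto simp: can_def)
qed

lemma edge_disjoint:
  assumes "i \<in> A" "j \<notin> A" "k \<in> A" "l \<notin> A" "i \<noteq> k" "j \<noteq> l" "A \<subseteq> {..<n}" "j < n" "l < n"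
  shows "{pos i, pos j} \<inter> {pos k, pos l} = {}"
proof -
  have "i < n" "k < n" using assms by auto
  then show ?thesis using inj_pos assms by (auto simp: inj_on_def)
qed

text \<open>Standard routes to all states: forward steps along the path, beginning with the tokens
  packed at its start. With forward steps only, the sum of the positions increases, which is what
  the inductions run on.\<close>

inductive upw :: "nat set \<Rightarrow> (int \<times> int) set set list \<Rightarrow> bool" where
  upw_base: "upw {..<K} []"
| upw_step: "upw A xs \<Longrightarrow> i \<in> A \<Longrightarrow> Suc i \<notin> A \<Longrightarrow> Suc i < n \<Longrightarrow>
    upw (move_token A i (Suc i)) (xs @ mv (plug A) {pos i, pos (Suc i)})"

lemma Kn: "K < n"
proof -
  have "0 < n" using n W R by simp
  then show ?thesis using K by linarith
qed

lemma path_edge: "Suc i < n \<Longrightarrow> snake_edge W n i (Suc i)"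
  by (simp add: snake_edge_def)

lemma upw_props:
  "upw A xs \<Longrightarrow> state A \<and> legit (plug {..<K}) xs \<and> fin (plug {..<K}) xs = plug A \<and> even (length xs)"
proof (induction rule: upw.induct)
  case upw_base
  then show ?case using Kn plug_subset by auto
next
  case (upw_step A xs i)
  note c = can_plug[of A i "Suc i"]
  show ?case using upw_step c path_edge state_move[of A i "Suc i"] mv_legit by auto
qed

lemma move_back: "i \<in> A \<Longrightarrow> j \<notin> A \<Longrightarrow> move_token (move_token A i j) j i = A"
  by (auto simp: move_token_def)

lemma upw_exists: "state A \<Longrightarrow> \<exists>xs. upw A xs"
proof (induction "\<Sum>A" arbitrary: A rule: less_induct)
  case less
  have fin: "finite A" using less.prems finite_subset by blast
  show ?case
  proof (cases "\<exists>x. Suc x \<in> A \<and> x \<notin> A")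
    case True
    then obtain x where x: "Suc x \<in> A" "x \<notin> A" by blast
    define B where "B = move_token A (Suc x) x"
    have "\<Sum>A = Suc x + \<Sum>(A - {Suc x})" by (rule sum.remove[OF fin x(1)])
    moreover have "\<Sum>B = x + \<Sum>(A - {Suc x})"
      unfolding B_def move_token_def using fin x by (subst sum.insert) auto
    ultimately have lt: "\<Sum>B < \<Sum>A" by simp
    have xn: "Suc x < n" using x less.prems by auto
    have "state B" unfolding B_def using less.prems x xn by (intro state_move) auto
    then obtain xs where "upw B xs" using less.hyps[OF lt] by blast
    then have "upw (move_token B x (Suc x)) (xs @ mv (plug B) {pos x, pos (Suc x)})"
      using x xn by (intro upw_step) (auto simp: B_def move_token_def)
    then show ?thesis using move_back[OF x] by (auto simp: B_def)
  next
    case False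
    then have "A = {0..<0 + card A}" using less.prems by (intro down_closed_block[of A 0 n]) auto
    then have "A = {..<K}" using less.prems by auto
    then show ?thesis using upw_base by auto
  qed
qed

text \<open>A diamond argument. If the last steps of the two words differ, both can be undone, which
  gives a common earlier state \<open>F\<close>. From there the two steps use disjoint dominoes and
  commute, and the intermediate states are covered by induction.\<close>

lemma upw_unique: "upw A xs \<Longrightarrow> upw A ys \<Longrightarrow> eqw True (plug {..<K}) xs ys"
proof (induction "\<Sum>A" arbitrary: A xs ys rule: less_induct)
  case less
  have base: "zs = [] \<and> A = {..<K} \<or> (\<exists>B zs' i. A = move_token B i (Suc i) \<and> zs = zs' @ mv (plug B) {pos i, pos (Suc i)} \<and>
      upw B zs' \<and> i \<in> B \<and> Suc i \<notin> B \<and> Suc i < n)" if "upw A zs" for zs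
    using that by (cases rule: upw.cases) auto
  have lt: "\<Sum>B < \<Sum>(move_token B i (Suc i))" if "state B" "i \<in> B" "Suc i \<notin> B" for B i
  proof -
    have fin: "finite B" using that finite_subset by blast
    have "\<Sum>B = i + \<Sum>(B - {i})" by (rule sum.remove[OF fin that(2)])
    moreover have "\<Sum>(move_token B i (Suc i)) = Suc i + \<Sum>(B - {i})"
      unfolding move_token_def using fin that by (subst sum.insert) auto
    ultimately show ?thesis by simp
  qed
  have nb: "move_token B i (Suc i) \<noteq> {..<K}" if "i \<in> B" for B i
  proof
    assume eq: "move_token B i (Suc i) = {..<K}"
    have "Suc i \<in> move_token B i (Suc i)" "i \<notin> move_token B i (Suc i)" by (auto simp: move_token_def)
    then show False unfolding eq by simp
  qed
  show ?case
  proof (cases "xs = [] \<or> ys = []")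
    case True
    then have "A = {..<K}" using base[OF less.prems(1)] base[OF less.prems(2)] nb by (auto simp: mv_def split: if_splits)
    then have "xs = []" "ys = []" using base[OF less.prems(1)] base[OF less.prems(2)] nb by metis+
    then show ?thesis using Kn plug_subset[of "{..<K}"] by (auto intro: eqw_refl)
  next
    case False
    then obtain B xs' i where B: "A = move_token B i (Suc i)" "xs = xs' @ mv (plug B) {pos i, pos (Suc i)}"
      "upw B xs'" "i \<in> B" "Suc i \<notin> B" "Suc i < n" using base[OF less.prems(1)] by blast
    from False obtain C ys' j where C: "A = move_token C j (Suc j)" "ys = ys' @ mv (plug C) {pos j, pos (Suc j)}"
      "upw C ys'" "j \<in> C" "Suc j \<notin> C" "Suc j < n" using base[OF less.prems(2)] by blast
    note pB = upw_props[OF B(3)] and pC = upw_props[OF C(3)]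
    have ltB: "\<Sum>B < \<Sum>A" using lt pB B by blast
    have ltC: "\<Sum>C < \<Sum>A" using lt pC C by blast
    have lB: "legit (plug B) (mv (plug B) {pos i, pos (Suc i)})"
      using can_plug(1)[of B i "Suc i"] pB B path_edge mv_legit by auto
    have lC: "legit (plug C) (mv (plug C) {pos j, pos (Suc j)})"
      using can_plug(1)[of C j "Suc j"] pC C path_edge mv_legit by auto
    show ?thesis
    proof (cases "i = j")
      case True
      then have "B = C" using B C move_back[of i B "Suc i"] move_back[of j C "Suc j"] by metis
      have e: "eqw True (plug {..<K}) xs' ys'" using less.hyps[OF ltB B(3)] C \<open>B = C\<close> by blast
      have y: "ys = ys' @ mv (plug B) {pos i, pos (Suc i)}" using C(2) True \<open>B = C\<close> by simp
      show ?thesis unfolding B(2) y by (rule eqw_append_right[OF e]) (use pB lB in simp)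
    next
      case False
      have mB: "Suc i \<in> A" "i \<notin> A" unfolding B(1) by (simp_all add: move_token_def)
      have mC: "Suc j \<in> A" "j \<notin> A" unfolding C(1) by (simp_all add: move_token_def)
      note mem = mB mC
      have ne: "Suc i \<noteq> j" "Suc j \<noteq> i" using mem by auto
      have stA: "state A" using upw_props[OF less.prems(1)] by blast
      have Beq: "B = move_token A (Suc i) i"
        unfolding B(1) using move_back[of i B "Suc i"] B(4,5) by simp
      have Ceq: "C = move_token A (Suc j) j"
        unfolding C(1) using move_back[of j C "Suc j"] C(4,5) by simp
      define F where "F = move_token B (Suc j) j"
      have stF: "state F" unfolding F_def using pB mem False ne C(6)
        by (intro state_move) (auto simp: Beq move_token_def)
      obtain zs where zs: "upw F zs" using upw_exists[OF stF] by blast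
      have F1: "move_token F j (Suc j) = B" and F2: "move_token F i (Suc i) = C"
        using mem False ne by (auto simp: F_def Beq Ceq move_token_def)
      have Fm: "j \<in> F" "Suc j \<notin> F" "i \<in> F" "Suc i \<notin> F"
        using mem False ne by (auto simp: F_def Beq move_token_def)
      have u1: "upw B (zs @ mv (plug F) {pos j, pos (Suc j)})" using upw_step[OF zs Fm(1,2) C(6)] F1 by simp
      have u2: "upw C (zs @ mv (plug F) {pos i, pos (Suc i)})" using upw_step[OF zs Fm(3,4) B(6)] F2 by simp
      have cj: "can (plug F) {pos j, pos (Suc j)}" "togl (plug F) {pos j, pos (Suc j)} = plug B"
        using can_plug[of F j "Suc j"] stF Fm C(6) path_edge F1 by auto
      have ci: "can (plug F) {pos i, pos (Suc i)}" "togl (plug F) {pos i, pos (Suc i)} = plug C"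
        using can_plug[of F i "Suc i"] stF Fm B(6) path_edge F2 by auto
      have dj: "{pos i, pos (Suc i)} \<inter> {pos j, pos (Suc j)} = {}"
        using edge_disjoint[of i F "Suc i" j "Suc j"] Fm False stF B(6) C(6) by auto
      then have dj': "{pos j, pos (Suc j)} \<inter> {pos i, pos (Suc i)} = {}" by blast
      have mB: "mv (plug B) {pos i, pos (Suc i)} = mv (plug F) {pos i, pos (Suc i)}"
        using mv_disjoint[OF dj', of "plug F"] cj by simp
      have mC: "mv (plug C) {pos j, pos (Suc j)} = mv (plug F) {pos j, pos (Suc j)}"
        using mv_disjoint[OF dj, of "plug F"] ci by simp
      note pz = upw_props[OF zs]
      have "eqw True (plug {..<K}) xs ((zs @ mv (plug F) {pos j, pos (Suc j)}) @ mv (plug B) {pos i, pos (Suc i)})"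
        unfolding B(2) using less.hyps[OF ltB B(3) u1] pB lB by (intro eqw_append_right) auto
      also have "eqw True (plug {..<K}) ((zs @ mv (plug F) {pos j, pos (Suc j)}) @ mv (plug B) {pos i, pos (Suc i)})
         ((zs @ mv (plug F) {pos i, pos (Suc i)}) @ mv (plug C) {pos j, pos (Suc j)})"
        unfolding mB mC append_assoc using mv_comm[OF cj(1) ci(1) dj'] pz
        by (intro eqw_append_left) auto
      also have "eqw True (plug {..<K}) ((zs @ mv (plug F) {pos i, pos (Suc i)}) @ mv (plug C) {pos j, pos (Suc j)}) ys"
        unfolding C(2) using less.hyps[OF ltC u2 C(3)] upw_props[OF u2] lC by (intro eqw_append_right) auto
      finally show ?thesis .
    qed
  qed
qed

definition up :: "nat set \<Rightarrow> (int \<times> int) set set list" where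
  "up A = (SOME xs. upw A xs)"

lemma up: "state A \<Longrightarrow> upw A (up A)"
  unfolding up_def using upw_exists by (rule someI_ex)

text \<open>The routes \<open>up\<close> start in the packed state, but loops are based at the empty
  plug, which is the state \<open>even_below n\<close>; the reflected route connects the two base
  points.\<close>

definition walk :: "nat set \<Rightarrow> (int \<times> int) set set list" where
  "walk A = rev (up (even_below n)) @ up A"

lemma walk_props:
  assumes "state A" shows "legit {} (walk A)" "fin {} (walk A) = plug A" "even (length (walk A))"
proof -
  note 1 = upw_props[OF up[OF assms]] and 2 = upw_props[OF up[OF state_even]]
  have "legit {} (rev (up (even_below n)))" "fin {} (rev (up (even_below n))) = plug {..<K}"
    using legit_rev[of "plug {..<K}" "up (even_below n)"] 2 by (simp_all add: plug_empty)
  then show "legit {} (walk A)" "fin {} (walk A) = plug A" "even (length (walk A))"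
    using 1 2 by (simp_all add: walk_def)
qed

lemma walk_step:
  assumes "state A" "i \<in> A" "Suc i \<notin> A" "Suc i < n"
  shows "eqw True {} (walk A @ mv (plug A) {pos i, pos (Suc i)}) (walk (move_token A i (Suc i)))"
proof -
  have st: "state (move_token A i (Suc i))" using state_move assms by blast
  have "eqw True (plug {..<K}) (up A @ mv (plug A) {pos i, pos (Suc i)}) (up (move_token A i (Suc i)))"
    using upw_unique[OF upw_step[OF up[OF assms(1)] assms(2-4)] up[OF st]] .
  moreover have "legit {} (rev (up (even_below n)))" "fin {} (rev (up (even_below n))) = plug {..<K}"
    using legit_rev[of "plug {..<K}" "up (even_below n)"] upw_props[OF up[OF state_even]] by (simp_all add: plug_empty)
  ultimately show ?thesis by (simp add: walk_def eqw_append_left)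
qed

lemma walk_empty: "eqw True {} (walk (even_below n)) []"
  using eqw_rev_left[of "plug {..<K}" "up (even_below n)"] upw_props[OF up[OF state_even]]
  by (simp add: walk_def plug_empty)

end

section \<open>Passages of tokens as loops at the empty plug\<close>

locale snake_loops = snake_board + group G for G (structure) +
  fixes cl :: "(int \<times> int) set set list \<Rightarrow> 'a"
  assumes cl_closed: "legit {} xs \<Longrightarrow> fin {} xs = {} \<Longrightarrow> even (length xs) \<Longrightarrow> cl xs \<in> carrier G"
    and cl_eq: "eqw True {} xs ys \<Longrightarrow> fin {} xs = {} \<Longrightarrow> even (length xs) \<Longrightarrow> cl xs = cl ys"
    and cl_append: "legit {} xs \<Longrightarrow> fin {} xs = {} \<Longrightarrow> even (length xs) \<Longrightarrow>
       legit {} ys \<Longrightarrow> fin {} ys = {} \<Longrightarrow> even (length ys) \<Longrightarrow> cl (xs @ ys) = cl xs \<otimes> cl ys"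
begin

lemma cl_Nil: "cl [] = \<one>"
  using cl_append[of "[]" "[]"] cl_closed[of "[]"] by simp

definition joins :: "nat set \<Rightarrow> (int \<times> int) set set list \<Rightarrow> nat set \<Rightarrow> bool" where
  "joins A w B \<longleftrightarrow> state A \<and> state B \<and> legit (plug A) w \<and> fin (plug A) w = plug B \<and> even (length w)"

definition lp :: "nat set \<Rightarrow> (int \<times> int) set set list \<Rightarrow> nat set \<Rightarrow> 'a" where
  "lp A w B = cl (walk A @ w @ rev (walk B))"

lemma lp_list:
  assumes "joins A w B"
  shows "legit {} (walk A @ w @ rev (walk B))" "fin {} (walk A @ w @ rev (walk B)) = {}"
    "even (length (walk A @ w @ rev (walk B)))"
  using assms walk_props[of A] walk_props[of B] legit_rev[of "{}" "walk B"] by (auto simp: joins_def)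

lemma lp_closed: "joins A w B \<Longrightarrow> lp A w B \<in> carrier G"
  unfolding lp_def using lp_list by (intro cl_closed) auto

lemma lp_eq: "joins A w B \<Longrightarrow> eqw True (plug A) w v \<Longrightarrow> lp A w B = lp A v B"
proof -
  assume j: "joins A w B" and e: "eqw True (plug A) w v"
  have st: "state A" "state B" using j by (auto simp: joins_def)
  have "eqw True (plug A) (w @ rev (walk B)) (v @ rev (walk B))"
    using lp_list(1)[OF j] j walk_props[OF st(1)] by (intro eqw_append_right[OF e]) (auto simp: joins_def)
  then have "eqw True {} (walk A @ w @ rev (walk B)) (walk A @ v @ rev (walk B))"
    using walk_props[OF st(1)] by (intro eqw_append_left) auto
  then show ?thesis unfolding lp_def using lp_list[OF j] by (intro cl_eq)
qed

lemma joins_append: "joins A w B \<Longrightarrow> joins B v C \<Longrightarrow> joins A (w @ v) C"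
  by (auto simp: joins_def)

text \<open>Between the two words the walk back from \<open>B\<close> meets the walk out to
  \<open>B\<close>, and they cancel.\<close>

lemma lp_append:
  assumes "joins A w B" "joins B v C" shows "lp A (w @ v) C = lp A w B \<otimes> lp B v C"
proof -
  have st: "state A" "state B" "state C" using assms by (auto simp: joins_def)
  note l1 = lp_list[OF assms(1)] and l2 = lp_list[OF assms(2)] and l = lp_list[OF joins_append[OF assms]]
  have "lp A w B \<otimes> lp B v C = cl ((walk A @ w @ rev (walk B)) @ (walk B @ v @ rev (walk C)))"
    unfolding lp_def by (rule cl_append[OF l1 l2, symmetric])
  also have "\<dots> = cl ((walk A @ w) @ (rev (walk B) @ walk B) @ (v @ rev (walk C)))" by simp
  also have "\<dots> = cl ((walk A @ w) @ [] @ (v @ rev (walk C)))"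
  proof (rule cl_eq)
    have e: "eqw True (plug B) (rev (walk B) @ walk B) []"
      using eqw_rev_left[of "{}" "walk B"] walk_props[OF st(2)] by simp
    have f: "fin {} (walk A @ w) = plug B" "legit {} (walk A @ w)"
      using assms walk_props[OF st(1)] by (auto simp: joins_def)
    have "eqw True (plug B) ((rev (walk B) @ walk B) @ (v @ rev (walk C))) ([] @ (v @ rev (walk C)))"
      using l2(1) walk_props[OF st(2)] eqw_legit[OF e] by (intro eqw_append_right[OF e]) auto
    then show "eqw True {} ((walk A @ w) @ (rev (walk B) @ walk B) @ (v @ rev (walk C))) ((walk A @ w) @ [] @ (v @ rev (walk C)))"
      using f by (intro eqw_append_left) auto
    show "fin {} ((walk A @ w) @ (rev (walk B) @ walk B) @ (v @ rev (walk C))) = {}"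
      "even (length ((walk A @ w) @ (rev (walk B) @ walk B) @ (v @ rev (walk C))))"
      using l1 l2 by simp_all
  qed
  also have "\<dots> = lp A (w @ v) C" by (simp add: lp_def)
  finally show ?thesis by simp
qed

lemma lp_Nil: "state A \<Longrightarrow> joins A [] A \<and> lp A [] A = \<one>"
proof
  assume st: "state A"
  then show j: "joins A [] A" using plug_subset by (auto simp: joins_def)
  have "eqw True {} (walk A @ [] @ rev (walk A)) []" using eqw_rev walk_props[OF st] by simp
  from cl_eq[OF this] lp_list[OF j] show "lp A [] A = \<one>" by (simp add: lp_def cl_Nil)
qed

definition Phi :: "nat set \<Rightarrow> nat \<Rightarrow> nat \<Rightarrow> 'a" where
  "Phi A i j = lp A (mv (plug A) {pos i, pos j}) (move_token A i j)"

lemma joins_mv: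
  assumes "token_state n K A i j" "snake_edge W n i j"
  shows "joins A (mv (plug A) {pos i, pos j}) (move_token A i j)"
proof -
  have st: "state A" "i \<in> A" "j \<notin> A" "j < n" using assms by (auto simp: token_state_def snake_edge_def)
  then show ?thesis using can_plug[of A i j] assms mv_legit state_move by (auto simp: joins_def)
qed

lemma joins_mv_back:
  assumes "token_state n K A i j" "snake_edge W n i j"
  defines "B \<equiv> move_token A i j"
  shows "joins B (mv (plug B) {pos i, pos j}) A"
    "lp B (mv (plug B) {pos i, pos j}) A = inv (Phi A i j)"
    "joins A (mv (plug A) {pos i, pos j}) B"
proof -
  have st: "state A" "i \<in> A" "j \<notin> A" "j < n" using assms by (auto simp: token_state_def snake_edge_def)
  note c = can_plug[of A i j, folded B_def]
  show j1: "joins A (mv (plug A) {pos i, pos j}) B" using joins_mv assms by blast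
  have stB: "state B" using j1 by (simp add: joins_def)
  have cB: "can (plug B) {pos i, pos j}" "togl (plug B) {pos i, pos j} = plug A"
    using can_togl[of "plug A" "{pos i, pos j}"] togl_togl[of "plug A" "{pos i, pos j}"] c st assms(2) by simp_all
  then show j2: "joins B (mv (plug B) {pos i, pos j}) A" using mv_legit[OF cB(1)] st stB by (auto simp: joins_def)
  have "eqw True (plug A) (mv (plug A) {pos i, pos j} @ mv (plug B) {pos i, pos j}) []"
    using mv_cancel[of "plug A" "{pos i, pos j}"] c st assms(2) by auto
  then have 1: "Phi A i j \<otimes> lp B (mv (plug B) {pos i, pos j}) A = \<one>"
    using lp_append[OF j1 j2] lp_eq[OF joins_append[OF j1 j2]] lp_Nil[OF st(1)] by (simp add: Phi_def B_def)
  have cl: "Phi A i j \<in> carrier G" "lp B (mv (plug B) {pos i, pos j}) A \<in> carrier G"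
    using lp_closed[OF j1] lp_closed[OF j2] by (simp_all add: Phi_def B_def)
  show "lp B (mv (plug B) {pos i, pos j}) A = inv (Phi A i j)"
    using inv_equality[OF inv_comm[OF 1 cl] cl] by simp
qed

text \<open>A walk followed by a step along the path is equivalent to the walk to the new state, by
  uniqueness of the routes. The loop therefore reduces to a walk and its reflection.\<close>

lemma Phi_path:
  assumes "token_state n K A i (Suc i)" "Suc i < n" shows "Phi A i (Suc i) = \<one>"
proof -
  define B where "B = move_token A i (Suc i)"
  note j = joins_mv[OF assms(1) path_edge[OF assms(2)], folded B_def]
  have st: "state A" "i \<in> A" "Suc i \<notin> A" "state B" using assms j by (auto simp: token_state_def joins_def)
  have "eqw True {} ((walk A @ mv (plug A) {pos i, pos (Suc i)}) @ rev (walk B)) (walk B @ rev (walk B))"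
    using walk_step[OF st(1-3) assms(2)] lp_list(1)[OF j] by (intro eqw_append_right) (auto simp: B_def)
  also have "eqw True {} (walk B @ rev (walk B)) []" using walk_props[OF st(4)] by (intro eqw_rev)
  finally have "eqw True {} (walk A @ mv (plug A) {pos i, pos (Suc i)} @ rev (walk B)) []" by simp
  from cl_eq[OF this] lp_list[OF j] show ?thesis by (simp add: Phi_def lp_def B_def cl_Nil)
qed

lemma Phi_comm_gen:
  assumes ij: "joins A (mv (plug A) d) B1" "joins B1 (mv (plug B1) e) C"
    and kl: "joins A (mv (plug A) e) B2" "joins B2 (mv (plug B2) d) C"
    and eq: "eqw True (plug A) (mv (plug A) d @ mv (plug B1) e) (mv (plug A) e @ mv (plug B2) d)"
  shows "lp A (mv (plug A) d) B1 \<otimes> lp B1 (mv (plug B1) e) C = lp A (mv (plug A) e) B2 \<otimes> lp B2 (mv (plug B2) d) C"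
  using lp_append[OF ij] lp_append[OF kl] lp_eq[OF joins_append[OF ij] eq] by simp

lemma token_state_move':
  assumes "token_state n K A i j" "token_state n K A k l" "i \<noteq> k" "j \<noteq> l" "j < n"
  shows "token_state n K (move_token A i j) k l"
  using assms state_move[of A i j] by (auto simp: token_state_def move_token_def)

lemma Phi_comm:
  assumes st: "token_state n K A i j" "token_state n K A k l" and e: "snake_edge W n i j" "snake_edge W n k l"
    and ne: "i \<noteq> k" "j \<noteq> l"
  shows "Phi A i j \<otimes> Phi (move_token A i j) k l = Phi A k l \<otimes> Phi (move_token A k l) i j"
proof -
  have b: "i < n" "j < n" "k < n" "l < n" using e by (auto simp: snake_edge_def)
  have st': "token_state n K (move_token A i j) k l" "token_state n K (move_token A k l) i j"
    using token_state_move' st ne b by auto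
  have s: "A \<subseteq> {..<n}" "i \<in> A" "j \<notin> A" "k \<in> A" "l \<notin> A" using st by (auto simp: token_state_def)
  have C: "move_token (move_token A i j) k l = move_token (move_token A k l) i j"
    using s ne by (auto simp: move_token_def)
  have dj: "{pos i, pos j} \<inter> {pos k, pos l} = {}" using edge_disjoint s ne b by blast
  then have dj': "{pos k, pos l} \<inter> {pos i, pos j} = {}" by blast
  note c1 = can_plug[OF s(1,2,3) e(1)] and c2 = can_plug[OF s(1,4,5) e(2)]
  have m: "mv (plug (move_token A i j)) {pos k, pos l} = mv (plug A) {pos k, pos l}"
    "mv (plug (move_token A k l)) {pos i, pos j} = mv (plug A) {pos i, pos j}"
    using mv_disjoint[OF dj, of "plug A"] mv_disjoint[OF dj', of "plug A"] c1 c2 by simp_all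
  show ?thesis unfolding Phi_def C
    using joins_mv[OF st(1) e(1)] joins_mv[OF st(2) e(2)] joins_mv[OF st'(1) e(2)] joins_mv[OF st'(2) e(1)]
      mv_comm[OF c1(1) c2(1) dj]
    by (intro Phi_comm_gen) (simp_all add: C m)
qed

text \<open>The two tilings of the square give two equivalent pairs of moves from \<open>A\<close>
  to \<open>B\<close>. The pair along the path is trivial; in the other pair the token from
  \<open>j\<close> to \<open>Suc i\<close> moves backwards, which contributes an inverse.\<close>

lemma Phi_face:
  assumes st: "token_state n K A i (Suc j)" "token_state n K A j (Suc i)"
    and e: "snake_edge W n i (Suc j)" "snake_edge W n (Suc i) j"
  defines "B \<equiv> move_token (move_token A i (Suc i)) j (Suc j)"
  shows "Phi A i (Suc j) = Phi B (Suc i) j"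
proof -
  have b: "Suc i < j" "Suc j < n" using e by (auto simp: snake_edge_def)
  have s: "state A" "i \<in> A" "Suc j \<notin> A" "j \<in> A" "Suc i \<notin> A" using st by (auto simp: token_state_def)
  define A1 where "A1 = move_token A i (Suc j)"
  define A2 where "A2 = move_token A i (Suc i)"
  have p: "token_state n K A i (Suc i)" "snake_edge W n i (Suc i)" "snake_edge W n j (Suc j)"
    using s b by (auto simp: token_state_def path_edge)
  have st2: "token_state n K A2 j (Suc j)"
    unfolding A2_def by (rule token_state_move'[OF p(1)]) (use s b in \<open>auto simp: token_state_def\<close>)
  have stB: "token_state n K B (Suc i) j"
  proof -
    have "state A2" "state B" using joins_mv[OF p(1,2)] joins_mv[OF st2 p(3)] by (simp_all add: joins_def A2_def B_def)
    then show ?thesis using s b by (auto simp: token_state_def B_def move_token_def)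
  qed
  have BA1: "move_token B (Suc i) j = A1" using s b by (auto simp: B_def A1_def move_token_def)
  note jb = joins_mv_back[OF stB e(2), unfolded BA1]
  note j1 = joins_mv[OF st(1) e(1), folded A1_def] and j2 = joins_mv[OF p(1,2), folded A2_def]
    and j3 = joins_mv[OF st2 p(3), unfolded A2_def, folded B_def, folded A2_def]
  have jB: "joins A1 (mv (plug A1) {pos j, pos (Suc i)}) B"
    "lp A1 (mv (plug A1) {pos j, pos (Suc i)}) B = inv (Phi B (Suc i) j)"
    using jb by (simp_all add: insert_commute)
  obtain x y where xy: "{{pos i, pos (Suc i)}, {pos j, pos (Suc j)}} = hblock x y \<and> {{pos i, pos (Suc j)}, {pos j, pos (Suc i)}} = vblock x y \<or>
            {{pos i, pos (Suc i)}, {pos j, pos (Suc j)}} = vblock x y \<and> {{pos i, pos (Suc j)}, {pos j, pos (Suc i)}} = hblock x y"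
    using face[OF e b(1)] by blast
  have inj: "pos i \<noteq> pos j" "pos i \<noteq> pos (Suc j)" "pos (Suc i) \<noteq> pos j" "pos (Suc i) \<noteq> pos (Suc j)"
     "pos i \<noteq> pos (Suc i)" "pos j \<noteq> pos (Suc j)"
    using b by (simp_all add: pos_eq)
  then have ne: "{pos i, pos (Suc i)} \<noteq> {pos j, pos (Suc j)}" "{pos i, pos (Suc j)} \<noteq> {pos j, pos (Suc i)}"
    by (auto simp: doubleton_eq_iff)
  have U: "\<Union>(hblock x y) = {pos i, pos (Suc i), pos j, pos (Suc j)}"
    using xy Union_blocks[of x y] by (metis (no_types, lifting) Union_insert Un_insert_left Union_empty sup_bot.right_neutral Un_empty_left insert_commute)
  have UD: "\<Union>(hblock x y) \<subseteq> D" unfolding U using pos_D b by auto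
  have cc: "can (plug A) {pos i, pos (Suc i)}" "can (plug A) {pos j, pos (Suc j)}"
    "can (plug A) {pos i, pos (Suc j)}"
    using can_plug(1) s p(2,3) e(1) by auto
  then have Up: "\<Union>(hblock x y) \<subseteq> plug A \<or> \<Union>(hblock x y) \<inter> plug A = {}"
    unfolding U can_def by auto
  have pA: "plug A \<subseteq> D" using plug_subset s by blast
  have blk: "eqw True (plug A) (mv (plug A) {pos i, pos (Suc i)} @ mv (plug A) {pos j, pos (Suc j)})
     (mv (plug A) {pos i, pos (Suc j)} @ mv (plug A) {pos j, pos (Suc i)})"
  proof (rule disjE[OF xy])
    assume h: "{{pos i, pos (Suc i)}, {pos j, pos (Suc j)}} = hblock x y \<and> {{pos i, pos (Suc j)}, {pos j, pos (Suc i)}} = vblock x y"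
    show ?thesis by (rule mv_block[OF pA UD Up]) (use h ne in auto)
  next
    assume h: "{{pos i, pos (Suc i)}, {pos j, pos (Suc j)}} = vblock x y \<and> {{pos i, pos (Suc j)}, {pos j, pos (Suc i)}} = hblock x y"
    show ?thesis by (rule eqw_sym[OF mv_block[OF pA UD Up]]) (use h ne in auto)
  qed
  have d1: "{pos i, pos (Suc i)} \<inter> {pos j, pos (Suc j)} = {}" "{pos i, pos (Suc j)} \<inter> {pos j, pos (Suc i)} = {}"
    using inj by auto
  have m: "mv (plug A2) {pos j, pos (Suc j)} = mv (plug A) {pos j, pos (Suc j)}"
    "mv (plug A1) {pos j, pos (Suc i)} = mv (plug A) {pos j, pos (Suc i)}"
    using mv_disjoint[OF d1(1), of "plug A"] mv_disjoint[OF d1(2), of "plug A"]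
      can_plug(2)[of A i "Suc i"] can_plug(2)[of A i "Suc j"] s p e by (simp_all add: A1_def A2_def)
  have "lp A (mv (plug A) {pos i, pos (Suc i)} @ mv (plug A2) {pos j, pos (Suc j)}) B =
     lp A (mv (plug A) {pos i, pos (Suc j)} @ mv (plug A1) {pos j, pos (Suc i)}) B"
    unfolding m by (rule lp_eq[OF _ blk]) (use joins_append[OF j2 j3] m in simp)
  then have "Phi A i (Suc i) \<otimes> Phi A2 j (Suc j) = Phi A i (Suc j) \<otimes> inv (Phi B (Suc i) j)"
    unfolding lp_append[OF j2 j3] lp_append[OF j1 jB(1)] jB(2)
    by (simp add: Phi_def A1_def A2_def B_def)
  moreover have "Phi A i (Suc i) = \<one>" "Phi A2 j (Suc j) = \<one>" using Phi_path p(1) st2 b by auto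
  ultimately have "Phi A i (Suc j) \<otimes> inv (Phi B (Suc i) j) = \<one>" by simp
  moreover have "Phi A i (Suc j) \<in> carrier G" "Phi B (Suc i) j \<in> carrier G"
    using lp_closed[OF j1] lp_closed[OF joins_mv[OF stB e(2)]] by (simp_all add: Phi_def A1_def)
  ultimately show ?thesis by (metis inv_closed inv_equality inv_inv)
qed

sublocale tok: token_rep G n K W R Phi
proof
  show "Phi A i j \<in> carrier G" if "token_state n K A i j" "snake_edge W n i j" for A i j
    unfolding Phi_def using lp_closed joins_mv that by blast
qed (use W R n K Phi_path Phi_comm Phi_face in auto)

text \<open>A loop is a word of moves, and each move is a passage or the reverse of one. Closing up
  the word at its ends costs only the walk to the empty plug, which is trivial.\<close>

theorem cl_generated:
  assumes seed: "token_state n K A0 (W - 2) (W + 1)" "W - 1 \<in> A0" "W \<in> A0"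
    and H: "subgroup H G" "Phi A0 (W - 2) (W + 1) \<in> H"
    and xs: "legit {} xs" "fin {} xs = {}" "even (length xs)"
  shows "cl xs \<in> H"
proof -
  obtain ds where ds: "canw {} ds" "eqw True {} xs (wd {} ds)" using word_exists xs by blast
  have main: "\<exists>B. joins A (wd (plug A) ds) B \<and> lp A (wd (plug A) ds) B \<in> H"
    if "state A" "canw (plug A) ds" for A ds
    using that
  proof (induction ds arbitrary: A)
    case Nil
    then show ?case using lp_Nil[of A] subgroup.one_closed[OF H(1)] by auto
  next
    case (Cons d ds)
    have c: "can (plug A) d" and dD: "planar_domino d" "d \<subseteq> D" using Cons.prems by (auto simp: can_def)
    obtain i j where ij: "d = {pos i, pos j}" "i < j" "j < n"
    proof -
      obtain a b where ab: "d = {a, b}" "a \<noteq> b" using dD(1) by (auto simp: planar_domino_def)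
      then obtain i j where "a = pos i" "b = pos j" "i < n" "j < n" using dD(2) bij by (auto simp: bij_betw_def)
      then show ?thesis using that[of i j] that[of j i] ab by (cases i j rule: linorder_cases) auto
    qed
    have e: "snake_edge W n i j" using edge ij dD by blast
    have par: "even i \<noteq> even j" using edge_parity[OF e] .
    have "\<exists>B. joins A (mv (plug A) d) B \<and> togl (plug A) d = plug B \<and> lp A (mv (plug A) d) B \<in> H"
    proof -
      have inp: "pos k \<in> plug A \<longleftrightarrow> k \<in> flip_even n A" if "k < n" for k
      proof -
        have "flip_even n A \<subseteq> {..<n}" using flip_even_subset Cons.prems by blast
        then show ?thesis unfolding plug_def using inj_on_image_mem_iff[OF inj_pos, of k] that by auto
      qed
      have "pos i \<in> plug A \<longleftrightarrow> pos j \<in> plug A" using c ij by (auto simp: can_def)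
      then have "i \<in> flip_even n A \<longleftrightarrow> j \<in> flip_even n A" using inp ij by simp
      then have "i \<in> A \<longleftrightarrow> j \<notin> A" using par ij by (auto simp: flip_even_def even_below_def)
      then consider "i \<in> A" "j \<notin> A" | "j \<in> A" "i \<notin> A" by blast
      then show ?thesis
      proof cases
        case 1
        then have st: "token_state n K A i j" using Cons.prems by (simp add: token_state_def)
        have "Phi A i j \<in> H" using tok.Phi_generated[OF seed H st e] .
        then show ?thesis using joins_mv[OF st e] can_plug(2)[of A i j] 1 e Cons.prems ij by (auto simp: Phi_def)
      next
        case 2
        define B where "B = move_token A j i"
        have AB: "A = move_token B i j" using 2 by (auto simp: B_def move_token_def)
        have stB: "state B" unfolding B_def using Cons.prems 2 ij by (intro state_move) auto
        then have st: "token_state n K B i j" using 2 ij by (auto simp: token_state_def B_def move_token_def)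
        have "Phi B i j \<in> H" using tok.Phi_generated[OF seed H st e] .
        then have "inv (Phi B i j) \<in> H" using subgroup.m_inv_closed[OF H(1)] by blast
        moreover have "togl (plug A) {pos i, pos j} = plug B"
          using can_plug(2)[of B i j] st e togl_togl[of "plug B" "{pos i, pos j}"] AB by (auto simp: token_state_def)
        ultimately show ?thesis using joins_mv_back[OF st e] AB ij by auto
      qed
    qed
    then obtain B where B: "joins A (mv (plug A) d) B" "togl (plug A) d = plug B" "lp A (mv (plug A) d) B \<in> H" by blast
    have "state B" "canw (plug B) ds" using B Cons.prems by (auto simp: joins_def)
    then obtain C where C: "joins B (wd (plug B) ds) C" "lp B (wd (plug B) ds) C \<in> H" using Cons.IH by blast
    have "lp A (mv (plug A) d @ wd (plug B) ds) C \<in> H"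
      unfolding lp_append[OF B(1) C(1)] using B C subgroup.m_closed[OF H(1)] by blast
    then show ?case using joins_append[OF B(1) C(1)] B(2) by auto
  qed
  obtain B where B: "joins (even_below n) (wd {} ds) B" "lp (even_below n) (wd {} ds) B \<in> H"
    using main[OF state_even, of ds] ds by (auto simp: plug_empty)
  have fw: "fin {} (wd {} ds) = {}" "even (length (wd {} ds))" using eqw_legit[OF ds(2)] eqw_length[OF ds(2)] xs by auto
  have "plug B = {}" using B fw by (auto simp: joins_def plug_empty)
  then have "flip_even n B = {}" by (simp add: plug_def)
  then have Be: "B = even_below n" by (auto simp: flip_even_def)
  have we: "eqw True {} (rev (walk (even_below n))) []"
  proof -
    have w: "legit {} (walk (even_below n))" "fin {} (walk (even_below n)) = {}"
      using walk_props[OF state_even] plug_empty by auto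
    have "eqw True {} (rev (walk (even_below n)) @ walk (even_below n)) (rev (walk (even_below n)) @ [])"
      using walk_empty w legit_rev[of "{}" "walk (even_below n)"] by (intro eqw_append_left) auto
    then show ?thesis using eqw_rev_left[OF w(1)] w eqw_sym eqw_trans by (metis append_Nil2)
  qed
  have lw: "legit {} (wd {} ds)" using eqw_legit[OF ds(2)] by blast
  have "eqw True {} (wd {} ds @ rev (walk (even_below n))) (wd {} ds @ [])"
    using we lw fw by (intro eqw_append_left) auto
  then have "eqw True {} (walk (even_below n) @ (wd {} ds @ rev (walk (even_below n)))) ([] @ (wd {} ds @ []))"
    using walk_props[OF state_even] plug_empty by (intro eqw_append[OF walk_empty]) auto
  then have "eqw True {} (walk (even_below n) @ wd {} ds @ rev (walk (even_below n))) (wd {} ds)" by simp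
  from cl_eq[OF this] lp_list[OF B(1)] Be have "lp (even_below n) (wd {} ds) B = cl (wd {} ds)" by (simp add: lp_def)
  moreover have "cl xs = cl (wd {} ds)" using cl_eq[OF ds(2)] xs by blast
  ultimately show ?thesis using B by simp
qed

end

section \<open>The twist floor by floor\<close>

definition chi :: "int \<times> int \<Rightarrow> int" where
  "chi c = (if even (fst c + snd c) then 1 else -1)"

definition north :: "int \<times> int \<Rightarrow> int \<times> int" where
  "north c = (fst c, snd c + 1)"

definition ylow :: "(int \<times> int) set set \<Rightarrow> (int \<times> int) set" where
  "ylow f = {c. {c, north c} \<in> f}"

text \<open>
  The contribution to four times the twist of a horizontal domino in direction \<open>e2\<close> with lower
  square \<open>c\<close> and of a vertical domino over the square \<open>e\<close>.
\<close>

definition ker :: "int \<times> int \<Rightarrow> int \<times> int \<Rightarrow> int" where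
  "ker c e = (if snd e = snd c \<or> snd e = snd c + 1 then chi c * sgn (fst c - fst e) * chi e else 0)"

lemma planar_cases:
  assumes "planar_domino d"
  obtains c where "d = {c, north c}" | x y where "d = {(x, y), (x + 1, y)}"
  using assms by (auto simp: planar_domino_def north_def)

lemma north_inj: "{c, north c} = {e, north e} \<longleftrightarrow> c = e"
  by (auto simp: north_def doubleton_eq_iff prod_eq_iff)

lemma x_not_y: "{(x, y), (x + 1, y)} \<noteq> {c, north c}"
  by (cases c) (auto simp: north_def doubleton_eq_iff)

lemma chi_north: "chi (north c) = - chi c"
  by (auto simp: chi_def north_def)

text \<open>The two squares are of opposite color and lie on the same side of the bar.\<close>

lemma ker_xdom:
  assumes "{c, north c} \<inter> {(x, y), (x + 1, y)} = {}"
  shows "ker c (x, y) + ker c (x + 1, y) = 0"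
proof (cases "y = snd c \<or> y = snd c + 1")
  case True
  then have "fst c \<noteq> x" "fst c \<noteq> x + 1" using assms by (cases c; auto simp: north_def)+
  then have "sgn (fst c - x) = sgn (fst c - (x + 1))" by (auto simp: sgn_if)
  moreover have "chi (x + 1, y) = - chi (x, y)" by (auto simp: chi_def)
  ultimately show ?thesis using True by (simp add: ker_def)
qed (auto simp: ker_def)

text \<open>For parallel bars at equal heights both sides vanish. If the bars are shifted by one,
  each sees one square of the other; exchanging them reverses the order of the first coordinates and
  also replaces one of the two squares by its neighbor of opposite color.\<close>

lemma ker_sym: "ker b c + ker b (north c) = ker c b + ker c (north b)"
proof -
  have "sgn (fst b - fst c) = - sgn (fst c - fst b)" by (auto simp: sgn_if)
  moreover have "chi (north c) = - chi c" "chi (north b) = - chi b" by (rule chi_north)+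
  ultimately show ?thesis by (auto simp: ker_def north_def)
qed

lemma ker_block:
  assumes "e \<notin> {(x, y), (x + 1, y), (x, y + 1), (x + 1, y + 1)}"
  shows "ker (x, y) e + ker (x + 1, y) e = 0"
proof (cases "snd e = y \<or> snd e = y + 1")
  case True
  then have "fst e \<noteq> x" "fst e \<noteq> x + 1" using assms by (auto simp: prod_eq_iff)
  then have "sgn (x - fst e) = sgn (x + 1 - fst e)" by (auto simp: sgn_if)
  moreover have "chi (x + 1, y) = - chi (x, y)" by (auto simp: chi_def)
  ultimately show ?thesis by (simp add: ker_def)
qed (auto simp: ker_def)

context board begin

text \<open>A pillar from below has its lower cube one floor further down, hence of the other color
  than a pillar going up from the same square. This accounts for the difference of the two
  plugs.\<close>

definition weight :: "(int \<times> int) set \<Rightarrow> (int \<times> int) set set \<Rightarrow> int" where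
  "weight p f = - (\<Sum>c\<in>ylow f. \<Sum>e\<in>D. ker c e * (of_bool (e \<in> p) - of_bool (e \<in> next_plug p f)))"

fun tw4 :: "(int \<times> int) set \<Rightarrow> (int \<times> int) set set list \<Rightarrow> int" where
  "tw4 p [] = 0"
| "tw4 p (f # fs) = weight p f + tw4 (next_plug p f) fs"

lemma tw4_append: "tw4 p (xs @ ys) = tw4 p xs + tw4 (fin p xs) ys"
  by (induction xs arbitrary: p) auto

lemma weight_empty [simp]: "weight p {} = 0"
  by (simp add: weight_def ylow_def)

lemma finite_ylow: assumes "floor_ok p f" shows "finite (ylow f)"
proof (rule finite_subset)
  show "ylow f \<subseteq> D" using assms by (auto simp: ylow_def floor_ok_def)
qed (rule finite_D)

lemma sum_over_floor:
  assumes "floor_ok p f" and "\<And>x y. {(x, y), (x + 1, y)} \<in> f \<Longrightarrow> h (x, y) + h (x + 1, y) = (0::int)"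
  shows "(\<Sum>e\<in>\<Union>f. h e) = (\<Sum>c\<in>ylow f. h c + h (north c))"
proof -
  have "\<forall>d\<in>f. d \<subseteq> D" using assms(1) by (auto simp: floor_ok_def)
  then have fin: "finite f" "\<forall>d\<in>f. finite d"
    using floor_ok_finite[OF assms(1)] finite_subset[OF _ finite_D] by auto
  have "(\<Sum>e\<in>\<Union>f. h e) = (\<Sum>d\<in>f. \<Sum>e\<in>d. h e)"
    using assms(1) fin by (subst sum.Union_disjoint) (auto simp: floor_ok_def pairwise_def disjnt_def)
  also have "\<dots> = (\<Sum>d\<in>(\<lambda>c. {c, north c}) ` ylow f. \<Sum>e\<in>d. h e)"
  proof (rule sum.mono_neutral_right[OF fin(1)])
    show "\<forall>d\<in>f - (\<lambda>c. {c, north c}) ` ylow f. (\<Sum>e\<in>d. h e) = 0"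
    proof
      fix d assume d: "d \<in> f - (\<lambda>c. {c, north c}) ` ylow f"
      then have "planar_domino d" using assms(1) by (auto simp: floor_ok_def)
      then show "(\<Sum>e\<in>d. h e) = 0"
        using d assms(2) by (cases rule: planar_cases) (auto simp: ylow_def)
    qed
  qed (auto simp: ylow_def)
  also have "\<dots> = (\<Sum>c\<in>ylow f. \<Sum>e\<in>{c, north c}. h e)"
    by (subst sum.reindex) (auto simp: inj_on_def north_inj)
  also have "\<dots> = (\<Sum>c\<in>ylow f. h c + h (north c))"
    by (intro sum.cong) (auto simp: north_def prod_eq_iff)
  finally show ?thesis .
qed

lemma ylow_disjoint:
  assumes "floor_ok p f" "c \<in> ylow f" "d \<in> f" "d \<noteq> {c, north c}"
  shows "{c, north c} \<inter> d = {}"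
proof -
  have "pairwise disjnt f" "{c, north c} \<in> f" using assms by (simp_all add: floor_ok_def ylow_def)
  then show ?thesis using assms(3,4) by (metis disjnt_def pairwiseD)
qed

text \<open>The two bars that appear lie side by side and have opposite colors. A pillar at their
  height lies outside of the square and thus on the same side of both, so the contributions
  cancel.\<close>

lemma weight_hflip:
  assumes f: "floor_ok p f" and H: "hblock x y \<subseteq> f"
  shows "weight p (f - hblock x y \<union> vblock x y) = weight p f"
proof -
  define f' where "f' = f - hblock x y \<union> vblock x y"
  have nx: "next_plug p f' = next_plug p f" using floor_ok_hflip[OF assms] by (simp add: f'_def)
  have cov: "(x, y) \<in> \<Union>f" "(x + 1, y) \<in> \<Union>f" "(x, y + 1) \<in> \<Union>f" "(x + 1, y + 1) \<in> \<Union>f"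
    using H by (auto simp: hblock_def)
  have dj: "disjoint f" using f by (simp add: floor_ok_def)
  have notin: "(x, y) \<notin> ylow f" "(x + 1, y) \<notin> ylow f"
  proof -
    have h: "{(x, y), (x + 1, y)} \<in> f" using H by (simp add: hblock_def)
    show "(x, y) \<notin> ylow f"
      using ylow_disjoint[OF f _ h x_not_y, of "(x, y)"] by auto
    show "(x + 1, y) \<notin> ylow f"
      using ylow_disjoint[OF f _ h x_not_y, of "(x + 1, y)"] by auto
  qed
  have yl: "ylow f' = insert (x, y) (insert (x + 1, y) (ylow f))"
  proof (rule Set.set_eqI)
    fix c
    have "{c, north c} \<notin> hblock x y" using x_not_y[of x y c] x_not_y[of x "y + 1" c] by (auto simp: hblock_def)
    moreover have "{c, north c} \<in> vblock x y \<longleftrightarrow> c = (x, y) \<or> c = (x + 1, y)"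
      using north_inj[of c "(x, y)"] north_inj[of c "(x + 1, y)"] by (simp add: vblock_def north_def)
    ultimately show "c \<in> ylow f' \<longleftrightarrow> c \<in> insert (x, y) (insert (x + 1, y) (ylow f))"
      by (auto simp: ylow_def f'_def)
  qed
  have cov0: "of_bool (e \<in> p) - of_bool (e \<in> next_plug p f) = (0::int)" if "e \<in> \<Union>f" for e
    using that f by (force simp: floor_ok_def next_plug_def)
  let ?s = "\<lambda>e. of_bool (e \<in> p) - of_bool (e \<in> next_plug p f) :: int"
  have z: "(\<Sum>e\<in>D. ker (x, y) e * ?s e) + (\<Sum>e\<in>D. ker (x + 1, y) e * ?s e) = 0"
  proof -
    have "(\<Sum>e\<in>D. ker (x, y) e * ?s e) + (\<Sum>e\<in>D. ker (x + 1, y) e * ?s e) =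
      (\<Sum>e\<in>D. (ker (x, y) e + ker (x + 1, y) e) * ?s e)" by (simp add: sum.distrib distrib_right)
    also have "\<dots> = 0"
    proof (rule sum.neutral, rule ballI)
      fix e
      show "(ker (x, y) e + ker (x + 1, y) e) * ?s e = 0"
      proof (cases "e \<in> {(x, y), (x + 1, y), (x, y + 1), (x + 1, y + 1)}")
        case True
        then have "e \<in> \<Union>f" using cov by auto
        then show ?thesis by (simp only: cov0 mult_zero_right)
      next
        case False
        from ker_block[OF this] show ?thesis by (simp only: mult_zero_left)
      qed
    qed
    finally show ?thesis .
  qed
  have "(\<Sum>c\<in>ylow f'. \<Sum>e\<in>D. ker c e * ?s e) = (\<Sum>c\<in>ylow f. \<Sum>e\<in>D. ker c e * ?s e)"
    unfolding yl using notin finite_ylow[OF f] z by simp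
  then show ?thesis unfolding f'_def[symmetric] weight_def nx by simp
qed

lemma sum_of_bool: "finite S \<Longrightarrow> d \<subseteq> S \<Longrightarrow> (\<Sum>e\<in>S. h e * of_bool (e \<in> d)) = (\<Sum>e\<in>d. h e :: int)"
proof -
  assume S: "finite S" "d \<subseteq> S"
  have "(\<Sum>e\<in>S. h e * of_bool (e \<in> d)) = (\<Sum>e\<in>S. if e \<in> d then h e else 0)"
    by (rule sum.cong) auto
  also have "\<dots> = (\<Sum>e\<in>S \<inter> d. h e)" by (rule sum.inter_restrict[OF S(1), symmetric])
  also have "S \<inter> d = d" using S by blast
  finally show ?thesis .
qed

text \<open>The plug between the floors gains \<open>d\<close>, so new pillars act on the other bars
  of both floors. If \<open>d\<close> points in the first direction, its two squares cancel. If
  \<open>d\<close> is itself a bar, its own contribution disappears as well, and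
  \<open>ker_sym\<close> identifies the two changes.\<close>

lemma weight_vflip:
  assumes l: "legit p [f, g]" and d: "d \<in> f" "d \<in> g"
  shows "weight p f + weight (next_plug p f) g =
    weight p (f - {d}) + weight (next_plug p (f - {d})) (g - {d})"
proof -
  define p1 where "p1 = next_plug p f"
  define p2 where "p2 = next_plug p1 g"
  have f: "floor_ok p f" and g: "floor_ok p1 g" using l by (auto simp: p1_def)
  note v = legit_vflip[OF l d, folded p1_def, folded p2_def]
  have dD: "d \<subseteq> D" "planar_domino d" using f d by (auto simp: floor_ok_def)
  have dp: "d \<inter> p = {}" "d \<inter> p1 = {}" "d \<inter> p2 = {}"
    using f g d by (auto simp: floor_ok_def p1_def p2_def next_plug_def)
  have s1: "of_bool (e \<in> p1 \<union> d) = of_bool (e \<in> p1) + (of_bool (e \<in> d) :: int)" for e using dp by auto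
  let ?F = "\<lambda>Y. \<Sum>c\<in>Y. \<Sum>e\<in>d. ker c e"
  have W1: "weight p (f - {d}) = - (\<Sum>c\<in>ylow (f - {d}). \<Sum>e\<in>D. ker c e * (of_bool (e \<in> p) - of_bool (e \<in> p1))) + ?F (ylow (f - {d}))"
    unfolding weight_def v(3) s1
    by (simp add: algebra_simps sum.distrib sum_subtractf sum_of_bool[OF finite_D dD(1)])
  have W2: "weight (p1 \<union> d) (g - {d}) = - (\<Sum>c\<in>ylow (g - {d}). \<Sum>e\<in>D. ker c e * (of_bool (e \<in> p1) - of_bool (e \<in> p2))) - ?F (ylow (g - {d}))"
    unfolding weight_def v(2)[unfolded v(3)] s1
    by (simp add: algebra_simps sum.distrib sum_subtractf sum_of_bool[OF finite_D dD(1)])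
  show ?thesis
  proof (cases rule: planar_cases[OF dD(2)])
    case (2 x y)
    have yl: "ylow (f - {d}) = ylow f" "ylow (g - {d}) = ylow g"
      by (auto simp: ylow_def 2 x_not_y[symmetric])
    have "(\<Sum>e\<in>d. ker c e) = 0" if "floor_ok q h" "c \<in> ylow h" "d \<in> h" for q h c
      using ker_xdom[of c x y] ylow_disjoint[OF that] x_not_y[of x y c] 2 by simp
    then have "?F (ylow f) = 0" "?F (ylow g) = 0" using f g d by (auto intro!: sum.neutral)
    then show ?thesis
      unfolding p1_def[symmetric] v(3) W1 W2 yl unfolding weight_def p1_def[symmetric] p2_def[symmetric] by simp
  next
    case (1 b)
    have yl: "ylow f = insert b (ylow (f - {d}))" "ylow g = insert b (ylow (g - {d}))"
      "b \<notin> ylow (f - {d})" "b \<notin> ylow (g - {d})"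
      using d unfolding ylow_def 1 by (auto simp: north_inj)
    have fin: "finite (ylow (f - {d}))" "finite (ylow (g - {d}))" using yl finite_ylow[OF f] finite_ylow[OF g] by auto
    have Fb: "(\<Sum>e\<in>d. ker b e) = 0" by (rule sum.neutral) (auto simp: 1 ker_def north_def)
    \<comment> \<open>What \<open>d\<close> sees of the bars on a floor equals what these bars see
      of the squares of \<open>d\<close>; dominoes in the first direction are invisible to
      \<open>d\<close>.\<close>
    have key: "(\<Sum>e\<in>\<Union>h. ker b e) = ?F (ylow h)" if h: "floor_ok q h" "d \<in> h" for q h
    proof -
      have bh: "b \<in> ylow h" using that 1 by (simp add: ylow_def)
      have "(\<Sum>e\<in>\<Union>h. ker b e) = (\<Sum>c\<in>ylow h. ker b c + ker b (north c))"
      proof (rule sum_over_floor[OF h(1)])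
        fix x y assume a: "{(x, y), (x + 1, y)} \<in> h"
        show "ker b (x, y) + ker b (x + 1, y) = 0"
          by (rule ker_xdom[OF ylow_disjoint[OF h(1) bh a x_not_y]])
      qed
      also have "\<dots> = (\<Sum>c\<in>ylow h. ker c b + ker c (north b))" by (simp add: ker_sym)
      also have "\<dots> = ?F (ylow h)" by (intro sum.cong) (auto simp: 1 north_def prod_eq_iff)
      finally show ?thesis .
    qed
    \<comment> \<open>The board is the disjoint union of \<open>p\<close>, \<open>p1\<close> and the
      dominoes of the floor. Eliminating \<open>p\<close>, and later \<open>p2\<close>, leaves terms
      in \<open>D\<close> and \<open>p1\<close> that cancel between the two floors.\<close>
    have sp: "(\<Sum>e\<in>D. ker b e * of_bool (e \<in> p)) = (\<Sum>e\<in>D. ker b e) - (\<Sum>e\<in>D. ker b e * of_bool (e \<in> p1)) - (\<Sum>e\<in>\<Union>f. ker b e)"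
    proof -
      have Uf: "\<Union>f \<subseteq> D" using f by (auto simp: floor_ok_def)
      have "of_bool (e \<in> p) = 1 - of_bool (e \<in> p1) - (of_bool (e \<in> \<Union>f) :: int)" if "e \<in> D" for e
      proof -
        have "e \<in> \<Union>f \<Longrightarrow> e \<notin> p" using f by (auto simp: floor_ok_def)
        moreover have "e \<in> p1 \<longleftrightarrow> e \<notin> p \<and> e \<notin> \<Union>f" using that by (auto simp: p1_def next_plug_def)
        ultimately show ?thesis by (auto simp: of_bool_def)
      qed
      then have "(\<Sum>e\<in>D. ker b e * of_bool (e \<in> p)) = (\<Sum>e\<in>D. ker b e * (1 - of_bool (e \<in> p1) - of_bool (e \<in> \<Union>f)))"
        by (intro sum.cong) auto
      then show ?thesis using sum_of_bool[OF finite_D Uf, of "ker b"] by (simp add: algebra_simps sum.distrib sum_subtractf)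
    qed
    have sp2: "(\<Sum>e\<in>D. ker b e * of_bool (e \<in> p2)) = (\<Sum>e\<in>D. ker b e) - (\<Sum>e\<in>D. ker b e * of_bool (e \<in> p1)) - (\<Sum>e\<in>\<Union>g. ker b e)"
    proof -
      have Ug: "\<Union>g \<subseteq> D" using g by (auto simp: floor_ok_def)
      have "of_bool (e \<in> p2) = 1 - of_bool (e \<in> p1) - (of_bool (e \<in> \<Union>g) :: int)" if "e \<in> D" for e
      proof -
        have "e \<in> \<Union>g \<Longrightarrow> e \<notin> p1" using g by (auto simp: floor_ok_def)
        moreover have "e \<in> p2 \<longleftrightarrow> e \<notin> p1 \<and> e \<notin> \<Union>g" using that by (auto simp: p2_def next_plug_def)
        ultimately show ?thesis by (auto simp: of_bool_def)
      qed
      then have "(\<Sum>e\<in>D. ker b e * of_bool (e \<in> p2)) = (\<Sum>e\<in>D. ker b e * (1 - of_bool (e \<in> p1) - of_bool (e \<in> \<Union>g)))"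
        by (intro sum.cong) auto
      then show ?thesis using sum_of_bool[OF finite_D Ug, of "ker b"] by (simp add: algebra_simps sum.distrib sum_subtractf)
    qed
    have Ff: "?F (ylow f) = ?F (ylow (f - {d}))" and Fg: "?F (ylow g) = ?F (ylow (g - {d}))"
      using yl fin Fb by simp_all
    have "(\<Sum>e\<in>D. ker b e * (of_bool (e \<in> p) - of_bool (e \<in> p1))) + (\<Sum>e\<in>D. ker b e * (of_bool (e \<in> p1) - of_bool (e \<in> p2)))
      = ?F (ylow (g - {d})) - ?F (ylow (f - {d}))"
      using sp sp2 key[OF f d(1)] key[OF g d(2)] Ff Fg by (simp add: right_diff_distrib sum_subtractf)
    moreover have "weight p f = - (\<Sum>c\<in>ylow (f - {d}). \<Sum>e\<in>D. ker c e * (of_bool (e \<in> p) - of_bool (e \<in> p1)))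
       - (\<Sum>e\<in>D. ker b e * (of_bool (e \<in> p) - of_bool (e \<in> p1)))"
      unfolding weight_def p1_def[symmetric] yl(1) using yl(3) fin by simp
    moreover have "weight p1 g = - (\<Sum>c\<in>ylow (g - {d}). \<Sum>e\<in>D. ker c e * (of_bool (e \<in> p1) - of_bool (e \<in> p2)))
       - (\<Sum>e\<in>D. ker b e * (of_bool (e \<in> p1) - of_bool (e \<in> p2)))"
      unfolding weight_def p2_def[symmetric] yl(2) using yl(4) fin by simp
    ultimately show ?thesis unfolding p1_def[symmetric] v(3) W1 W2 by linarith
  qed
qed

theorem tw4_eqw: "eqw b p xs ys \<Longrightarrow> tw4 p xs = tw4 p ys"
proof (induction rule: eqw.induct)
  case (eqw_hflip p f xs x y)
  then show ?case using weight_hflip[of p f x y] floor_ok_hflip[of p f x y] by simp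
next
  case (eqw_vflip p f g xs d)
  then have "legit p [f, g]" by simp
  from weight_vflip[OF this eqw_vflip(2,3)] legit_vflip(2)[OF eqw_vflip(1-3)]
  show ?case by simp
next
  case (eqw_stab p xs)
  then show ?case using next_plug_empty legit_subset by auto
qed auto

lemma tw4_rev: "legit p xs \<Longrightarrow> tw4 (fin p xs) (rev xs) = - tw4 p xs"
  using tw4_eqw[OF eqw_rev] by (fastforce simp: tw4_append)

subsection \<open>The twist of a single domino\<close>

lemma tw4_mv_x:
  assumes "can p {(x, y), (x + 1, y)}" shows "tw4 p (mv p {(x, y), (x + 1, y)}) = 0"
proof -
  have "ylow {{(x, y), (x + 1, y)}} = {}" by (auto simp: ylow_def x_not_y[symmetric])
  then have "weight q {{(x, y), (x + 1, y)}} = 0" for q by (simp add: weight_def)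
  then show ?thesis by (simp add: mv_def)
qed

text \<open>Off the domino every square of its floor carries a pillar, from below or from above, so
  the difference of the plugs is a sign determined by membership in \<open>p\<close>. For a removal
  the empty floor in front exchanges the two kinds.\<close>

lemma tw4_mv_y:
  assumes "can p {b, north b}"
  shows "tw4 p (mv p {b, north b}) =
    (if {b, north b} \<subseteq> p then -1 else 1) * ((\<Sum>e\<in>D. ker b e) - 2 * (\<Sum>e\<in>p. ker b e))"
proof -
  let ?d = "{b, north b}"
  have yl: "ylow {?d} = {b}" by (auto simp: ylow_def north_inj)
  have k0: "ker b b = 0" "ker b (north b) = 0" by (simp_all add: ker_def north_def)
  have p: "p \<subseteq> D" using assms by (simp add: can_def)
  have s: "(\<Sum>e\<in>D. ker b e * (1 - 2 * of_bool (e \<in> p))) = (\<Sum>e\<in>D. ker b e) - 2 * (\<Sum>e\<in>p. ker b e)"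
    using sum_of_bool[OF finite_D p, of "ker b"]
    by (simp add: right_diff_distrib sum_subtractf sum_distrib_left[symmetric] mult.left_commute[of _ 2])
  have W: "weight q {?d} = - (\<Sum>e\<in>D. ker b e * (of_bool (e \<in> q) - of_bool (e \<in> next_plug q {?d})))" for q
    by (simp add: weight_def yl)
  show ?thesis
  proof (cases "?d \<subseteq> p")
    case True
    have eq: "ker b e * (of_bool (e \<in> next_plug p {}) - of_bool (e \<in> next_plug (next_plug p {}) {?d})) = ker b e * (1 - 2 * of_bool (e \<in> p))"
      if "e \<in> D" for e
      using that k0 by (cases "e \<in> ?d") (auto simp: next_plug_def)
    have "weight (next_plug p {}) {?d} = - ((\<Sum>e\<in>D. ker b e) - 2 * (\<Sum>e\<in>p. ker b e))"
      unfolding W s[symmetric] by (simp only: sum.cong[OF refl eq])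
    then show ?thesis using True by (simp add: mv_def)
  next
    case False
    then have "?d \<inter> p = {}" using assms by (auto simp: can_def)
    then have eq: "ker b e * (of_bool (e \<in> p) - of_bool (e \<in> next_plug p {?d})) = - (ker b e * (1 - 2 * of_bool (e \<in> p)))"
      if "e \<in> D" for e
      using that k0 by (cases "e \<in> ?d") (auto simp: next_plug_def)
    have "weight p {?d} = (\<Sum>e\<in>D. ker b e) - 2 * (\<Sum>e\<in>p. ker b e)"
      unfolding W s[symmetric] by (simp only: sum.cong[OF refl eq] sum_negf minus_minus)
    moreover have "mv p ?d = [{?d}, {}]" by (simp only: mv_def if_not_P[OF False])
    ultimately show ?thesis unfolding if_not_P[OF False] by simp
  qed
qed

end

section \<open>The boustrophedon order of a rectangle\<close>

definition rect :: "nat \<Rightarrow> nat \<Rightarrow> (int \<times> int) set" where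
  "rect a b = {0..<int a} \<times> {0..<int b}"

definition snake_pos :: "bool \<Rightarrow> nat \<Rightarrow> nat \<Rightarrow> int \<times> int" where
  "snake_pos s W i =
     (let r = i div W; x = (if even r then int (i mod W) else int W - 1 - int (i mod W))
      in if s then (int r, x) else (x, int r))"

lemma snake_pos_row:
  assumes "a < W" shows "snake_pos s W (r * W + a) =
    (let x = (if even r then int a else int W - 1 - int a) in if s then (int r, x) else (x, int r))"
proof -
  have "(r * W + a) div W = r" "(r * W + a) mod W = a" using assms by auto
  then show ?thesis by (simp only: snake_pos_def Let_def)
qed

lemma row_form: assumes "0 < W" obtains r a where "i = r * W + a" "a < (W::nat)"
  using that[of "i div W" "i mod W"] assms by simp

lemma planar_domino_iff:
  "planar_domino {c, e} \<longleftrightarrow> \<bar>fst c - fst e\<bar> + \<bar>snd c - snd e\<bar> = 1"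
proof -
  obtain a b u v where ce: "c = (a, b)" "e = (u, v)" by (cases c, cases e)
  show ?thesis
  proof
    assume "planar_domino {c, e}"
    then show "\<bar>fst c - fst e\<bar> + \<bar>snd c - snd e\<bar> = 1"
      by (auto simp: planar_domino_def doubleton_eq_iff)
  next
    assume "\<bar>fst c - fst e\<bar> + \<bar>snd c - snd e\<bar> = 1"
    then consider "u = a + 1" "v = b" | "a = u + 1" "v = b" | "u = a" "v = b + 1" | "u = a" "b = v + 1"
      unfolding ce by auto linarith+
    then show "planar_domino {c, e}"
      unfolding ce planar_domino_def by cases (auto simp: insert_commute)
  qed
qed

lemma snake_bij:
  assumes "0 < W" shows "bij_betw (snake_pos s W) {..<R * W} (if s then rect R W else rect W R)"
proof (rule bij_betw_imageI)
  show "inj_on (snake_pos s W) {..<R * W}"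
  proof
    fix i j assume eq: "snake_pos s W i = snake_pos s W j"
    obtain r a where i: "i = r * W + a" "a < W" using row_form assms by blast
    obtain t b where j: "j = t * W + b" "b < W" using row_form assms by blast
    have "r = t" using eq unfolding i(1) j(1) snake_pos_row[OF i(2)] snake_pos_row[OF j(2)]
      by (auto simp: Let_def split: if_splits)
    then have "a = b" using eq unfolding i(1) j(1) snake_pos_row[OF i(2)] snake_pos_row[OF j(2)]
      by (auto simp: Let_def split: if_splits)
    then show "i = j" using i j \<open>r = t\<close> by simp
  qed
  show "snake_pos s W ` {..<R * W} = (if s then rect R W else rect W R)"
  proof (rule Set.set_eqI, rule iffI)
    fix c assume "c \<in> snake_pos s W ` {..<R * W}"
    then obtain i where "i < R * W" "c = snake_pos s W i" by auto
    obtain r a where i: "i = r * W + a" "a < W" using row_form assms by blast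
    have "r * W < R * W" using i \<open>i < R * W\<close> by linarith
    then have "r < R" by simp
    then show "c \<in> (if s then rect R W else rect W R)"
      unfolding \<open>c = snake_pos s W i\<close> i(1) snake_pos_row[OF i(2)] using i(2) by (auto simp: rect_def Let_def)
  next
    fix c assume c: "c \<in> (if s then rect R W else rect W R)"
    define y x where "y = (if s then fst c else snd c)" and "x = (if s then snd c else fst c)"
    have b: "0 \<le> y" "y < int R" "0 \<le> x" "x < int W" using c by (auto simp: rect_def x_def y_def split: if_splits)
    define r a where "r = nat y" and "a = (if even r then nat x else nat (int W - 1 - x))"
    have ra: "int r = y" "r < R" "a < W" "(if even r then int a else int W - 1 - int a) = x"
      using b by (auto simp: r_def a_def)
    have "snake_pos s W (r * W + a) = c"
      unfolding snake_pos_row[OF ra(3)] using ra(1,4) by (auto simp: Let_def x_def y_def)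
    moreover have "r * W + a < R * W"
    proof -
      have "Suc r * W \<le> R * W" using ra(2) by (intro mult_right_mono) auto
      then show ?thesis using ra(3) by simp
    qed
    ultimately show "c \<in> snake_pos s W ` {..<R * W}" by force
  qed
qed

text \<open>Offsets in consecutive rows run in opposite directions, so two squares of such rows are
  adjacent exactly when their offsets add up to \<open>W - 1\<close>, that is, when they are mirror
  images in the turning point.\<close>

lemma snake_edge_iff:
  assumes W: "0 < W" and ij: "i < j" "j < R * W"
  shows "planar_domino {snake_pos s W i, snake_pos s W j} \<longleftrightarrow> snake_edge W (R * W) i j"
proof -
  obtain r a where i: "i = r * W + a" "a < W" using row_form W by blast
  obtain t b where j: "j = t * W + b" "b < W" using row_form W by blast
  have rt: "r \<le> t"
  proof (rule ccontr)
    assume "\<not> r \<le> t"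
    then have "Suc t * W \<le> r * W" by (intro mult_right_mono) auto
    then show False using i j ij by simp
  qed
  have P: "planar_domino {snake_pos s W i, snake_pos s W j} \<longleftrightarrow>
     \<bar>(if even r then int a else int W - 1 - int a) - (if even t then int b else int W - 1 - int b)\<bar> + \<bar>int r - int t\<bar> = 1"
    unfolding planar_domino_iff i(1) j(1) snake_pos_row[OF i(2)] snake_pos_row[OF j(2)] by (auto simp: Let_def)
  consider "t = r" | "t = Suc r" | "r + 2 \<le> t" using rt by linarith
  then show ?thesis
  proof cases
    case 1
    have "a < b" using ij i j 1 by simp
    then have "planar_domino {snake_pos s W i, snake_pos s W j} \<longleftrightarrow> b = Suc a" unfolding P 1 by auto
    \<comment> \<open>Within row \<open>r\<close> the left side lies strictly between
      \<open>2 * r * W\<close> and \<open>2 * (r + 1) * W\<close>.\<close>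
    moreover have "i + j + 1 \<noteq> 2 * (q * W)" for q
    proof
      assume "i + j + 1 = 2 * (q * W)"
      then have "2 * (r * W) + (a + b + 1) = 2 * (q * W)" using i j 1 by simp
      moreover have "a + b + 1 < 2 * W" using i j \<open>a < b\<close> by linarith
      ultimately have "r * W < q * W" "q * W < Suc r * W" unfolding mult_Suc by linarith+
      then have "r < q" "q < Suc r" by (metis mult_less_cancel2)+
      then show False by simp
    qed
    ultimately show ?thesis unfolding snake_edge_def using ij i j 1 by auto
  next
    case 2
    have "planar_domino {snake_pos s W i, snake_pos s W j} \<longleftrightarrow> a + b + 1 = W"
      unfolding P 2 using i j by auto
    moreover have "snake_edge W (R * W) i j \<longleftrightarrow> a + b + 1 = W"
    proof
      assume "a + b + 1 = W"
      then have "i + j + 1 = 2 * (t * W)" "j < t * W + W" "1 \<le> t" using i j 2 by auto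
      then show "snake_edge W (R * W) i j" unfolding snake_edge_def using ij by blast
    next
      assume "snake_edge W (R * W) i j"
      then consider "j = Suc i" | q where "i + j + 1 = 2 * (q * W)" by (auto simp: snake_edge_def)
      then show "a + b + 1 = W"
      proof cases
        case 1
        then show ?thesis using i j 2 by simp
      next
        case (2 q)
        have e: "2 * (r * W) + W + (a + b + 1) = 2 * (q * W)" using 2 i j \<open>t = Suc r\<close> by simp
        then have "r * W < q * W" "q * W < Suc (Suc r) * W" unfolding mult_Suc using i j W by linarith+
        then have "r < q" "q < Suc (Suc r)" by (metis mult_less_cancel2)+
        then have "q = Suc r" by simp
        then show ?thesis using e by simp
      qed
    qed
    ultimately show ?thesis by simp
  next
    case 3
    then have "\<not> planar_domino {snake_pos s W i, snake_pos s W j}" unfolding P by linarith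
    moreover have "\<not> snake_edge W (R * W) i j"
    proof
      assume "snake_edge W (R * W) i j"
      then consider "j = Suc i" | q where "i + j + 1 = 2 * (q * W)" "j < q * W + W" by (auto simp: snake_edge_def)
      then show False
      proof cases
        case 1
        have "Suc (Suc r) * W \<le> t * W" using 3 by (intro mult_right_mono) auto
        then show ?thesis using 1 i j by simp
      next
        case (2 q)
        have a: "t * W < Suc q * W" using 2 j by simp
        then have "t < Suc q" by (metis mult_less_cancel2)
        then have "t * W \<le> q * W" by (intro mult_right_mono) auto
        moreover have "Suc (Suc r) * W \<le> t * W" using 3 by (intro mult_right_mono) auto
        ultimately have "r * W + 2 * W \<le> q * W" unfolding mult_Suc by linarith
        then show ?thesis using 2 i by linarith
      qed
    qed
    ultimately show ?thesis by simp
  qed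
qed

text \<open>The corners of a square in the cyclic order in which the path visits them; the two
  alternatives are the two directions in which the first of its rows is traversed.\<close>

definition face_at :: "bool \<Rightarrow> int \<Rightarrow> int \<Rightarrow> int \<times> int \<Rightarrow> int \<times> int \<Rightarrow> int \<times> int \<Rightarrow> int \<times> int \<Rightarrow> bool" where
  "face_at s x y c0 c1 c2 c3 \<longleftrightarrow> (c0, c1, c2, c3) \<in>
     (if s then {((y, x), (y, x + 1), (y + 1, x + 1), (y + 1, x)), ((y, x + 1), (y, x), (y + 1, x), (y + 1, x + 1))}
      else {((x, y), (x + 1, y), (x + 1, y + 1), (x, y + 1)), ((x + 1, y), (x, y), (x, y + 1), (x + 1, y + 1))})"

lemma snake_face:
  assumes W: "0 < W" and e: "snake_edge W n i (Suc j)" and ij: "Suc i < j"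
  shows "\<exists>x y.
    face_at s x y (snake_pos s W i) (snake_pos s W (Suc i)) (snake_pos s W j) (snake_pos s W (Suc j))"
proof -
  obtain q where q: "1 \<le> q" "i + Suc j + 1 = 2 * (q * W)" "Suc j < q * W + W"
    using e ij by (auto simp: snake_edge_def)
  obtain r where r: "q = Suc r" using q by (cases q) auto
  have "r * W \<le> i" "Suc i < q * W" "q * W \<le> j" using q ij r by auto
  define a where "a = i - r * W"
  have a: "i = r * W + a" "a + 1 < W" using \<open>r * W \<le> i\<close> \<open>Suc i < q * W\<close> r by (auto simp: a_def)
  have i1: "Suc i = r * W + (a + 1)" using a by simp
  have "i + j + 2 = 2 * (r * W) + 2 * W" using q(2) r by simp
  then have j: "j = Suc r * W + (W - 2 - a)" "Suc j = Suc r * W + (W - 1 - a)"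
    unfolding mult_Suc using a by arith+
  have lt: "a < W" "W - 2 - a < W" "W - 1 - a < W" using a by auto
  have z: "int (W - 2 - a) = int W - 2 - int a" "int (W - 1 - a) = int W - 1 - int a" using a by auto
  \<comment> \<open>The smaller of the two coordinates along the row; in odd rows the offset is
    counted from the far end, so it belongs to the offset \<open>a + 1\<close>.\<close>
  define x y where "x = (if even r then int a else int W - 2 - int a)" and "y = int r"
  have "face_at s x y (snake_pos s W i) (snake_pos s W (Suc i)) (snake_pos s W j) (snake_pos s W (Suc j))"
    unfolding i1 j(2) unfolding a(1) j(1) snake_pos_row[OF lt(1)] snake_pos_row[OF a(2)] snake_pos_row[OF lt(2)] snake_pos_row[OF lt(3)] z x_def y_def face_at_def
    by (cases s; cases "even r") (simp_all add: Let_def)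
  then show ?thesis by (rule exI[of _ y, THEN exI[of _ x]])
qed

lemma snake_board_rect:
  assumes "3 \<le> W" "4 \<le> R" "2 * K = R * W"
  shows "snake_board (if s then rect R W else rect W R) (snake_pos s W) (R * W) K W R"
proof unfold_locales
  have W0: "0 < W" using assms by simp
  show "finite (if s then rect R W else rect W R)" by (simp add: rect_def)
  show "bij_betw (snake_pos s W) {..<R * W} (if s then rect R W else rect W R)" using snake_bij[OF W0] .
  show "planar_domino {snake_pos s W i, snake_pos s W j} \<longleftrightarrow> snake_edge W (R * W) i j" if "i < j" "j < R * W" for i j
    using snake_edge_iff[OF W0 that] .
  show "\<exists>x y. {{snake_pos s W i, snake_pos s W (Suc i)}, {snake_pos s W j, snake_pos s W (Suc j)}} = hblock x y \<and> {{snake_pos s W i, snake_pos s W (Suc j)}, {snake_pos s W j, snake_pos s W (Suc i)}} = vblock x y \<or>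
            {{snake_pos s W i, snake_pos s W (Suc i)}, {snake_pos s W j, snake_pos s W (Suc j)}} = vblock x y \<and> {{snake_pos s W i, snake_pos s W (Suc j)}, {snake_pos s W j, snake_pos s W (Suc i)}} = hblock x y"
    if e: "snake_edge W (R * W) i (Suc j)" "snake_edge W (R * W) (Suc i) j" "Suc i < j" for i j
  proof -
    obtain x y where xy: "face_at s x y (snake_pos s W i) (snake_pos s W (Suc i)) (snake_pos s W j) (snake_pos s W (Suc j))"
      using snake_face[OF W0 e(1,3)] by blast
    let ?p = "snake_pos s W"
    show ?thesis
    proof (cases s)
      case True
      from xy True have c: "(?p i = (y, x) \<and> ?p (Suc i) = (y, x + 1) \<and> ?p j = (y + 1, x + 1) \<and> ?p (Suc j) = (y + 1, x)) \<or>
         (?p i = (y, x + 1) \<and> ?p (Suc i) = (y, x) \<and> ?p j = (y + 1, x) \<and> ?p (Suc j) = (y + 1, x + 1))"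
        by (simp add: face_at_def)
      then have "{{?p i, ?p (Suc i)}, {?p j, ?p (Suc j)}} = vblock y x"
        "{{?p i, ?p (Suc j)}, {?p j, ?p (Suc i)}} = hblock y x"
        by (elim disjE conjE; simp add: hblock_def vblock_def insert_commute)+
      then show ?thesis by blast
    next
      case False
      from xy False have c: "(?p i = (x, y) \<and> ?p (Suc i) = (x + 1, y) \<and> ?p j = (x + 1, y + 1) \<and> ?p (Suc j) = (x, y + 1)) \<or>
         (?p i = (x + 1, y) \<and> ?p (Suc i) = (x, y) \<and> ?p j = (x, y + 1) \<and> ?p (Suc j) = (x + 1, y + 1))"
        by (simp add: face_at_def)
      then have "{{?p i, ?p (Suc i)}, {?p j, ?p (Suc j)}} = hblock x y"
        "{{?p i, ?p (Suc j)}, {?p j, ?p (Suc i)}} = vblock x y"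
        by (elim disjE conjE; simp add: hblock_def vblock_def insert_commute)+
      then show ?thesis by blast
    qed
  qed
qed (use assms in auto)

subsection \<open>The twist of a token turning around a face\<close>

context board begin

text \<open>A token goes from \<open>P0\<close> directly to \<open>P3\<close>, or three tokens
  advance around the square with the same result; the two forms of \<open>p\<close> are the two
  possible colorings. Only the moves in the second direction contribute, one on each of the two
  sides. Off the square their kernels are negatives of each other, so the rest of the board,
  recorded in \<open>a\<close> and \<open>s\<close>, cancels; the remainder is the mutual effect
  inside the square.\<close>

lemma face_twist:
  fixes x y :: int
  assumes q: "q \<subseteq> D" "q \<inter> {P0, P1, P2, P3} = {}" and D: "{P0, P1, P2, P3} \<subseteq> D"
    and P: "(P0, P1, P2, P3) \<in> {((x, y), (x + 1, y), (x + 1, y + 1), (x, y + 1)), ((x, y), (x, y + 1), (x + 1, y + 1), (x + 1, y))}"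
    and p: "p = q \<union> {P1} \<or> p = q \<union> {P0, P2, P3}"
  defines "p1 \<equiv> togl p {P2, P3}"
  defines "p2 \<equiv> togl p1 {P1, P2}"
  shows "\<bar>tw4 p (mv p {P0, P3}) - tw4 p (mv p {P2, P3}) - tw4 p1 (mv p1 {P1, P2}) - tw4 p2 (mv p2 {P0, P1})\<bar> = 4"
proof -
  define b0 b1 c0 c1 where "b0 = (x, y)" and "b1 = (x + 1, y)" and "c0 = (x, y + 1)" and "c1 = (x + 1, y + 1)"
  have four: "{P0, P1, P2, P3} = {b0, b1, c0, c1}" using P by (auto simp: b0_def b1_def c0_def c1_def)
  have ne: "b0 \<noteq> b1" "b0 \<noteq> c0" "b0 \<noteq> c1" "b1 \<noteq> c0" "b1 \<noteq> c1" "c0 \<noteq> c1"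
    "b1 \<noteq> b0" "c0 \<noteq> b0" "c1 \<noteq> b0" "c0 \<noteq> b1" "c1 \<noteq> b1" "c1 \<noteq> c0"
    by (simp_all add: b0_def b1_def c0_def c1_def)
  have nb: "north b0 = c0" "north b1 = c1" by (simp_all add: north_def b0_def b1_def c0_def c1_def)
  have bD: "b0 \<in> D" "b1 \<in> D" "c0 \<in> D" "c1 \<in> D" using D unfolding four by auto
  have nq: "b0 \<notin> q" "b1 \<notin> q" "c0 \<notin> q" "c1 \<notin> q" using q(2) unfolding four by auto
  have fin: "finite q" using q finite_D finite_subset by blast
  have k: "ker b0 b0 = 0" "ker b0 c0 = 0" "ker b1 b1 = 0" "ker b1 c1 = 0"
    "ker b0 b1 = 1" "ker b0 c1 = -1" "ker b1 b0 = -1" "ker b1 c0 = 1"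
    by (auto simp: ker_def chi_def b0_def b1_def c0_def c1_def)
  have kb: "ker b0 e + ker b1 e = 0" if "e \<notin> {b0, b1, c0, c1}" for e
    using ker_block[of e x y] that by (simp add: b0_def b1_def c0_def c1_def)
  have Sq: "(\<Sum>e\<in>q. ker b1 e) = - (\<Sum>e\<in>q. ker b0 e)"
  proof -
    have "(\<Sum>e\<in>q. ker b0 e + ker b1 e) = 0"
      by (rule sum.neutral, rule ballI, rule kb) (use nq in auto)
    then show ?thesis by (simp add: sum.distrib)
  qed
  have SD: "(\<Sum>e\<in>D. ker b1 e) = - (\<Sum>e\<in>D. ker b0 e)"
  proof -
    have "(\<Sum>e\<in>D. ker b0 e + ker b1 e) = (\<Sum>e\<in>{b0, b1, c0, c1}. ker b0 e + ker b1 e)"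
      by (rule sum.mono_neutral_right[OF finite_D]) (use bD kb in auto)
    also have "\<dots> = 0" using ne by (simp add: k)
    finally show ?thesis by (simp add: sum.distrib)
  qed
  have pl: "planar_domino {b0, b1}" "planar_domino {c0, c1}" "planar_domino {b0, c0}" "planar_domino {b1, c1}"
    by (auto simp: planar_domino_def b0_def b1_def c0_def c1_def)
  have cD: "can u d" if "planar_domino d" "d \<subseteq> {b0, b1, c0, c1}" "u \<subseteq> D" "d \<subseteq> u \<or> d \<inter> u = {}" for u d
    using that bD by (auto simp: can_def)
  have X: "tw4 u (mv u d) = 0" if "d = {b0, b1} \<or> d = {c0, c1}" "u \<subseteq> D" "d \<subseteq> u \<or> d \<inter> u = {}" for u d
    using that tw4_mv_x[of u x y] tw4_mv_x[of u x "y + 1"] cD[OF pl(1), of u] cD[OF pl(2), of u]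
    by (auto simp: b0_def b1_def c0_def c1_def)
  have Y: "tw4 u (mv u d) = (if d \<subseteq> u then -1 else 1) * ((\<Sum>e\<in>D. ker b e) - 2 * (\<Sum>e\<in>u. ker b e))"
    if "d = {b, north b}" "b = b0 \<or> b = b1" "u \<subseteq> D" "d \<subseteq> u \<or> d \<inter> u = {}" for u d b
    unfolding that(1) by (rule tw4_mv_y, rule cD) (use that pl nb in auto)
  note tg = togl_def
  have sub: "q \<union> S \<subseteq> D" if "S \<subseteq> {b0, b1, c0, c1}" for S using that q bD by auto
  have sumq: "(\<Sum>e\<in>q \<union> S. h e) = (\<Sum>e\<in>q. h e) + (\<Sum>e\<in>S. h e :: int)" if "S \<subseteq> {b0, b1, c0, c1}" for S h
    using that nq fin by (intro sum.union_disjoint) (auto dest: finite_subset)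
  have togq: "togl (q \<union> S) d = q \<union> ((S - d) \<union> (d - S))" if "d \<subseteq> {b0, b1, c0, c1}" for S d
    using that nq by (auto simp: togl_def)
  have insq: "d \<subseteq> q \<union> S \<longleftrightarrow> d \<subseteq> S" "d \<inter> (q \<union> S) = {} \<longleftrightarrow> d \<inter> S = {}" if "d \<subseteq> {b0, b1, c0, c1}" for S d
    using that nq by auto
  define S where "S = (if p = q \<union> {P1} then {P1} else {P0, P2, P3})"
  have pS: "p = q \<union> S" "S = {P1} \<or> S = {P0, P2, P3}" using p by (auto simp: S_def)
  define S1 S2 where "S1 = (S - {P2, P3}) \<union> ({P2, P3} - S)" and "S2 = (S1 - {P1, P2}) \<union> ({P1, P2} - S1)"
  have p1: "p1 = q \<union> S1" unfolding p1_def pS(1) S1_def by (rule togq) (use four in auto)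
  have p2: "p2 = q \<union> S2" unfolding p2_def p1 S2_def by (rule togq) (use four in auto)
  have sS: "S \<subseteq> {b0, b1, c0, c1}" "S1 \<subseteq> {b0, b1, c0, c1}" "S2 \<subseteq> {b0, b1, c0, c1}"
    using pS(2) unfolding four[symmetric] S1_def S2_def by auto
  have X': "tw4 (q \<union> T) (mv (q \<union> T) d) = 0"
    if "d = {b0, b1} \<or> d = {c0, c1}" "T \<subseteq> {b0, b1, c0, c1}" "d \<subseteq> T \<or> d \<inter> T = {}" for T d
  proof -
    have d: "d \<subseteq> {b0, b1, c0, c1}" using that(1) by auto
    show ?thesis by (rule X[OF that(1) sub[OF that(2)]]) (use that(3) insq[OF d, of T] in simp)
  qed
  have Y': "tw4 (q \<union> T) (mv (q \<union> T) d) = (if d \<subseteq> T then -1 else 1) * ((\<Sum>e\<in>D. ker b e) - 2 * ((\<Sum>e\<in>q. ker b e) + (\<Sum>e\<in>T. ker b e)))"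
    if "d = {b, north b}" "b = b0 \<or> b = b1" "T \<subseteq> {b0, b1, c0, c1}" "d \<subseteq> T \<or> d \<inter> T = {}" for T d b
  proof -
    have d: "d \<subseteq> {b0, b1, c0, c1}" using that(1,2) nb by auto
    show ?thesis
      using Y[OF that(1,2) sub[OF that(3)]] that(4) insq[OF d, of T] sumq[OF that(3), of "ker b"] by simp
  qed
  define a s where "a = (\<Sum>e\<in>D. ker b0 e)" and "s = (\<Sum>e\<in>q. ker b0 e)"
  consider "P0 = b0" "P1 = b1" "P2 = c1" "P3 = c0" | "P0 = b0" "P1 = c0" "P2 = c1" "P3 = b1"
    using P by (auto simp: b0_def b1_def c0_def c1_def)
  then show ?thesis
  proof cases
    case 1
    have eq: "{P0, P3} = {b0, north b0}" "{P1, P2} = {b1, north b1}" "{P2, P3} = {c0, c1}" "{P0, P1} = {b0, b1}"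
      using 1 nb by auto
    from pS(2) show ?thesis
    proof
      assume S: "S = {P1}"
      have S1: "S1 = {b1, c0, c1}" and S2: "S2 = {c0}" using S ne 1 unfolding S1_def S2_def by auto
      have "tw4 (q \<union> S) (mv (q \<union> S) {P0, P3}) = a - 2 * (s + 1)"
        by (subst Y'[OF eq(1) _ sS(1)]) (use S 1 ne k in \<open>auto simp: a_def s_def\<close>)
      moreover have "tw4 (q \<union> S) (mv (q \<union> S) {P2, P3}) = 0"
        by (rule X'[OF _ sS(1)]) (use S 1 ne in auto)
      moreover have "tw4 (q \<union> S1) (mv (q \<union> S1) {P1, P2}) = - (- a - 2 * (- s + 1))"
        by (subst Y'[OF eq(2) _ sS(2)]) (use S1 1 ne k Sq SD in \<open>auto simp: a_def s_def\<close>)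
      moreover have "tw4 (q \<union> S2) (mv (q \<union> S2) {P0, P1}) = 0"
        by (rule X'[OF _ sS(3)]) (use S2 1 ne in auto)
      ultimately show ?thesis unfolding p1 p2 pS(1) by simp
    next
      assume S: "S = {P0, P2, P3}"
      have S1: "S1 = {b0}" and S2: "S2 = {b0, b1, c1}" using S ne 1 unfolding S1_def S2_def by auto
      have "tw4 (q \<union> S) (mv (q \<union> S) {P0, P3}) = - (a - 2 * (s - 1))"
        by (subst Y'[OF eq(1) _ sS(1)]) (use S 1 ne k in \<open>auto simp: a_def s_def\<close>)
      moreover have "tw4 (q \<union> S) (mv (q \<union> S) {P2, P3}) = 0"
        by (rule X'[OF _ sS(1)]) (use S 1 ne in auto)
      moreover have "tw4 (q \<union> S1) (mv (q \<union> S1) {P1, P2}) = - a - 2 * (- s - 1)"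
        by (subst Y'[OF eq(2) _ sS(2)]) (use S1 1 ne k Sq SD in \<open>auto simp: a_def s_def\<close>)
      moreover have "tw4 (q \<union> S2) (mv (q \<union> S2) {P0, P1}) = 0"
        by (rule X'[OF _ sS(3)]) (use S2 1 ne in auto)
      ultimately show ?thesis unfolding p1 p2 pS(1) by simp
    qed
  next
    case 2
    have eq: "{P0, P1} = {b0, north b0}" "{P2, P3} = {b1, north b1}" "{P1, P2} = {c0, c1}" "{P0, P3} = {b0, b1}"
      using 2 nb by auto
    from pS(2) show ?thesis
    proof
      assume S: "S = {P1}"
      have S1: "S1 = {b1, c0, c1}" and S2: "S2 = {b1}" using S ne 2 unfolding S1_def S2_def by auto
      have "tw4 (q \<union> S) (mv (q \<union> S) {P0, P3}) = 0"
        by (rule X'[OF _ sS(1)]) (use S 2 ne in auto)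
      moreover have "tw4 (q \<union> S) (mv (q \<union> S) {P2, P3}) = - a - 2 * (- s + 1)"
        by (subst Y'[OF eq(2) _ sS(1)]) (use S 2 ne k Sq SD in \<open>auto simp: a_def s_def\<close>)
      moreover have "tw4 (q \<union> S1) (mv (q \<union> S1) {P1, P2}) = 0"
        by (rule X'[OF _ sS(2)]) (use S1 2 ne in auto)
      moreover have "tw4 (q \<union> S2) (mv (q \<union> S2) {P0, P1}) = a - 2 * (s + 1)"
        by (subst Y'[OF eq(1) _ sS(3)]) (use S2 2 ne k in \<open>auto simp: a_def s_def\<close>)
      ultimately show ?thesis unfolding p1 p2 pS(1) by simp
    next
      assume S: "S = {P0, P2, P3}"
      have S1: "S1 = {b0}" and S2: "S2 = {b0, c0, c1}" using S ne 2 unfolding S1_def S2_def by auto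
      have "tw4 (q \<union> S) (mv (q \<union> S) {P0, P3}) = 0"
        by (rule X'[OF _ sS(1)]) (use S 2 ne in auto)
      moreover have "tw4 (q \<union> S) (mv (q \<union> S) {P2, P3}) = - (- a - 2 * (- s - 1))"
        by (subst Y'[OF eq(2) _ sS(1)]) (use S 2 ne k Sq SD in \<open>auto simp: a_def s_def\<close>)
      moreover have "tw4 (q \<union> S1) (mv (q \<union> S1) {P1, P2}) = 0"
        by (rule X'[OF _ sS(2)]) (use S1 2 ne in auto)
      moreover have "tw4 (q \<union> S2) (mv (q \<union> S2) {P0, P1}) = - (a - 2 * (s - 1))"
        by (subst Y'[OF eq(1) _ sS(3)]) (use S2 2 ne k in \<open>auto simp: a_def s_def\<close>)
      ultimately show ?thesis unfolding p1 p2 pS(1) by simp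
    qed
  qed
qed

end

context snake_board begin

lemma tw4_walk:
  assumes "state A" "i \<in> A" "Suc i \<notin> A" "Suc i < n"
  shows "tw4 {} (walk (move_token A i (Suc i))) = tw4 {} (walk A) + tw4 (plug A) (mv (plug A) {pos i, pos (Suc i)})"
  using tw4_eqw[OF walk_step[OF assms]] walk_props[OF assms(1)] by (simp add: tw4_append)

text \<open>The walk to \<open>A'\<close> is equivalent to the walk to \<open>A\<close> followed by
  the three steps that advance the tokens at \<open>i + 2\<close>, \<open>i + 1\<close> and
  \<open>i\<close> in this order.\<close>

lemma tw4_loop:
  assumes A: "token_state n K A i (i + 3)" "i + 1 \<in> A" "i + 2 \<in> A" and e: "snake_edge W n i (i + 3)"
  defines "A' \<equiv> move_token A i (i + 3)"
  defines "p \<equiv> plug A"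
  defines "p1 \<equiv> togl p {pos (i + 2), pos (i + 3)}"
  defines "p2 \<equiv> togl p1 {pos (i + 1), pos (i + 2)}"
  shows "tw4 {} (walk A @ mv p {pos i, pos (i + 3)} @ rev (walk A')) =
    tw4 p (mv p {pos i, pos (i + 3)}) - tw4 p (mv p {pos (i + 2), pos (i + 3)}) -
    tw4 p1 (mv p1 {pos (i + 1), pos (i + 2)}) - tw4 p2 (mv p2 {pos i, pos (i + 1)})"
proof -
  have st: "state A" "i \<in> A" "i + 3 \<notin> A" "i + 3 < n" using A e by (auto simp: token_state_def snake_edge_def)
  define A1 where "A1 = move_token A (i + 2) (i + 3)"
  define A2 where "A2 = move_token A1 (i + 1) (i + 2)"
  have e23: "snake_edge W n (i + 2) (i + 3)" "snake_edge W n (i + 1) (i + 2)" "snake_edge W n i (i + 1)"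
    using st by (auto simp: snake_edge_def)
  have s1: "state A1" unfolding A1_def by (rule state_move) (use st A in auto)
  have s2: "state A2" unfolding A2_def by (rule state_move) (use st A s1 in \<open>auto simp: A1_def move_token_def\<close>)
  have m1: "i + 1 \<in> A1" "i + 2 \<notin> A1" and m2: "i \<in> A2" "i + 1 \<notin> A2"
    using st A by (auto simp: A1_def A2_def move_token_def)
  have A': "A' = move_token A2 i (i + 1)" using st A by (auto simp: A'_def A1_def A2_def move_token_def)
  have sA': "state A'" unfolding A'_def by (rule state_move) (use st in auto)
  have P1: "plug A1 = p1" unfolding p1_def p_def A1_def using can_plug(2)[OF _ A(3) st(3) e23(1)] st(1) by simp
  have P2: "plug A2 = p2" unfolding p2_def P1[symmetric] A2_def using can_plug(2)[OF _ m1 e23(2)] s1 by simp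
  have c: "can p {pos i, pos (i + 3)}" "togl p {pos i, pos (i + 3)} = plug A'"
    unfolding p_def A'_def using can_plug[OF _ st(2,3) e] st(1) by auto
  have w1: "tw4 {} (walk A1) = tw4 {} (walk A) + tw4 p (mv p {pos (i + 2), pos (i + 3)})"
    using tw4_walk[of A "i + 2"] st A by (simp add: A1_def p_def numeral_3_eq_3)
  have w2: "tw4 {} (walk A2) = tw4 {} (walk A1) + tw4 p1 (mv p1 {pos (i + 1), pos (i + 2)})"
    using tw4_walk[OF s1, of "i + 1"] m1 st unfolding P1 by (simp add: A2_def)
  have w3: "tw4 {} (walk A') = tw4 {} (walk A2) + tw4 p2 (mv p2 {pos i, pos (i + 1)})"
    using tw4_walk[OF s2, of i] m2 st unfolding P2 by (simp add: A')
  have r: "tw4 (plug A') (rev (walk A')) = - tw4 {} (walk A')"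
    using tw4_rev[of "{}" "walk A'"] walk_props[OF sA'] by simp
  have "tw4 {} (walk A @ mv p {pos i, pos (i + 3)} @ rev (walk A')) =
    tw4 {} (walk A) + tw4 p (mv p {pos i, pos (i + 3)}) - tw4 {} (walk A')"
    using walk_props[OF st(1)] mv_legit(2)[OF c(1)] c(2) r by (simp add: tw4_append p_def)
  then show ?thesis using w1 w2 w3 by simp
qed

lemma tw4_loop_face:
  assumes A: "token_state n K A i (i + 3)" "i + 1 \<in> A" "i + 2 \<in> A" and e: "snake_edge W n i (i + 3)"
    and P: "(pos i, pos (i + 1), pos (i + 2), pos (i + 3)) \<in> {((x, y), (x + 1, y), (x + 1, y + 1), (x, y + 1)), ((x, y), (x, y + 1), (x + 1, y + 1), (x + 1, y))}"
  shows "\<bar>tw4 {} (walk A @ mv (plug A) {pos i, pos (i + 3)} @ rev (walk (move_token A i (i + 3))))\<bar> = 4"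
proof -
  have st: "state A" "i \<in> A" "i + 3 \<notin> A" "i + 3 < n" using A e by (auto simp: token_state_def snake_edge_def)
  define q where "q = plug A - {pos i, pos (i + 1), pos (i + 2), pos (i + 3)}"
  have inp: "pos k \<in> plug A \<longleftrightarrow> k \<in> flip_even n A" if "k < n" for k
    unfolding plug_def using inj_on_image_mem_iff[OF inj_pos, of k] flip_even_subset[of A] that st(1) by auto
  have "plug A = q \<union> {pos (i + 1)} \<or> plug A = q \<union> {pos i, pos (i + 2), pos (i + 3)}"
  \<comment> \<open>On even positions the plug is the complement of the tokens, so the parity of
    \<open>i\<close> selects the alternative.\<close>
  proof (cases "even i")
    case True
    then have "pos i \<notin> plug A" "pos (i + 1) \<in> plug A" "pos (i + 2) \<notin> plug A" "pos (i + 3) \<notin> plug A"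
      using inp[of i] inp[of "i + 1"] inp[of "i + 2"] inp[of "i + 3"] st A by (auto simp: flip_even_def even_below_def)
    then show ?thesis by (auto simp: q_def)
  next
    case False
    then have "pos i \<in> plug A" "pos (i + 1) \<notin> plug A" "pos (i + 2) \<in> plug A" "pos (i + 3) \<in> plug A"
      using inp[of i] inp[of "i + 1"] inp[of "i + 2"] inp[of "i + 3"] st A by (auto simp: flip_even_def even_below_def)
    then show ?thesis by (auto simp: q_def)
  qed
  from face_twist[OF _ _ _ P this] plug_subset pos_D st show ?thesis
    unfolding tw4_loop[OF A e] by (auto simp: q_def)
qed

end

section \<open>Unions of unit cubes\<close>

definition cubes :: "(int^3) set \<Rightarrow> (real^3) set" where
  "cubes S = (\<Union>p\<in>S. unit_cube p)"

definition cell_tiling :: "(int^3) set \<Rightarrow> (int^3) set set \<Rightarrow> bool" where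
  "cell_tiling S m \<longleftrightarrow> (\<forall>e\<in>m. \<exists>p i. e = {p, p + axis i 1}) \<and> disjoint m \<and> \<Union>m = S"

definition flat_cells :: "int^3 \<Rightarrow> 3 \<Rightarrow> (int^3) set" where
  "flat_cells p i = {q. q $ i = p $ i \<and> (\<forall>j. j \<noteq> i \<longrightarrow> q $ j = p $ j \<or> q $ j = p $ j + 1)}"

definition cell_flip :: "(int^3) set set \<Rightarrow> (int^3) set set \<Rightarrow> bool" where
  "cell_flip m m' \<longleftrightarrow> (\<exists>p i f0 f1. cell_tiling (flat_cells p i) f0 \<and> cell_tiling (flat_cells p i) f1 \<and>
     f0 \<noteq> f1 \<and> f0 \<subseteq> m \<and> m' = (m - f0) \<union> f1)"

lemma mem_unit_cube:
  "x \<in> unit_cube p \<longleftrightarrow> (\<forall>i. real_of_int (p $ i) \<le> x $ i \<and> x $ i \<le> real_of_int (p $ i) + 1)"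
  by (simp add: unit_cube_def corner_def mem_box_cart)

lemma interior_unit_cube:
  "x \<in> interior (unit_cube p) \<longleftrightarrow> (\<forall>i. real_of_int (p $ i) < x $ i \<and> x $ i < real_of_int (p $ i) + 1)"
  by (simp add: unit_cube_def corner_def mem_box_cart interior_cbox)

lemma center_nth: "cube_center p $ i = real_of_int (p $ i) + 1/2"
  by (simp add: cube_center_def corner_def)

lemma center_in_unit_cube: "cube_center p \<in> unit_cube q \<longleftrightarrow> p = q"
proof
  assume c: "cube_center p \<in> unit_cube q"
  show "p = q"
  proof (subst vec_eq_iff, rule allI)
    fix i
    have "real_of_int (q $ i) \<le> real_of_int (p $ i) + 1/2" "real_of_int (p $ i) + 1/2 \<le> real_of_int (q $ i) + 1"
      using c by (auto simp: mem_unit_cube center_nth)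
    then show "p $ i = q $ i" by linarith
  qed
qed (simp add: mem_unit_cube center_nth)

lemma center_interior: "cube_center p \<in> interior (unit_cube p)"
  by (simp add: interior_unit_cube center_nth)

lemma center_in_cubes: "cube_center p \<in> cubes S \<longleftrightarrow> p \<in> S"
  by (auto simp: cubes_def center_in_unit_cube)

lemma cubes_eq_iff: "cubes S = cubes T \<longleftrightarrow> S = T"
  by (metis center_in_cubes subsetI subset_antisym)

lemma inj_cubes: "inj cubes"
  by (simp add: inj_def cubes_eq_iff)

lemma cubes_Union: "cubes (\<Union>m) = \<Union>(cubes ` m)"
  by (auto simp: cubes_def)

lemma interior_Union_empty:
  assumes "finite F" "\<And>A. A \<in> F \<Longrightarrow> closed A \<and> interior A = {}"
  shows "interior (\<Union>F) = ({} :: ('a::topological_space) set)"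
  using assms
proof (induction rule: finite_induct)
  case (insert A F)
  then have "interior (A \<union> \<Union>F) = interior A" by (intro interior_closed_Un_empty_interior) auto
  then show ?case using insert by simp
qed simp

text \<open>Distinct unit cubes meet in closed sets with empty interior, and so does a finite union
  of such intersections; conversely, a common cube puts its center into both interiors.\<close>

lemma interior_cubes_disjoint:
  assumes "finite S" "finite T"
  shows "interior (cubes S) \<inter> interior (cubes T) = {} \<longleftrightarrow> S \<inter> T = {}"
proof
  assume i: "interior (cubes S) \<inter> interior (cubes T) = {}"
  show "S \<inter> T = {}"
  proof (rule ccontr)
    assume "S \<inter> T \<noteq> {}"
    then obtain p where p: "p \<in> S" "p \<in> T" by blast
    have "cube_center p \<in> interior (cubes S)"
      using center_interior interior_mono[of "unit_cube p" "cubes S"] p by (auto simp: cubes_def)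
    moreover have "cube_center p \<in> interior (cubes T)"
      using center_interior interior_mono[of "unit_cube p" "cubes T"] p by (auto simp: cubes_def)
    ultimately show False using i by blast
  qed
next
  assume d: "S \<inter> T = {}"
  define F where "F = (\<lambda>(p, q). unit_cube p \<inter> unit_cube q) ` (S \<times> T)"
  have "interior (\<Union>F) = {}"
  proof (rule interior_Union_empty)
    show "finite F" using assms by (simp add: F_def)
    fix A assume "A \<in> F"
    then obtain p q where pq: "p \<in> S" "q \<in> T" "A = unit_cube p \<inter> unit_cube q" by (auto simp: F_def)
    then have "p \<noteq> q" using d by blast
    then obtain i where i: "p $ i \<noteq> q $ i" by (auto simp: vec_eq_iff)
    have "interior A = interior (unit_cube p) \<inter> interior (unit_cube q)" by (simp add: pq)
    moreover have "\<not> (x \<in> interior (unit_cube p) \<and> x \<in> interior (unit_cube q))" for x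
    proof
      assume "x \<in> interior (unit_cube p) \<and> x \<in> interior (unit_cube q)"
      then have "real_of_int (p $ i) < x $ i" "x $ i < real_of_int (p $ i) + 1"
        "real_of_int (q $ i) < x $ i" "x $ i < real_of_int (q $ i) + 1" by (auto simp: interior_unit_cube)
      then show False using i by linarith
    qed
    ultimately have "interior A = {}" by blast
    moreover have "closed A" unfolding pq unit_cube_def by (intro closed_Int closed_cbox)
    ultimately show "closed A \<and> interior A = {}" by simp
  qed
  moreover have "cubes S \<inter> cubes T = \<Union>F" by (auto simp: cubes_def F_def)
  ultimately show "interior (cubes S) \<inter> interior (cubes T) = {}" by (metis interior_Int)
qed

lemma domino_iff: "domino d \<longleftrightarrow> (\<exists>p i. d = cubes {p, p + axis i 1})"
  by (auto simp: domino_def cubes_def)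

text \<open>Centers detect which cubes belong to a union, so \<open>cubes\<close> is injective and
  tilings of regions in space become partitions of sets of cells into neighboring pairs.\<close>

lemma tilings_cubes:
  "t \<in> tilings (cubes S) \<longleftrightarrow> (\<exists>m. cell_tiling S m \<and> t = cubes ` m)"
proof
  assume t: "t \<in> tilings (cubes S)"
  define m where "m = {e. (\<exists>p i. e = {p, p + axis i 1}) \<and> cubes e \<in> t}"
  have tm: "t = cubes ` m"
  proof
    show "t \<subseteq> cubes ` m"
    proof
      fix d assume d: "d \<in> t"
      then have "domino d" using t by (simp add: tilings_def)
      then obtain p i where "d = cubes {p, p + axis i 1}" unfolding domino_iff by blast
      then show "d \<in> cubes ` m" using d unfolding m_def by blast
    qed
    show "cubes ` m \<subseteq> t" by (auto simp: m_def)
  qed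
  have "disjnt a b" if ab: "a \<in> m" "b \<in> m" "a \<noteq> b" for a b
  proof -
    have "cubes a \<noteq> cubes b" using ab cubes_eq_iff by simp
    then have "interior (cubes a) \<inter> interior (cubes b) = {}"
      using t ab by (simp add: m_def tilings_def pairwise_def)
    moreover have "finite a" "finite b" using ab by (auto simp: m_def)
    ultimately show ?thesis using interior_cubes_disjoint by (simp add: disjnt_def)
  qed
  then have "disjoint m" by (simp add: pairwise_def)
  moreover have "\<Union>m = S"
  proof -
    have "cubes (\<Union>m) = cubes S" unfolding cubes_Union tm[symmetric] using t by (simp add: tilings_def)
    then show ?thesis by (simp add: cubes_eq_iff)
  qed
  moreover have "\<forall>e\<in>m. \<exists>p i. e = {p, p + axis i 1}" by (simp add: m_def)
  ultimately have "cell_tiling S m" by (simp add: cell_tiling_def)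
  then show "\<exists>m. cell_tiling S m \<and> t = cubes ` m" using tm by blast
next
  assume "\<exists>m. cell_tiling S m \<and> t = cubes ` m"
  then obtain m where m: "cell_tiling S m" "t = cubes ` m" by blast
  have *: "interior (cubes a) \<inter> interior (cubes b) = {}" if ab: "a \<in> m" "b \<in> m" "cubes a \<noteq> cubes b" for a b
  proof -
    have "a \<noteq> b" using ab by auto
    then have "a \<inter> b = {}" using m ab by (auto simp: cell_tiling_def pairwise_def disjnt_def)
    moreover have "finite a" "finite b" using m ab by (auto simp: cell_tiling_def)
    ultimately show ?thesis using interior_cubes_disjoint by simp
  qed
  have "\<Union>m = S" using m(1) by (simp add: cell_tiling_def)
  then have "\<Union>t = cubes S" unfolding m(2) cubes_Union[symmetric] by simp
  moreover have "domino d" if dt: "d \<in> t" for d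
  proof -
    obtain e where e: "e \<in> m" "d = cubes e" using dt m(2) by blast
    then obtain p i where "e = {p, p + axis i 1}" using m(1) unfolding cell_tiling_def by blast
    then show ?thesis unfolding domino_iff e(2) by blast
  qed
  moreover have "pairwise (\<lambda>d e. interior d \<inter> interior e = {}) t"
    unfolding m(2)
  proof (rule pairwiseI)
    fix d e assume "d \<in> cubes ` m" "e \<in> cubes ` m" "d \<noteq> e"
    then show "interior d \<inter> interior e = {}" using * by (elim imageE) simp
  qed
  ultimately show "t \<in> tilings (cubes S)" by (simp add: tilings_def)
qed

lemma flat_box_iff: "flat_box B \<longleftrightarrow> (\<exists>p i. B = cubes (flat_cells p i))"
proof -
  have "cbox (corner p) (corner p + (\<chi> j. if j = i then 1 else 2)) = cubes (flat_cells p i)" for p i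
  proof (rule Set.set_eqI)
    fix x
    show "x \<in> cbox (corner p) (corner p + (\<chi> j. if j = i then 1 else 2)) \<longleftrightarrow> x \<in> cubes (flat_cells p i)"
    proof
      assume "x \<in> cbox (corner p) (corner p + (\<chi> j. if j = i then 1 else 2))"
      then have x: "real_of_int (p $ j) \<le> x $ j" "x $ j \<le> real_of_int (p $ j) + (if j = i then 1 else 2)" for j
        by (auto simp: mem_box_cart corner_def)
      define q where "q = (\<chi> j. if x $ j \<le> real_of_int (p $ j) + 1 then p $ j else p $ j + 1)"
      have "q \<in> flat_cells p i" using x(2)[of i] by (auto simp: flat_cells_def q_def)
      moreover have "x \<in> unit_cube q"
        unfolding mem_unit_cube
      proof
        fix j
        show "real_of_int (q $ j) \<le> x $ j \<and> x $ j \<le> real_of_int (q $ j) + 1"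
          using x[of j] by (auto simp: q_def split: if_splits)
      qed
      ultimately show "x \<in> cubes (flat_cells p i)" by (auto simp: cubes_def)
    next
      assume "x \<in> cubes (flat_cells p i)"
      then obtain q where q: "q \<in> flat_cells p i" "x \<in> unit_cube q" by (auto simp: cubes_def)
      have "real_of_int (p $ j) \<le> x $ j \<and> x $ j \<le> real_of_int (p $ j) + (if j = i then 1 else 2)" for j
      proof -
        have "real_of_int (q $ j) \<le> x $ j" "x $ j \<le> real_of_int (q $ j) + 1" using q by (auto simp: mem_unit_cube)
        moreover have "q $ j = p $ j \<or> (j \<noteq> i \<and> q $ j = p $ j + 1)" using q by (auto simp: flat_cells_def)
        ultimately show ?thesis by auto
      qed
      then show "x \<in> cbox (corner p) (corner p + (\<chi> j. if j = i then 1 else 2))"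
        by (auto simp: mem_box_cart corner_def)
    qed
  qed
  then show ?thesis by (simp add: flat_box_def)
qed

lemma cubes_image_diff: "cubes ` (m - f0 \<union> f1) = cubes ` m - cubes ` f0 \<union> cubes ` f1"
  by (simp add: image_Un image_set_diff[OF inj_cubes])

lemma flip_step_cubes: "flip_step (cubes ` m) t \<longleftrightarrow> (\<exists>m'. t = cubes ` m' \<and> cell_flip m m')"
proof
  assume "flip_step (cubes ` m) t"
  then obtain p i f0 f1 where f: "f0 \<in> tilings (cubes (flat_cells p i))" "f1 \<in> tilings (cubes (flat_cells p i))"
    "f0 \<noteq> f1" "f0 \<subseteq> cubes ` m" "t = (cubes ` m - f0) \<union> f1"
    unfolding flip_step_def flat_box_iff by blast
  obtain g0 g1 where g: "cell_tiling (flat_cells p i) g0" "f0 = cubes ` g0" "cell_tiling (flat_cells p i) g1" "f1 = cubes ` g1"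
    using f(1,2) unfolding tilings_cubes by blast
  have "g0 \<subseteq> m" using f(4) unfolding g by (simp add: inj_image_subset_iff[OF inj_cubes])
  moreover have "g0 \<noteq> g1" using f(3) g by auto
  ultimately have "cell_flip m (m - g0 \<union> g1)" unfolding cell_flip_def using g by blast
  moreover have "t = cubes ` (m - g0 \<union> g1)" using f(5) unfolding g cubes_image_diff .
  ultimately show "\<exists>m'. t = cubes ` m' \<and> cell_flip m m'" by blast
next
  assume "\<exists>m'. t = cubes ` m' \<and> cell_flip m m'"
  then obtain p i f0 f1 where f: "cell_tiling (flat_cells p i) f0" "cell_tiling (flat_cells p i) f1"
     "f0 \<noteq> f1" "f0 \<subseteq> m" "t = cubes ` (m - f0 \<union> f1)"
    unfolding cell_flip_def by blast
  have 1: "flat_box (cubes (flat_cells p i))" unfolding flat_box_iff by blast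
  have 2: "cubes ` f0 \<in> tilings (cubes (flat_cells p i))" "cubes ` f1 \<in> tilings (cubes (flat_cells p i))"
    unfolding tilings_cubes using f(1,2) by blast+
  have 3: "cubes ` f0 \<noteq> cubes ` f1" using f(3) by (simp add: inj_image_eq_iff[OF inj_cubes])
  have 4: "cubes ` f0 \<subseteq> cubes ` m" using f(4) by blast
  show "flip_step (cubes ` m) t"
    unfolding flip_step_def
    by (rule exI[of _ "cubes (flat_cells p i)"], rule exI[of _ "cubes ` f0"], rule exI[of _ "cubes ` f1"])
      (simp only: 1 2 3 4 f(5)[unfolded cubes_image_diff] simp_thms)
qed

lemma cell_tiling_Un:
  assumes "cell_tiling A m" "cell_tiling B m'" "A \<inter> B = {}"
  shows "cell_tiling (A \<union> B) (m \<union> m')"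
proof -
  have "disjnt a b" if "a \<in> m" "b \<in> m'" for a b
    using assms that unfolding cell_tiling_def disjnt_def by blast
  then have "disjoint (m \<union> m')" using assms(1,2) unfolding cell_tiling_def pairwise_def
    by (auto simp: disjnt_sym)
  then show ?thesis using assms(1,2) by (auto simp: cell_tiling_def)
qed

lemma cell_tiling_empty [simp]: "cell_tiling {} {}"
  by (simp add: cell_tiling_def)

lemma cell_tiling_nonempty: "cell_tiling S m \<Longrightarrow> e \<in> m \<Longrightarrow> e \<noteq> {}"
  by (auto simp: cell_tiling_def)

text \<open>A further domino would contain a cell that the smaller tiling already covers. Equality
  of tilings can thus be proved by a single inclusion.\<close>

lemma cell_tiling_subset_eq:
  assumes "cell_tiling S m" "cell_tiling S m'" "m \<subseteq> m'"
  shows "m = m'"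
proof (rule equalityI[OF assms(3)], rule subsetI)
  fix e assume e: "e \<in> m'"
  then obtain x where x: "x \<in> e" using cell_tiling_nonempty[OF assms(2)] by blast
  then have "x \<in> S" using assms(2) e by (auto simp: cell_tiling_def)
  then obtain a where a: "a \<in> m" "x \<in> a" using assms(1) by (auto simp: cell_tiling_def)
  have "a \<in> m'" using a(1) assms(3) by blast
  then have "a = e" using assms(2) e x a(2) unfolding cell_tiling_def pairwise_def disjnt_def by blast
  then show "e \<in> m" using a by simp
qed

lemma cell_flip_tiling:
  assumes m: "cell_tiling S m" and f: "cell_tiling B f0" "cell_tiling B f1" "f0 \<subseteq> m"
  shows "cell_tiling S (m - f0 \<union> f1)" "f1 \<inter> (m - f0) = {}"
proof -
  have B: "\<Union>f0 = B" "\<Union>f1 = B" and mS: "\<Union>m = S" and dm: "disjoint m"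
    using f(1,2) m by (simp_all add: cell_tiling_def)
  have d: "B \<inter> \<Union>(m - f0) = {}"
  proof (rule ccontr)
    assume "B \<inter> \<Union>(m - f0) \<noteq> {}"
    then obtain x b where b: "x \<in> B" "x \<in> b" "b \<in> m - f0" by blast
    then obtain a where a: "x \<in> a" "a \<in> f0" using B by blast
    have "a \<in> m" "b \<in> m" "a \<noteq> b" using a b f(3) by auto
    then have "disjnt a b" using dm by (simp add: pairwiseD)
    then show False using a b by (auto simp: disjnt_def)
  qed
  have "m = (m - f0) \<union> f0" using f(3) by blast
  then have S: "\<Union>(m - f0) \<union> B = S" using B(1) mS by (metis Union_Un_distrib)
  have "cell_tiling (\<Union>(m - f0)) (m - f0)"
    using m by (auto simp: cell_tiling_def intro: pairwise_subset)
  from cell_tiling_Un[OF this f(2)] d S show "cell_tiling S (m - f0 \<union> f1)" by (simp add: Int_commute)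
  show "f1 \<inter> (m - f0) = {}"
  proof (rule ccontr)
    assume "f1 \<inter> (m - f0) \<noteq> {}"
    then obtain e where e: "e \<in> f1" "e \<in> m - f0" by blast
    then obtain x where "x \<in> e" using cell_tiling_nonempty[OF f(2)] by blast
    then have "x \<in> B" "x \<in> \<Union>(m - f0)" using e B(2) by blast+
    then show False using d by blast
  qed
qed

lemma cell_flip_sym:
  assumes m: "cell_tiling S m" and f: "cell_flip m m'"
  shows "cell_tiling S m'" "cell_flip m' m"
proof -
  obtain p i f0 f1 where g: "cell_tiling (flat_cells p i) f0" "cell_tiling (flat_cells p i) f1"
     "f0 \<noteq> f1" "f0 \<subseteq> m" "m' = m - f0 \<union> f1" using f unfolding cell_flip_def by blast
  note c = cell_flip_tiling[OF m g(1,2,4)]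
  show "cell_tiling S m'" using c(1) g by simp
  have "m = (m' - f1) \<union> f0" using c(2) g(4,5) by blast
  then show "cell_flip m' m" unfolding cell_flip_def using g by blast
qed

lemma cell_flips_sym:
  assumes "cell_tiling S m" "cell_flip\<^sup>*\<^sup>* m m'"
  shows "cell_tiling S m' \<and> cell_flip\<^sup>*\<^sup>* m' m"
  using assms(2)
proof (induction rule: rtranclp_induct)
  case base
  then show ?case using assms(1) by simp
next
  case (step a b)
  have "cell_tiling S b" "cell_flip b a" using cell_flip_sym[of S a b] step by auto
  moreover have "cell_flip\<^sup>*\<^sup>* a m" using step by blast
  ultimately show ?case using converse_rtranclp_into_rtranclp[of cell_flip b a m] by simp
qed

lemma flat_cells_eq:
  assumes "j \<noteq> i" "k \<noteq> i" "j \<noteq> k"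
  shows "flat_cells p i = {p, p + axis j 1, p + axis k 1, p + axis j 1 + axis k 1}"
proof (rule Set.set_eqI)
  fix q
  have ex: "l = i \<or> l = j \<or> l = k" for l
    using assms exhaust_3[of l] exhaust_3[of i] exhaust_3[of j] exhaust_3[of k] by auto
  have all: "(\<forall>l. P l) \<longleftrightarrow> P i \<and> P j \<and> P k" for P using ex by metis
  show "q \<in> flat_cells p i \<longleftrightarrow> q \<in> {p, p + axis j 1, p + axis k 1, p + axis j 1 + axis k 1}"
    using assms by (simp add: flat_cells_def vec_eq_iff all axis_def) auto
qed

text \<open>The domino at the corner \<open>p\<close> has two possible directions, and the opposite
  pair of cells is then forced.\<close>

lemma cell_tiling_flat:
  assumes "j \<noteq> i" "k \<noteq> i" "j \<noteq> k"
  shows "cell_tiling (flat_cells p i) f \<longleftrightarrow>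
    f = {{p, p + axis j 1}, {p + axis k 1, p + axis j 1 + axis k 1}} \<or>
    f = {{p, p + axis k 1}, {p + axis j 1, p + axis j 1 + axis k 1}}"
proof -
  let ?a = "p + axis j 1" and ?b = "p + axis k 1" and ?c = "p + axis j 1 + axis k 1"
  have ex: "l = i \<or> l = j \<or> l = k" for l
    using assms exhaust_3[of l] exhaust_3[of i] exhaust_3[of j] exhaust_3[of k] by auto
  have all: "(\<forall>l. P l) \<longleftrightarrow> P i \<and> P j \<and> P k" for P using ex by metis
  have B: "flat_cells p i = {p, ?a, ?b, ?c}" by (rule flat_cells_eq[OF assms])
  have ne: "p \<noteq> ?a" "p \<noteq> ?b" "p \<noteq> ?c" "?a \<noteq> ?b" "?a \<noteq> ?c" "?b \<noteq> ?c"
    using assms by (simp_all add: vec_eq_iff all axis_def)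
  have sw: "?c = ?b + axis j 1" by (simp add: algebra_simps)
  have t1: "cell_tiling (flat_cells p i) {{p, ?a}, {?b, ?c}}"
    unfolding cell_tiling_def B
  proof (intro conjI ballI)
    fix e assume "e \<in> {{p, ?a}, {?b, ?c}}"
    then consider "e = {p, ?a}" | "e = {?b, ?c}" by blast
    then show "\<exists>q l. e = {q, q + axis l 1}"
    proof cases
      case 1 show ?thesis by (rule exI[of _ p], rule exI[of _ j]) (rule 1)
    next
      case 2 show ?thesis by (rule exI[of _ ?b], rule exI[of _ j]) (rule 2[unfolded sw])
    qed
  qed (use ne in \<open>auto simp: pairwise_def disjnt_def\<close>)
  have t2: "cell_tiling (flat_cells p i) {{p, ?b}, {?a, ?c}}"
    unfolding cell_tiling_def B
  proof (intro conjI ballI)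
    fix e assume "e \<in> {{p, ?b}, {?a, ?c}}"
    then consider "e = {p, ?b}" | "e = {?a, ?c}" by blast
    then show "\<exists>q l. e = {q, q + axis l 1}"
    proof cases
      case 1 show ?thesis by (rule exI[of _ p], rule exI[of _ k]) (rule 1)
    next
      case 2 show ?thesis by (rule exI[of _ ?a], rule exI[of _ k]) (rule 2)
    qed
  qed (use ne in \<open>auto simp: pairwise_def disjnt_def\<close>)
  have edges: "e \<in> {{p, ?a}, {?b, ?c}, {p, ?b}, {?a, ?c}}"
    if f: "cell_tiling (flat_cells p i) f" and e: "e \<in> f" for e
  proof -
    obtain q l where ql: "e = {q, q + axis l 1}" using f e by (auto simp: cell_tiling_def)
    have mem: "q \<in> flat_cells p i" "q + axis l 1 \<in> flat_cells p i" using f e ql by (auto simp: cell_tiling_def)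
    then have "l \<noteq> i" by (auto simp: flat_cells_def axis_def)
    moreover have "q $ l = p $ l"
      using mem \<open>l \<noteq> i\<close> by (auto simp: flat_cells_def axis_def split: if_splits)
    moreover have "q \<in> {p, ?a, ?b, ?c}" using mem B by simp
    ultimately consider "l = j" "q = p" | "l = j" "q = ?b" | "l = k" "q = p" | "l = k" "q = ?a"
      using ex[of l] assms by (auto simp: axis_def)
    then show ?thesis by cases (simp_all only: ql sw insert_iff simp_thms)
  qed
  show ?thesis
  proof
    assume f: "cell_tiling (flat_cells p i) f"
    have cov: "\<exists>e\<in>f. x \<in> e" if "x \<in> {p, ?a, ?b, ?c}" for x
    proof -
      have "\<Union>f = {p, ?a, ?b, ?c}" using f B by (simp add: cell_tiling_def)
      then have "x \<in> \<Union>f" using that by (simp only:)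
      then show ?thesis by (simp only: Union_iff)
    qed
    obtain e where e: "e \<in> f" "p \<in> e" using cov[of p] by auto
    have "e = {p, ?a} \<or> e = {p, ?b}" using edges[OF f e(1)] e(2) ne by auto
    then show "f = {{p, ?a}, {?b, ?c}} \<or> f = {{p, ?b}, {?a, ?c}}"
    proof
      assume ea: "e = {p, ?a}"
      obtain g where g: "g \<in> f" "?b \<in> g" using cov[of ?b] by auto
      have "g \<noteq> e" using g ea ne by auto
      then have "g \<inter> e = {}" using f e g by (auto simp: cell_tiling_def pairwise_def disjnt_def)
      then have "g = {?b, ?c}" using edges[OF f g(1)] g(2) ne ea by auto
      then have "{{p, ?a}, {?b, ?c}} \<subseteq> f" using e g ea by auto
      then show ?thesis using cell_tiling_subset_eq[OF t1 f] by auto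
    next
      assume ea: "e = {p, ?b}"
      obtain g where g: "g \<in> f" "?a \<in> g" using cov[of ?a] by auto
      have "g \<noteq> e" using g ea ne by auto
      then have "g \<inter> e = {}" using f e g by (auto simp: cell_tiling_def pairwise_def disjnt_def)
      then have "g = {?a, ?c}" using edges[OF f g(1)] g(2) ne ea by auto
      then have "{{p, ?b}, {?a, ?c}} \<subseteq> f" using e g ea by auto
      then show ?thesis using cell_tiling_subset_eq[OF t2 f] by auto
    qed
  qed (use t1 t2 in auto)
qed

text \<open>A directed normal form: \<open>j\<close> is the direction of the removed dominoes,
  \<open>k\<close> that of the inserted ones.\<close>

lemma cell_flip_iff:
  "cell_flip m m' \<longleftrightarrow> (\<exists>p j k. j \<noteq> k \<and> {{p, p + axis j 1}, {p + axis k 1, p + axis j 1 + axis k 1}} \<subseteq> m \<and>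
     m' = m - {{p, p + axis j 1}, {p + axis k 1, p + axis j 1 + axis k 1}} \<union>
        {{p, p + axis k 1}, {p + axis j 1, p + axis j 1 + axis k 1}})"
proof
  assume "cell_flip m m'"
  then obtain p i f0 f1 where f: "cell_tiling (flat_cells p i) f0" "cell_tiling (flat_cells p i) f1"
     "f0 \<noteq> f1" "f0 \<subseteq> m" "m' = m - f0 \<union> f1" unfolding cell_flip_def by blast
  obtain j k where jk: "j \<noteq> i" "k \<noteq> i" "j \<noteq> k"
  proof -
    have "(1::3) \<noteq> 2" "(1::3) \<noteq> 3" "(2::3) \<noteq> 3" by simp_all
    then show ?thesis using exhaust_3[of i] that by metis
  qed
  have sw: "p + axis k 1 + axis j 1 = p + axis j 1 + axis k 1" by (simp add: algebra_simps)
  from f(1-3) show "\<exists>p j k. j \<noteq> k \<and> {{p, p + axis j 1}, {p + axis k 1, p + axis j 1 + axis k 1}} \<subseteq> m \<and>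
     m' = m - {{p, p + axis j 1}, {p + axis k 1, p + axis j 1 + axis k 1}} \<union>
        {{p, p + axis k 1}, {p + axis j 1, p + axis j 1 + axis k 1}}"
    unfolding cell_tiling_flat[OF jk]
  proof (elim disjE)
    assume "f0 = {{p, p + axis j 1}, {p + axis k 1, p + axis j 1 + axis k 1}}"
      "f1 = {{p, p + axis k 1}, {p + axis j 1, p + axis j 1 + axis k 1}}"
    then show ?thesis using f(4,5) jk by blast
  next
    assume "f1 = {{p, p + axis j 1}, {p + axis k 1, p + axis j 1 + axis k 1}}"
      "f0 = {{p, p + axis k 1}, {p + axis j 1, p + axis j 1 + axis k 1}}"
    then show ?thesis
      using f(4,5) jk by (intro exI[of _ p] exI[of _ k] exI[of _ j]) (simp add: sw)
  qed (use f(3) in auto)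
next
  assume "\<exists>p j k. j \<noteq> k \<and> {{p, p + axis j 1}, {p + axis k 1, p + axis j 1 + axis k 1}} \<subseteq> m \<and>
     m' = m - {{p, p + axis j 1}, {p + axis k 1, p + axis j 1 + axis k 1}} \<union>
        {{p, p + axis k 1}, {p + axis j 1, p + axis j 1 + axis k 1}}"
  then obtain p and j k :: 3 where h: "j \<noteq> k" "{{p, p + axis j 1}, {p + axis k 1, p + axis j 1 + axis k 1}} \<subseteq> m"
     "m' = m - {{p, p + axis j 1}, {p + axis k 1, p + axis j 1 + axis k 1}} \<union>
        {{p, p + axis k 1}, {p + axis j 1, p + axis j 1 + axis k 1}}" by blast
  obtain i where i: "j \<noteq> i" "k \<noteq> i"
  proof -
    have "card {j, k} < CARD(3)" using h(1) by simp
    then have "{j, k} \<noteq> UNIV" by (metis less_irrefl)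
    then obtain i where "i \<notin> {j, k}" by blast
    then show ?thesis using that[of i] by auto
  qed
  have "p \<noteq> p + axis j 1" "p + axis j 1 \<noteq> p + axis k 1" "p + axis j 1 \<noteq> p + axis j 1 + axis k 1"
    using h(1) by (auto simp: vec_eq_iff axis_def)
  moreover have "axis j 1 + axis k 1 \<noteq> (0 :: int^3)"
  proof
    assume "axis j 1 + axis k 1 = (0 :: int^3)"
    from arg_cong[OF this, of "\<lambda>v. v $ j"] show False by (auto simp: axis_def split: if_splits)
  qed
  ultimately have "{{p, p + axis j 1}, {p + axis k 1, p + axis j 1 + axis k 1}} \<noteq> {{p, p + axis k 1}, {p + axis j 1, p + axis j 1 + axis k 1}}"
    by (auto simp: doubleton_eq_iff)
  moreover define f0 f1 where "f0 = {{p, p + axis j 1}, {p + axis k 1, p + axis j 1 + axis k 1}}"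
    and "f1 = {{p, p + axis k 1}, {p + axis j 1, p + axis j 1 + axis k 1}}"
  ultimately have "f0 \<noteq> f1" by simp
  moreover have "cell_tiling (flat_cells p i) f0" "cell_tiling (flat_cells p i) f1"
    unfolding cell_tiling_flat[OF i h(1)] f0_def f1_def by simp_all
  moreover have "f0 \<subseteq> m" "m' = m - f0 \<union> f1" using h(2,3) by (simp_all only: f0_def f1_def)
  ultimately show "cell_flip m m'" unfolding cell_flip_def by blast
qed

section \<open>Floors as sets of cells\<close>

definition cell :: "int \<times> int \<Rightarrow> int \<Rightarrow> int^3" where
  "cell c z = vector [fst c, snd c, z]"

definition lift_domino :: "int \<Rightarrow> (int \<times> int) set \<Rightarrow> (int^3) set" where
  "lift_domino z d = (\<lambda>c. cell c z) ` d"

definition pillar :: "int \<Rightarrow> int \<times> int \<Rightarrow> (int^3) set" where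
  "pillar z c = {cell c z, cell c (z + 1)}"

definition slab :: "int \<Rightarrow> (int \<times> int) set \<Rightarrow> (int^3) set" where
  "slab z A = (\<lambda>c. cell c z) ` A"

definition column_box :: "(int \<times> int) set \<Rightarrow> int \<Rightarrow> nat \<Rightarrow> (int^3) set" where
  "column_box D z N = {cell c h | c h. c \<in> D \<and> z \<le> h \<and> h < z + int N}"

lemma cell_nth [simp]: "cell c z $ 1 = fst c" "cell c z $ 2 = snd c" "cell c z $ 3 = z"
  by (simp_all add: cell_def)

lemma cell_eq_iff [simp]: "cell c z = cell d w \<longleftrightarrow> c = d \<and> z = w"
  by (auto simp: vec_eq_iff forall_3 prod_eq_iff)

lemma cell_surj: obtains c z where "q = cell c z"
proof -
  have "q = cell (q $ 1, q $ 2) (q $ 3)" by (simp add: vec_eq_iff forall_3)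
  then show ?thesis by (rule that)
qed

lemma cell_axis:
  "cell (x, y) z + axis 1 1 = cell (x + 1, y) z"
  "cell (x, y) z + axis 2 1 = cell (x, y + 1) z"
  "cell (x, y) z + axis 3 1 = cell (x, y) (z + 1)"
  by (simp_all add: vec_eq_iff forall_3 axis_def)

lemma cell_set_eqI: "(\<And>c z. cell c z \<in> A \<longleftrightarrow> cell c z \<in> B) \<Longrightarrow> A = B"
  by (metis cell_surj subsetI subset_antisym)

lemma cell_in_slab [simp]: "cell c h \<in> slab z A \<longleftrightarrow> h = z \<and> c \<in> A"
  by (auto simp: slab_def)

lemma cell_in_box [simp]: "cell c h \<in> column_box D z N \<longleftrightarrow> c \<in> D \<and> z \<le> h \<and> h < z + int N"
  unfolding column_box_def by (cases c) auto

lemma cell_in_lift [simp]: "cell c h \<in> lift_domino z d \<longleftrightarrow> h = z \<and> c \<in> d"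
  by (auto simp: lift_domino_def)

lemma cell_in_pillar [simp]: "cell c h \<in> pillar z d \<longleftrightarrow> c = d \<and> (h = z \<or> h = z + 1)"
  by (auto simp: pillar_def)

lemma lift_eq_iff: "d \<noteq> {} \<Longrightarrow> lift_domino z d = lift_domino w e \<longleftrightarrow> z = w \<and> d = e"
proof
  assume d: "d \<noteq> {}" and eq: "lift_domino z d = lift_domino w e"
  obtain c where "c \<in> d" using d by blast
  then have "cell c z \<in> lift_domino w e" unfolding eq[symmetric] by simp
  then have "z = w" by simp
  moreover have "c \<in> d \<longleftrightarrow> c \<in> e" for c
    using arg_cong[OF eq, of "\<lambda>S. cell c z \<in> S"] \<open>z = w\<close> by simp
  ultimately show "z = w \<and> d = e" by blast
qed auto

lemma lift_not_pillar: "lift_domino z d \<noteq> pillar w c"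
proof
  assume eq: "lift_domino z d = pillar w c"
  have "cell c w \<in> lift_domino z d" "cell c (w + 1) \<in> lift_domino z d" unfolding eq by simp_all
  then show False by simp
qed

lemma pillar_eq_iff [simp]: "pillar z c = pillar w d \<longleftrightarrow> z = w \<and> c = d"
proof
  assume eq: "pillar z c = pillar w d"
  have "cell c z \<in> pillar w d" "cell c (z + 1) \<in> pillar w d" unfolding eq[symmetric] by simp_all
  then show "z = w \<and> c = d" by auto
qed simp

lemma planar_lift:
  assumes "planar_domino d" shows "\<exists>p i. lift_domino z d = {p, p + axis i 1}"
proof -
  obtain x y where "d = {(x, y), (x + 1, y)} \<or> d = {(x, y), (x, y + 1)}"
    using assms by (auto simp: planar_domino_def)
  then show ?thesis
  proof
    assume d: "d = {(x, y), (x + 1, y)}"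
    show ?thesis by (rule exI[of _ "cell (x, y) z"], rule exI[of _ 1]) (simp add: d lift_domino_def cell_axis)
  next
    assume d: "d = {(x, y), (x, y + 1)}"
    show ?thesis by (rule exI[of _ "cell (x, y) z"], rule exI[of _ 2]) (simp add: d lift_domino_def cell_axis)
  qed
qed

lemma edge_cases:
  assumes "e = {p, p + axis i 1}"
  obtains z d where "planar_domino d" "e = lift_domino z d" | z c where "e = pillar z c"
proof -
  obtain c z where p: "p = cell c z" by (rule cell_surj)
  obtain x y where c: "c = (x, y)" by (cases c)
  consider "i = 1" | "i = 2" | "i = 3" using exhaust_3 by blast
  then show ?thesis
  proof cases
    case 1
    have "e = lift_domino z {(x, y), (x + 1, y)}" unfolding assms p c 1 cell_axis by (simp add: lift_domino_def)
    moreover have "planar_domino {(x, y), (x + 1, y)}" by (auto simp: planar_domino_def)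
    ultimately show ?thesis using that(1) by blast
  next
    case 2
    have "e = lift_domino z {(x, y), (x, y + 1)}" unfolding assms p c 2 cell_axis by (simp add: lift_domino_def)
    moreover have "planar_domino {(x, y), (x, y + 1)}" by (auto simp: planar_domino_def)
    ultimately show ?thesis using that(1) by blast
  next
    case 3
    have "e = pillar z (x, y)" unfolding assms p c 3 cell_axis by (simp add: pillar_def)
    then show ?thesis using that(2) by blast
  qed
qed

lemma cell_tiling_Diff:
  assumes m: "cell_tiling S m" and f: "cell_tiling B f" "f \<subseteq> m"
  shows "cell_tiling (S - B) (m - f)"
proof -
  have U: "\<Union>f = B" "\<Union>m = S" and dm: "disjoint m" using f m by (simp_all add: cell_tiling_def)
  have "\<Union>(m - f) = S - B"
  proof (rule Set.set_eqI, rule iffI)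
    fix x assume "x \<in> \<Union>(m - f)"
    then obtain b where b: "x \<in> b" "b \<in> m" "b \<notin> f" by blast
    have "x \<notin> B"
    proof
      assume "x \<in> B"
      then obtain a where a: "x \<in> a" "a \<in> f" using U by blast
      then have "a \<in> m" "a \<noteq> b" using f(2) b by auto
      then have "disjnt a b" using dm b by (simp add: pairwiseD)
      then show False using a b by (auto simp: disjnt_def)
    qed
    then show "x \<in> S - B" using b U by blast
  next
    fix x assume "x \<in> S - B"
    then show "x \<in> \<Union>(m - f)" using U by blast
  qed
  moreover have "disjoint (m - f)" using dm by (rule pairwise_subset) blast
  moreover have "\<forall>e\<in>m - f. \<exists>p i. e = {p, p + axis i 1}" using m by (simp add: cell_tiling_def)
  ultimately show ?thesis by (simp add: cell_tiling_def)
qed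

lemma cell_flipI:
  assumes t: "cell_tiling S m" "cell_tiling S m'" and jk: "j \<noteq> k"
    and f: "{p, p + axis j 1} \<in> m" "{p + axis k 1, p + axis j 1 + axis k 1} \<in> m"
    and f': "{p, p + axis k 1} \<in> m'" "{p + axis j 1, p + axis j 1 + axis k 1} \<in> m'"
    and sub: "m - {{p, p + axis j 1}, {p + axis k 1, p + axis j 1 + axis k 1}} \<subseteq> m'"
  shows "cell_flip m m'"
proof -
  define m2 where "m2 = m - {{p, p + axis j 1}, {p + axis k 1, p + axis j 1 + axis k 1}} \<union>
        {{p, p + axis k 1}, {p + axis j 1, p + axis j 1 + axis k 1}}"
  have "cell_flip m m2"
    unfolding cell_flip_iff by (rule exI[of _ p], rule exI[of _ j], rule exI[of _ k]) (use jk f in \<open>simp add: m2_def\<close>)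
  moreover have "m2 \<subseteq> m'" using sub f' by (auto simp: m2_def)
  then have "m2 = m'" using cell_tiling_subset_eq cell_flip_sym(1)[OF t(1) calculation] t(2) by blast
  ultimately show ?thesis by simp
qed

lemma cell_flip_block:
  assumes t: "cell_tiling S m" "cell_tiling S m'"
    and f: "lift_domino z ` hblock x y \<subseteq> m" "lift_domino z ` vblock x y \<subseteq> m'" "m - lift_domino z ` hblock x y \<subseteq> m'"
  shows "cell_flip m m'"
proof -
  have h: "lift_domino z ` hblock x y = {{cell (x, y) z, cell (x, y) z + axis 1 1}, {cell (x, y) z + axis 2 1, cell (x, y) z + axis 1 1 + axis 2 1}}"
    by (simp add: hblock_def cell_axis lift_domino_def)
  have v: "lift_domino z ` vblock x y = {{cell (x, y) z, cell (x, y) z + axis 2 1}, {cell (x, y) z + axis 1 1, cell (x, y) z + axis 1 1 + axis 2 1}}"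
    by (simp add: vblock_def cell_axis lift_domino_def)
  show ?thesis
    by (rule cell_flipI[OF t, of 1 2 "cell (x, y) z"]) (use f in \<open>simp_all add: h v\<close>)
qed

lemma cell_flip_pillars:
  assumes t: "cell_tiling S m" "cell_tiling S m'" and d: "planar_domino d"
    and f: "lift_domino z d \<in> m" "lift_domino (z + 1) d \<in> m" "pillar z ` d \<subseteq> m'"
      "m - {lift_domino z d, lift_domino (z + 1) d} \<subseteq> m'"
  shows "cell_flip m m'"
proof -
  obtain x y where "d = {(x, y), (x + 1, y)} \<or> d = {(x, y), (x, y + 1)}"
    using d by (auto simp: planar_domino_def)
  then show ?thesis
  proof
    assume d: "d = {(x, y), (x + 1, y)}"
    show ?thesis
      by (rule cell_flipI[OF t, of 1 3 "cell (x, y) z"])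
        (use f in \<open>simp_all add: d lift_domino_def pillar_def cell_axis\<close>)
  next
    assume d: "d = {(x, y), (x, y + 1)}"
    show ?thesis
      by (rule cell_flipI[OF t, of 2 3 "cell (x, y) z"])
        (use f in \<open>simp_all add: d lift_domino_def pillar_def cell_axis\<close>)
  qed
qed

lemma cell_flips_connected:
  assumes "cell_flip\<^sup>*\<^sup>* m m'" shows "flip_connected (cubes ` m) (cubes ` m')"
  using assms
proof (induction rule: rtranclp_induct)
  case (step a b)
  then have "flip_step (cubes ` a) (cubes ` b)" unfolding flip_step_cubes by blast
  with step(3) show ?case by (rule rtranclp.rtrancl_into_rtrancl)
qed simp

section \<open>Stacks of layers and their cells\<close>

context board begin

definition layer :: "int \<Rightarrow> (int \<times> int) set \<Rightarrow> (int \<times> int) set set \<Rightarrow> (int^3) set set" where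
  "layer z p f = lift_domino z ` f \<union> pillar z ` next_plug p f"

fun stack :: "int \<Rightarrow> (int \<times> int) set \<Rightarrow> (int \<times> int) set set list \<Rightarrow> (int^3) set set" where
  "stack z p [] = {}"
| "stack z p (f # fs) = layer z p f \<union> stack (z + 1) (next_plug p f) fs"

text \<open>The bottom plug is missing since its cells belong to dominoes from below; in return the
  stack reaches into the level above its last floor, over the final plug.\<close>

definition stack_cells :: "int \<Rightarrow> (int \<times> int) set \<Rightarrow> (int \<times> int) set set list \<Rightarrow> (int^3) set" where
  "stack_cells z p fs = (column_box D z (length fs) \<union> slab (z + int (length fs)) (fin p fs)) - slab z p"

lemma lift_tiling: assumes "floor_ok p f" shows "cell_tiling (slab z (\<Union>f)) (lift_domino z ` f)"
proof -
  have "\<forall>e\<in>lift_domino z ` f. \<exists>p i. e = {p, p + axis i 1}"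
    using assms planar_lift by (auto simp: floor_ok_def)
  moreover have "\<Union>(lift_domino z ` f) = slab z (\<Union>f)" by (auto simp: lift_domino_def slab_def)
  moreover have "disjoint (lift_domino z ` f)"
  proof (rule pairwiseI)
    fix a b assume "a \<in> lift_domino z ` f" "b \<in> lift_domino z ` f" "a \<noteq> b"
    then obtain d e where de: "d \<in> f" "e \<in> f" "d \<noteq> e" "a = lift_domino z d" "b = lift_domino z e" by blast
    then have "d \<inter> e = {}" using assms by (auto simp: floor_ok_def pairwise_def disjnt_def)
    then show "disjnt a b" unfolding de by (auto simp: lift_domino_def disjnt_def)
  qed
  ultimately show ?thesis by (simp add: cell_tiling_def)
qed

lemma pillar_tiling: "cell_tiling (slab z q \<union> slab (z + 1) q) (pillar z ` q)"
proof -
  have "\<exists>p i. pillar z c = {p, p + axis i 1}" for c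
    by (rule exI[of _ "cell c z"], rule exI[of _ 3]) (cases c, simp add: pillar_def cell_axis)
  moreover have "\<Union>(pillar z ` q) = slab z q \<union> slab (z + 1) q" by (auto simp: pillar_def slab_def)
  moreover have "disjoint (pillar z ` q)"
    by (auto simp: pairwise_def pillar_def disjnt_def)
  ultimately show ?thesis by (simp add: cell_tiling_def)
qed

lemma floor_split:
  assumes "floor_ok p f" shows "D - p = \<Union>f \<union> next_plug p f" "\<Union>f \<inter> next_plug p f = {}"
proof -
  have "\<Union>f \<subseteq> D - p" using assms by (auto simp: floor_ok_def)
  then show "D - p = \<Union>f \<union> next_plug p f" "\<Union>f \<inter> next_plug p f = {}" by (auto simp: next_plug_def)
qed

lemma layer_tiling:
  assumes "floor_ok p f"
  shows "cell_tiling (slab z (D - p) \<union> slab (z + 1) (next_plug p f)) (layer z p f)"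
proof -
  have "slab z (\<Union>f) \<inter> (slab z (next_plug p f) \<union> slab (z + 1) (next_plug p f)) = {}"
    using floor_split(2)[OF assms] by (auto simp: slab_def)
  from cell_tiling_Un[OF lift_tiling[OF assms] pillar_tiling this]
  show ?thesis unfolding layer_def floor_split(1)[OF assms] by (simp add: slab_def image_Un Un_assoc)
qed

lemma stack_cells_Cons:
  fixes z :: int
  assumes "p \<subseteq> D" "floor_ok p f" "legit (next_plug p f) fs"
  defines "L \<equiv> slab z (D - p) \<union> slab (z + 1) (next_plug p f)"
  shows "stack_cells z p (f # fs) = L \<union> stack_cells (z + 1) (next_plug p f) fs"
    "L \<inter> stack_cells (z + 1) (next_plug p f) fs = {}"
proof -
  have q: "c \<in> D" if "c \<in> next_plug p f" for c using that next_plug_subset by blast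
  have "fin (next_plug p f) fs \<subseteq> D" by (simp add: fin_subset)
  then have q': "c \<in> D" if "c \<in> fin (next_plug p f) fs" for c using that by blast
  show "stack_cells z p (f # fs) = L \<union> stack_cells (z + 1) (next_plug p f) fs"
  proof (rule cell_set_eqI)
    fix c h
    show "cell c h \<in> stack_cells z p (f # fs) \<longleftrightarrow> cell c h \<in> L \<union> stack_cells (z + 1) (next_plug p f) fs"
    proof (cases fs)
      case Nil
      then show ?thesis using q[of c] q'[of c] assms(1) by (auto simp: stack_cells_def L_def)
    next
      case (Cons g gs)
      then show ?thesis using q[of c] q'[of c] assms(1) by (auto simp: stack_cells_def L_def)
    qed
  qed
  show "L \<inter> stack_cells (z + 1) (next_plug p f) fs = {}"
    by (rule cell_set_eqI) (auto simp: stack_cells_def L_def)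
qed

lemma stack_tiling: "legit p fs \<Longrightarrow> cell_tiling (stack_cells z p fs) (stack z p fs)"
proof (induction fs arbitrary: z p)
  case Nil
  have "stack_cells z p [] = {}" by (rule cell_set_eqI) (auto simp: stack_cells_def)
  then show ?case by simp
next
  case (Cons f fs)
  then have l: "p \<subseteq> D" "floor_ok p f" "legit (next_plug p f) fs" by auto
  show ?case unfolding stack_cells_Cons(1)[OF l] stack.simps
    by (rule cell_tiling_Un[OF layer_tiling[OF l(2)] Cons.IH[OF l(3)] stack_cells_Cons(2)[OF l]])
qed

lemma stack_append: "stack z p (xs @ ys) = stack z p xs \<union> stack (z + int (length xs)) (fin p xs) ys"
  by (induction xs arbitrary: z p) (auto simp: add.assoc add.commute)

lemma stack_level:
  assumes "legit p fs" "e \<in> stack z p fs" "cell c h \<in> e" shows "z \<le> h" "c \<in> D"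
proof -
  have "cell c h \<in> stack_cells z p fs"
    using stack_tiling[OF assms(1), of z] assms(2,3) by (auto simp: cell_tiling_def)
  then show "z \<le> h" "c \<in> D" using fin_subset[OF legit_subset[OF assms(1)]] by (auto simp: stack_cells_def)
qed

lemma layer_level:
  assumes "floor_ok p f" "e \<in> layer z p f" obtains c where "cell c z \<in> e"
proof -
  from assms(2) consider d where "d \<in> f" "e = lift_domino z d" | c where "e = pillar z c"
    by (auto simp: layer_def)
  then show ?thesis
  proof cases
    case 1
    then have "planar_domino d" using assms(1) by (auto simp: floor_ok_def)
    then obtain c where "c \<in> d" using planar_domino_nonempty by blast
    then show ?thesis using that[of c] 1 by simp
  next
    case 2
    then show ?thesis using that[of c] by simp
  qed
qed

lemma lift_in_layer:
  assumes "planar_domino d" shows "lift_domino w d \<in> layer z p f \<longleftrightarrow> w = z \<and> d \<in> f"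
  by (auto simp: layer_def image_iff lift_eq_iff[OF planar_domino_nonempty[OF assms]] lift_not_pillar)

lemma lift_in_stack:
  assumes "planar_domino d" "legit p (f # fs)"
  shows "lift_domino z d \<in> stack z p (f # fs) \<longleftrightarrow> d \<in> f"
proof
  obtain c where c: "c \<in> d" using assms(1) planar_domino_nonempty by blast
  assume "lift_domino z d \<in> stack z p (f # fs)"
  then consider "d \<in> f" | "lift_domino z d \<in> stack (z + 1) (next_plug p f) fs"
    unfolding stack.simps Un_iff lift_in_layer[OF assms(1)] by blast
  then show "d \<in> f"
  proof cases
    case 2
    have "legit (next_plug p f) fs" using assms(2) by simp
    from stack_level(1)[OF this 2, of c z] c show ?thesis by simp
  qed
qed (simp add: lift_in_layer[OF assms(1)])

text \<open>The first floor is read off from the horizontal dominoes at the lowest level, and it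
  determines the next plug. The dominoes above never reach down to this level, so the first layer
  can be removed.\<close>

lemma stack_inj:
  "legit p fs \<Longrightarrow> legit p gs \<Longrightarrow> length fs = length gs \<Longrightarrow> stack z p fs = stack z p gs \<Longrightarrow> fs = gs"
proof (induction fs arbitrary: z p gs)
  case (Cons f fs)
  obtain g gs' where gs: "gs = g # gs'" using Cons.prems(3) by (cases gs) auto
  have l: "floor_ok p f" "legit (next_plug p f) fs" "floor_ok p g" "legit (next_plug p g) gs'"
    using Cons.prems gs by auto
  have "d \<in> f \<longleftrightarrow> d \<in> g" for d
  proof (cases "planar_domino d")
    case True
    have "stack z p (g # gs') = stack z p (f # fs)" using Cons.prems(4) gs by simp
    then show ?thesis
      using lift_in_stack[OF True Cons.prems(1), of z] lift_in_stack[OF True, of p g gs' z] Cons.prems(2)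
      unfolding gs by metis
  next
    case False
    then show ?thesis using l by (auto simp: floor_ok_def)
  qed
  then have fg: "f = g" by blast
  have d: "layer z p f \<inter> stack (z + 1) (next_plug p f) hs = {}" if "legit (next_plug p f) hs" for hs
  proof (rule ccontr)
    assume "layer z p f \<inter> stack (z + 1) (next_plug p f) hs \<noteq> {}"
    then obtain e where e: "e \<in> layer z p f" "e \<in> stack (z + 1) (next_plug p f) hs" by blast
    obtain c where "cell c z \<in> e" using layer_level[OF l(1) e(1)] .
    then show False using stack_level(1)[OF that e(2)] by fastforce
  qed
  have "layer z p f \<union> stack (z + 1) (next_plug p f) fs = layer z p f \<union> stack (z + 1) (next_plug p f) gs'"
    using Cons.prems(4) gs fg by simp
  then have "stack (z + 1) (next_plug p f) fs = stack (z + 1) (next_plug p f) gs'"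
    using d[OF l(2)] d[of gs'] l(4) fg by blast
  then show ?case using Cons.IH[OF l(2), of gs'] l(4) Cons.prems(3) gs fg by simp
qed simp

text \<open>The dominoes starting at the lowest level form a layer, given by \<open>f\<close> and
  \<open>q\<close>. Its removal leaves the same task one level higher with \<open>q\<close> already
  occupied. Without levels the plug has to be empty, since nothing may stick out at the top.\<close>

lemma stack_exists:
  "cell_tiling (column_box D z N - slab z p) m \<Longrightarrow> p \<subseteq> D \<Longrightarrow> (N = 0 \<longrightarrow> p = {}) \<Longrightarrow>
   \<exists>fs. length fs = N \<and> legit p fs \<and> fin p fs = {} \<and> m = stack z p fs"
proof (induction N arbitrary: z p m)
  case 0
  have "column_box D z 0 - slab z p = {}" by (rule cell_set_eqI) auto
  then have "\<Union>m = {}" using 0 by (simp add: cell_tiling_def)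
  then have "m = {}" using cell_tiling_nonempty[OF 0(1)] by auto
  then show ?case using 0 by (intro exI[of _ "[]"]) simp
next
  case (Suc N)
  note m = Suc.prems(1)
  define f where "f = {d. planar_domino d \<and> lift_domino z d \<in> m}"
  define q where "q = {c. pillar z c \<in> m}"
  have reg: "c \<in> D \<and> z \<le> h \<and> h < z + int (Suc N) \<and> (h = z \<longrightarrow> c \<notin> p)" if "e \<in> m" "cell c h \<in> e" for e c h
  proof -
    have "cell c h \<in> column_box D z (Suc N) - slab z p" using m that unfolding cell_tiling_def by blast
    then show ?thesis by auto
  qed
  have same: "a = b" if "a \<in> m" "b \<in> m" "x \<in> a" "x \<in> b" for a b x
    using m that unfolding cell_tiling_def pairwise_def disjnt_def by blast
  have key: "(\<exists>d\<in>f. c \<in> d) \<or> c \<in> q" if c: "c \<in> D" "c \<notin> p" for c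
  proof -
    have "cell c z \<in> column_box D z (Suc N) - slab z p" using c by simp
    then obtain e where e: "e \<in> m" "cell c z \<in> e" using m unfolding cell_tiling_def by blast
    then obtain a i where "e = {a, a + axis i 1}" using m unfolding cell_tiling_def by blast
    then show ?thesis
    proof (cases rule: edge_cases)
      case (1 w d)
      then show ?thesis using e by (auto simp: f_def)
    next
      case (2 w b)
      have "cell b w \<in> e" using 2 by simp
      then have "z \<le> w" using reg[OF e(1)] by blast
      then show ?thesis using 2 e by (auto simp: q_def)
    qed
  qed
  have fD: "d \<subseteq> D - p" if "d \<in> f" for d
  proof
    fix c assume "c \<in> d"
    then have "cell c z \<in> lift_domino z d" by simp
    then show "c \<in> D - p" using reg[of "lift_domino z d" c z] that by (simp add: f_def)
  qed
  have qD: "c \<in> D - p" if "c \<in> q" for c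
    using reg[of "pillar z c" c z] that by (simp add: q_def)
  have dj: "c \<notin> q" if "d \<in> f" "c \<in> d" for c d
  proof
    assume "c \<in> q"
    then have "lift_domino z d = pillar z c" using same[of "lift_domino z d" "pillar z c" "cell c z"] that
      by (simp add: f_def q_def)
    then show False using lift_not_pillar by blast
  qed
  have "disjoint f"
  proof (rule pairwiseI)
    fix d e assume de: "d \<in> f" "e \<in> f" "d \<noteq> e"
    show "disjnt d e"
    proof (rule ccontr)
      assume "\<not> disjnt d e"
      then obtain c where "c \<in> d" "c \<in> e" by (auto simp: disjnt_def)
      then have "lift_domino z d = lift_domino z e"
        using same[of "lift_domino z d" "lift_domino z e" "cell c z"] de by (simp add: f_def)
      then show False using lift_eq_iff \<open>c \<in> d\<close> de by blast
    qed
  qed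
  then have f: "floor_ok p f" using fD by (auto simp: floor_ok_def f_def)
  have q: "next_plug p f = q"
    unfolding next_plug_def
  proof (rule Set.set_eqI)
    fix c
    show "c \<in> D - p - \<Union>f \<longleftrightarrow> c \<in> q" using key[of c] qD[of c] dj[of _ c] by blast
  qed
  have lm: "layer z p f \<subseteq> m" unfolding layer_def q by (auto simp: f_def q_def)
  have "(column_box D z (Suc N) - slab z p) - (slab z (D - p) \<union> slab (z + 1) q) = column_box D (z + 1) N - slab (z + 1) q"
    by (rule cell_set_eqI) auto
  then have m': "cell_tiling (column_box D (z + 1) N - slab (z + 1) q) (m - layer z p f)"
    using cell_tiling_Diff[OF m layer_tiling[OF f] lm] q by simp
  have "q \<subseteq> D" using qD by blast
  moreover have "N = 0 \<longrightarrow> q = {}"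
  proof
    assume "N = 0"
    then have "c \<notin> q" for c using reg[of "pillar z c" c "z + 1"] by (auto simp: q_def)
    then show "q = {}" by blast
  qed
  ultimately obtain fs where fs: "length fs = N" "legit q fs" "fin q fs = {}" "m - layer z p f = stack (z + 1) q fs"
    using Suc.IH[OF m'] by blast
  have "m = stack z p (f # fs)" using fs(4) lm q by auto
  then show ?case using fs f Suc.prems(2) q by (intro exI[of _ "f # fs"]) simp
qed

lemma stack_find_lift:
  assumes "planar_domino d" "legit p fs" "lift_domino h d \<in> stack z p fs"
  shows "\<exists>xs f ys. fs = xs @ f # ys \<and> h = z + int (length xs) \<and> d \<in> f"
  using assms(2,3)
proof (induction fs arbitrary: z p)
  case (Cons f fs)
  then consider "h = z" "d \<in> f" | "lift_domino h d \<in> stack (z + 1) (next_plug p f) fs"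
    unfolding stack.simps Un_iff lift_in_layer[OF assms(1)] by blast
  then show ?case
  proof cases
    case 1
    then show ?thesis by (intro exI[of _ "[]"]) auto
  next
    case 2
    then obtain xs g ys where "fs = xs @ g # ys" "h = z + 1 + int (length xs)" "d \<in> g"
      using Cons.IH[of "next_plug p f" "z + 1"] Cons.prems by auto
    then show ?thesis by (intro exI[of _ "f # xs"] exI[of _ g] exI[of _ ys]) simp
  qed
qed simp

section \<open>Flips of stacks as flips of lists of floors\<close>

definition closed_floors :: "(int \<times> int) set set list \<Rightarrow> bool" where
  "closed_floors xs \<longleftrightarrow> legit {} xs \<and> fin {} xs = {}"

lemma stack_hflip_sub:
  assumes l: "legit p (f # ys)" and H: "hblock x y \<subseteq> f"
  defines "f' \<equiv> f - hblock x y \<union> vblock x y"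
  shows "stack z p (f # ys) - lift_domino z ` hblock x y \<subseteq> stack z p (f' # ys)"
    "lift_domino z ` vblock x y \<subseteq> stack z p (f' # ys)" "lift_domino z ` hblock x y \<subseteq> stack z p (f # ys)"
proof -
  have "next_plug p f' = next_plug p f" using l floor_ok_hflip(3)[OF _ H] by (simp add: f'_def)
  then show "stack z p (f # ys) - lift_domino z ` hblock x y \<subseteq> stack z p (f' # ys)"
    by (auto simp: layer_def f'_def)
  show "lift_domino z ` vblock x y \<subseteq> stack z p (f' # ys)" by (auto simp: layer_def f'_def)
  show "lift_domino z ` hblock x y \<subseteq> stack z p (f # ys)" using H by (auto simp: layer_def)
qed

lemma stack_vflip_sub:
  assumes l: "legit p (f # g # ys)" and d: "d \<in> f" "d \<in> g"
  defines "xs' \<equiv> (f - {d}) # (g - {d}) # ys"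
  shows "stack z p (f # g # ys) - {lift_domino z d, lift_domino (z + 1) d} \<subseteq> stack z p xs'"
    "pillar z ` d \<subseteq> stack z p xs'" "{lift_domino z d, lift_domino (z + 1) d} \<subseteq> stack z p (f # g # ys)"
proof -
  note v = legit_vflip(2,3)[OF l d]
  show "stack z p (f # g # ys) - {lift_domino z d, lift_domino (z + 1) d} \<subseteq> stack z p xs'"
    unfolding xs'_def stack.simps layer_def v(1) unfolding v(2) by auto
  show "pillar z ` d \<subseteq> stack z p xs'"
    unfolding xs'_def stack.simps layer_def v(2) by auto
  show "{lift_domino z d, lift_domino (z + 1) d} \<subseteq> stack z p (f # g # ys)" using d by (auto simp: layer_def)
qed

lemma eqw_stack_cells: "eqw False p xs ys \<Longrightarrow> stack_cells z p xs = stack_cells z p ys"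
  using eqw_legit[of False p xs ys] eqw_length_eq[of p xs ys] by (simp add: stack_cells_def)

text \<open>The frame \<open>X\<close>, a tiling of cells disjoint from the stack, makes the
  induction possible: in the case of \<open>eqw_Cons\<close> the lowest layer joins the
  frame.\<close>

lemma eqw_cell_flips:
  "eqw False p xs ys \<Longrightarrow> cell_tiling A X \<Longrightarrow> A \<inter> stack_cells z p xs = {} \<Longrightarrow>
   cell_flip\<^sup>*\<^sup>* (X \<union> stack z p xs) (X \<union> stack z p ys)"
proof (induction arbitrary: A X z rule: eqw.induct)
  case (eqw_refl p xs)
  then show ?case by simp
next
  case (eqw_sym p xs ys)
  have "cell_tiling (A \<union> stack_cells z p xs) (X \<union> stack z p xs)"
    using eqw_legit[OF eqw_sym(1)] eqw_stack_cells[OF eqw_sym(1)] eqw_sym.prems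
    by (intro cell_tiling_Un stack_tiling) auto
  moreover have "cell_flip\<^sup>*\<^sup>* (X \<union> stack z p xs) (X \<union> stack z p ys)"
    using eqw_stack_cells[OF eqw_sym(1)] eqw_sym.prems by (intro eqw_sym.IH) auto
  ultimately show ?case using cell_flips_sym by blast
next
  case (eqw_trans p xs ys zs)
  have 1: "cell_flip\<^sup>*\<^sup>* (X \<union> stack z p xs) (X \<union> stack z p ys)"
    by (rule eqw_trans.IH(1)[OF eqw_trans.prems])
  have "A \<inter> stack_cells z p ys = {}"
    using eqw_trans.prems(2) unfolding eqw_stack_cells[OF eqw_trans.hyps(1), of z] .
  then have "cell_flip\<^sup>*\<^sup>* (X \<union> stack z p ys) (X \<union> stack z p zs)"
    by (rule eqw_trans.IH(2)[OF eqw_trans.prems(1)])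
  with 1 show ?case by (rule rtranclp_trans)
next
  case (eqw_hflip p f xs x y)
  define f' where "f' = f - hblock x y \<union> vblock x y"
  have e: "eqw False p (f # xs) (f' # xs)" unfolding f'_def using eqw_hflip.hyps by (rule eqw.eqw_hflip)
  note l = eqw_legit[OF e]
  have t1: "cell_tiling (A \<union> stack_cells z p (f # xs)) (X \<union> stack z p (f # xs))"
    using l eqw_hflip.prems by (intro cell_tiling_Un stack_tiling) auto
  have t2: "cell_tiling (A \<union> stack_cells z p (f # xs)) (X \<union> stack z p (f' # xs))"
    using l eqw_hflip.prems unfolding eqw_stack_cells[OF e] by (intro cell_tiling_Un stack_tiling) auto
  note s = stack_hflip_sub[OF eqw_hflip.hyps, of z, folded f'_def]
  have "cell_flip (X \<union> stack z p (f # xs)) (X \<union> stack z p (f' # xs))"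
    by (rule cell_flip_block[OF t1 t2, of z x y]) (use s in blast)+
  then show ?case unfolding f'_def by blast
next
  case (eqw_vflip p f g xs d)
  define gs where "gs = (f - {d}) # (g - {d}) # xs"
  have e: "eqw False p (f # g # xs) gs" unfolding gs_def using eqw_vflip.hyps by (rule eqw.eqw_vflip)
  note l = eqw_legit[OF e]
  have t1: "cell_tiling (A \<union> stack_cells z p (f # g # xs)) (X \<union> stack z p (f # g # xs))"
    using l eqw_vflip.prems by (intro cell_tiling_Un stack_tiling) auto
  have t2: "cell_tiling (A \<union> stack_cells z p (f # g # xs)) (X \<union> stack z p gs)"
    using l eqw_vflip.prems unfolding eqw_stack_cells[OF e] by (intro cell_tiling_Un stack_tiling) auto
  note s = stack_vflip_sub[OF eqw_vflip.hyps, of z, folded gs_def]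
  have d: "planar_domino d" using eqw_vflip.hyps by (auto simp: floor_ok_def)
  have "cell_flip (X \<union> stack z p (f # g # xs)) (X \<union> stack z p gs)"
    by (rule cell_flip_pillars[OF t1 t2 d, of z]) (use s in blast)+
  then show ?case unfolding gs_def by blast
next
  case (eqw_stab p xs)
  then show ?case by simp
next
  case (eqw_Cons p f xs ys)
  let ?L = "slab z (D - p) \<union> slab (z + 1) (next_plug p f)"
  have lx: "legit (next_plug p f) xs" using eqw_legit[OF eqw_Cons.hyps(3)] by simp
  note c = stack_cells_Cons[OF eqw_Cons.hyps(1,2) lx, of z]
  have "cell_tiling (A \<union> ?L) (X \<union> layer z p f)"
    using eqw_Cons.prems c by (intro cell_tiling_Un layer_tiling eqw_Cons.hyps(2)) auto
  moreover have "(A \<union> ?L) \<inter> stack_cells (z + 1) (next_plug p f) xs = {}"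
    using eqw_Cons.prems(2) c by blast
  ultimately have "cell_flip\<^sup>*\<^sup>* ((X \<union> layer z p f) \<union> stack (z + 1) (next_plug p f) xs)
     ((X \<union> layer z p f) \<union> stack (z + 1) (next_plug p f) ys)"
    by (rule eqw_Cons.IH)
  then show ?case by (simp add: Un_assoc)
qed

lemma closed_cells: "closed_floors xs \<Longrightarrow> stack_cells 0 {} xs = column_box D 0 (length xs)"
  by (rule cell_set_eqI) (auto simp: stack_cells_def closed_floors_def)

lemma closed_tiling: "closed_floors xs \<Longrightarrow> cell_tiling (column_box D 0 (length xs)) (stack 0 {} xs)"
  using stack_tiling[of "{}" xs 0] closed_cells by (simp add: closed_floors_def)

lemma tiling_closed:
  assumes "cell_tiling (column_box D 0 N) m"
  shows "\<exists>xs. closed_floors xs \<and> length xs = N \<and> m = stack 0 {} xs"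
proof -
  have "column_box D 0 N - slab 0 {} = column_box D 0 N" by (simp add: slab_def)
  then show ?thesis using stack_exists[of 0 N "{}" m] assms by (auto simp: closed_floors_def)
qed

lemma cell_flip_stack_h:
  assumes c: "closed_floors xs" and f: "lift_domino z ` hblock x y \<subseteq> stack 0 {} xs"
    "m' = stack 0 {} xs - lift_domino z ` hblock x y \<union> lift_domino z ` vblock x y"
    and t: "cell_tiling (column_box D 0 (length xs)) m'"
  shows "\<exists>ys. closed_floors ys \<and> length ys = length xs \<and> m' = stack 0 {} ys \<and> eqw False {} xs ys"
proof -
  define d1 d2 where "d1 = {(x, y), (x + 1, y)}" and "d2 = {(x, y + 1), (x + 1, y + 1)}"
  have h: "hblock x y = {d1, d2}" by (simp add: hblock_def d1_def d2_def)
  have pl: "planar_domino d1" "planar_domino d2" by (auto simp: planar_domino_def d1_def d2_def)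
  have l: "legit {} xs" using c by (simp add: closed_floors_def)
  have m: "lift_domino z d1 \<in> stack 0 {} xs" "lift_domino z d2 \<in> stack 0 {} xs" using f(1) by (auto simp: h)
  obtain as g bs where 1: "xs = as @ g # bs" "z = 0 + int (length as)" "d1 \<in> g"
    using stack_find_lift[OF pl(1) l m(1)] by blast
  obtain as' g' bs' where 2: "xs = as' @ g' # bs'" "z = 0 + int (length as')" "d2 \<in> g'"
    using stack_find_lift[OF pl(2) l m(2)] by blast
  have "as = as'" "g = g'" using 1 2 by (auto simp: append_eq_append_conv)
  then have hg: "hblock x y \<subseteq> g" using 1 2 h by auto
  define ys where "ys = as @ (g - hblock x y \<union> vblock x y) # bs"
  have lg: "legit (fin {} as) (g # bs)" "legit {} as" using l unfolding 1(1) by auto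
  have e: "eqw False {} xs ys" unfolding ys_def 1(1) by (rule eqw_append_left[OF lg(2) eqw_hflip[OF lg(1) hg]])
  have cy: "closed_floors ys" "length ys = length xs" using eqw_legit[OF e] eqw_length_eq[OF e] c by (auto simp: closed_floors_def)
  note s = stack_hflip_sub[OF lg(1) hg, of z]
  have "m' \<subseteq> stack 0 {} ys" unfolding f(2) ys_def 1(1) stack_append using s 1(2) by auto
  then have "m' = stack 0 {} ys" using cell_tiling_subset_eq[OF t, of "stack 0 {} ys"] closed_tiling[OF cy(1)] cy(2) by simp
  then show ?thesis using cy e by blast
qed

lemma cell_flip_stack_v:
  assumes c: "closed_floors xs" and d: "planar_domino d" and f: "{lift_domino z d, lift_domino (z + 1) d} \<subseteq> stack 0 {} xs"
    "m' = stack 0 {} xs - {lift_domino z d, lift_domino (z + 1) d} \<union> pillar z ` d"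
    and t: "cell_tiling (column_box D 0 (length xs)) m'"
  shows "\<exists>ys. closed_floors ys \<and> length ys = length xs \<and> m' = stack 0 {} ys \<and> eqw False {} xs ys"
proof -
  have l: "legit {} xs" using c by (simp add: closed_floors_def)
  have m: "lift_domino z d \<in> stack 0 {} xs" "lift_domino (z + 1) d \<in> stack 0 {} xs" using f(1) by auto
  obtain as g bs where 1: "xs = as @ g # bs" "z = 0 + int (length as)" "d \<in> g"
    using stack_find_lift[OF d l m(1)] by blast
  obtain as' g' bs' where 2: "xs = as' @ g' # bs'" "z + 1 = 0 + int (length as')" "d \<in> g'"
    using stack_find_lift[OF d l m(2)] by blast
  have "length as' = length (as @ [g])" using 1(2) 2(2) by simp
  moreover have "as' @ g' # bs' = (as @ [g]) @ bs" using 1(1) 2(1) by simp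
  ultimately have "bs = g' # bs'" using append_eq_append_conv[of as' "as @ [g]"] by blast
  then have xs: "xs = as @ g # g' # bs'" using 1 by simp
  define ys where "ys = as @ (g - {d}) # (g' - {d}) # bs'"
  have lg: "legit (fin {} as) (g # g' # bs')" "legit {} as" using l unfolding xs by auto
  have e: "eqw False {} xs ys" unfolding ys_def xs by (rule eqw_append_left[OF lg(2) eqw_vflip[OF lg(1) 1(3) 2(3)]])
  have cy: "closed_floors ys" "length ys = length xs" using eqw_legit[OF e] eqw_length_eq[OF e] c by (auto simp: closed_floors_def)
  note s = stack_vflip_sub[OF lg(1) 1(3) 2(3), of z]
  have "m' \<subseteq> stack 0 {} ys" unfolding f(2) ys_def xs stack_append using s 1(2) by auto
  then have "m' = stack 0 {} ys" using cell_tiling_subset_eq[OF t, of "stack 0 {} ys"] closed_tiling[OF cy(1)] cy(2) by simp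
  then show ?thesis using cy e by blast
qed

text \<open>There are six ordered pairs of directions. Three of them are flips of \<open>eqw\<close>
  as they stand; for the others the reverse flip is one of these, and the original list is recovered
  because a stack determines its floors.\<close>

lemma cell_flip_stack:
  assumes c: "closed_floors xs" and f: "cell_flip (stack 0 {} xs) m'"
  shows "\<exists>ys. closed_floors ys \<and> length ys = length xs \<and> m' = stack 0 {} ys \<and> eqw False {} xs ys"
proof -
  note tx = closed_tiling[OF c]
  have t: "cell_tiling (column_box D 0 (length xs)) m'" "cell_flip m' (stack 0 {} xs)"
    using cell_flip_sym[OF tx f] by blast+
  have main: "\<exists>ys. closed_floors ys \<and> length ys = length xs \<and> m' = stack 0 {} ys \<and> eqw False {} xs ys"
    if c: "closed_floors xs" and t: "cell_tiling (column_box D 0 (length xs)) m'" and jk: "j \<noteq> k" "k \<noteq> 1" "(j, k) \<noteq> (3, 2)"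
      and g: "{{p, p + axis j 1}, {p + axis k 1, p + axis j 1 + axis k 1}} \<subseteq> stack 0 {} xs"
       "m' = stack 0 {} xs - {{p, p + axis j 1}, {p + axis k 1, p + axis j 1 + axis k 1}} \<union>
        {{p, p + axis k 1}, {p + axis j 1, p + axis j 1 + axis k 1}}" for xs m' p and j k :: 3
  proof -
    obtain c0 z where p0: "p = cell c0 z" by (rule cell_surj)
    obtain x y where "c0 = (x, y)" by (cases c0)
    then have p: "p = cell (x, y) z" using p0 by simp
    consider "j = 1" "k = 2" | "j = 1" "k = 3" | "j = 2" "k = 3"
      using jk exhaust_3[of j] exhaust_3[of k] by auto
    then show ?thesis
    proof cases
      case 1
      have h: "lift_domino z ` hblock x y = {{p, p + axis j 1}, {p + axis k 1, p + axis j 1 + axis k 1}}"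
        "lift_domino z ` vblock x y = {{p, p + axis k 1}, {p + axis j 1, p + axis j 1 + axis k 1}}"
        by (simp_all add: 1 p hblock_def vblock_def cell_axis lift_domino_def)
      show ?thesis by (rule cell_flip_stack_h[OF c _ _ t, of z x y]) (simp_all only: h g)
    next
      case 2
      define d where "d = {(x, y), (x + 1, y)}"
      have pd: "planar_domino d" by (auto simp: planar_domino_def d_def)
      have h: "{lift_domino z d, lift_domino (z + 1) d} = {{p, p + axis j 1}, {p + axis k 1, p + axis j 1 + axis k 1}}"
        "pillar z ` d = {{p, p + axis k 1}, {p + axis j 1, p + axis j 1 + axis k 1}}"
        by (simp_all add: 2 p d_def cell_axis lift_domino_def pillar_def)
      show ?thesis by (rule cell_flip_stack_v[OF c pd _ _ t, of z]) (simp_all only: h g)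
    next
      case 3
      define d where "d = {(x, y), (x, y + 1)}"
      have pd: "planar_domino d" by (auto simp: planar_domino_def d_def)
      have h: "{lift_domino z d, lift_domino (z + 1) d} = {{p, p + axis j 1}, {p + axis k 1, p + axis j 1 + axis k 1}}"
        "pillar z ` d = {{p, p + axis k 1}, {p + axis j 1, p + axis j 1 + axis k 1}}"
        by (simp_all add: 3 p d_def cell_axis lift_domino_def pillar_def)
      show ?thesis by (rule cell_flip_stack_v[OF c pd _ _ t, of z]) (simp_all only: h g)
    qed
  qed
  obtain p j k where jk: "j \<noteq> k" and g: "{{p, p + axis j 1}, {p + axis k 1, p + axis j 1 + axis k 1}} \<subseteq> stack 0 {} xs"
       "m' = stack 0 {} xs - {{p, p + axis j 1}, {p + axis k 1, p + axis j 1 + axis k 1}} \<union>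
        {{p, p + axis k 1}, {p + axis j 1, p + axis j 1 + axis k 1}}"
    using f unfolding cell_flip_iff by blast
  show ?thesis
  proof (cases "k \<noteq> 1 \<and> (j, k) \<noteq> (3, 2)")
    case True
    then show ?thesis using main[OF c t(1) jk _ _ g] by blast
  next
    case False
    then have kj: "k \<noteq> j" "j \<noteq> 1" "(k, j) \<noteq> (3, 2)" using jk by auto
    obtain ys where ys: "closed_floors ys" "length ys = length xs" "m' = stack 0 {} ys" using tiling_closed[OF t(1)] by blast
    have sw: "p + axis k 1 + axis j 1 = p + axis j 1 + axis k 1" by (simp add: algebra_simps)
    let ?f0 = "{{p, p + axis j 1}, {p + axis k 1, p + axis j 1 + axis k 1}}"
    let ?f1 = "{{p, p + axis k 1}, {p + axis j 1, p + axis j 1 + axis k 1}}"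
    have i: "\<exists>i. j \<noteq> i \<and> k \<noteq> i"
    proof -
      have "card {j, k} < CARD(3)" using jk by simp
      then have "{j, k} \<noteq> UNIV" by (metis less_irrefl)
      then obtain i where "i \<notin> {j, k}" by blast
      then show ?thesis by auto
    qed
    then obtain i where i: "j \<noteq> i" "k \<noteq> i" by blast
    have ct: "cell_tiling (flat_cells p i) ?f0" "cell_tiling (flat_cells p i) ?f1"
      unfolding cell_tiling_flat[OF i jk] by simp_all
    have "?f1 \<inter> (stack 0 {} xs - ?f0) = {}" using cell_flip_tiling(2)[OF tx ct g(1)] .
    then have "stack 0 {} xs = m' - ?f1 \<union> ?f0" using g by blast
    then have e1: "stack 0 {} xs = stack 0 {} ys - {{p, p + axis k 1}, {p + axis j 1, p + axis k 1 + axis j 1}} \<union>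
        {{p, p + axis j 1}, {p + axis k 1, p + axis k 1 + axis j 1}}" unfolding sw ys(3) .
    have e2: "{{p, p + axis k 1}, {p + axis j 1, p + axis k 1 + axis j 1}} \<subseteq> stack 0 {} ys"
      unfolding sw using g(2) ys(3) by blast
    have tx': "cell_tiling (column_box D 0 (length ys)) (stack 0 {} xs)" using tx ys(2) by simp
    obtain zs where zs: "closed_floors zs" "length zs = length ys" "stack 0 {} xs = stack 0 {} zs" "eqw False {} ys zs"
      using main[OF ys(1) tx' kj e2 e1] by blast
    have "xs = zs" using stack_inj[of "{}" xs zs 0] zs ys c by (simp add: closed_floors_def)
    then have "eqw False {} xs ys" using eqw_sym[OF zs(4)] by simp
    then show ?thesis using ys by blast
  qed
qed

definition tiling_of :: "(int \<times> int) set set list \<Rightarrow> (real^3) set set" where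
  "tiling_of xs = cubes ` stack 0 {} xs"

lemma tiling_of_inj: "closed_floors xs \<Longrightarrow> closed_floors ys \<Longrightarrow> length xs = length ys \<Longrightarrow> tiling_of xs = tiling_of ys \<Longrightarrow> xs = ys"
  using stack_inj[of "{}" xs ys 0] by (simp add: tiling_of_def closed_floors_def inj_image_eq_iff[OF inj_cubes])

lemma tilings_column: "t \<in> tilings (cubes (column_box D 0 N)) \<longleftrightarrow> (\<exists>xs. closed_floors xs \<and> length xs = N \<and> t = tiling_of xs)"
  unfolding tilings_cubes tiling_of_def using tiling_closed closed_tiling by blast

lemma flips_tiling_of:
  assumes "closed_floors xs" "flip_connected (tiling_of xs) t"
  shows "\<exists>ys. closed_floors ys \<and> length ys = length xs \<and> t = tiling_of ys \<and> eqw False {} xs ys"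
  using assms(2)
proof (induction rule: rtranclp_induct)
  case base
  then show ?case using assms(1) by (intro exI[of _ xs]) (simp add: eqw_refl closed_floors_def)
next
  case (step a b)
  then obtain ys where ys: "closed_floors ys" "length ys = length xs" "a = tiling_of ys" "eqw False {} xs ys" by blast
  then obtain m' where m': "b = cubes ` m'" "cell_flip (stack 0 {} ys) m'"
    using step(2) unfolding tiling_of_def by (auto simp: flip_step_cubes)
  then obtain zs where zs: "closed_floors zs" "length zs = length ys" "m' = stack 0 {} zs" "eqw False {} ys zs"
    using cell_flip_stack[OF ys(1)] by blast
  have "eqw False {} xs zs" using ys(4) zs(4) by (rule eqw_trans)
  then show ?case using zs ys m' by (auto simp: tiling_of_def)
qed

theorem flip_connected_iff:
  assumes "closed_floors xs" "closed_floors ys" "length xs = length ys"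
  shows "flip_connected (tiling_of xs) (tiling_of ys) \<longleftrightarrow> eqw False {} xs ys"
proof
  assume "flip_connected (tiling_of xs) (tiling_of ys)"
  then obtain zs where zs: "closed_floors zs" "length zs = length xs" "tiling_of ys = tiling_of zs" "eqw False {} xs zs"
    using flips_tiling_of[OF assms(1)] by blast
  have "length ys = length zs" using zs(2) assms(3) by argo
  then have "ys = zs" using tiling_of_inj[OF assms(2) zs(1) _ zs(3)] by blast
  then show "eqw False {} xs ys" using zs(4) by (simp only:)
next
  assume e: "eqw False {} xs ys"
  have "cell_flip\<^sup>*\<^sup>* ({} \<union> stack 0 {} xs) ({} \<union> stack 0 {} ys)"
    by (rule eqw_cell_flips[OF e cell_tiling_empty]) simp
  then have "cell_flip\<^sup>*\<^sup>* (stack 0 {} xs) (stack 0 {} ys)" by simp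
  then show "flip_connected (tiling_of xs) (tiling_of ys)"
    unfolding tiling_of_def by (rule cell_flips_connected)
qed

end

section \<open>The twist as a sum over floors\<close>

definition cell_sign :: "int^3 \<Rightarrow> real" where
  "cell_sign p = (if black p then -1 else 1)"

lemma axis_nth3: "axis i (1::'a::zero_neq_one) $ j = (if j = i then 1 else 0)"
  by (simp add: axis_def)

lemma black_step: "black (p + axis i 1) \<longleftrightarrow> \<not> black p"
  using exhaust_3[of i] by (auto simp: black_def axis_nth3)

lemma domino_vec_cubes: "domino_vec (cubes {p, p + axis i 1}) = cell_sign p *\<^sub>R axis i 1"
proof -
  have c: "cube_center (p + axis i 1) - cube_center p = axis i 1"
    by (simp add: vec_eq_iff cube_center_def corner_def axis_nth3)
  then have c': "cube_center p - cube_center (p + axis i 1) = - axis i 1" by (metis minus_diff_eq)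
  have e: "cubes {p, p + axis i 1} = unit_cube a \<union> unit_cube b \<longleftrightarrow> {p, p + axis i 1} = {a, b}" for a b
  proof -
    have "unit_cube a \<union> unit_cube b = cubes {a, b}" by (simp add: cubes_def)
    then show ?thesis by (simp add: cubes_eq_iff)
  qed
  have "(\<exists>a b. \<not> black a \<and> black b \<and> cubes {p, p + axis i 1} = unit_cube a \<union> unit_cube b \<and>
      w = cube_center b - cube_center a) \<longleftrightarrow> w = cell_sign p *\<^sub>R axis i 1" for w
  proof
    assume "\<exists>a b. \<not> black a \<and> black b \<and> cubes {p, p + axis i 1} = unit_cube a \<union> unit_cube b \<and> w = cube_center b - cube_center a"
    then obtain a b where ab: "\<not> black a" "black b" "{p, p + axis i 1} = {a, b}" "w = cube_center b - cube_center a"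
      unfolding e by blast
    then have "(a = p \<and> b = p + axis i 1) \<or> (b = p \<and> a = p + axis i 1)" by (auto simp: doubleton_eq_iff)
    then show "w = cell_sign p *\<^sub>R axis i 1" using ab c c' by (auto simp: cell_sign_def)
  next
    assume w: "w = cell_sign p *\<^sub>R axis i 1"
    show "\<exists>a b. \<not> black a \<and> black b \<and> cubes {p, p + axis i 1} = unit_cube a \<union> unit_cube b \<and> w = cube_center b - cube_center a"
    proof (cases "black p")
      case True
      then show ?thesis unfolding e
        by (intro exI[of _ "p + axis i 1"] exI[of _ p]) (simp add: black_step w cell_sign_def c' insert_commute)
    next
      case False
      then show ?thesis unfolding e
        by (intro exI[of _ p] exI[of _ "p + axis i 1"]) (simp add: black_step w cell_sign_def c)
    qed
  qed
  then show ?thesis unfolding domino_vec_def by simp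
qed

text \<open>In the direction of the first axis only pairs of a domino in the second and one in the
  third direction contribute to the twist.\<close>

lemma det_axis:
  "det (vector [s *\<^sub>R axis j 1, t *\<^sub>R axis i 1, axis 1 1] :: real^3^3) =
   s * t * ((if j = 2 \<and> i = 3 then 1 else 0) - (if j = 3 \<and> i = 2 then 1 else 0))"
  unfolding det_3 by (simp add: vector_3 axis_nth3)

section \<open>Shadows of dominoes\<close>

definition hit :: "(int^3) set \<Rightarrow> (int^3) set \<Rightarrow> bool" where
  "hit e0 e1 \<longleftrightarrow> (\<exists>p\<in>e1. \<exists>q\<in>e0. q $ 1 < p $ 1 \<and> p $ 2 = q $ 2 \<and> p $ 3 = q $ 3)"

lemma domino_box:
  "x \<in> cubes {p, p + axis i 1} \<longleftrightarrow>
   (\<forall>j. real_of_int (p $ j) \<le> x $ j \<and> x $ j \<le> real_of_int (p $ j) + (if j = i then 2 else 1))"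
proof
  assume "x \<in> cubes {p, p + axis i 1}"
  then have "x \<in> unit_cube p \<or> x \<in> unit_cube (p + axis i 1)" by (simp add: cubes_def)
  then have c: "(\<forall>j. real_of_int (p $ j) \<le> x $ j \<and> x $ j \<le> real_of_int (p $ j) + 1) \<or>
     (\<forall>j. real_of_int ((p + axis i 1) $ j) \<le> x $ j \<and> x $ j \<le> real_of_int ((p + axis i 1) $ j) + 1)"
    by (simp only: mem_unit_cube)
  show "\<forall>j. real_of_int (p $ j) \<le> x $ j \<and> x $ j \<le> real_of_int (p $ j) + (if j = i then 2 else 1)"
  proof
    fix j
    have "(real_of_int (p $ j) \<le> x $ j \<and> x $ j \<le> real_of_int (p $ j) + 1) \<or>
       (real_of_int ((p + axis i 1) $ j) \<le> x $ j \<and> x $ j \<le> real_of_int ((p + axis i 1) $ j) + 1)"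
      using c by blast
    then show "real_of_int (p $ j) \<le> x $ j \<and> x $ j \<le> real_of_int (p $ j) + (if j = i then 2 else 1)"
      by (auto simp: axis_nth3 split: if_splits)
  qed
next
  assume b: "\<forall>j. real_of_int (p $ j) \<le> x $ j \<and> x $ j \<le> real_of_int (p $ j) + (if j = i then 2 else 1)"
  have "x \<in> unit_cube p \<or> x \<in> unit_cube (p + axis i 1)"
  proof (cases "x $ i \<le> real_of_int (p $ i) + 1")
    case True
    have "x \<in> unit_cube p" unfolding mem_unit_cube
    proof
      fix j show "real_of_int (p $ j) \<le> x $ j \<and> x $ j \<le> real_of_int (p $ j) + 1"
        using b[rule_format, of j] True by (cases "j = i") auto
    qed
    then show ?thesis by simp
  next
    case False
    have "x \<in> unit_cube (p + axis i 1)" unfolding mem_unit_cube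
    proof
      fix j show "real_of_int ((p + axis i 1) $ j) \<le> x $ j \<and> x $ j \<le> real_of_int ((p + axis i 1) $ j) + 1"
        using b[rule_format, of j] False by (cases "j = i") (auto simp: axis_nth3)
    qed
    then show ?thesis by simp
  qed
  then show "x \<in> cubes {p, p + axis i 1}" by (simp add: cubes_def)
qed

text \<open>Passing to the interior makes the transverse bounds strict. The bound on the first
  coordinate is strict already, because the part of the swept set up to \<open>p $ 1 + 1\<close> is
  the domino itself.\<close>

lemma shade_domino:
  assumes i: "i \<noteq> 1"
  shows "shade (axis 1 1) (cubes {p, p + axis i 1}) =
    {x. real_of_int (p $ 1) + 1 < x $ 1 \<and>
        (\<forall>j. j \<noteq> 1 \<longrightarrow> real_of_int (p $ j) < x $ j \<and> x $ j < real_of_int (p $ j) + (if j = i then 2 else 1))}"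
    (is "_ = ?T")
proof -
  define X where "X = cubes {p, p + axis i 1}"
  define Y where "Y = {x + s *\<^sub>R axis 1 1 | x s. x \<in> X \<and> 0 \<le> s} - X"
  let ?h = "\<lambda>j. real_of_int (p $ j) + (if j = i then 2 else 1)"
  have Ysub: "real_of_int (p $ 1) + 1 < y $ 1 \<and> (\<forall>j. j \<noteq> 1 \<longrightarrow> real_of_int (p $ j) \<le> y $ j \<and> y $ j \<le> ?h j)"
    if "y \<in> Y" for y
  proof -
    obtain x s where x: "y = x + s *\<^sub>R axis 1 1" "x \<in> X" "0 \<le> s" "y \<notin> X" using \<open>y \<in> Y\<close> by (auto simp: Y_def)
    have xj: "real_of_int (p $ j) \<le> x $ j \<and> x $ j \<le> ?h j" for j using x(2) unfolding X_def domino_box by blast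
    have yj: "y $ j = x $ j" if "j \<noteq> 1" for j using that by (simp add: x(1) axis_nth3)
    have y1: "y $ 1 = x $ 1 + s" by (simp add: x(1) axis_nth3)
    have "\<not> y $ 1 \<le> real_of_int (p $ 1) + 1"
    proof
      assume "y $ 1 \<le> real_of_int (p $ 1) + 1"
      then have "real_of_int (p $ j) \<le> y $ j \<and> y $ j \<le> ?h j" for j
        using xj[of j] yj[of j] y1 x(3) i by (cases "j = 1") auto
      then have "y \<in> X" unfolding X_def domino_box by blast
      then show False using x(4) by blast
    qed
    then show ?thesis using xj yj by auto
  qed
  have "?T \<subseteq> Y"
  proof
    fix y assume y: "y \<in> ?T"
    define x where "x = y - (y $ 1 - real_of_int (p $ 1)) *\<^sub>R axis 1 1"
    have x1: "x $ 1 = real_of_int (p $ 1)" by (simp add: x_def axis_nth3)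
    have xj: "x $ j = y $ j" if "j \<noteq> 1" for j using that by (simp add: x_def axis_nth3)
    have "real_of_int (p $ j) \<le> x $ j \<and> x $ j \<le> ?h j" for j
      using y x1 xj[of j] i by (cases "j = 1") (auto intro: less_imp_le)
    then have "x \<in> X" unfolding X_def domino_box by blast
    moreover have "y = x + (y $ 1 - real_of_int (p $ 1)) *\<^sub>R axis 1 1" by (simp add: x_def)
    moreover have "0 \<le> y $ 1 - real_of_int (p $ 1)" using y by simp
    moreover have "y \<notin> X"
    proof
      assume "y \<in> X"
      then have "y $ 1 \<le> ?h 1" unfolding X_def domino_box by blast
      then show False using y i by simp
    qed
    ultimately show "y \<in> Y" unfolding Y_def by blast
  qed
  moreover have "open ?T"
  proof -
    have eq: "?T = {x. real_of_int (p $ 1) + 1 < x $ 1} \<inter>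
      (\<Inter>j\<in>{j. j \<noteq> 1}. {x. real_of_int (p $ j) < x $ j} \<inter> {x. x $ j < ?h j})"
    proof (rule Set.set_eqI)
      fix x :: "real^3"
      show "x \<in> ?T \<longleftrightarrow> x \<in> {x. real_of_int (p $ 1) + 1 < x $ 1} \<inter>
        (\<Inter>j\<in>{j. j \<noteq> 1}. {x. real_of_int (p $ j) < x $ j} \<inter> {x. x $ j < ?h j})"
        by (simp only: mem_Collect_eq Int_iff INT_iff) blast
    qed
    show ?thesis unfolding eq
      by (intro open_Int open_INT ballI open_halfspace_component_lt_cart open_halfspace_component_gt_cart
          open_Collect_less continuous_intros) auto
  qed
  ultimately have "?T \<subseteq> interior Y" by (rule interior_maximal)
  moreover have "interior Y \<subseteq> ?T"
  proof
    fix y assume y: "y \<in> interior Y"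
    have "real_of_int (p $ j) < y $ j \<and> y $ j < ?h j" if j: "j \<noteq> 1" for j
    proof -
      have "Y \<subseteq> {x. real_of_int (p $ j) \<le> x $ j}" "Y \<subseteq> {x. x $ j \<le> ?h j}" using Ysub j by blast+
      then have "y \<in> interior {x. real_of_int (p $ j) \<le> x $ j}" "y \<in> interior {x. x $ j \<le> ?h j}"
        using y interior_mono by blast+
      then show ?thesis
        by (simp add: interior_halfspace_component_le interior_halfspace_component_ge)
    qed
    moreover have "real_of_int (p $ 1) + 1 < y $ 1" using Ysub y interior_subset by blast
    ultimately show "y \<in> ?T" by blast
  qed
  ultimately show ?thesis unfolding shade_def X_def[symmetric] Y_def[symmetric] by blast
qed

text \<open>The shadow has integral bounds, so if it meets a unit cube then it contains the center
  of that cube. This makes the condition one on cells.\<close>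

lemma hit_iff:
  assumes i: "i \<noteq> 1"
  shows "cubes e1 \<inter> shade (axis 1 1) (cubes {p, p + axis i 1}) \<noteq> {} \<longleftrightarrow> hit {p, p + axis i 1} e1"
proof -
  have cubeq: "unit_cube q \<inter> shade (axis 1 1) (cubes {p, p + axis i 1}) \<noteq> {} \<longleftrightarrow>
     p $ 1 < q $ 1 \<and> (\<forall>j. j \<noteq> 1 \<longrightarrow> q $ j = p $ j \<or> (j = i \<and> q $ j = p $ j + 1))" for q
  proof
    assume "unit_cube q \<inter> shade (axis 1 1) (cubes {p, p + axis i 1}) \<noteq> {}"
    then obtain x where x: "x \<in> unit_cube q" "real_of_int (p $ 1) + 1 < x $ 1"
      "\<And>j. j \<noteq> 1 \<Longrightarrow> real_of_int (p $ j) < x $ j \<and> x $ j < real_of_int (p $ j) + (if j = i then 2 else 1)"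
      unfolding shade_domino[OF i] by blast
    have xq: "real_of_int (q $ j) \<le> x $ j" "x $ j \<le> real_of_int (q $ j) + 1" for j
      using x(1) by (auto simp: mem_unit_cube)
    have "p $ 1 < q $ 1" using x(2) xq(2)[of 1] by linarith
    moreover have "q $ j = p $ j \<or> (j = i \<and> q $ j = p $ j + 1)" if j: "j \<noteq> 1" for j
    proof (cases "j = i")
      case True
      then have "real_of_int (p $ j) < x $ j" "x $ j < real_of_int (p $ j) + 2" using x(3)[OF j] by auto
      then have "q $ j < p $ j + 2" "p $ j < q $ j + 1" using xq[of j] by linarith+
      then show ?thesis using True by auto
    next
      case False
      then have "real_of_int (p $ j) < x $ j" "x $ j < real_of_int (p $ j) + 1" using x(3)[OF j] by auto
      then have "q $ j < p $ j + 1" "p $ j < q $ j + 1" using xq[of j] by linarith+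
      then show ?thesis by auto
    qed
    ultimately show "p $ 1 < q $ 1 \<and> (\<forall>j. j \<noteq> 1 \<longrightarrow> q $ j = p $ j \<or> (j = i \<and> q $ j = p $ j + 1))" by blast
  next
    assume q: "p $ 1 < q $ 1 \<and> (\<forall>j. j \<noteq> 1 \<longrightarrow> q $ j = p $ j \<or> (j = i \<and> q $ j = p $ j + 1))"
    have "cube_center q \<in> unit_cube q" by (simp add: center_in_unit_cube)
    moreover have "cube_center q \<in> shade (axis 1 1) (cubes {p, p + axis i 1})"
      unfolding shade_domino[OF i] mem_Collect_eq center_nth
    proof (intro conjI allI impI)
      show "real_of_int (p $ 1) + 1 < real_of_int (q $ 1) + 1 / 2" using q by linarith
      fix j :: 3 assume "j \<noteq> 1"
      then have "q $ j = p $ j \<or> (j = i \<and> q $ j = p $ j + 1)" using q by blast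
      then show "real_of_int (p $ j) < real_of_int (q $ j) + 1 / 2"
        "real_of_int (q $ j) + 1 / 2 < real_of_int (p $ j) + (if j = i then 2 else 1)" by auto
    qed
    ultimately show "unit_cube q \<inter> shade (axis 1 1) (cubes {p, p + axis i 1}) \<noteq> {}" by blast
  qed
  have "hit {p, p + axis i 1} e1 \<longleftrightarrow> (\<exists>q\<in>e1. p $ 1 < q $ 1 \<and> (\<forall>j. j \<noteq> 1 \<longrightarrow> q $ j = p $ j \<or> (j = i \<and> q $ j = p $ j + 1)))"
    (is "_ \<longleftrightarrow> (\<exists>q\<in>e1. ?P q)")
  proof -
    consider "i = 2" | "i = 3" using i exhaust_3[of i] by auto
    then have "?P q \<longleftrightarrow> (\<exists>r\<in>{p, p + axis i 1}. r $ 1 < q $ 1 \<and> q $ 2 = r $ 2 \<and> q $ 3 = r $ 3)" for q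
      by cases (auto simp: forall_3 axis_nth3)
    then show ?thesis unfolding hit_def by blast
  qed
  moreover have "cubes e1 \<inter> shade (axis 1 1) (cubes {p, p + axis i 1}) \<noteq> {} \<longleftrightarrow>
     (\<exists>q\<in>e1. unit_cube q \<inter> shade (axis 1 1) (cubes {p, p + axis i 1}) \<noteq> {})" by (auto simp: cubes_def)
  ultimately show ?thesis using cubeq by simp
qed

lemma tau_cubes:
  "tau (axis 1 1) (cubes {p, p + axis i 1}) (cubes {q, q + axis j 1}) =
    (if j = 3 \<and> i = 2 \<and> hit {p, p + axis i 1} {q, q + axis j 1} then - cell_sign p * cell_sign q / 4
     else if j = 2 \<and> i = 3 \<and> hit {p, p + axis i 1} {q, q + axis j 1} then cell_sign p * cell_sign q / 4 else 0)"
proof (cases "i = 1")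
  case True
  then show ?thesis by (simp add: tau_def domino_vec_cubes det_axis)
next
  case False
  show ?thesis unfolding tau_def hit_iff[OF False] domino_vec_cubes det_axis by auto
qed

subsection \<open>Sums over a stack of floors\<close>

definition ybar :: "int \<Rightarrow> int \<times> int \<Rightarrow> (int^3) set" where
  "ybar z c = lift_domino z {c, north c}"

lemma ybar_cells: "ybar z c = {cell c z, cell c z + axis 2 1}"
  by (cases c) (simp add: ybar_def lift_domino_def north_def cell_axis)

lemma pillar_cells: "pillar z c = {cell c z, cell c z + axis 3 1}"
  by (cases c) (simp add: pillar_def cell_axis)

lemma cell_sign_cell: "cell_sign (cell c z) = - of_int (chi c) * (if even z then 1 else -1)"
  by (auto simp: cell_sign_def black_def chi_def)

text \<open>The first argument is a bar, the second a pillar, each with the level of its lowest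
  cells. A pillar starting on the level of the bar counts positively, one arriving there from below
  negatively.\<close>

definition overlap :: "(int \<times> int) \<times> int \<Rightarrow> (int \<times> int) \<times> int \<Rightarrow> int" where
  "overlap a b = ker (fst a) (fst b) * (of_bool (snd b = snd a) - of_bool (snd b = snd a - 1))"

text \<open>At most one of the two dominoes lies in the shadow of the other, and the determinants of
  the two orders have opposite signs; both cases together produce the \<open>sgn\<close> in
  \<open>ker\<close>.\<close>

lemma tau_bar_pillar:
  "tau (axis 1 1) (cubes (ybar z c)) (cubes (pillar w d)) + tau (axis 1 1) (cubes (pillar w d)) (cubes (ybar z c)) =
     of_int (overlap (c, z) (d, w)) / 4"
proof -
  define ov where "ov \<longleftrightarrow> (snd d = snd c \<or> snd d = snd c + 1) \<and> (z = w \<or> z = w + 1)"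
  have h1: "hit (ybar z c) (pillar w d) \<longleftrightarrow> fst c < fst d \<and> ov"
    by (auto simp: hit_def ybar_def lift_domino_def pillar_def north_def ov_def)
  have h2: "hit (pillar w d) (ybar z c) \<longleftrightarrow> fst d < fst c \<and> ov"
    by (auto simp: hit_def ybar_def lift_domino_def pillar_def north_def ov_def)
  have 1: "tau (axis 1 1) (cubes (ybar z c)) (cubes (pillar w d)) =
    (if fst c < fst d \<and> ov then - cell_sign (cell c z) * cell_sign (cell d w) / 4 else 0)"
    unfolding h1[symmetric] unfolding ybar_cells pillar_cells tau_cubes by simp
  have 2: "tau (axis 1 1) (cubes (pillar w d)) (cubes (ybar z c)) =
    (if fst d < fst c \<and> ov then cell_sign (cell d w) * cell_sign (cell c z) / 4 else 0)"
    unfolding h2[symmetric] unfolding ybar_cells pillar_cells tau_cubes by simp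
  show ?thesis
  proof (cases ov)
    case True
    then have y: "snd d = snd c \<or> snd d = snd c + 1" and zw: "w = z \<or> w = z - 1" by (auto simp: ov_def)
    have "overlap (c, z) (d, w) = chi c * sgn (fst c - fst d) * chi d * (if w = z then 1 else -1)"
      using y zw by (auto simp: overlap_def ker_def)
    moreover have "cell_sign (cell c z) * cell_sign (cell d w) = of_int (chi c * chi d) * (if w = z then 1 else -1)"
      using zw by (auto simp: cell_sign_cell)
    ultimately show ?thesis unfolding 1 2 using True
      by (cases "fst c" "fst d" rule: linorder_cases) (auto simp: mult.commute)
  next
    case False
    then have "overlap (c, z) (d, w) = 0" by (auto simp: overlap_def ker_def ov_def)
    then show ?thesis unfolding 1 2 using False by simp
  qed
qed

context board begin

fun bars :: "int \<Rightarrow> (int \<times> int) set \<Rightarrow> (int \<times> int) set set list \<Rightarrow> ((int \<times> int) \<times> int) set" where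
  "bars z p [] = {}"
| "bars z p (f # fs) = (\<lambda>c. (c, z)) ` ylow f \<union> bars (z + 1) (next_plug p f) fs"

fun posts :: "int \<Rightarrow> (int \<times> int) set \<Rightarrow> (int \<times> int) set set list \<Rightarrow> ((int \<times> int) \<times> int) set" where
  "posts z p [] = {}"
| "posts z p (f # fs) = (\<lambda>c. (c, z)) ` next_plug p f \<union> posts (z + 1) (next_plug p f) fs"

lemma bars_level: "a \<in> bars z p fs \<Longrightarrow> z \<le> snd a"
  by (induction fs arbitrary: z p) fastforce+

lemma posts_level: "a \<in> posts z p fs \<Longrightarrow> z \<le> snd a"
  by (induction fs arbitrary: z p) fastforce+

lemma finite_plug: "p \<subseteq> D \<Longrightarrow> finite p"
  using finite_D finite_subset by blast

lemma finite_bars: "legit p fs \<Longrightarrow> finite (bars z p fs)"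
  by (induction fs arbitrary: z p) (auto simp: finite_ylow)

lemma finite_posts: "finite (posts z p fs)"
  by (induction fs arbitrary: z p) (auto simp: finite_plug)

lemma finite_stack: "legit p fs \<Longrightarrow> finite (stack z p fs)"
  by (induction fs arbitrary: z p) (auto simp: layer_def finite_plug floor_ok_finite)

text \<open>The plug below the first floor enters as pillars that start on a fictitious level
  \<open>z - 1\<close>; this makes the statement fit for induction.\<close>

lemma tw4_overlap:
  "legit p fs \<Longrightarrow> tw4 p fs = (\<Sum>a\<in>bars z p fs. \<Sum>b\<in>posts z p fs \<union> (\<lambda>c. (c, z - 1)) ` p. overlap a b)"
proof (induction fs arbitrary: z p)
  case Nil
  then show ?case by simp
next
  case (Cons f fs)
  define q where "q = next_plug p f"
  have l: "p \<subseteq> D" "floor_ok p f" "legit q fs" "q \<subseteq> D" using Cons.prems by (auto simp: q_def)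
  define B P where "B = bars (z + 1) q fs" and "P = posts (z + 1) q fs"
  let ?at = "\<lambda>h A. (\<lambda>c. (c :: int \<times> int, h :: int)) ` A"
  have fin: "finite B" "finite P" "finite (ylow f)" "finite p" "finite q"
    using l finite_bars finite_posts finite_ylow finite_plug by (auto simp: B_def P_def)
  have Bl: "z + 1 \<le> snd a" if "a \<in> B" for a using bars_level that by (auto simp: B_def)
  have Pl: "z + 1 \<le> snd a" if "a \<in> P" for a using posts_level that by (auto simp: P_def)
  define S where "S = (?at z q \<union> P) \<union> ?at (z - 1) p"
  have finS: "finite S" using fin by (simp add: S_def)
  have s1: "(\<Sum>a\<in>?at z (ylow f). \<Sum>b\<in>S. overlap a b) = weight p f"
  proof -
    have inner: "(\<Sum>b\<in>S. overlap (c, z) b) = (\<Sum>e\<in>q. ker c e) - (\<Sum>e\<in>p. ker c e)" for c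
    proof -
      have "(\<Sum>b\<in>S. overlap (c, z) b) = (\<Sum>b\<in>?at z q \<union> ?at (z - 1) p. overlap (c, z) b)"
        using finS Pl by (intro sum.mono_neutral_right) (fastforce simp: S_def overlap_def)+
      also have "\<dots> = (\<Sum>b\<in>?at z q. overlap (c, z) b) + (\<Sum>b\<in>?at (z - 1) p. overlap (c, z) b)"
        using fin by (intro sum.union_disjoint) auto
      also have "(\<Sum>b\<in>?at z q. overlap (c, z) b) = (\<Sum>e\<in>q. ker c e)"
        by (subst sum.reindex) (auto simp: inj_on_def overlap_def)
      also have "(\<Sum>b\<in>?at (z - 1) p. overlap (c, z) b) = - (\<Sum>e\<in>p. ker c e)"
        by (subst sum.reindex) (auto simp: inj_on_def overlap_def sum_negf)
      finally show ?thesis by simp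
    qed
    have "(\<Sum>a\<in>?at z (ylow f). \<Sum>b\<in>S. overlap a b) = (\<Sum>c\<in>ylow f. \<Sum>b\<in>S. overlap (c, z) b)"
      by (subst sum.reindex) (auto simp: inj_on_def)
    also have "\<dots> = (\<Sum>c\<in>ylow f. (\<Sum>e\<in>q. ker c e) - (\<Sum>e\<in>p. ker c e))" by (simp add: inner)
    also have "\<dots> = weight p f"
      using sum_of_bool[OF finite_D l(1)] sum_of_bool[OF finite_D l(4)]
      by (simp add: weight_def q_def[symmetric] right_diff_distrib sum_subtractf sum_negf[symmetric])
    finally show ?thesis .
  qed
  have s2: "(\<Sum>a\<in>B. \<Sum>b\<in>S. overlap a b) = tw4 q fs"
  proof -
    have "(\<Sum>b\<in>S. overlap a b) = (\<Sum>b\<in>P \<union> ?at z q. overlap a b)" if "a \<in> B" for a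
      using finS Bl[OF that] by (intro sum.mono_neutral_right) (auto simp: S_def overlap_def)
    then have "(\<Sum>a\<in>B. \<Sum>b\<in>S. overlap a b) = (\<Sum>a\<in>B. \<Sum>b\<in>P \<union> ?at z q. overlap a b)" by simp
    also have "\<dots> = tw4 q fs" using Cons.IH[OF l(3), of "z + 1"] by (simp add: B_def P_def)
    finally show ?thesis .
  qed
  have "(\<Sum>a\<in>bars z p (f # fs). \<Sum>b\<in>posts z p (f # fs) \<union> ?at (z - 1) p. overlap a b) =
     (\<Sum>a\<in>?at z (ylow f) \<union> B. \<Sum>b\<in>S. overlap a b)"
    by (simp add: B_def P_def S_def q_def)
  also have "\<dots> = (\<Sum>a\<in>?at z (ylow f). \<Sum>b\<in>S. overlap a b) + (\<Sum>a\<in>B. \<Sum>b\<in>S. overlap a b)"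
    using fin Bl by (intro sum.union_disjoint) fastforce+
  finally show ?case using s1 s2 by (simp add: q_def)
qed

lemma bars_in_stack: "a \<in> bars z p fs \<Longrightarrow> ybar (snd a) (fst a) \<in> stack z p fs"
  by (induction fs arbitrary: z p) (auto simp: layer_def ybar_def ylow_def)

lemma posts_in_stack: "a \<in> posts z p fs \<Longrightarrow> pillar (snd a) (fst a) \<in> stack z p fs"
  by (induction fs arbitrary: z p) (auto simp: layer_def)

lemma stack_elements:
  assumes "legit p fs" "e \<in> stack z p fs"
  shows "(\<exists>a\<in>bars z p fs. e = ybar (snd a) (fst a)) \<or> (\<exists>a\<in>posts z p fs. e = pillar (snd a) (fst a)) \<or>
    (\<exists>q. e = {q, q + axis 1 1})"
  using assms
proof (induction fs arbitrary: z p)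
  case (Cons f fs)
  from Cons.prems(2) consider d where "d \<in> f" "e = lift_domino z d" | c where "c \<in> next_plug p f" "e = pillar z c"
    | "e \<in> stack (z + 1) (next_plug p f) fs" by (auto simp: layer_def)
  then show ?case
  proof cases
    case 1
    then have "planar_domino d" using Cons.prems(1) by (auto simp: floor_ok_def)
    then show ?thesis
    proof (cases rule: planar_cases)
      case (1 c)
      then show ?thesis using \<open>d \<in> f\<close> \<open>e = lift_domino z d\<close>
        by (intro disjI1 bexI[of _ "(c, z)"]) (auto simp: ybar_def ylow_def)
    next
      case (2 x y)
      then have "e = {cell (x, y) z, cell (x, y) z + axis 1 1}"
        using \<open>e = lift_domino z d\<close> by (simp add: lift_domino_def cell_axis)
      then show ?thesis by blast
    qed
  next
    case 2
    then show ?thesis by (intro disjI2 disjI1 bexI[of _ "(c, z)"]) auto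
  next
    case 3
    then show ?thesis using Cons.IH[of "next_plug p f" "z + 1"] Cons.prems(1) by auto
  qed
qed simp

text \<open>Dominoes in the first direction and pairs of equal direction have vanishing determinant.
  The remaining ordered pairs consist of a bar and a pillar, and the two orders are added
  together.\<close>

theorem tau_sum:
  assumes l: "legit {} xs"
  shows "(\<Sum>d0\<in>tiling_of xs. \<Sum>d1\<in>tiling_of xs. tau (axis 1 1) d0 d1) = of_int (tw4 {} xs) / 4"
proof -
  define m where "m = stack 0 {} xs"
  define Y P where "Y = bars 0 {} xs" and "P = posts 0 {} xs"
  define A B where "A = (\<lambda>a. ybar (snd a) (fst a)) ` Y" and "B = (\<lambda>a. pillar (snd a) (fst a)) ` P"
  have fin: "finite m" "finite Y" "finite P" using l finite_stack finite_bars finite_posts by (auto simp: m_def Y_def P_def)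
  have sub: "A \<subseteq> m" "B \<subseteq> m" using bars_in_stack posts_in_stack by (auto simp: A_def B_def Y_def P_def m_def)
  have injY: "inj_on (\<lambda>a. ybar (snd a) (fst a)) Y"
    by (auto simp: inj_on_def ybar_def lift_eq_iff north_inj)
  have injP: "inj_on (\<lambda>a. pillar (snd a) (fst a)) P" by (auto simp: inj_on_def)
  have dAB: "A \<inter> B = {}" using lift_not_pillar by (auto simp: A_def B_def ybar_def)
  let ?t = "\<lambda>a b. tau (axis 1 1) (cubes a) (cubes b)"
  have el: "a \<in> A \<or> a \<in> B \<or> (\<exists>q. a = {q, q + axis 1 1})" if "a \<in> m" for a
    using stack_elements[OF l, of a 0] that by (auto simp: A_def B_def Y_def P_def m_def)
  have ed: "\<exists>r j. b = {r, r + axis j 1}" if "b \<in> m" for b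
    using stack_tiling[OF l, of 0] that unfolding cell_tiling_def m_def by blast
  have x0: "?t {q, q + axis 1 1} b = 0" if b: "b \<in> m" for q b
  proof -
    obtain r j where "b = {r, r + axis j 1}" using ed[OF b] by blast
    then show ?thesis by (simp add: tau_cubes)
  qed
  have x1: "?t b {q, q + axis 1 1} = 0" if b: "b \<in> m" for q b
  proof -
    obtain r j where "b = {r, r + axis j 1}" using ed[OF b] by blast
    then show ?thesis by (simp add: tau_cubes)
  qed
  have AA: "?t a b = 0" if "a \<in> A" "b \<in> A" for a b using that by (auto simp: A_def ybar_cells tau_cubes)
  have BB: "?t a b = 0" if "a \<in> B" "b \<in> B" for a b using that by (auto simp: B_def pillar_cells tau_cubes)
  have inA: "(\<Sum>b\<in>m. ?t a b) = (\<Sum>b\<in>B. ?t a b)" if "a \<in> A" for a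
  proof (rule sum.mono_neutral_right[OF fin(1) sub(2)], rule ballI)
    fix b assume b: "b \<in> m - B"
    then consider "b \<in> A" | q where "b = {q, q + axis 1 1}" using el by blast
    then show "?t a b = 0" by cases (use AA that x1 sub in auto)
  qed
  have inB: "(\<Sum>b\<in>m. ?t a b) = (\<Sum>b\<in>A. ?t a b)" if "a \<in> B" for a
  proof (rule sum.mono_neutral_right[OF fin(1) sub(1)], rule ballI)
    fix b assume b: "b \<in> m - A"
    then consider "b \<in> B" | q where "b = {q, q + axis 1 1}" using el by blast
    then show "?t a b = 0" by cases (use BB that x1 sub in auto)
  qed
  have "(\<Sum>d0\<in>tiling_of xs. \<Sum>d1\<in>tiling_of xs. tau (axis 1 1) d0 d1) = (\<Sum>a\<in>m. \<Sum>b\<in>m. ?t a b)"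
    unfolding tiling_of_def m_def[symmetric]
    using inj_cubes by (simp add: sum.reindex inj_on_def inj_def)
  also have "\<dots> = (\<Sum>a\<in>A \<union> B. \<Sum>b\<in>m. ?t a b)"
  proof (rule sum.mono_neutral_right[OF fin(1)])
    show "A \<union> B \<subseteq> m" using sub by blast
    show "\<forall>a\<in>m - (A \<union> B). (\<Sum>b\<in>m. ?t a b) = 0"
    proof
      fix a assume "a \<in> m - (A \<union> B)"
      then obtain q where "a = {q, q + axis 1 1}" using el by blast
      then show "(\<Sum>b\<in>m. ?t a b) = 0" using x0 by (intro sum.neutral) auto
    qed
  qed
  also have "\<dots> = (\<Sum>a\<in>A. \<Sum>b\<in>m. ?t a b) + (\<Sum>a\<in>B. \<Sum>b\<in>m. ?t a b)"
    using fin dAB by (intro sum.union_disjoint) (auto simp: A_def B_def)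
  also have "\<dots> = (\<Sum>a\<in>A. \<Sum>b\<in>B. ?t a b) + (\<Sum>a\<in>B. \<Sum>b\<in>A. ?t a b)" by (simp add: inA inB)
  also have "(\<Sum>a\<in>B. \<Sum>b\<in>A. ?t a b) = (\<Sum>b\<in>A. \<Sum>a\<in>B. ?t a b)" by (rule sum.swap)
  also have "(\<Sum>a\<in>A. \<Sum>b\<in>B. ?t a b) + (\<Sum>b\<in>A. \<Sum>a\<in>B. ?t a b) = (\<Sum>a\<in>A. \<Sum>b\<in>B. ?t a b + ?t b a)"
    by (simp add: sum.distrib)
  also have "\<dots> = (\<Sum>a\<in>Y. \<Sum>b\<in>P. of_int (overlap a b) / 4)"
    unfolding A_def B_def using injY injP
    by (simp add: sum.reindex tau_bar_pillar)
  also have "\<dots> = of_int (\<Sum>a\<in>Y. \<Sum>b\<in>P. overlap a b) / 4" by (simp add: sum_divide_distrib)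
  also have "(\<Sum>a\<in>Y. \<Sum>b\<in>P. overlap a b) = tw4 {} xs" using tw4_overlap[OF l, of 0] by (simp add: Y_def P_def)
  finally show ?thesis .
qed

end

section \<open>Cylinders over a rectangle\<close>

lemma unit_interval_cover:
  fixes x :: real
  assumes "0 < n" "0 \<le> x" "x \<le> real n"
  shows "\<exists>k. 0 \<le> k \<and> k < int n \<and> real_of_int k \<le> x \<and> x \<le> real_of_int k + 1"
proof (cases "x = real n")
  case True
  then show ?thesis using assms by (intro exI[of _ "int n - 1"]) auto
next
  case False
  have "x < real_of_int (int n)" using False assms by simp
  then have "\<lfloor>x\<rfloor> < int n" by (rule iffD2[OF floor_less_iff])
  moreover have "x \<le> real_of_int \<lfloor>x\<rfloor> + 1" by linarith
  ultimately show ?thesis using assms by (intro exI[of _ "\<lfloor>x\<rfloor>"]) auto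
qed

abbreviation real_rect :: "nat \<Rightarrow> nat \<Rightarrow> (real \<times> real) set" where
  "real_rect L M \<equiv> {0..real L} \<times> {0..real M}"

lemma mem_rect: "c \<in> rect L M \<longleftrightarrow> 0 \<le> fst c \<and> fst c < int L \<and> 0 \<le> snd c \<and> snd c < int M"
  by (auto simp: rect_def mem_Times_iff)

lemma mem_cylinder:
  "x \<in> cylinder (real_rect L M) N \<longleftrightarrow>
     0 \<le> x $ 1 \<and> x $ 1 \<le> real L \<and> 0 \<le> x $ 2 \<and> x $ 2 \<le> real M \<and> 0 \<le> x $ 3 \<and> x $ 3 \<le> real N"
  by (auto simp: cylinder_def)

lemma unit_cube_subset_cylinder:
  "unit_cube p \<subseteq> cylinder (real_rect L M) N \<longleftrightarrow> p \<in> column_box (rect L M) 0 N"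
proof
  assume s: "unit_cube p \<subseteq> cylinder (real_rect L M) N"
  obtain c z where p: "p = cell c z" by (rule cell_surj)
  have "corner p \<in> unit_cube p" "corner p + 1 \<in> unit_cube p" by (simp_all add: mem_unit_cube corner_def)
  then have "corner p \<in> cylinder (real_rect L M) N" "corner p + 1 \<in> cylinder (real_rect L M) N" using s by blast+
  then show "p \<in> column_box (rect L M) 0 N"
    by (simp add: p mem_cylinder corner_def mem_rect)
next
  assume b: "p \<in> column_box (rect L M) 0 N"
  obtain c z where p: "p = cell c z" by (rule cell_surj)
  have "0 \<le> fst c \<and> fst c + 1 \<le> int L \<and> 0 \<le> snd c \<and> snd c + 1 \<le> int M \<and> 0 \<le> z \<and> z + 1 \<le> int N"
    using b by (auto simp: p mem_rect)
  then have "0 \<le> real_of_int (fst c) \<and> real_of_int (fst c) + 1 \<le> real L \<and> 0 \<le> real_of_int (snd c) \<and>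
    real_of_int (snd c) + 1 \<le> real M \<and> 0 \<le> real_of_int z \<and> real_of_int z + 1 \<le> real N" by linarith
  then show "unit_cube p \<subseteq> cylinder (real_rect L M) N"
    by (auto simp: p mem_cylinder mem_unit_cube forall_3)
qed

text \<open>Positive height matters: for \<open>N = 0\<close> the cylinder is a flat rectangle,
  while the union of no cubes is empty.\<close>

lemma cylinder_cubes:
  assumes "0 < L" "0 < M" "0 < N"
  shows "cylinder (real_rect L M) N = cubes (column_box (rect L M) 0 N)"
proof
  show "cubes (column_box (rect L M) 0 N) \<subseteq> cylinder (real_rect L M) N"
    unfolding cubes_def using unit_cube_subset_cylinder by blast
  show "cylinder (real_rect L M) N \<subseteq> cubes (column_box (rect L M) 0 N)"
  proof
    fix x assume "x \<in> cylinder (real_rect L M) N"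
    then obtain a b h where
      "0 \<le> a \<and> a < int L \<and> real_of_int a \<le> x $ 1 \<and> x $ 1 \<le> real_of_int a + 1"
      "0 \<le> b \<and> b < int M \<and> real_of_int b \<le> x $ 2 \<and> x $ 2 \<le> real_of_int b + 1"
      "0 \<le> h \<and> h < int N \<and> real_of_int h \<le> x $ 3 \<and> x $ 3 \<le> real_of_int h + 1"
      unfolding mem_cylinder using unit_interval_cover assms by metis
    then have "cell (a, b) h \<in> column_box (rect L M) 0 N" "x \<in> unit_cube (cell (a, b) h)"
      by (auto simp: mem_rect mem_unit_cube forall_3)
    then show "x \<in> cubes (column_box (rect L M) 0 N)" unfolding cubes_def by blast
  qed
qed

lemma unit_cube_add: "unit_cube (v + p) = (+) (corner v) ` unit_cube p"
proof -
  have "corner (v + p) = corner v + corner p" by (simp add: corner_def vec_eq_iff)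
  then show ?thesis by (simp add: unit_cube_def cbox_translation add.assoc)
qed

lemma cubes_add: "cubes ((+) v ` e) = (+) (corner v) ` cubes e"
  by (auto simp: cubes_def unit_cube_add)

lemma corner_axis: "corner (axis 3 (int k)) = axis 3 (real k)"
  by (simp add: corner_def vec_eq_iff axis_def)

lemma cell_raise: "axis 3 k + cell c z = cell c (z + k)"
  by (simp add: vec_eq_iff forall_3 axis_def)

context board begin

lemma layer_shift: "layer (z + k) p f = (\<lambda>e. (+) (axis 3 k) ` e) ` layer z p f"
proof -
  have "lift_domino (z + k) d = (+) (axis 3 k) ` lift_domino z d" for d
    by (simp add: lift_domino_def image_image cell_raise)
  moreover have "pillar (z + k) c = (+) (axis 3 k) ` pillar z c" for c
    unfolding pillar_def image_insert image_empty cell_raise by (simp add: add.commute add.left_commute)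
  ultimately show ?thesis by (simp add: layer_def image_Un image_image)
qed

lemma stack_shift: "stack (z + k) p xs = (\<lambda>e. (+) (axis 3 k) ` e) ` stack z p xs"
proof (induction xs arbitrary: z p)
  case (Cons f xs)
  have "z + k + 1 = z + 1 + k" by simp
  then show ?case by (simp only: stack.simps image_Un layer_shift Cons)
qed simp

lemma concat_tiling_of:
  assumes "fin {} xs = {}"
  shows "concat_tiling (length xs, tiling_of xs) (length ys, tiling_of ys) = (length (xs @ ys), tiling_of (xs @ ys))"
  using stack_shift[of 0 "int (length xs)" "{}" ys] assms
  by (simp add: tiling_of_def stack_append image_Un image_image cubes_add corner_axis)

lemma stack_vert: "stack z {} (vert (2 * n)) = {pillar w c | w c. c \<in> D \<and> z \<le> w \<and> w < z + 2 * int n \<and> even (w - z)}"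
proof (induction n arbitrary: z)
  case (Suc n)
  have "stack z {} (vert (2 * Suc n)) = pillar z ` D \<union> stack (z + 2) {} (vert (2 * n))"
    by (simp add: layer_def next_plug_def add.commute)
  also have "\<dots> = {pillar w c | w c. c \<in> D \<and> z \<le> w \<and> w < z + 2 * int (Suc n) \<and> even (w - z)}" (is "?A = ?B")
  proof
    show "?A \<subseteq> ?B"
    proof
      fix e assume "e \<in> ?A"
      then obtain w c where "e = pillar w c" "c \<in> D" "w = z \<or> z + 2 \<le> w \<and> w < z + 2 + 2 * int n \<and> even (w - (z + 2))"
        unfolding Suc by blast
      then show "e \<in> ?B" by (intro CollectI exI[of _ w] exI[of _ c]) auto
    qed
    show "?B \<subseteq> ?A"
    proof
      fix e assume "e \<in> ?B"
      then obtain w c where e: "e = pillar w c" "c \<in> D" "z \<le> w" "w < z + 2 * int (Suc n)" "even (w - z)" by blast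
      then have "w = z \<or> z + 2 \<le> w \<and> w < z + 2 + 2 * int n \<and> even (w - (z + 2))" by simp presburger
      then show "e \<in> ?A" unfolding Suc using e(1,2) by blast
    qed
  qed
  finally show ?case .
qed simp

end

lemma (in board) vert_tiling_of:
  assumes D: "D = rect L M" and N: "even N"
  shows "vert_tiling (real_rect L M) N = tiling_of (vert N)"
proof -
  obtain n where n: "N = 2 * n" using N by blast
  have sub: "unit_cube p \<union> unit_cube (p + axis 3 1) \<subseteq> cylinder (real_rect L M) N \<longleftrightarrow>
     p \<in> column_box D 0 N \<and> p + axis 3 1 \<in> column_box D 0 N" for p
    unfolding Un_subset_iff unit_cube_subset_cylinder D ..
  have pc: "cubes (pillar w c) = unit_cube (cell c w) \<union> unit_cube (cell c w + axis 3 1)" for w c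
    by (cases c) (simp add: pillar_def cubes_def cell_axis)
  have st: "tiling_of (vert N) = {cubes (pillar w c) | w c. c \<in> D \<and> 0 \<le> w \<and> w < int N \<and> even w}"
    unfolding tiling_of_def n stack_vert by auto
  show ?thesis
  proof (rule Set.set_eqI)
    fix d
    have "d \<in> vert_tiling (real_rect L M) N \<longleftrightarrow>
      (\<exists>p. even (p $ 3) \<and> d = unit_cube p \<union> unit_cube (p + axis 3 1) \<and> p \<in> column_box D 0 N \<and> p + axis 3 1 \<in> column_box D 0 N)"
      unfolding vert_tiling_def using sub by blast
    also have "\<dots> \<longleftrightarrow> (\<exists>w c. even w \<and> d = cubes (pillar w c) \<and> c \<in> D \<and> 0 \<le> w \<and> w < int N)"
    proof
      assume "\<exists>p. even (p $ 3) \<and> d = unit_cube p \<union> unit_cube (p + axis 3 1) \<and> p \<in> column_box D 0 N \<and> p + axis 3 1 \<in> column_box D 0 N"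
      then obtain p where p: "even (p $ 3)" "d = unit_cube p \<union> unit_cube (p + axis 3 1)" "p \<in> column_box D 0 N" by blast
      obtain c z where "p = cell c z" by (rule cell_surj)
      then show "\<exists>w c. even w \<and> d = cubes (pillar w c) \<and> c \<in> D \<and> 0 \<le> w \<and> w < int N"
        using p by (intro exI[of _ z] exI[of _ c]) (simp add: pc)
    next
      assume "\<exists>w c. even w \<and> d = cubes (pillar w c) \<and> c \<in> D \<and> 0 \<le> w \<and> w < int N"
      then obtain w c where w: "even w" "d = cubes (pillar w c)" "c \<in> D" "0 \<le> w" "w < int N" by blast
      \<comment> \<open>Since \<open>w\<close> and \<open>N\<close> are both even, the upper cube of
        the pillar is still inside the cylinder.\<close>
      have w': "w + 1 < int N" using w(1,5) n by presburger
      obtain x y where c: "c = (x, y)" by (cases c)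
      show "\<exists>p. even (p $ 3) \<and> d = unit_cube p \<union> unit_cube (p + axis 3 1) \<and> p \<in> column_box D 0 N \<and> p + axis 3 1 \<in> column_box D 0 N"
        using w w' by (intro exI[of _ "cell c w"]) (simp add: pc c cell_axis)
    qed
    also have "\<dots> \<longleftrightarrow> d \<in> tiling_of (vert N)" unfolding st by auto
    finally show "d \<in> vert_tiling (real_rect L M) N \<longleftrightarrow> d \<in> tiling_of (vert N)" .
  qed
qed

section \<open>The domino group in terms of floors\<close>

locale rect_board =
  fixes L M :: nat
  assumes L: "0 < L" and M: "0 < M"
begin

sublocale board "rect L M"
  by unfold_locales (simp add: rect_def)

abbreviation Q :: "(real \<times> real) set" where
  "Q \<equiv> real_rect L M"

definition ctil :: "(int \<times> int) set set list \<Rightarrow> cyl_tiling" where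
  "ctil xs = (length xs, tiling_of xs)"

lemma ctil_eq_iff: "closed_floors xs \<Longrightarrow> closed_floors ys \<Longrightarrow> ctil xs = ctil ys \<longleftrightarrow> xs = ys"
  unfolding ctil_def using tiling_of_inj by auto

lemma cyl_tilings_iff: "x \<in> cyl_tilings Q \<longleftrightarrow> (\<exists>xs. closed_floors xs \<and> xs \<noteq> [] \<and> x = ctil xs)"
proof
  assume "x \<in> cyl_tilings Q"
  then obtain N t where x: "x = (N, t)" "1 \<le> N" "t \<in> tilings (cylinder Q N)" unfolding cyl_tilings_def by auto
  have "t \<in> tilings (cubes (column_box (rect L M) 0 N))" using x cylinder_cubes[OF L M, of N] by simp
  then obtain xs where "closed_floors xs" "length xs = N" "t = tiling_of xs" unfolding tilings_column by blast
  then show "\<exists>xs. closed_floors xs \<and> xs \<noteq> [] \<and> x = ctil xs" using x by (intro exI[of _ xs]) (auto simp: ctil_def)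
next
  assume "\<exists>xs. closed_floors xs \<and> xs \<noteq> [] \<and> x = ctil xs"
  then obtain xs where xs: "closed_floors xs" "xs \<noteq> []" "x = ctil xs" by blast
  then have "tiling_of xs \<in> tilings (cubes (column_box (rect L M) 0 (length xs)))" unfolding tilings_column by blast
  then show "x \<in> cyl_tilings Q" using xs cylinder_cubes[OF L M, of "length xs"] by (auto simp: ctil_def cyl_tilings_def Suc_le_eq)
qed

lemma concat_ctil: "closed_floors xs \<Longrightarrow> concat_tiling (ctil xs) (ctil ys) = ctil (xs @ ys)"
  unfolding ctil_def by (rule concat_tiling_of) (simp add: closed_floors_def)

lemma closed_append: "closed_floors xs \<Longrightarrow> closed_floors ys \<Longrightarrow> closed_floors (xs @ ys)"
  by (simp add: closed_floors_def)

lemma closed_vert: "even n \<Longrightarrow> closed_floors (vert n)"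
  by (simp add: closed_floors_def fin_vert)

lemma ctil_vert: "even n \<Longrightarrow> ctil (vert n) = (n, vert_tiling Q n)"
  using vert_tiling_of[OF refl, of n] by (simp add: ctil_def)

text \<open>Flips preserve the height, so the equality of the padded heights is automatic, and
  \<open>eqw_iff_vert\<close> replaces the padding by stable equivalence.\<close>

lemma tiling_rel_ctil:
  assumes c: "closed_floors xs" "closed_floors ys"
  shows "(ctil xs, ctil ys) \<in> tiling_rel Q \<longleftrightarrow> xs \<noteq> [] \<and> ys \<noteq> [] \<and> eqw True {} xs ys"
proof -
  have mem: "ctil zs \<in> cyl_tilings Q \<longleftrightarrow> zs \<noteq> []" if "closed_floors zs" for zs
    using that cyl_tilings_iff ctil_eq_iff by metis
  have l: "legit {} xs" "legit {} ys" using c by (simp_all add: closed_floors_def)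
  have v: "snd (concat_tiling (length zs, tiling_of zs) (n, vert_tiling Q n)) = tiling_of (zs @ vert n)"
    if "closed_floors zs" "even n" for zs n
    using concat_ctil[OF that(1), of "vert n"] ctil_vert[OF that(2)] by (simp add: ctil_def)
  have fl: "flip_connected (tiling_of (xs @ vert a)) (tiling_of (ys @ vert b)) \<longleftrightarrow> eqw False {} (xs @ vert a) (ys @ vert b)"
    if "even a" "even b" "length xs + a = length ys + b" for a b
    using that by (intro flip_connected_iff closed_append c closed_vert) simp_all
  have "(ctil xs, ctil ys) \<in> tiling_rel Q \<longleftrightarrow> ctil xs \<in> cyl_tilings Q \<and> ctil ys \<in> cyl_tilings Q \<and>
     (even (length xs) \<longleftrightarrow> even (length ys)) \<and>
     (\<exists>a b. even a \<and> even b \<and> length xs + a = length ys + b \<and>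
        flip_connected (snd (concat_tiling (length xs, tiling_of xs) (a, vert_tiling Q a)))
          (snd (concat_tiling (length ys, tiling_of ys) (b, vert_tiling Q b))))"
    by (simp add: tiling_rel_def ctil_def del: concat_tiling.simps)
  also have "\<dots> \<longleftrightarrow> xs \<noteq> [] \<and> ys \<noteq> [] \<and> (even (length xs) \<longleftrightarrow> even (length ys)) \<and>
     (\<exists>a b. even a \<and> even b \<and> length xs + a = length ys + b \<and> eqw False {} (xs @ vert a) (ys @ vert b))"
    unfolding mem[OF c(1)] mem[OF c(2)]
    by (intro ex_cong1 conj_cong refl) (simp only: v[OF c(1)] v[OF c(2)] fl)
  also have "\<dots> \<longleftrightarrow> xs \<noteq> [] \<and> ys \<noteq> [] \<and> eqw True {} xs ys"
  proof -
    have "length xs + a = length ys + b" if "eqw False {} (xs @ vert a) (ys @ vert b)" for a b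
      using eqw_length_eq[OF that] by simp
    then show ?thesis using eqw_iff_vert[OF l] eqw_length[of True "{}" xs ys] by blast
  qed
  finally show ?thesis .
qed

lemma equiv_tiling_rel: "equiv (cyl_tilings Q) (tiling_rel Q)"
proof (rule equivI)
  show s: "tiling_rel Q \<subseteq> cyl_tilings Q \<times> cyl_tilings Q" by (auto simp: tiling_rel_def)
  show "refl_on (cyl_tilings Q) (tiling_rel Q)"
  proof (rule refl_onI)
    fix x assume "x \<in> cyl_tilings Q"
    then obtain xs where "closed_floors xs" "xs \<noteq> []" "x = ctil xs" unfolding cyl_tilings_iff by blast
    then show "(x, x) \<in> tiling_rel Q" using tiling_rel_ctil[of xs xs] by (simp add: closed_floors_def eqw_refl)
  qed
  show "sym (tiling_rel Q)"
  proof (rule symI)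
    fix x y assume r: "(x, y) \<in> tiling_rel Q"
    then have "x \<in> cyl_tilings Q" "y \<in> cyl_tilings Q" using s by auto
    then obtain xs ys where xy: "closed_floors xs" "x = ctil xs" "closed_floors ys" "y = ctil ys" unfolding cyl_tilings_iff by blast
    then show "(y, x) \<in> tiling_rel Q" using r tiling_rel_ctil[of xs ys] tiling_rel_ctil[of ys xs] eqw_sym[of True "{}" xs ys] by simp
  qed
  show "trans (tiling_rel Q)"
  proof (rule transI)
    fix x y z assume r: "(x, y) \<in> tiling_rel Q" "(y, z) \<in> tiling_rel Q"
    then have "x \<in> cyl_tilings Q" "y \<in> cyl_tilings Q" "z \<in> cyl_tilings Q" using s by auto
    then obtain xs ys zs where xy: "closed_floors xs" "x = ctil xs" "closed_floors ys" "y = ctil ys"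
      "closed_floors zs" "z = ctil zs" unfolding cyl_tilings_iff by blast
    then show "(x, z) \<in> tiling_rel Q"
      using r tiling_rel_ctil[of xs ys] tiling_rel_ctil[of ys zs] tiling_rel_ctil[of xs zs] eqw_trans[of True "{}" xs ys zs] by simp
  qed
qed

text \<open>
  The appended vertical floors do not change the class of a tiling. They are there for the empty
  list, which does not encode a tiling but should get the class of the unit.
\<close>

definition cls :: "(int \<times> int) set set list \<Rightarrow> cyl_tiling set" where
  "cls xs = tiling_rel Q `` {ctil (xs @ vert 2)}"

lemma closed_vert2: "closed_floors xs \<Longrightarrow> closed_floors (xs @ vert 2)"
  by (intro closed_append closed_vert) simp_all

lemma closed_eqw: "eqw True {} xs ys \<Longrightarrow> closed_floors xs \<longleftrightarrow> closed_floors ys"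
  using eqw_legit[of True "{}" xs ys] by (simp add: closed_floors_def)

lemma eqw_vert2: "closed_floors xs \<Longrightarrow> eqw True {} (xs @ vert 2) xs"
  by (rule eqw_append_vert) (simp_all add: closed_floors_def)

lemma eqw_vert2_iff:
  assumes "closed_floors xs" "closed_floors ys"
  shows "eqw True {} (xs @ vert 2) (ys @ vert 2) \<longleftrightarrow> eqw True {} xs ys"
proof
  assume "eqw True {} (xs @ vert 2) (ys @ vert 2)"
  from eqw_trans[OF eqw_trans[OF eqw_sym[OF eqw_vert2[OF assms(1)]] this] eqw_vert2[OF assms(2)]]
  show "eqw True {} xs ys" .
next
  assume "eqw True {} xs ys"
  from eqw_trans[OF eqw_trans[OF eqw_vert2[OF assms(1)] this] eqw_sym[OF eqw_vert2[OF assms(2)]]]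
  show "eqw True {} (xs @ vert 2) (ys @ vert 2)" .
qed

lemma ctil_mem: "closed_floors xs \<Longrightarrow> xs \<noteq> [] \<Longrightarrow> ctil xs \<in> cyl_tilings Q"
  unfolding cyl_tilings_iff by blast

lemma cls_eq_iff:
  assumes "closed_floors xs" "closed_floors ys"
  shows "cls xs = cls ys \<longleftrightarrow> eqw True {} xs ys"
proof -
  have "cls xs = cls ys \<longleftrightarrow> (ctil (xs @ vert 2), ctil (ys @ vert 2)) \<in> tiling_rel Q"
    unfolding cls_def by (intro eq_equiv_class_iff[OF equiv_tiling_rel] ctil_mem closed_vert2 assms) simp_all
  also have "\<dots> \<longleftrightarrow> eqw True {} xs ys"
    using tiling_rel_ctil[OF closed_vert2[OF assms(1)] closed_vert2[OF assms(2)]] eqw_vert2_iff[OF assms] by simp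
  finally show ?thesis .
qed

lemma cls_nonempty:
  assumes "closed_floors xs" "xs \<noteq> []" shows "cls xs = tiling_rel Q `` {ctil xs}"
proof -
  have "(ctil (xs @ vert 2), ctil xs) \<in> tiling_rel Q"
    using tiling_rel_ctil[OF closed_vert2[OF assms(1)] assms(1)] eqw_vert2[OF assms(1)] assms by simp
  then show ?thesis unfolding cls_def by (rule equiv_class_eq[OF equiv_tiling_rel])
qed

lemma mem_cls:
  assumes "closed_floors xs"
  shows "x \<in> cls xs \<longleftrightarrow> (\<exists>ys. x = ctil ys \<and> closed_floors ys \<and> ys \<noteq> [] \<and> eqw True {} xs ys)"
proof -
  have "x \<in> cls xs \<longleftrightarrow> (\<exists>ys. x = ctil ys \<and> closed_floors ys \<and> ys \<noteq> [] \<and> eqw True {} (xs @ vert 2) ys)"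
  proof
    assume r: "x \<in> cls xs"
    then have "x \<in> cyl_tilings Q" by (auto simp: cls_def tiling_rel_def)
    then obtain ys where y: "closed_floors ys" "ys \<noteq> []" "x = ctil ys" unfolding cyl_tilings_iff by blast
    then show "\<exists>ys. x = ctil ys \<and> closed_floors ys \<and> ys \<noteq> [] \<and> eqw True {} (xs @ vert 2) ys"
      using r tiling_rel_ctil[OF closed_vert2[OF assms] y(1)] by (auto simp: cls_def)
  next
    assume "\<exists>ys. x = ctil ys \<and> closed_floors ys \<and> ys \<noteq> [] \<and> eqw True {} (xs @ vert 2) ys"
    then show "x \<in> cls xs" using tiling_rel_ctil[OF closed_vert2[OF assms]] by (auto simp: cls_def)
  qed
  moreover have "eqw True {} (xs @ vert 2) ys \<longleftrightarrow> eqw True {} xs ys" for ys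
    using eqw_vert2[OF assms] eqw_trans[of True "{}" "xs @ vert 2" xs ys] eqw_trans[OF eqw_sym[OF eqw_vert2[OF assms]], of ys] by blast
  ultimately show ?thesis by simp
qed

section \<open>The even domino group as classes of lists\<close>

definition even_closed :: "(int \<times> int) set set list \<Rightarrow> bool" where
  "even_closed xs \<longleftrightarrow> closed_floors xs \<and> even (length xs)"

lemma carrier_even: "carrier (even_domino_group Q) = cls ` Collect even_closed"
proof -
  have "{(N, t) \<in> cyl_tilings Q. even N} = ctil ` {xs. even_closed xs \<and> xs \<noteq> []}"
    by (auto simp: cyl_tilings_iff even_closed_def ctil_def)
  then have "carrier (even_domino_group Q) = (\<lambda>xs. tiling_rel Q `` {ctil xs}) ` {xs. even_closed xs \<and> xs \<noteq> []}"
    by (simp add: even_domino_group_def quotient_def image_image UNION_singleton_eq_range)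
  also have "\<dots> = cls ` Collect even_closed"
  proof
    show "(\<lambda>xs. tiling_rel Q `` {ctil xs}) ` {xs. even_closed xs \<and> xs \<noteq> []} \<subseteq> cls ` Collect even_closed"
      using cls_nonempty by (force simp: even_closed_def)
    show "cls ` Collect even_closed \<subseteq> (\<lambda>xs. tiling_rel Q `` {ctil xs}) ` {xs. even_closed xs \<and> xs \<noteq> []}"
      using closed_vert2 by (force simp: even_closed_def cls_def)
  qed
  finally show ?thesis .
qed

lemma one_even: "\<one>\<^bsub>even_domino_group Q\<^esub> = cls []"
  using ctil_vert[of 2] by (simp add: even_domino_group_def domino_group_def cls_def)

text \<open>All choices of representatives give equivalent concatenations, so the union in the
  definition is a union of equal classes.\<close>

lemma mult_even:
  assumes "closed_floors xs" "closed_floors ys"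
  shows "cls xs \<otimes>\<^bsub>even_domino_group Q\<^esub> cls ys = cls (xs @ ys)"
proof -
  have c: "closed_floors (xs @ ys)" by (intro closed_append assms)
  have "tiling_rel Q `` {concat_tiling x y} = cls (xs @ ys)" if xy: "x \<in> cls xs" "y \<in> cls ys" for x y
  proof -
    obtain us where u: "x = ctil us" "closed_floors us" "us \<noteq> []" "eqw True {} xs us" using xy(1) mem_cls[OF assms(1)] by blast
    obtain vs where v: "y = ctil vs" "closed_floors vs" "vs \<noteq> []" "eqw True {} ys vs" using xy(2) mem_cls[OF assms(2)] by blast
    have cu: "closed_floors (us @ vs)" by (intro closed_append u v)
    have "fin {} xs = {}" using assms by (simp add: closed_floors_def)
    then have "eqw True {} (xs @ ys) (us @ vs)" using eqw_append[OF u(4)] v(4) by simp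
    then show ?thesis using cls_eq_iff[OF c cu] cls_nonempty[OF cu] u v concat_ctil[OF u(2), of vs] by simp
  qed
  moreover have "ctil (xs @ vert 2) \<in> cls xs" "ctil (ys @ vert 2) \<in> cls ys"
    using equiv_class_self[OF equiv_tiling_rel] ctil_mem closed_vert2 assms by (auto simp: cls_def)
  ultimately show ?thesis
    unfolding even_domino_group_def domino_group_def by auto
qed

lemma even_closed_append: "even_closed xs \<Longrightarrow> even_closed ys \<Longrightarrow> even_closed (xs @ ys)"
  by (simp add: even_closed_def closed_append)

lemma even_closed_rev: "even_closed xs \<Longrightarrow> even_closed (rev xs)"
  using legit_rev[of "{}" xs] by (simp add: even_closed_def closed_floors_def)

lemma even_closed_Nil [simp]: "even_closed []"
  by (simp add: even_closed_def closed_floors_def)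

lemma group_even: "group (even_domino_group Q)"
proof (rule groupI)
  let ?G = "even_domino_group Q"
  show "\<one>\<^bsub>?G\<^esub> \<in> carrier ?G" unfolding one_even carrier_even by simp
  fix x assume "x \<in> carrier ?G"
  then obtain xs where x: "x = cls xs" "even_closed xs" "closed_floors xs" unfolding carrier_even by (auto simp: even_closed_def)
  have n: "closed_floors []" by (simp add: closed_floors_def)
  show "\<one>\<^bsub>?G\<^esub> \<otimes>\<^bsub>?G\<^esub> x = x" using mult_even[OF n x(3)] by (simp add: one_even x(1))
  have r: "closed_floors (rev xs)" using even_closed_rev[OF x(2)] by (simp add: even_closed_def)
  have "eqw True {} (rev xs @ xs) []" using eqw_rev_left[of "{}" xs] x(3) by (simp add: closed_floors_def)
  then have "cls (rev xs @ xs) = cls []" using cls_eq_iff[OF closed_append[OF r x(3)] n] by simp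
  then show "\<exists>y\<in>carrier ?G. y \<otimes>\<^bsub>?G\<^esub> x = \<one>\<^bsub>?G\<^esub>"
    using mult_even[OF r x(3)] even_closed_rev[OF x(2)] unfolding one_even carrier_even x(1) by auto
  fix y assume "y \<in> carrier ?G"
  then obtain ys where y: "y = cls ys" "even_closed ys" "closed_floors ys" unfolding carrier_even by (auto simp: even_closed_def)
  show "x \<otimes>\<^bsub>?G\<^esub> y \<in> carrier ?G"
    using mult_even[OF x(3) y(3)] even_closed_append[OF x(2) y(2)] unfolding carrier_even x(1) y(1) by auto
  fix z assume "z \<in> carrier ?G"
  then obtain zs where z: "z = cls zs" "even_closed zs" "closed_floors zs" unfolding carrier_even by (auto simp: even_closed_def)
  show "x \<otimes>\<^bsub>?G\<^esub> y \<otimes>\<^bsub>?G\<^esub> z = x \<otimes>\<^bsub>?G\<^esub> (y \<otimes>\<^bsub>?G\<^esub> z)"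
    unfolding x(1) y(1) z(1) by (simp add: mult_even closed_append x(3) y(3) z(3))
qed

text \<open>The twist is a definite description of an integer and has a known value only if the real
  sum is integral; divisibility by 4 guarantees this.\<close>

lemma twist_cls:
  assumes "closed_floors xs" "4 dvd tw4 {} xs"
  shows "twist_class (cls xs) = tw4 {} xs div 4"
proof -
  have "twist (tiling_of ys) = tw4 {} xs div 4" if y: "closed_floors ys" "eqw True {} xs ys" for ys
  proof -
    have s: "(\<Sum>d0\<in>tiling_of ys. \<Sum>d1\<in>tiling_of ys. tau (axis 1 1) d0 d1) = real_of_int (tw4 {} xs div 4)"
      using tau_sum[of ys] tw4_eqw[OF y(2)] y(1) assms(2) by (simp add: closed_floors_def real_of_int_div)
    show ?thesis unfolding twist_def s by (rule the_equality) auto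
  qed
  then have "(\<lambda>(N, t). twist t) x = tw4 {} xs div 4" if "x \<in> cls xs" for x
    using that mem_cls[OF assms(1)] by (auto simp: ctil_def)
  moreover have "ctil (xs @ vert 2) \<in> cls xs"
    using equiv_class_self[OF equiv_tiling_rel ctil_mem[OF closed_vert2[OF assms(1)]]] by (simp add: cls_def)
  ultimately have "(\<lambda>(N, t). twist t) ` cls xs = (\<lambda>x. tw4 {} xs div 4) ` cls xs" "cls xs \<noteq> {}"
    by (intro image_cong refl, blast, blast)
  then have "(\<lambda>(N, t). twist t) ` cls xs = {tw4 {} xs div 4}" by (simp only: image_constant_conv if_False)
  then show ?thesis by (simp add: twist_class_def)
qed

end

section \<open>Rectangles as balanced disks\<close>

context rect_board begin

lemma unit_square_subset: "unit_square a b \<subseteq> Q \<longleftrightarrow> (a, b) \<in> rect L M"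
proof -
  have "unit_square a b \<subseteq> Q \<longleftrightarrow> {real_of_int a..real_of_int a + 1} \<subseteq> {0..real L} \<and> {real_of_int b..real_of_int b + 1} \<subseteq> {0..real M}"
    unfolding unit_square_def times_subset_iff by auto
  also have "\<dots> \<longleftrightarrow> (a, b) \<in> rect L M"
    by (simp add: mem_rect) linarith
  finally show ?thesis .
qed

lemma Q_squares: "Q = (\<Union>(a, b)\<in>rect L M. unit_square a b)"
proof
  show "(\<Union>(a, b)\<in>rect L M. unit_square a b) \<subseteq> Q" using unit_square_subset by fast
  show "Q \<subseteq> (\<Union>(a, b)\<in>rect L M. unit_square a b)"
  proof
    fix c assume c: "c \<in> Q"
    obtain x y where xy: "c = (x, y)" by (cases c)
    obtain a where a: "0 \<le> a \<and> a < int L \<and> real_of_int a \<le> x \<and> x \<le> real_of_int a + 1"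
      using unit_interval_cover[OF L, of x] c xy by auto
    obtain b where b: "0 \<le> b \<and> b < int M \<and> real_of_int b \<le> y \<and> y \<le> real_of_int b + 1"
      using unit_interval_cover[OF M, of y] c xy by auto
    have "c \<in> unit_square a b" "(a, b) \<in> rect L M" using a b by (simp_all add: xy unit_square_def mem_rect)
    then show "c \<in> (\<Union>(a, b)\<in>rect L M. unit_square a b)" by blast
  qed
qed

lemma quadriculated_Q: "quadriculated_disk Q"
proof -
  have int: "interior Q = {0<..<real L} \<times> {0<..<real M}" by (simp add: interior_Times)
  have "contractible Q" "contractible (interior Q)"
    unfolding int by (intro convex_imp_contractible convex_Times convex_real_interval)+
  moreover have "real L / 2 \<in> {0<..<real L}" "real M / 2 \<in> {0<..<real M}" using L M by auto
  then have "interior Q \<noteq> {}" unfolding int by blast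
  moreover have "Q \<noteq> {}" by auto
  ultimately show ?thesis unfolding quadriculated_disk_def using Q_squares finite_D by blast
qed

text \<open>Along an even side the coordinates are exchanged in pairs, 0 with 1, 2 with 3 and so on;
  this involution reverses the colors.\<close>

lemma balanced_Q:
  assumes "even (L * M)" shows "balanced Q"
proof -
  define s :: "int \<Rightarrow> int" where "s a = (if even a then a + 1 else a - 1)" for a
  have s: "s (s a) = a" "even (s a) \<longleftrightarrow> odd a" for a by (auto simp: s_def)
  have r: "0 \<le> s a \<and> s a < int n" if n: "even n" "0 \<le> a" "a < int n" for a n
  proof -
    obtain k where "n = 2 * k" using n(1) by (rule evenE)
    then show ?thesis using n by (simp add: s_def) presburger
  qed
  define g where "g c = (if even L then (s (fst c), snd c) else (fst c, s (snd c)))" for c :: "int \<times> int"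
  have g: "g (g c) = c" "even (fst (g c) + snd (g c)) \<longleftrightarrow> odd (fst c + snd c)" for c
    by (auto simp: g_def s)
  have gr: "g c \<in> rect L M" if "c \<in> rect L M" for c
    using that r[of L] r[of M] assms by (auto simp: g_def mem_rect)
  have "bij_betw g {c \<in> rect L M. even (fst c + snd c)} {c \<in> rect L M. odd (fst c + snd c)}"
  proof (rule bij_betw_byWitness[where f' = g])
    show "g ` {c \<in> rect L M. even (fst c + snd c)} \<subseteq> {c \<in> rect L M. odd (fst c + snd c)}"
      "g ` {c \<in> rect L M. odd (fst c + snd c)} \<subseteq> {c \<in> rect L M. even (fst c + snd c)}"
      using g(2) gr by blast+
  qed (simp_all add: g(1))
  then have "card {c \<in> rect L M. even (fst c + snd c)} = card {c \<in> rect L M. odd (fst c + snd c)}"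
    by (rule bij_betw_same_card)
  moreover have "{(a, b). unit_square a b \<subseteq> Q \<and> even (a + b)} = {c \<in> rect L M. even (fst c + snd c)}"
    "{(a, b). unit_square a b \<subseteq> Q \<and> odd (a + b)} = {c \<in> rect L M. odd (fst c + snd c)}"
    by (auto simp: unit_square_subset)
  ultimately show ?thesis unfolding balanced_def by (simp only:)
qed

lemma regular_Q:
  assumes "even (L * M)"
  shows "regular_disk Q \<longleftrightarrow> twist_class \<in> iso (even_domino_group Q) integer_group"
  using quadriculated_Q balanced_Q[OF assms] by (simp add: regular_disk_def)

end

section \<open>Regular rectangles\<close>

lemma snake_corner:
  assumes "3 \<le> W"
  shows "(snake_pos s W (W - 2), snake_pos s W (W - 1), snake_pos s W W, snake_pos s W (W + 1)) =
    (let x = int W - 2 in if s then ((0, x), (0, x + 1), (1, x + 1), (1, x)) else ((x, 0), (x + 1, 0), (x + 1, 1), (x, 1)))"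
  using snake_pos_row[of "W - 2" W s 0] snake_pos_row[of "W - 1" W s 0] snake_pos_row[of 0 W s 1] snake_pos_row[of 1 W s 1] assms
  by (simp add: Let_def of_nat_diff)

lemma (in rect_board) regular:
  assumes LM: "3 \<le> L" "3 \<le> M" "even (L * M)"
  shows "twist_class \<in> iso (even_domino_group Q) integer_group"
proof -
  define W R K where "W = min L M" and "R = max L M" and "K = L * M div 2"
  define s where "s = (M < L)"
  \<comment> \<open>The seed state: \<open>K\<close> tokens packed to the left, except for a hole at
    the target \<open>W + 1\<close> of the corner passage.\<close>
  define A where "A = {..<Suc K} - {W + 1}"
  have K: "2 * K = R * W" using LM(3) by (simp add: K_def R_def W_def min_def max_def)
  have W: "3 \<le> W" using LM by (simp add: W_def)
  \<comment> \<open>The longer side is taken as the number of rows. It cannot be 3, because a board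
    of sides 3 and 3 has odd area.\<close>
  have R: "4 \<le> R"
  proof (rule ccontr)
    assume "\<not> 4 \<le> R"
    then have "L = 3" "M = 3" using LM by (auto simp: R_def)
    then show False using LM(3) by simp
  qed
  have WK: "2 * W \<le> K" using mult_le_mono1[OF R, of W] K by linarith
  have rect: "(if s then rect R W else rect W R) = rect L M"
    by (auto simp: s_def R_def W_def)
  let ?G = "even_domino_group Q"
  have sb: "snake_board (rect L M) (snake_pos s W) (R * W) K W R"
    using snake_board_rect[OF W R K, of s] unfolding rect .
  interpret G: group ?G by (rule group_even)
  interpret sl: snake_loops "rect L M" "snake_pos s W" "R * W" K W R ?G cls
  proof (intro snake_loops.intro sb group_even snake_loops_axioms.intro)
    fix xs assume "legit {} xs" "fin {} xs = {}" "even (length xs)"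
    then show "cls xs \<in> carrier ?G" unfolding carrier_even by (simp add: even_closed_def closed_floors_def)
  next
    fix xs ys assume e: "eqw True {} xs ys" "fin {} xs = {}" "even (length xs)"
    then have "closed_floors xs" using eqw_legit[OF e(1)] by (simp add: closed_floors_def)
    then show "cls xs = cls ys" using cls_eq_iff[of xs ys] closed_eqw[OF e(1)] e(1) by simp
  next
    fix xs ys assume "legit {} xs" "fin {} xs = {}" "even (length xs)" "legit {} ys" "fin {} ys = {}" "even (length ys)"
    then show "cls (xs @ ys) = cls xs \<otimes>\<^bsub>?G\<^esub> cls ys" using mult_even[of xs ys] by (simp add: closed_floors_def)
  qed
  have ts: "token_state (R * W) K A (W - 2) (W + 1)" "W - 1 \<in> A" "W \<in> A"
    using WK W K by (auto simp: token_state_def A_def)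
  have edge: "snake_edge W (R * W) (W - 2) (W + 1)"
    using W K WK unfolding snake_edge_def by (intro conjI disjI2 exI[of _ 1]) auto
  define ls where "ls = sl.walk A @ mv (sl.plug A) {snake_pos s W (W - 2), snake_pos s W (W + 1)} @ rev (sl.walk (move_token A (W - 2) (W + 1)))"
  define z where "z = sl.Phi A (W - 2) (W + 1)"
  have z: "z = cls ls" by (simp add: z_def ls_def sl.Phi_def sl.lp_def)
  have ec: "even_closed ls"
    using sl.lp_list[OF sl.joins_mv[OF ts(1) edge]] by (simp add: even_closed_def closed_floors_def ls_def)
  then have cl: "closed_floors ls" by (simp add: even_closed_def)
  have W3: "W - 2 + 1 = W - 1" "W - 2 + 2 = W" "W - 2 + 3 = W + 1" using W by simp_all
  have t4: "\<bar>tw4 {} ls\<bar> = 4"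
  proof -
    have "(snake_pos s W (W - 2), snake_pos s W (W - 1), snake_pos s W W, snake_pos s W (W + 1)) \<in>
      {((x, y), (x + 1, y), (x + 1, y + 1), (x, y + 1)), ((x, y), (x, y + 1), (x + 1, y + 1), (x + 1, y))}"
      if "x = (if s then 0 else int W - 2)" "y = (if s then int W - 2 else 0)" for x y
      unfolding snake_corner[OF W] that by (simp add: Let_def)
    then show ?thesis
      using sl.tw4_loop_face[of A "W - 2"] ts edge unfolding W3 ls_def by blast
  qed
  have gen: "cls xs \<in> H" if "subgroup H ?G" "z \<in> H" "even_closed xs" for H xs
    using sl.cl_generated[OF ts] that by (simp add: z_def even_closed_def closed_floors_def)
  \<comment> \<open>Integrality by generation: the classes with a representative of divisible value
    form a subgroup, and it contains the generator \<open>z\<close>. Since \<open>tw4\<close> is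
    constant on classes, the property passes to all representatives.\<close>
  have dvd: "4 dvd tw4 {} xs" if xs: "even_closed xs" for xs
  proof -
    define H where "H = {cls ys | ys. even_closed ys \<and> 4 dvd tw4 {} ys}"
    have mul: "cls ys \<otimes>\<^bsub>?G\<^esub> cls zs = cls (ys @ zs)" if "even_closed ys" "even_closed zs" for ys zs
      using mult_even that by (simp add: even_closed_def)
    have tw: "tw4 {} (ys @ zs) = tw4 {} ys + tw4 {} zs" "tw4 {} (rev ys) = - tw4 {} ys" if "even_closed ys" for ys zs
      using that tw4_append[of "{}" ys zs] tw4_rev[of "{}" ys] by (simp_all add: even_closed_def closed_floors_def)
    have inv: "inv\<^bsub>?G\<^esub> (cls ys) = cls (rev ys)" if ys: "even_closed ys" for ys
    proof (rule G.inv_equality)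
      show "cls ys \<in> carrier ?G" "cls (rev ys) \<in> carrier ?G" using ys even_closed_rev[OF ys] by (auto simp: carrier_even)
      have "eqw True {} (rev ys @ ys) []" using eqw_rev_left[of "{}" ys] ys by (simp add: even_closed_def closed_floors_def)
      moreover have "even_closed (rev ys @ ys)" using even_closed_append[OF even_closed_rev] ys by simp
      ultimately show "cls (rev ys) \<otimes>\<^bsub>?G\<^esub> cls ys = \<one>\<^bsub>?G\<^esub>"
        using mul[OF even_closed_rev] ys cls_eq_iff[of "rev ys @ ys" "[]"] even_closed_Nil unfolding one_even even_closed_def by simp
    qed
    have "subgroup H ?G"
    proof (rule G.subgroupI)
      show "H \<subseteq> carrier ?G" by (auto simp: H_def carrier_even)
      show "H \<noteq> {}" using even_closed_Nil by (auto simp: H_def intro: exI[of _ "[]"])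
      fix a assume "a \<in> H"
      then obtain ys where a: "a = cls ys" "even_closed ys" "4 dvd tw4 {} ys" by (auto simp: H_def)
      show "inv\<^bsub>?G\<^esub> a \<in> H" unfolding H_def a(1) inv[OF a(2)] using even_closed_rev[OF a(2)] tw(2)[OF a(2)] a(3) by auto
      fix b assume "b \<in> H"
      then obtain zs where b: "b = cls zs" "even_closed zs" "4 dvd tw4 {} zs" by (auto simp: H_def)
      show "a \<otimes>\<^bsub>?G\<^esub> b \<in> H" unfolding H_def a(1) b(1) mul[OF a(2) b(2)]
        using even_closed_append[OF a(2) b(2)] tw(1)[OF a(2), of zs] a(3) b(3) by auto
    qed
    moreover have "z \<in> H" proof -
      have "4 dvd tw4 {} ls" using t4 by (metis dvd_abs_iff dvd_refl)
      then show ?thesis unfolding H_def z using ec by blast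
    qed
    ultimately have "cls xs \<in> H" using gen xs by blast
    then obtain ys where ys: "cls xs = cls ys" "even_closed ys" "4 dvd tw4 {} ys" by (auto simp: H_def)
    then have "eqw True {} xs ys" using cls_eq_iff[of xs ys] xs by (simp add: even_closed_def)
    then show ?thesis using tw4_eqw[of True "{}" xs ys] ys(3) by simp
  qed
  have T: "twist_class (cls xs) = tw4 {} xs div 4" if "even_closed xs" for xs
    using twist_cls[OF _ dvd[OF that]] that by (simp add: even_closed_def)
  have hom: "twist_class \<in> hom ?G integer_group"
  proof (rule homI)
    fix a b assume "a \<in> carrier ?G" "b \<in> carrier ?G"
    then obtain xs ys where a: "a = cls xs" "even_closed xs" and b: "b = cls ys" "even_closed ys" by (auto simp: carrier_even)
    have "tw4 {} (xs @ ys) = tw4 {} xs + tw4 {} ys" using a(2) by (simp add: tw4_append even_closed_def closed_floors_def)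
    moreover have "a \<otimes>\<^bsub>?G\<^esub> b = cls (xs @ ys)" using a b mult_even[of xs ys] by (simp add: even_closed_def)
    ultimately show "twist_class (a \<otimes>\<^bsub>?G\<^esub> b) = twist_class a \<otimes>\<^bsub>integer_group\<^esub> twist_class b"
      using T[OF a(2)] T[OF b(2)] T[OF even_closed_append[OF a(2) b(2)]] dvd[OF a(2)] by (simp add: a(1) b(1) div_plus_div_distrib_dvd_left)
  qed simp
  have zc: "z \<in> carrier ?G" unfolding z carrier_even using ec by simp
  interpret h: group_hom ?G integer_group twist_class
    by (rule group_hom.intro[OF group_even group_integer_group]) (simp add: group_hom_axioms_def hom)
  have Tz: "twist_class (z [^]\<^bsub>?G\<^esub> k) = k * twist_class z" for k :: int
    using h.hom_int_pow[OF zc, of k] by simp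
  have Tz1: "\<bar>twist_class z\<bar> = 1" using t4 T[OF ec] by (auto simp: z abs_if split: if_splits)
  have powers: "\<exists>k::int. a = z [^]\<^bsub>?G\<^esub> k" if "a \<in> carrier ?G" for a
  proof -
    have "subgroup (generate ?G {z}) ?G" using zc by (intro G.generate_is_subgroup) simp
    moreover have "z \<in> generate ?G {z}" by (rule generate.incl) simp
    ultimately have "a \<in> generate ?G {z}" using gen that unfolding carrier_even by blast
    then show ?thesis unfolding G.generate_pow[OF zc] by blast
  qed
  have "bij_betw twist_class (carrier ?G) UNIV"
  proof (rule bij_betw_imageI)
    show "inj_on twist_class (carrier ?G)"
    proof (rule inj_onI)
      fix a b assume ab: "a \<in> carrier ?G" "b \<in> carrier ?G" "twist_class a = twist_class b"
      obtain k l :: int where kl: "a = z [^]\<^bsub>?G\<^esub> k" "b = z [^]\<^bsub>?G\<^esub> l" using powers ab(1,2) by metis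
      then have "k = l" using ab(3) Tz1 by (auto simp: Tz)
      then show "a = b" using kl by simp
    qed
    show "twist_class ` carrier ?G = UNIV"
    proof (rule UNIV_eq_I[symmetric])
      fix k :: int
      have "(k * twist_class z) * twist_class z = k" using Tz1 by (auto simp: abs_if split: if_splits)
      then have "k = twist_class (z [^]\<^bsub>?G\<^esub> (k * twist_class z))" unfolding Tz by simp
      then show "k \<in> twist_class ` carrier ?G" using zc by blast
    qed
  qed
  then show ?thesis using hom by (simp add: iso_def)
qed

section \<open>Rectangles of width two\<close>

text \<open>The flag \<open>s\<close> exchanges the two coordinates, so that both orientations are treated at once.\<close>

definition pt :: "bool \<Rightarrow> int \<Rightarrow> int \<Rightarrow> int \<times> int" where
  "pt s u y = (if s then (y, u) else (u, y))"

definition height :: "bool \<Rightarrow> int \<times> int \<Rightarrow> int" where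
  "height s c = (if s then fst c else snd c)"

definition rung :: "bool \<Rightarrow> int \<Rightarrow> (int \<times> int) set" where
  "rung s y = {pt s 0 y, pt s 1 y}"

definition parity :: "int \<Rightarrow> int" where
  "parity y = (if even y then 1 else -1)"

lemma pt_eq_iff [simp]: "pt s u y = pt s v z \<longleftrightarrow> u = v \<and> y = z"
  by (auto simp: pt_def)

lemma height_pt [simp]: "height s (pt s u y) = y"
  by (simp add: pt_def height_def)

lemma chi_pt: "chi (pt s u y) = parity (u + y)"
  by (simp add: chi_def pt_def parity_def add.commute)

lemma parity_Suc: "parity (y + 1) = - parity y" "parity (1 + y) = - parity y"
  by (simp_all add: parity_def)

lemma rung_eq_iff [simp]: "rung s y = rung s z \<longleftrightarrow> y = z"
  by (auto simp: rung_def doubleton_eq_iff)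

lemma rung_not_block: "rung True j \<notin> hblock x y" "rung False j \<notin> vblock x y"
  by (auto simp: rung_def pt_def hblock_def vblock_def doubleton_eq_iff)

locale ladder = board +
  fixes s :: bool and n :: nat
  assumes D: "D = (if s then rect n 2 else rect 2 n)"
begin

definition above :: "(int \<times> int) set \<Rightarrow> int \<Rightarrow> int" where
  "above A j = (\<Sum>c\<in>A. if height s c > j then chi c else 0)"

lemma pt_in_D: "pt s u y \<in> D \<longleftrightarrow> (u = 0 \<or> u = 1) \<and> 0 \<le> y \<and> y < int n"
  by (auto simp: D pt_def mem_rect)

lemma pt_surj: obtains u y where "c = pt s u y"
  by (rule that[of "if s then snd c else fst c" "height s c"]) (simp add: pt_def height_def)

lemma domino_cases:
  assumes "planar_domino d" "d \<subseteq> D"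
  obtains y where "d = rung s y" | u y where "d = {pt s u y, pt s u (y + 1)}"
proof -
  obtain a b where "d = {(a, b), (a + 1, b)} \<or> d = {(a, b), (a, b + 1)}"
    using assms(1) by (auto simp: planar_domino_def)
  then consider u y where "d = {pt s u y, pt s (u + 1) y}" | u y where "d = {pt s u y, pt s u (y + 1)}"
    by (cases s) (auto simp: pt_def)
  then show ?thesis
  proof cases
    case (1 u y)
    then have "u = 0" using assms(2) by (auto simp: pt_in_D)
    then show ?thesis using 1 by (intro that(1)[of y]) (simp add: rung_def)
  qed (rule that(2))
qed

lemma above_rung: "above (rung s y) j = 0"
  by (simp add: above_def rung_def chi_pt parity_Suc)

text \<open>A domino across the board is balanced. A lengthwise one has both squares beyond rung
  \<open>j\<close> or none, unless its lower square lies on that rung.\<close>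

lemma above_domino:
  assumes "planar_domino d" "d \<subseteq> D" "d \<inter> rung s j = {} \<or> d = rung s j"
  shows "above d j = 0"
  using domino_cases[OF assms(1,2)]
proof cases
  case (1 y)
  then show ?thesis by (simp add: above_rung)
next
  case (2 u y)
  have "u = 0 \<or> u = 1" using assms(2) by (simp add: 2 pt_in_D)
  then have "d \<noteq> rung s j" "y \<noteq> j" using assms(3) by (auto simp: 2 rung_def doubleton_eq_iff)
  then show ?thesis by (simp add: 2 above_def chi_pt parity_Suc add.assoc[symmetric])
qed

lemma above_Union:
  assumes f: "floor_ok p f" and "\<And>d. d \<in> f \<Longrightarrow> above d j = 0"
  shows "above (\<Union>f) j = 0"
proof -
  have fin: "finite d" if "d \<in> f" for d
    using f that finite_subset[OF _ finite_D] by (auto simp: floor_ok_def)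
  have "above (\<Union>f) j = (\<Sum>d\<in>f. above d j)"
    unfolding above_def using f fin
    by (subst sum.Union_disjoint) (auto simp: floor_ok_def pairwise_def disjnt_def)
  then show ?thesis using assms(2) by simp
qed

lemma above_Un: "A \<inter> B = {} \<Longrightarrow> A \<subseteq> D \<Longrightarrow> B \<subseteq> D \<Longrightarrow> above (A \<union> B) j = above A j + above B j"
  unfolding above_def using finite_subset[OF _ finite_D] by (intro sum.union_disjoint) auto

lemma rung_planar: "planar_domino (rung s y)"
proof (cases s)
  case True
  then show ?thesis unfolding planar_domino_def by (intro exI[of _ y] exI[of _ 0]) (simp add: rung_def pt_def)
next
  case False
  then show ?thesis unfolding planar_domino_def by (intro exI[of _ 0] exI[of _ y]) (simp add: rung_def pt_def)
qed

lemma above_D: "above D j = 0"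
proof -
  define f where "f = rung s ` {0..<int n}"
  have "floor_ok {} f"
    by (auto simp: floor_ok_def f_def rung_planar pairwise_def disjnt_def) (auto simp: rung_def pt_in_D)
  moreover have "\<Union>f = D"
  proof
    show "\<Union>f \<subseteq> D" by (auto simp: f_def rung_def pt_in_D)
    show "D \<subseteq> \<Union>f"
    proof
      fix c assume "c \<in> D"
      moreover obtain u y where "c = pt s u y" by (rule pt_surj)
      ultimately show "c \<in> \<Union>f" by (auto simp: f_def rung_def pt_in_D)
    qed
  qed
  moreover have "above d j = 0" if "d \<in> f" for d using that by (auto simp: f_def above_rung)
  ultimately show ?thesis using above_Union[of "{}" f j] by simp
qed

text \<open>No domino of the floor leads across the boundary beyond rung \<open>j\<close>, so the
  dominoes have total color 0 beyond it, as does the whole board. The two plugs share what is left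
  and therefore have opposite values.\<close>

lemma above_next:
  assumes "p \<subseteq> D" "floor_ok p f" "f = {} \<or> rung s j \<in> f"
  shows "above (next_plug p f) j = - above p j"
proof -
  have "above d j = 0" if "d \<in> f" for d
  proof (rule above_domino)
    show "planar_domino d" "d \<subseteq> D" using assms(2) that by (auto simp: floor_ok_def)
    show "d \<inter> rung s j = {} \<or> d = rung s j"
      using assms(2,3) that unfolding floor_ok_def pairwise_def disjnt_def by blast
  qed
  then have u: "above (\<Union>f) j = 0" by (rule above_Union[OF assms(2)])
  have sub: "\<Union>f \<subseteq> D - p" using assms(2) by (auto simp: floor_ok_def)
  define q where "q = next_plug p f"
  have q: "q \<subseteq> D" "\<Union>f \<inter> q = {}" "p \<inter> (\<Union>f \<union> q) = {}" "D = p \<union> (\<Union>f \<union> q)" "\<Union>f \<subseteq> D"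
    using assms(1) sub by (auto simp: q_def next_plug_def)
  have "above D j = above p j + above (\<Union>f \<union> q) j"
    using above_Un[OF q(3) assms(1), of j] q(1,4,5) by simp
  also have "above (\<Union>f \<union> q) j = above (\<Union>f) j + above q j" by (rule above_Un[OF q(2,5,1)])
  finally show ?thesis using u above_D[of j] by (simp add: q_def)
qed

definition rungs :: "(int \<times> int) set set \<Rightarrow> int set" where
  "rungs f = {j. rung s j \<in> f}"

text \<open>The factor \<open>parity j * e\<close> is the sign of the rung in space. The test uses
  \<open>e * above p j\<close> because, by \<open>above_next\<close>, this product has the same
  value for the plugs below and above a floor containing the rung.\<close>

definition rung_term :: "int \<Rightarrow> int \<Rightarrow> (int \<times> int) set \<Rightarrow> int \<Rightarrow> int" where
  "rung_term k e p j = parity j * e * of_bool (e * above p j = k)"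

text \<open>The argument \<open>e\<close> is the sign of the height of the current floor.\<close>

fun phi :: "int \<Rightarrow> int \<Rightarrow> (int \<times> int) set \<Rightarrow> (int \<times> int) set set list \<Rightarrow> int" where
  "phi k e p [] = 0"
| "phi k e p (f # fs) = (\<Sum>j\<in>rungs f. rung_term k e p j) + phi k (- e) (next_plug p f) fs"

lemma phi_append: "phi k e p (xs @ ys) = phi k e p xs + phi k (parity (int (length xs)) * e) (fin p xs) ys"
proof (induction xs arbitrary: e p)
  case (Cons f xs)
  have "parity (int (length (f # xs))) = - parity (int (length xs))" by (simp add: parity_Suc)
  then show ?case using Cons[of "- e"] by simp
qed (simp add: parity_def)

lemma finite_rungs: "floor_ok p f \<Longrightarrow> finite (rungs f)"
  using floor_ok_finite[of p f] finite_vimageI[of f "rung s"] by (simp add: rungs_def vimage_def inj_def)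

lemma rungs_block:
  assumes "\<Union>(hblock x y) \<subseteq> D"
  obtains j where "hblock x y = {rung s j, rung s (j + 1)}" "rungs (vblock x y) = {}"
    | j where "vblock x y = {rung s j, rung s (j + 1)}" "rungs (hblock x y) = {}"
proof (cases s)
  case True
  then have "y = 0" using assms by (auto simp: hblock_def D mem_rect)
  then have "vblock x y = {rung s x, rung s (x + 1)}" using True by (auto simp: vblock_def rung_def pt_def)
  moreover have "rungs (hblock x y) = {}" unfolding rungs_def using rung_not_block(1) True by simp
  ultimately show ?thesis by (rule that(2))
next
  case False
  then have "x = 0" using assms by (auto simp: hblock_def D mem_rect)
  then have "hblock x y = {rung s y, rung s (y + 1)}" using False by (auto simp: hblock_def rung_def pt_def)
  moreover have "rungs (vblock x y) = {}" unfolding rungs_def using rung_not_block(2) False by simp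
  ultimately show ?thesis by (rule that(1))
qed

text \<open>No square of the plug lies on rung \<open>j + 1\<close>, so both rungs see the same
  colors beyond them, and their parities are opposite: the two terms cancel.\<close>

lemma sum_rung_pair:
  assumes f: "floor_ok p f" and p: "p \<subseteq> D" and r: "rung s j \<in> f" "rung s (j + 1) \<in> f"
    and g: "f - {rung s j, rung s (j + 1)} \<subseteq> g" "rungs g = rungs f - {j, j + 1}"
  shows "(\<Sum>i\<in>rungs f. rung_term k e p i) = (\<Sum>i\<in>rungs g. rung_term k e p i)"
proof -
  have "(\<Sum>i\<in>rungs f. rung_term k e p i) = (\<Sum>i\<in>rungs g. rung_term k e p i) + (\<Sum>i\<in>{j, j + 1}. rung_term k e p i)"
    unfolding g(2) using finite_rungs[OF f] r by (intro sum.subset_diff) (auto simp: rungs_def)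
  moreover have "above p j = above p (j + 1)"
    unfolding above_def
  proof (rule sum.cong[OF refl])
    fix c assume "c \<in> p"
    moreover obtain u y where c: "c = pt s u y" by (rule pt_surj)
    ultimately have "c \<in> D" "c \<notin> rung s (j + 1)" using p r(2) f by (auto simp: floor_ok_def)
    then have "y \<noteq> j + 1" by (auto simp: c pt_in_D rung_def)
    then have "j < y \<longleftrightarrow> j + 1 < y" by linarith
    then show "(if j < height s c then chi c else 0) = (if j + 1 < height s c then chi c else 0)" by (simp add: c)
  qed
  ultimately show ?thesis by (simp add: rung_term_def parity_Suc del: sum_of_bool_mult_eq sum_mult_of_bool_eq)
qed

text \<open>A horizontal flip creates or removes two adjacent rungs, whose terms cancel. In a
  vertical flip of rungs the two copies have opposite signs and pass the same test. The other rungs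
  on the upper floor do not meet \<open>d\<close>, so adding \<open>d\<close> to the plug leaves
  their value of \<open>above\<close> unchanged.\<close>

lemma phi_eqw: "eqw b p xs ys \<Longrightarrow> phi k e p xs = phi k e p ys"
proof (induction arbitrary: e rule: eqw.induct)
  case (eqw_hflip p f xs x y)
  define g where "g = f - hblock x y \<union> vblock x y"
  have f: "floor_ok p f" "p \<subseteq> D" using eqw_hflip(1) by auto
  note h = floor_ok_hflip[OF f(1) eqw_hflip(2), folded g_def]
  have "\<Union>f \<subseteq> D" using f by (auto simp: floor_ok_def)
  then have "\<Union>(hblock x y) \<subseteq> D" using eqw_hflip(2) by blast
  then have "(\<Sum>i\<in>rungs f. rung_term k e p i) = (\<Sum>i\<in>rungs g. rung_term k e p i)"
  proof (cases rule: rungs_block)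
    case (1 j)
    then show ?thesis using eqw_hflip(2) f
      by (intro sum_rung_pair[of p f j]) (auto simp: g_def rungs_def)
  next
    case (2 j)
    have e: "vblock x y \<inter> (f - hblock x y) = {}"
    proof (rule ccontr)
      assume "vblock x y \<inter> (f - hblock x y) \<noteq> {}"
      then obtain d where d: "d \<in> vblock x y" "d \<in> f" "d \<notin> hblock x y" by blast
      have "disjoint f" using f(1) by (simp add: floor_ok_def)
      then have "disjnt d c" if c: "c \<in> hblock x y" for c
        by (rule pairwiseD) (use c d eqw_hflip(2) in auto)
      then have "d \<inter> \<Union>(hblock x y) = {}" by (auto simp: disjnt_def)
      then show False using d(1) by (auto simp: Union_blocks vblock_def)
    qed
    have "(\<Sum>i\<in>rungs g. rung_term k e p i) = (\<Sum>i\<in>rungs f. rung_term k e p i)"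
      using h f 2 e by (intro sum_rung_pair[of p g j]) (auto simp: g_def rungs_def)
    then show ?thesis by (rule sym)
  qed
  then show ?case using h(3) by (simp add: g_def)
next
  case (eqw_vflip p f g xs d)
  define q where "q = next_plug p f"
  have ok: "p \<subseteq> D" "floor_ok p f" "floor_ok q g" "q \<subseteq> D" using eqw_vflip(1) by (auto simp: q_def)
  note v = legit_vflip[OF eqw_vflip]
  have d: "planar_domino d" "d \<subseteq> D" "d \<inter> q = {}" using ok(3) eqw_vflip(3) by (auto simp: floor_ok_def)
  have other: "rung_term k (- e) (q \<union> d) i = rung_term k (- e) q i" if "i \<in> rungs g - rungs {d}" for i
  proof -
    have "rung s i \<in> g" "rung s i \<noteq> d" using that by (auto simp: rungs_def)
    then have "d \<inter> rung s i = {}" using ok(3) eqw_vflip(3) by (auto simp: floor_ok_def pairwise_def disjnt_def)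
    then have "above d i = 0" using above_domino d by blast
    then have "above (q \<union> d) i = above q i" using above_Un[of q d i] ok(4) d by auto
    then show ?thesis by (simp add: rung_term_def)
  qed
  have rd: "rungs (f - {d}) = rungs f - rungs {d}" for f by (auto simp: rungs_def)
  have split: "(\<Sum>i\<in>rungs f. t i) = (\<Sum>i\<in>rungs f - rungs {d}. t i) + (\<Sum>i\<in>rungs {d}. t i)"
    if "floor_ok r f" "d \<in> f" for t :: "int \<Rightarrow> int" and r f
    using finite_rungs[OF that(1)] that(2) by (intro sum.subset_diff) (auto simp: rungs_def)
  have "(\<Sum>i\<in>rungs {d}. rung_term k (- e) q i) = (\<Sum>i\<in>rungs {d}. - rung_term k e p i)"
  proof (rule sum.cong[OF refl])
    fix i assume "i \<in> rungs {d}"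
    then have "rung s i \<in> f" using eqw_vflip(2) by (auto simp: rungs_def)
    then show "rung_term k (- e) q i = - rung_term k e p i"
      using above_next[OF ok(1,2), of i] by (simp add: rung_term_def q_def)
  qed
  then show ?case
    using split[OF ok(2) eqw_vflip(2), of "rung_term k e p"] split[OF ok(3) eqw_vflip(3), of "rung_term k (- e) q"]
      sum.cong[OF refl other, of "rungs g - rungs {d}"]
    unfolding phi.simps v(2) rd unfolding v(3) by (simp add: q_def sum_negf)
next
  case (eqw_stab p xs)
  have "rungs {} = {}" by (simp add: rungs_def)
  then show ?case using next_plug_empty[OF legit_subset[OF eqw_stab(2)]] by simp
qed simp_all

lemma phi_mv_rung:
  assumes "can p (rung s j)"
  shows "phi k 1 p (mv p (rung s j)) = (if rung s j \<subseteq> p then -1 else 1) * parity j * of_bool (above p j = k)"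
proof -
  have "rungs {rung s j} = {j}" "rungs {} = {}" by (auto simp: rungs_def)
  then show ?thesis using above_next[of p "{}" j] assms by (auto simp: mv_def rung_term_def can_def)
qed

lemma phi_mv_other: "(\<And>j. d \<noteq> rung s j) \<Longrightarrow> phi k 1 p (mv p d) = 0"
proof -
  assume "\<And>j. d \<noteq> rung s j"
  then have "rungs {d} = {}" "rungs {} = {}" by (auto simp: rungs_def)
  then show ?thesis by (simp add: mv_def)
qed

lemma phi_wd: "can p d \<Longrightarrow> phi k 1 p (wd p (d # ds)) = phi k 1 p (mv p d) + phi k 1 (togl p d) (wd (togl p d) ds)"
  by (simp add: phi_append mv_legit parity_def)

end

section \<open>Loops that separate the two counts\<close>

context ladder begin

lemma column_planar: "planar_domino {pt s u y, pt s u (y + 1)}"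
proof (cases s)
  case True
  then show ?thesis unfolding planar_domino_def by (intro exI[of _ y] exI[of _ u]) (simp add: pt_def)
next
  case False
  then show ?thesis unfolding planar_domino_def by (intro exI[of _ u] exI[of _ y]) (simp add: pt_def)
qed

lemma phi_mv_column: "phi k 1 p (mv p {pt s u y, pt s u z}) = 0"
  by (rule phi_mv_other) (auto simp: rung_def doubleton_eq_iff)

text \<open>A loop on three rungs in which two rungs are removed from the plug. At rung 1 only the
  square \<open>A 2\<close>, of color \<open>k\<close>, lies beyond it in the plug. At rung 0 the
  squares \<open>A 1\<close> and \<open>A 2\<close> lie beyond it and cancel, so this rung counts
  only for level 0.\<close>

lemma loop_exists:
  assumes n: "3 \<le> n" and k: "k = 1 \<or> k = -1"
  shows "\<exists>xs. legit {} xs \<and> fin {} xs = {} \<and> even (length xs) \<and> (\<forall>l. l \<noteq> 0 \<longrightarrow> phi l 1 {} xs = of_bool (l = k))"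
proof -
  \<comment> \<open>The column \<open>a\<close> is chosen such that its square at height 2 has color
    \<open>k\<close>.\<close>
  define a b :: int where "a = (if k = 1 then 0 else 1)" and "b = 1 - a"
  have ab: "(a = 0 \<and> b = 1) \<or> (a = 1 \<and> b = 0)" by (simp add: a_def b_def)
  have pa: "parity (a + 2) = k" "parity (a + 1) = - k" using k by (auto simp: a_def parity_def)
  define A B where "A y = pt s a y" and "B y = pt s b y" for y
  have eq: "A x = A y \<longleftrightarrow> x = y" "B x = B y \<longleftrightarrow> x = y" "A x \<noteq> B y" "B x \<noteq> A y" for x y
    using ab by (auto simp: A_def B_def)
  have inD: "A 0 \<in> D" "A 1 \<in> D" "A 2 \<in> D" "B 0 \<in> D" "B 1 \<in> D"
    using ab n by (auto simp: A_def B_def pt_in_D)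
  have r: "{A y, B y} = rung s y" for y using ab by (auto simp: A_def B_def rung_def)
  have pl: "planar_domino {A 0, A 1}" "planar_domino {A 1, A 2}" "planar_domino {B 0, B 1}"
    "planar_domino {A y, B y}" for y
    unfolding r using column_planar[of a 0] column_planar[of a 1] column_planar[of b 0]
    by (simp_all add: A_def B_def rung_planar)
  define ds where "ds = [{A 1, A 2}, {B 0, B 1}, {A 1, B 1}, {A 0, A 1}, {A 0, B 0}, {A 1, A 2}]"
  have c: "can {} {A 1, A 2}" "can {A 1, A 2} {B 0, B 1}" "can {A 1, A 2, B 0, B 1} {A 1, B 1}"
    "can {A 2, B 0} {A 0, A 1}" "can {A 0, A 1, A 2, B 0} {A 0, B 0}" "can {A 1, A 2} {A 1, A 2}"
    using inD by (simp_all add: can_def pl eq)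
  have t: "togl {} {A 1, A 2} = {A 1, A 2}" "togl {A 1, A 2} {B 0, B 1} = {A 1, A 2, B 0, B 1}"
    "togl {A 1, A 2, B 0, B 1} {A 1, B 1} = {A 2, B 0}" "togl {A 2, B 0} {A 0, A 1} = {A 0, A 1, A 2, B 0}"
    "togl {A 0, A 1, A 2, B 0} {A 0, B 0} = {A 1, A 2}" "togl {A 1, A 2} {A 1, A 2} = {}"
    by (auto simp: togl_def eq)
  have col: "phi l 1 p (mv p {A y, A z}) = 0" "phi l 1 p (mv p {B y, B z}) = 0" for l p y z
    unfolding A_def B_def by (rule phi_mv_column)+
  have ab1: "above {A 1, A 2, B 0, B 1} 1 = k"
    using eq pa by (simp add: above_def) (simp add: A_def B_def chi_pt)
  have ab0: "above {A 0, A 1, A 2, B 0} 0 = 0"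
    using eq pa by (simp add: above_def) (simp add: A_def B_def chi_pt)
  have rungs: "phi l 1 {A 1, A 2, B 0, B 1} (mv {A 1, A 2, B 0, B 1} {A 1, B 1}) = of_bool (k = l)"
    "phi l 1 {A 0, A 1, A 2, B 0} (mv {A 0, A 1, A 2, B 0} {A 0, B 0}) = 0" if "l \<noteq> 0" for l
    using phi_mv_rung[of "{A 1, A 2, B 0, B 1}" 1 l] phi_mv_rung[of "{A 0, A 1, A 2, B 0}" 0 l] c(3,5) ab0 ab1 that
    unfolding r[symmetric] by (simp_all add: parity_def)
  have "canw {} ds" by (simp add: ds_def c t)
  moreover have "fin {} (wd {} ds) = {}" by (simp add: ds_def c t mv_legit)
  moreover have "even (length (wd {} ds))" by (simp add: ds_def)
  moreover have "phi l 1 {} (wd {} ds) = of_bool (k = l)" if "l \<noteq> 0" for l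
    unfolding ds_def by (simp add: phi_wd c t col rungs[OF that] del: wd.simps(2))
  ultimately show ?thesis using wd_legit by (intro exI[of _ "wd {} ds"]) auto
qed

end

text \<open>Through \<open>T\<close> the power of \<open>x\<close> with exponent \<open>T y\<close>
  equals the power of \<open>y\<close> with exponent \<open>T x\<close>. Under \<open>h1\<close>
  this gives \<open>T y = 0\<close>, so \<open>y\<close> is trivial, contrary to
  \<open>h2 y = 1\<close>.\<close>

lemma (in group) not_iso_integer_group:
  assumes T: "T \<in> iso G integer_group" and h: "h1 \<in> hom G integer_group" "h2 \<in> hom G integer_group"
    and x: "x \<in> carrier G" "y \<in> carrier G" and v: "h1 x = 1" "h1 y = 0" "h2 x = 0" "h2 y = 1"
  shows False
proof -
  have T': "T \<in> hom G integer_group" "inj_on T (carrier G)" using T by (auto simp: iso_def bij_betw_def)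
  have pow: "f (a [^] k) = k * f a" if "f \<in> hom G integer_group" "a \<in> carrier G" for f a and k :: int
  proof -
    interpret group_hom G integer_group f
      by (rule group_hom.intro[OF is_group group_integer_group]) (simp add: group_hom_axioms_def that)
    show ?thesis using hom_int_pow[OF that(2), of k] by simp
  qed
  have "T (x [^] T y) = T (y [^] T x)" using pow[OF T'(1)] x by simp
  then have e: "x [^] T y = y [^] T x" using T'(2) x by (simp add: inj_on_eq_iff)
  have "T y = 0" using arg_cong[OF e, of h1] pow[OF h(1)] x v by simp
  moreover have "T \<one> = 0" using pow[OF T'(1) x(1), of 0] by simp
  ultimately have "y = \<one>" using T'(2) x(2) by (simp add: inj_on_eq_iff[of T "carrier G" y \<one>, symmetric])
  then have "h2 y = 0" using pow[OF h(2) x(1), of 0] by simp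
  then show False using v by simp
qed

context rect_board begin

lemma not_iso_width_two:
  assumes "(L = 2 \<and> 3 \<le> M) \<or> (M = 2 \<and> 3 \<le> L)"
  shows "twist_class \<notin> iso (even_domino_group Q) integer_group"
proof
  assume T: "twist_class \<in> iso (even_domino_group Q) integer_group"
  let ?G = "even_domino_group Q"
  define s n where "s = (M = 2 \<and> 3 \<le> L)" and "n = max L M"
  interpret ladder "rect L M" s n
    by unfold_locales (use assms in \<open>auto simp: s_def n_def\<close>)
  interpret G: group ?G by (rule group_even)
  have n: "3 \<le> n" using assms by (auto simp: n_def)
  \<comment> \<open>The count is read off from an arbitrary representative; by
    \<open>phi_eqw\<close> all of them give the same value.\<close>
  define psi where "psi k c = phi k 1 {} (SOME xs. even_closed xs \<and> cls xs = c)" for k c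
  have psi: "psi k (cls xs) = phi k 1 {} xs" if xs: "even_closed xs" for k xs
  proof -
    define ys where "ys = (SOME ys. even_closed ys \<and> cls ys = cls xs)"
    have "even_closed ys \<and> cls ys = cls xs" unfolding ys_def by (rule someI[of _ xs]) (use xs in simp)
    then have "eqw True {} ys xs" using cls_eq_iff[of ys xs] xs by (simp add: even_closed_def)
    then show ?thesis unfolding psi_def ys_def[symmetric] by (rule phi_eqw)
  qed
  have hom: "psi k \<in> hom ?G integer_group" for k
  proof (rule homI)
    fix a b assume "a \<in> carrier ?G" "b \<in> carrier ?G"
    then obtain xs ys where a: "a = cls xs" "even_closed xs" and b: "b = cls ys" "even_closed ys" by (auto simp: carrier_even)
    have "phi k 1 {} (xs @ ys) = phi k 1 {} xs + phi k 1 {} ys"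
      using a(2) by (simp add: phi_append even_closed_def closed_floors_def parity_def)
    moreover have "a \<otimes>\<^bsub>?G\<^esub> b = cls (xs @ ys)" using a b mult_even[of xs ys] by (simp add: even_closed_def)
    ultimately show "psi k (a \<otimes>\<^bsub>?G\<^esub> b) = psi k a \<otimes>\<^bsub>integer_group\<^esub> psi k b"
      using psi[OF a(2)] psi[OF b(2)] psi[OF even_closed_append[OF a(2) b(2)]] by (simp add: a(1) b(1))
  qed simp
  obtain xs where xs: "even_closed xs" "\<And>l. l \<noteq> 0 \<Longrightarrow> phi l 1 {} xs = of_bool (l = 1)"
    using loop_exists[OF n, of 1] by (auto simp: even_closed_def closed_floors_def)
  obtain ys where ys: "even_closed ys" "\<And>l. l \<noteq> 0 \<Longrightarrow> phi l 1 {} ys = of_bool (l = -1)"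
    using loop_exists[OF n, of "-1"] by (auto simp: even_closed_def closed_floors_def)
  show False
    by (rule G.not_iso_integer_group[OF T hom[of 1] hom[of "-1"], of "cls xs" "cls ys"])
      (use xs ys in \<open>auto simp: psi carrier_even\<close>)
qed

section \<open>Boards on which the twist vanishes\<close>

lemma not_iso_zero_twist:
  assumes "\<And>xs. even_closed xs \<Longrightarrow> tw4 {} xs = 0"
  shows "twist_class \<notin> iso (even_domino_group Q) integer_group"
proof
  assume "twist_class \<in> iso (even_domino_group Q) integer_group"
  then have "twist_class ` carrier (even_domino_group Q) = UNIV" by (auto simp: iso_def bij_betw_def)
  then have "1 \<in> twist_class ` carrier (even_domino_group Q)" by simp
  then obtain xs where "even_closed xs" "twist_class (cls xs) = 1" by (auto simp: carrier_even)
  then show False using twist_cls[of xs] assms[of xs] by (simp add: even_closed_def)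
qed

lemma ylow_in_floor:
  assumes "floor_ok p f" "c \<in> ylow f"
  shows "c \<in> rect L M - p" "north c \<in> rect L M - p" "c \<notin> next_plug p f" "north c \<notin> next_plug p f"
  using assms by (auto simp: floor_ok_def ylow_def next_plug_def)

text \<open>For \<open>M = 1\<close> there are no bars in the second direction. For
  \<open>L = 1\<close> all squares have the same first coordinate, so the sign in \<open>ker\<close>
  is 0.\<close>

lemma weight_strip:
  assumes "L = 1 \<or> M = 1" "floor_ok p f" shows "weight p f = 0"
proof (cases "M = 1")
  case True
  then have "ylow f = {}" using ylow_in_floor[OF assms(2)] by (force simp: mem_rect north_def)
  then show ?thesis by (simp add: weight_def)
next
  case False
  have "ker c e = 0" if "c \<in> ylow f" "e \<in> rect L M" for c e
  proof -
    have "fst c = 0" "fst e = 0"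
      using False ylow_in_floor(1)[OF assms(2) that(1)] that(2) assms(1) by (auto simp: mem_rect)
    then show ?thesis by (simp add: ker_def)
  qed
  then show ?thesis by (simp add: weight_def)
qed

lemma chi_next_plug:
  assumes "p \<subseteq> rect L M" "floor_ok p f"
  shows "sum chi (next_plug p f) = sum chi (rect L M) - sum chi p"
proof -
  have f: "\<Union>f \<subseteq> rect L M - p" using assms by (auto simp: floor_ok_def)
  have "sum chi d = 0" if "d \<in> f" for d
  proof -
    have "planar_domino d" using assms(2) that by (simp add: floor_ok_def)
    then show ?thesis by (auto simp: planar_domino_def chi_def)
  qed
  then have "sum chi (\<Union>f) = 0"
    using assms(2) finite_subset[OF _ finite_D]
    by (subst sum.Union_disjoint) (auto simp: floor_ok_def pairwise_def disjnt_def)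
  moreover have "sum chi (rect L M - p - \<Union>f) = sum chi (rect L M) - sum chi p - sum chi (\<Union>f)"
    using f assms(1) finite_D finite_subset[OF assms(1) finite_D] finite_subset[OF f]
    by (simp add: sum_diff)
  ultimately show ?thesis by (simp add: next_plug_def)
qed

text \<open>A bar fills one column of the square, so the plugs below and above its floor lie in the
  other column, where \<open>ker\<close> is a fixed multiple of the color. The plugs are balanced,
  hence both sums vanish.\<close>

lemma weight_square:
  assumes LM: "L = 2" "M = 2" and p: "p \<subseteq> rect L M" "sum chi p = 0" and f: "floor_ok p f"
  shows "weight p f = 0" "sum chi (next_plug p f) = 0"
proof -
  have "rect L M = {(0, 0), (0, 1), (1, 0), (1, 1)}" by (auto simp: LM mem_rect)
  then have "sum chi (rect L M) = 0" by (simp add: chi_def)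
  then show q: "sum chi (next_plug p f) = 0" using chi_next_plug[OF p(1) f] p(2) by simp
  have zero: "(\<Sum>e\<in>q. ker c e) = 0"
    if q: "q \<subseteq> rect L M" "sum chi q = 0" and c: "c \<in> rect L M - q" "north c \<in> rect L M - q" for q c
  proof -
    have "ker c e = chi c * sgn (2 * fst c - 1) * chi e" if e: "e \<in> q" for e
    proof -
      obtain x y u v where xy: "c = (x, y)" "e = (u, v)" by (cases c, cases e)
      have "e \<noteq> c" "e \<noteq> north c" "e \<in> rect L M" using e c q(1) by auto
      then have "u \<noteq> x" "y = 0" "(x = 0 \<or> x = 1)" "(u = 0 \<or> u = 1)" "v = 0 \<or> v = 1"
        using c LM by (auto simp: xy mem_rect north_def)
      then show ?thesis by (auto simp: ker_def xy)
    qed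
    then have "(\<Sum>e\<in>q. ker c e) = (\<Sum>e\<in>q. chi c * sgn (2 * fst c - 1) * chi e)" by (rule sum.cong[OF refl])
    then show ?thesis using q(2) by (simp add: sum_distrib_left[symmetric])
  qed
  have "(\<Sum>e\<in>rect L M. ker c e * (of_bool (e \<in> p) - of_bool (e \<in> next_plug p f))) = 0" if c: "c \<in> ylow f" for c
  proof -
    have s: "(\<Sum>e\<in>rect L M. ker c e * of_bool (e \<in> A)) = (\<Sum>e\<in>A. ker c e)" if "A \<subseteq> rect L M" for A
      using that finite_D by (simp add: Int_absorb1)
    note y = ylow_in_floor[OF f c]
    show ?thesis
      using s[OF p(1)] s[OF next_plug_subset[of p f]] zero[OF p] zero[OF next_plug_subset[of p f] q] y
      by (simp add: right_diff_distrib sum_subtractf del: sum_mult_of_bool_eq)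
  qed
  then show "weight p f = 0" by (simp add: weight_def)
qed

lemma tw4_strip: "L = 1 \<or> M = 1 \<Longrightarrow> legit p xs \<Longrightarrow> tw4 p xs = 0"
  by (induction xs arbitrary: p) (auto simp: weight_strip)

lemma tw4_square:
  assumes "L = 2" "M = 2" shows "legit p xs \<Longrightarrow> sum chi p = 0 \<Longrightarrow> tw4 p xs = 0"
  by (induction xs arbitrary: p) (simp_all add: weight_square[OF assms])

lemma regular_iff:
  assumes "even (L * M)"
  shows "regular_disk Q \<longleftrightarrow> 3 \<le> min L M"
proof -
  have "twist_class \<notin> iso (even_domino_group Q) integer_group" if small: "\<not> 3 \<le> min L M"
  proof -
    consider "L = 1 \<or> M = 1" | "L = 2" "M = 2" | "(L = 2 \<and> 3 \<le> M) \<or> (M = 2 \<and> 3 \<le> L)"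
      using small L M by linarith
    then show ?thesis
    proof cases
      case 1
      then show ?thesis by (intro not_iso_zero_twist) (auto simp: even_closed_def closed_floors_def tw4_strip)
    next
      case 2
      show ?thesis by (intro not_iso_zero_twist) (simp add: even_closed_def closed_floors_def tw4_square[OF 2])
    next
      case 3
      then show ?thesis by (rule not_iso_width_two)
    qed
  qed
  then show ?thesis using regular_Q[OF assms] regular assms by auto
qed

end

theorem theorem1p1:
  fixes L M :: nat
  assumes "L > 0" and "M > 0" and "even (L * M)"
  shows "regular_disk ({0..real L} \<times> {0..real M}) \<longleftrightarrow> min L M \<ge> 3"
  using rect_board.regular_iff[OF rect_board.intro[OF assms(1,2)] assms(3)] .

end
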